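(* (The Full Irreducibility Criterion.) Let $g:\Gamma\to\Gamma$ be an irreducible train track representative of $\phi\in\mathrm{Out}(F_r)$. Suppose that $g$ has no periodic Nielsen paths, that the transition matrix of $g$ is Perron-Frobenius, and that for every vertex $x$ of $\Gamma$ the local Whitehead graph $LW(g;x)$ is connected. Then $\phi$ is fully irreducible.
   Context: $F_r$ is the free group of rank $r$. An element $\phi\in\mathrm{Out}(F_r)$ is reducible if there are nontrivial proper free factors $F^1,\dots,F^k$ of $F_r$ whose conjugacy classes are permuted by $\phi$ and such that $F^1*\cdots*F^k$ is a free factor of $F_r$; otherwise irreducible; fully irreducible if every positive power is irreducible. A marked graph is a finite connected graph $\Gamma$ without valence-one vertices together with a homotopy equivalence $R_r\to\Gamma$ from the $r$-petaled rose. A train track representative of $\phi$ is a homotopy equivalence $g:\Gamma\to\Gamma$ of a marked graph inducing $\phi$ on fundamental groups, mapping vertices to vertices, such that every $g^k$, $k>0$, is locally injective on edge interiors. It is irreducible if it has no proper $g$-invariant subgraph with a noncontractible component. A periodic Nielsen path (PNP) is a nontrivial path $\rho$ between fixed points of $g$ with $g^k(\rho)\simeq\rho$ rel endpoints for some $k\ge1$. The transition matrix of $g$ has $ij$-entry equal to the number of times $g(E_j)$ crosses $E_i$ in either direction, where $E_1,\dots,E_n$ are the edges of $\Gamma$. A nonnegative square matrix $A$ is Perron-Frobenius if $A^k$ is strictly positive for all sufficiently large $k$. Directions at a vertex $x$ are germs of initial segments of oriented edges emanating from $x$; $D_0(e)$ is the initial direction of $e$ and $\bar e$ is $e$ reversed.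 An edge path $\cdots e e'\cdots$ takes the turn $\{D_0(\bar e),D_0(e')\}$. The local Whitehead graph $LW(g;x)$ has one vertex for each direction at $x$ and an edge joining $d_1,d_2$ if the turn $\{d_1,d_2\}$ is taken by $g^k(e)$ for some $k>0$ and some edge $e$ of $\Gamma$.
   Formalization: A periodic Nielsen path is taken to have end points fixed by the power g^k with g^k(ρ) ≃ ρ (periodic points), not necessarily fixed by g itself; with end points required to be fixed by g the criterion is false. *)

theory Defs
  imports
    "HOL-Analysis.Analysis"
    "HOL-Algebra.Bij"
    "HOL-Algebra.Coset"
    "HOL-Algebra.Generated_Groups"
    "HOL-Combinatorics.Permutations"
    "Jordan_Normal_Form.Matrix"
begin

section \<open>Free groups and outer automorphisms\<close>

text \<open>The pair \<open>(i, True)\<close> stands for the \<open>i\<close>-th generator (or positively oriented edge),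
  \<open>(i, False)\<close> for its inverse (or the edge reversed).\<close>

type_synonym letter = "nat \<times> bool"

definition flip :: "letter \<Rightarrow> letter" where
  "flip d = (fst d, \<not> snd d)"

definition reduced_word :: "letter list \<Rightarrow> bool" where
  "reduced_word w \<longleftrightarrow> successively (\<lambda>x y. y \<noteq> flip x) w"

fun push :: "letter \<Rightarrow> letter list \<Rightarrow> letter list" where
  "push x [] = [x]"
| "push x (y # ys) = (if y = flip x then ys else x # y # ys)"

text \<open>\<open>foldr push u v\<close> is the free reduction of \<open>u @ v\<close> when \<open>v\<close> is reduced.\<close>

definition free_group :: "nat \<Rightarrow> letter list monoid" where
  "free_group r =
     \<lparr>carrier = {w. reduced_word w \<and> fst ` set w \<subseteq> {..<r}}, mult = foldr push, one = []\<rparr>"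

lemma flip_flip [simp]: "flip (flip d) = d"
  and fst_flip [simp]: "fst (flip d) = fst d"
  and flip_neq [simp]: "flip d \<noteq> d"
  by (auto simp: flip_def prod_eq_iff)

lemma reduced_Nil [simp]: "reduced_word []"
  by (simp add: reduced_word_def)

lemma reduced_Cons: "reduced_word (x # w) \<longleftrightarrow> (w = [] \<or> hd w \<noteq> flip x) \<and> reduced_word w"
  by (cases w) (auto simp: reduced_word_def)

lemma reduced_push: "reduced_word w \<Longrightarrow> reduced_word (push x w)"
  by (cases w) (auto simp: reduced_Cons)

lemma reduced_foldr_push: "reduced_word w \<Longrightarrow> reduced_word (foldr push u w)"
  by (induction u) (auto intro: reduced_push)

lemma push_push_flip: "reduced_word w \<Longrightarrow> push x (push (flip x) w) = w"
  by (cases w; cases "tl w") (auto simp: reduced_Cons)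

lemma foldr_push_push:
  assumes "reduced_word w"
  shows "foldr push (push x v) w = push x (foldr push v w)"
  using assms by (cases v) (auto simp: push_push_flip reduced_foldr_push)

lemma foldr_push_assoc:
  assumes "reduced_word w"
  shows "foldr push (foldr push u v) w = foldr push u (foldr push v w)"
  by (induction u) (auto simp: foldr_push_push assms)

lemma foldr_push_Nil: "reduced_word w \<Longrightarrow> foldr push w [] = w"
proof (induction w)
  case (Cons x w)
  then show ?case by (cases w) (auto simp: reduced_Cons)
qed simp

lemma foldr_push_inverse: "reduced_word v \<Longrightarrow> foldr push (rev (map flip w)) (foldr push w v) = v"
proof (induction w)
  case (Cons x w)
  then show ?case
    using push_push_flip [of "foldr push w v" "flip x"] by (simp add: reduced_foldr_push)
qed simp

lemma set_foldr_push: "fst ` set (foldr push u v) \<subseteq> fst ` set u \<union> fst ` set v"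
proof (induction u)
  case (Cons x u)
  have "set (push x w) \<subseteq> insert x (set w)" for w by (cases w) auto
  then have "fst ` set (push x (foldr push u v)) \<subseteq> insert (fst x) (fst ` set (foldr push u v))"
    by (metis image_insert image_mono)
  then have "fst ` set (foldr push (x # u) v) \<subseteq> insert (fst x) (fst ` set (foldr push u v))"
    by simp
  also have "\<dots> \<subseteq> insert (fst x) (fst ` set u \<union> fst ` set v)"
    using Cons by (rule insert_mono)
  finally show ?case by simp
qed simp

lemma group_free_group: "Group.group (free_group r)"
proof (rule groupI)
  fix x y assume "x \<in> carrier (free_group r)" "y \<in> carrier (free_group r)"
  then show "x \<otimes>\<^bsub>free_group r\<^esub> y \<in> carrier (free_group r)"
    using order_trans [OF set_foldr_push [of x y]]
    by (simp add: free_group_def reduced_foldr_push)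
next
  fix x assume x: "x \<in> carrier (free_group r)"
  let ?y = "foldr push (rev (map flip x)) []"
  have "foldr push ?y x = foldr push (rev (map flip x)) (foldr push [] x)"
    by (rule foldr_push_assoc) (use x in \<open>simp add: free_group_def\<close>)
  also have "\<dots> = foldr push (rev (map flip x)) (foldr push x [])"
    using x by (simp add: free_group_def foldr_push_Nil)
  also have "\<dots> = []" by (rule foldr_push_inverse) simp
  finally have "?y \<otimes>\<^bsub>free_group r\<^esub> x = \<one>\<^bsub>free_group r\<^esub>"
    by (simp add: free_group_def)
  moreover have "?y \<in> carrier (free_group r)"
    using x order_trans [OF set_foldr_push [of "rev (map flip x)" "[]"]]
    by (simp add: free_group_def reduced_foldr_push image_image)
  ultimately show "\<exists>y\<in>carrier (free_group r). y \<otimes>\<^bsub>free_group r\<^esub> x = \<one>\<^bsub>free_group r\<^esub>" by blast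
qed (auto simp: free_group_def foldr_push_assoc)

definition conjugation :: "('a, 'b) monoid_scheme \<Rightarrow> 'a \<Rightarrow> 'a \<Rightarrow> 'a" where
  "conjugation G a = (\<lambda>x\<in>carrier G. a \<otimes>\<^bsub>G\<^esub> x \<otimes>\<^bsub>G\<^esub> inv\<^bsub>G\<^esub> a)"

definition Inn :: "('a, 'b) monoid_scheme \<Rightarrow> ('a \<Rightarrow> 'a) set" where
  "Inn G = conjugation G ` carrier G"

definition Out :: "('a, 'b) monoid_scheme \<Rightarrow> ('a \<Rightarrow> 'a) set monoid" where
  "Out G = AutoGroup G Mod Inn G"

lemma (in Group.group) conjugation_auto:
  assumes a: "a \<in> carrier G"
  shows "conjugation G a \<in> auto G"
proof -
  have cancel: "inv a \<otimes> (a \<otimes> x) = x" "a \<otimes> (inv a \<otimes> x) = x" if "x \<in> carrier G" for x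
    using a that by (simp_all flip: m_assoc)
  have "bij_betw (conjugation G a) (carrier G) (carrier G)"
    by (rule bij_betw_byWitness [where f' = "conjugation G (inv a)"])
      (use a in \<open>auto simp: conjugation_def m_assoc cancel\<close>)
  moreover have "conjugation G a \<in> hom G G"
    by (rule homI) (use a in \<open>auto simp: conjugation_def m_assoc cancel\<close>)
  ultimately show ?thesis
    by (auto simp: auto_def Bij_def conjugation_def)
qed

lemma (in Group.group) mult_AutoGroup:
  "\<lbrakk>f \<in> auto G; h \<in> auto G\<rbrakk> \<Longrightarrow> f \<otimes>\<^bsub>AutoGroup G\<^esub> h = compose (carrier G) f h"
  by (simp add: AutoGroup_def BijGroup_def auto_def)

lemma carrier_AutoGroup: "carrier (AutoGroup G) = auto G"
  by (simp add: AutoGroup_def)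

lemma (in Group.group) hom_conjugation: "conjugation G \<in> hom G (AutoGroup G)"
proof (rule homI)
  fix a b assume ab: "a \<in> carrier G" "b \<in> carrier G"
  then have "compose (carrier G) (conjugation G a) (conjugation G b) = conjugation G (a \<otimes> b)"
    by (auto simp: fun_eq_iff compose_def conjugation_def m_assoc inv_mult_group)
  with ab show "conjugation G (a \<otimes> b) = conjugation G a \<otimes>\<^bsub>AutoGroup G\<^esub> conjugation G b"
    by (simp add: mult_AutoGroup conjugation_auto)
qed (simp add: carrier_AutoGroup conjugation_auto)

lemma (in Group.group) normal_Inn: "Inn G \<lhd> AutoGroup G"
proof -
  interpret A: Group.group "AutoGroup G" by (rule AutoGroup)
  interpret h: group_hom G "AutoGroup G" "conjugation G"
    by unfold_locales (rule hom_conjugation)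
  have "subgroup (Inn G) (AutoGroup G)"
    unfolding Inn_def by (rule h.img_is_subgroup)
  moreover have "f \<otimes>\<^bsub>AutoGroup G\<^esub> h \<otimes>\<^bsub>AutoGroup G\<^esub> inv\<^bsub>AutoGroup G\<^esub> f \<in> Inn G"
    if f: "f \<in> carrier (AutoGroup G)" and h: "h \<in> Inn G" for f h
  proof -
    obtain a where a: "a \<in> carrier G" "h = conjugation G a" using h by (auto simp: Inn_def)
    have fa: "f \<in> auto G" using f by (simp add: carrier_AutoGroup)
    then have hom: "f \<in> hom G G" by (simp add: auto_def)
    interpret f: group_hom G G f by unfold_locales (rule hom)
    have "compose (carrier G) f (conjugation G a) = compose (carrier G) (conjugation G (f a)) f"
      using a by (auto simp: fun_eq_iff compose_def conjugation_def)
    then have "f \<otimes>\<^bsub>AutoGroup G\<^esub> h = conjugation G (f a) \<otimes>\<^bsub>AutoGroup G\<^esub> f"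
      using a fa by (simp add: mult_AutoGroup conjugation_auto)
    then have "f \<otimes>\<^bsub>AutoGroup G\<^esub> h \<otimes>\<^bsub>AutoGroup G\<^esub> inv\<^bsub>AutoGroup G\<^esub> f = conjugation G (f a)"
      using f h.hom_closed [OF f.hom_closed [OF a(1)]]
      by (simp add: a(2) A.m_assoc del: f.hom_closed)
    then show ?thesis using a by (simp add: Inn_def)
  qed
  ultimately show ?thesis by (simp add: A.normal_inv_iff)
qed

lemma (in Group.group) group_Out: "Group.group (Out G)"
  unfolding Out_def by (rule normal.factorgroup_is_group [OF normal_Inn])

definition conjugate_subgroups :: "('a, 'b) monoid_scheme \<Rightarrow> 'a set \<Rightarrow> 'a set \<Rightarrow> bool" where
  "conjugate_subgroups G H K \<longleftrightarrow> (\<exists>a\<in>carrier G. K = conjugation G a ` H)"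

text \<open>\<open>K\<close> is the internal free product of the subgroups \<open>F i\<close>, \<open>i \<in> I\<close>: they generate \<open>K\<close>, and no
  nonempty alternating product of nontrivial elements of the \<open>F i\<close> is trivial.\<close>

definition internal_free_product ::
    "('a, 'b) monoid_scheme \<Rightarrow> 'i set \<Rightarrow> ('i \<Rightarrow> 'a set) \<Rightarrow> 'a set \<Rightarrow> bool" where
  "internal_free_product G I F K \<longleftrightarrow>
     (\<forall>i\<in>I. subgroup (F i) G) \<and>
     K = generate G (\<Union>i\<in>I. F i) \<and>
     (\<forall>xs. xs \<noteq> [] \<and>
           (\<forall>(i, x)\<in>set xs. i \<in> I \<and> x \<in> F i \<and> x \<noteq> \<one>\<^bsub>G\<^esub>) \<and>
           successively (\<lambda>p q. fst p \<noteq> fst q) xs \<longrightarrow>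
           foldr (\<otimes>\<^bsub>G\<^esub>) (map snd xs) \<one>\<^bsub>G\<^esub> \<noteq> \<one>\<^bsub>G\<^esub>)"

definition free_factor :: "('a, 'b) monoid_scheme \<Rightarrow> 'a set \<Rightarrow> bool" where
  "free_factor G H \<longleftrightarrow>
     (\<exists>K. internal_free_product G UNIV (\<lambda>b. if b then H else K) (carrier G))"

text \<open>An element \<open>\<phi>\<close> of \<open>Out G\<close> is a coset of \<open>Inn G\<close>, so its members \<open>f\<close> are the automorphisms
  representing it; the conjugacy class of \<open>f ` H\<close> does not depend on the choice of \<open>f\<close>.\<close>

definition reducible_out :: "('a, 'b) monoid_scheme \<Rightarrow> ('a \<Rightarrow> 'a) set \<Rightarrow> bool" where
  "reducible_out G \<phi> \<longleftrightarrow>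
     (\<exists>k>0. \<exists>F :: nat \<Rightarrow> 'a set.
        (\<forall>i<k. free_factor G (F i) \<and> F i \<noteq> {\<one>\<^bsub>G\<^esub>} \<and> F i \<noteq> carrier G) \<and>
        (\<exists>\<pi>. \<pi> permutes {..<k} \<and>
             (\<forall>i<k. \<forall>f\<in>\<phi>. conjugate_subgroups G (f ` F i) (F (\<pi> i)))) \<and>
        (\<exists>K. internal_free_product G {..<k} F K \<and> free_factor G K))"

definition fully_irreducible :: "('a, 'b) monoid_scheme \<Rightarrow> ('a \<Rightarrow> 'a) set \<Rightarrow> bool" where
  "fully_irreducible G \<phi> \<longleftrightarrow> (\<forall>k::nat>0. \<not> reducible_out G (\<phi> [^]\<^bsub>Out G\<^esub> k))"

section \<open>Finite graphs\<close>

text \<open>A finite graph is a finite one-dimensional CW complex inside a Hausdorff space: \<open>verts\<close> is its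
  vertex set and \<open>edge i\<close>, \<open>i < nedges\<close>, are the characteristic maps on \<open>[0,1]\<close> of its edges.
  Since the space is Hausdorff and there are finitely many compact cells, the subspace topology
  of the union is the CW topology.\<close>

record 'a fgraph =
  verts :: "'a set"
  nedges :: nat
  edge :: "nat \<Rightarrow> real \<Rightarrow> 'a"

definition graph_space :: "('a::topological_space) fgraph \<Rightarrow> 'a set" where
  "graph_space G = verts G \<union> (\<Union>i<nedges G. path_image (edge G i))"

definition open_edge :: "('a::topological_space) fgraph \<Rightarrow> nat \<Rightarrow> 'a set" where
  "open_edge G i = edge G i ` {0<..<1}"

definition finite_graph :: "('a::t2_space) fgraph \<Rightarrow> bool" where
  "finite_graph G \<longleftrightarrow>
     finite (verts G) \<and> verts G \<noteq> {} \<and>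
     (\<forall>i<nedges G. path (edge G i) \<and> inj_on (edge G i) {0<..<1} \<and>
        pathstart (edge G i) \<in> verts G \<and> pathfinish (edge G i) \<in> verts G \<and>
        open_edge G i \<inter> verts G = {}) \<and>
     (\<forall>i<nedges G. \<forall>j<nedges G. i \<noteq> j \<longrightarrow> open_edge G i \<inter> open_edge G j = {})"

definition oriented_edge :: "('a::topological_space) fgraph \<Rightarrow> letter \<Rightarrow> real \<Rightarrow> 'a" where
  "oriented_edge G d = (if snd d then edge G (fst d) else reversepath (edge G (fst d)))"

text \<open>Distinct oriented edges emanating from a vertex have distinct germs there, so a direction at a
  vertex is represented by the oriented edge whose initial direction it is; thus \<open>D\<^sub>0\<close> is the
  identity. A loop edge contributes two directions.\<close>

definition directions :: "('a::topological_space) fgraph \<Rightarrow> 'a \<Rightarrow> letter set" where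
  "directions G x = {d. fst d < nedges G \<and> pathstart (oriented_edge G d) = x}"

definition homotopy_equivalence ::
    "('a::topological_space) set \<Rightarrow> ('b::topological_space) set \<Rightarrow> ('a \<Rightarrow> 'b) \<Rightarrow> bool" where
  "homotopy_equivalence S T f \<longleftrightarrow>
     continuous_on S f \<and> f ` S \<subseteq> T \<and>
     (\<exists>h. continuous_on T h \<and> h ` T \<subseteq> S \<and>
          homotopic_with_canon (\<lambda>_. True) S S (h \<circ> f) id \<and>
          homotopic_with_canon (\<lambda>_. True) T T (f \<circ> h) id)"

text \<open>The rose in the complex plane: petal \<open>i\<close> is the circle of radius \<open>i + 1\<close> about \<open>i + 1\<close>, so that
  all petals are tangent to each other at \<open>0\<close>.\<close>

definition rose :: "nat \<Rightarrow> complex fgraph" where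
  "rose r = \<lparr>verts = {0}, nedges = r,
     edge = (\<lambda>i t. of_nat (i + 1) * (1 - cis (2 * pi * t)))\<rparr>"

definition rose_loop :: "nat \<Rightarrow> letter list \<Rightarrow> real \<Rightarrow> complex" where
  "rose_loop r w = foldr (\<lambda>d p. oriented_edge (rose r) d +++ p) w (\<lambda>_. 0)"

definition marked_graph :: "nat \<Rightarrow> ('a::t2_space) fgraph \<Rightarrow> (complex \<Rightarrow> 'a) \<Rightarrow> bool" where
  "marked_graph r G m \<longleftrightarrow>
     finite_graph G \<and> connected (graph_space G) \<and>
     (\<forall>x\<in>verts G. card (directions G x) \<noteq> 1) \<and>
     homotopy_equivalence (graph_space (rose r)) (graph_space G) m"

section \<open>Train track representatives\<close>

text \<open>The marking \<open>m\<close> identifies \<open>F\<^sub>r\<close> with the fundamental group of the graph at \<open>m 0\<close>, a word \<open>w\<close>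
  corresponding to the class of \<open>m \<circ> rose_loop r w\<close>. A path \<open>\<delta>\<close> from \<open>m 0\<close> to \<open>g (m 0)\<close> is needed to
  bring \<open>g\<^sub>*\<close> back to this base point; changing \<open>\<delta>\<close> changes the automorphism \<open>f\<close> by an inner one.\<close>

definition induces ::
    "nat \<Rightarrow> ('a::t2_space) fgraph \<Rightarrow> (complex \<Rightarrow> 'a) \<Rightarrow> ('a \<Rightarrow> 'a) \<Rightarrow>
     (letter list \<Rightarrow> letter list) set \<Rightarrow> bool" where
  "induces r G m g \<phi> \<longleftrightarrow>
     (\<exists>f\<in>\<phi>. \<exists>\<delta>. path \<delta> \<and> path_image \<delta> \<subseteq> graph_space G \<and>
        pathstart \<delta> = m 0 \<and> pathfinish \<delta> = g (m 0) \<and>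
        (\<forall>w\<in>carrier (free_group r).
           homotopic_paths (graph_space G)
             (\<delta> +++ ((g \<circ> m \<circ> rose_loop r w) +++ reversepath \<delta>))
             (m \<circ> rose_loop r (f w))))"

definition locally_injective_on :: "('a::topological_space) set \<Rightarrow> ('a \<Rightarrow> 'b) \<Rightarrow> bool" where
  "locally_injective_on S f \<longleftrightarrow>
     (\<forall>x\<in>S. \<exists>U. openin (top_of_set S) U \<and> x \<in> U \<and> inj_on f U)"

definition train_track_representative ::
    "nat \<Rightarrow> ('a::t2_space) fgraph \<Rightarrow> (complex \<Rightarrow> 'a) \<Rightarrow> ('a \<Rightarrow> 'a) \<Rightarrow>
     (letter list \<Rightarrow> letter list) set \<Rightarrow> bool" where
  "train_track_representative r G m g \<phi> \<longleftrightarrow>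
     marked_graph r G m \<and>
     homotopy_equivalence (graph_space G) (graph_space G) g \<and>
     induces r G m g \<phi> \<and>
     g ` verts G \<subseteq> verts G \<and>
     (\<forall>k>0. \<forall>i<nedges G. locally_injective_on (open_edge G i) (g ^^ k))"

definition subgraph_space :: "('a::topological_space) fgraph \<Rightarrow> 'a set \<Rightarrow> bool" where
  "subgraph_space G S \<longleftrightarrow>
     (\<exists>W\<subseteq>verts G. \<exists>J\<subseteq>{..<nedges G}.
        (\<forall>j\<in>J. pathstart (edge G j) \<in> W \<and> pathfinish (edge G j) \<in> W) \<and>
        S = W \<union> (\<Union>j\<in>J. path_image (edge G j)))"

definition irreducible_map :: "('a::topological_space) fgraph \<Rightarrow> ('a \<Rightarrow> 'a) \<Rightarrow> bool" where
  "irreducible_map G g \<longleftrightarrow>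
     \<not> (\<exists>S. subgraph_space G S \<and> S \<noteq> graph_space G \<and> g ` S \<subseteq> S \<and>
            (\<exists>C\<in>components S. \<not> contractible C))"

text \<open>The end points of a periodic Nielsen path are fixed by the power \<open>g\<^sup>k\<close> in question, as in
  Bestvina and Handel, and need not be fixed by \<open>g\<close> itself. Requiring the latter would make the
  criterion false: a pseudo-Anosov map of the twice-punctured torus that interchanges the two
  punctures, both two-pronged, induces an irreducible but not fully irreducible class, and the
  periodic Nielsen paths of its train track representatives have no end point fixed by \<open>g\<close>. Paths here are not assumed to be tight, so
  nontrivial means not homotopic rel end points to a constant path.\<close>

definition periodic_nielsen_path ::
    "('a::topological_space) fgraph \<Rightarrow> ('a \<Rightarrow> 'a) \<Rightarrow> (real \<Rightarrow> 'a) \<Rightarrow> bool" where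
  "periodic_nielsen_path G g \<rho> \<longleftrightarrow>
     path \<rho> \<and> path_image \<rho> \<subseteq> graph_space G \<and>
     \<not> homotopic_paths (graph_space G) \<rho> (\<lambda>_. pathstart \<rho>) \<and>
     (\<exists>k\<ge>1. (g ^^ k) (pathstart \<rho>) = pathstart \<rho> \<and> (g ^^ k) (pathfinish \<rho>) = pathfinish \<rho> \<and>
            homotopic_paths (graph_space G) ((g ^^ k) \<circ> \<rho>) \<rho>)"

text \<open>\<open>runs_through G p ds\<close>: up to orientation preserving reparametrization, \<open>p\<close> is the edge path
  whose successive oriented edges are \<open>ds\<close>; \<open>\<tau> l\<close> is the time at which the \<open>l\<close>-th edge begins.\<close>

definition runs_through ::
    "('a::topological_space) fgraph \<Rightarrow> (real \<Rightarrow> 'a) \<Rightarrow> letter list \<Rightarrow> bool" where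
  "runs_through G p ds \<longleftrightarrow>
     (\<exists>\<tau> :: nat \<Rightarrow> real. \<tau> 0 = 0 \<and> \<tau> (length ds) = 1 \<and>
        (\<forall>l<length ds. fst (ds ! l) < nedges G \<and> \<tau> l < \<tau> (Suc l) \<and>
           (\<exists>h. continuous_on {\<tau> l..\<tau> (Suc l)} h \<and> strict_mono_on {\<tau> l..\<tau> (Suc l)} h \<and>
                h (\<tau> l) = 0 \<and> h (\<tau> (Suc l)) = 1 \<and>
                (\<forall>t\<in>{\<tau> l..\<tau> (Suc l)}. p t = oriented_edge G (ds ! l) (h t)))))"

text \<open>For a train track map \<open>g\<close> every \<open>g\<^sup>k \<circ> edge G j\<close> runs through exactly one edge path: near each
  point it is an immersed path, and it starts and ends at vertices.\<close>

definition crossings :: "('a::topological_space) fgraph \<Rightarrow> (real \<Rightarrow> 'a) \<Rightarrow> nat \<Rightarrow> nat" where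
  "crossings G p i = count_list (map fst (THE ds. runs_through G p ds)) i"

definition transition_matrix :: "('a::topological_space) fgraph \<Rightarrow> ('a \<Rightarrow> 'a) \<Rightarrow> real mat" where
  "transition_matrix G g =
     mat (nedges G) (nedges G) (\<lambda>(i, j). real (crossings G (g \<circ> edge G j) i))"

definition perron_frobenius :: "real mat \<Rightarrow> bool" where
  "perron_frobenius A \<longleftrightarrow>
     square_mat A \<and>
     (\<forall>i<dim_row A. \<forall>j<dim_col A. 0 \<le> A $$ (i, j)) \<and>
     (\<forall>\<^sub>F k in sequentially. \<forall>i<dim_row A. \<forall>j<dim_col A. 0 < (A ^\<^sub>m k) $$ (i, j))"

definition takes_turn ::
    "('a::topological_space) fgraph \<Rightarrow> (real \<Rightarrow> 'a) \<Rightarrow> letter set \<Rightarrow> bool" where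
  "takes_turn G p T \<longleftrightarrow>
     (\<exists>ds l. runs_through G p ds \<and> Suc l < length ds \<and> T = {flip (ds ! l), ds ! Suc l})"

text \<open>The vertex set of the local Whitehead graph at \<open>x\<close> is \<open>directions G x\<close>.\<close>

definition LW_edges ::
    "('a::topological_space) fgraph \<Rightarrow> ('a \<Rightarrow> 'a) \<Rightarrow> 'a \<Rightarrow> (letter \<times> letter) set" where
  "LW_edges G g x =
     {(d1, d2). d1 \<in> directions G x \<and> d2 \<in> directions G x \<and>
        (\<exists>k>0. \<exists>i<nedges G. takes_turn G ((g ^^ k) \<circ> edge G i) {d1, d2})}"

definition LW_connected :: "('a::topological_space) fgraph \<Rightarrow> ('a \<Rightarrow> 'a) \<Rightarrow> 'a \<Rightarrow> bool" where
  "LW_connected G g x \<longleftrightarrow>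
     (\<forall>d1\<in>directions G x. \<forall>d2\<in>directions G x. (d1, d2) \<in> (LW_edges G g x)\<^sup>*)"

end

theory Submission
  imports Defs
begin

text \<open>Suppose that a power of an automorphism representing the class maps a free factor \<open>A\<close> with nontrivial
  complement to a conjugate of itself. For nontrivial \<open>a\<close> in \<open>A\<close>, the circuits of the iterated images of \<open>a\<close>
  contain every \<open>g\<^sup>N(e)\<close>: cut them into maximal legal pieces, the number of which eventually stabilises. If
  the lengths of the pieces were bounded, the circuits would recur, and a piece reproduced by a power
  of \<open>g\<close> would contain a fixed point at which a periodic Nielsen loop is based; unbounded pieces contain long
  iterates of edges by bounded cancellation.

  On the other hand, by residual finiteness \<open>F\<^sub>r\<close> has finite quotients of arbitrarily large order that kill
  \<open>A\<close>. In the corresponding cover of the graph, every element of \<open>A\<close> is represented by a path in the union of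
  the lifts of \<open>r\<close> fixed loops, and so crosses a number of lifted edges that is bounded
  independently of the quotient. But connectedness of the local Whitehead graphs and the Perron-Frobenius
  property force the lifts of \<open>g\<^sup>N(e)\<close> to cross all translates of an edge once \<open>N\<close> is suitable and large.

  Paths in the topological graph are converted to words by counting crossings of the midpoints of edges,
  a quantity that determines the homotopy class.\<close>

section \<open>The free group on countably many letters\<close>

text \<open>The upper bound is fixed before the quotient. Projecting the generators of
  \<open>F\<^sub>r\<close> to \<open>A\<close> gives \<open>r\<close> loops that generate the loops
  of \<open>A\<close>; their total length is the constant \<open>C\<close>. Only then is a finite
  quotient chosen: it factors through the projection to the complement \<open>K\<close>, so it kills
  \<open>A\<close>, and its order exceeds \<open>C\<close> because a nontrivial element of
  \<open>K\<close> has a nontrivial \<open>C!\<close>-th power in a torsion-free group.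

  The obstacle is that the quotient need not be preserved by the map, so the map need not lift to
  the cover. But only finitely many edge weights take values in a given finite group, so the
  pullbacks of the weight under the iterates repeat. Some pullback is fixed by a power of the map;
  it still kills \<open>A\<close>, since the iterates of elements of \<open>A\<close> are conjugate
  to elements of \<open>A\<close>, and it has the same image up to conjugation.

  In the cover, reachability between lifted edges under the lifted power is symmetric, because deck
  translations have finite order. This is what turns connectedness at the single vertices into
  reachability of all translates of an edge.\<close>

definition iword :: "letter list \<Rightarrow> letter list" where
  "iword w = rev (map flip w)"

lemma iword_simps [simp]:
  "iword [] = []" "iword (u @ v) = iword v @ iword u" "iword (d # w) = iword w @ [flip d]"
  "length (iword w) = length w" "iword (iword w) = w" "iword w = [] \<longleftrightarrow> w = []"
  by (auto simp: iword_def rev_map comp_def)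

lemma flip_eq_iff: "flip a = b \<longleftrightarrow> a = flip b"
  by auto

lemma hd_iword: "w \<noteq> [] \<Longrightarrow> hd (iword w) = flip (last w)"
  and last_iword: "w \<noteq> [] \<Longrightarrow> last (iword w) = flip (hd w)"
  by (simp_all add: iword_def hd_rev last_rev last_map list.map_sel)

lemma reduced_append:
  "reduced_word (u @ v) \<longleftrightarrow>
     reduced_word u \<and> reduced_word v \<and> (u = [] \<or> v = [] \<or> hd v \<noteq> flip (last u))"
  unfolding reduced_word_def by (auto simp: successively_append_iff)

lemma reduced_iword [simp]: "reduced_word (iword w) = reduced_word w"
proof -
  have *: "reduced_word (iword w)" if "reduced_word w" for w
    using that
  proof (induction w)
    case (Cons d w)
    moreover have "reduced_word [flip d]" by (simp add: reduced_word_def)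
    ultimately show ?case
      by (auto simp: reduced_append reduced_Cons last_iword flip_eq_iff)
  qed simp
  show ?thesis using * [of w] * [of "iword w"] by auto
qed

text \<open>All ranks share this one group: it holds words in the edges of a graph as well as words
  in the generators of \<open>free_group r\<close>. It is written additively, without commutativity,
  so that the cancellation rules of class \<open>group_add\<close> apply.\<close>

typedef fg = "{w. reduced_word w}" morphisms word_of Abs_fg
  by (rule exI [of _ "[]"]) simp

setup_lifting type_definition_fg

lemma reduced_word_of [simp]: "reduced_word (word_of x)"
  using word_of by simp

instantiation fg :: group_add
begin
lift_definition zero_fg :: fg is "[]" by simp
lift_definition plus_fg :: "fg \<Rightarrow> fg \<Rightarrow> fg" is "foldr push" by (rule reduced_foldr_push)
lift_definition uminus_fg :: "fg \<Rightarrow> fg" is iword by simp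
definition minus_fg :: "fg \<Rightarrow> fg \<Rightarrow> fg" where "minus_fg a b = a + - b"
instance
proof
  fix a b c :: fg
  show "a + b + c = a + (b + c)" by transfer (rule foldr_push_assoc)
  show "0 + a = a" by transfer simp
  show "a + 0 = a" by transfer (rule foldr_push_Nil)
  show "- a + a = 0"
  proof transfer
    fix a assume "reduced_word a"
    then show "foldr push (iword a) a = []"
      using foldr_push_inverse [of "[]" a] by (simp add: iword_def foldr_push_Nil)
  qed
  show "a + - b = a - b" by (simp add: minus_fg_def)
qed
end

lift_definition cls :: "letter list \<Rightarrow> fg" is "\<lambda>w. foldr push w []"
  by (rule reduced_foldr_push) simp

lemma cls_Nil [simp]: "cls [] = 0" by transfer simp
lemma cls_append [simp]: "cls (u @ v) = cls u + cls v"
proof transfer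
  fix u v
  have "foldr push u (foldr push v []) = foldr push (foldr push u []) (foldr push v [])"
    using foldr_push_assoc [of "foldr push v []" u "[]"] by (simp add: reduced_foldr_push)
  then show "foldr push (u @ v) [] = foldr push (foldr push u []) (foldr push v [])" by simp
qed
lemma cls_Cons: "cls (d # w) = cls [d] + cls w"
  using cls_append [of "[d]" w] by simp
lemma cls_flip [simp]: "cls [flip d] = - cls [d]"
proof -
  have "cls [flip d] + cls [d] = 0"
    unfolding cls_append [symmetric] by transfer simp
  then show ?thesis by (metis add_eq_0_iff2)
qed
lemma cls_iword [simp]: "cls (iword w) = - cls w"
proof (induction w)
  case (Cons d w)
  then show ?case by (subst cls_Cons) (simp add: minus_add)
qed simp
lemma word_of_cls [simp]: "reduced_word w \<Longrightarrow> word_of (cls w) = w"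
  by transfer (rule foldr_push_Nil)
lemma cls_word_of [simp]: "cls (word_of x) = x"
  by transfer (rule foldr_push_Nil)
lemma cls_eq_0_reduced: "reduced_word w \<Longrightarrow> cls w = 0 \<longleftrightarrow> w = []"
  by (metis cls_Nil reduced_Nil word_of_cls)
lemma cls_inj_reduced: "reduced_word v \<Longrightarrow> reduced_word w \<Longrightarrow> cls v = cls w \<longleftrightarrow> v = w"
  by (metis word_of_cls)
lemma word_of_uminus: "word_of (- x) = iword (word_of x)"
  by transfer simp

definition lw :: "(nat \<Rightarrow> 'h::group_add) \<Rightarrow> letter \<Rightarrow> 'h" where
  "lw s d = (if snd d then s (fst d) else - s (fst d))"

text \<open>The homomorphism from the free group that sends generator \<open>i\<close> to
  \<open>s i\<close>, applied to an arbitrary word; by \<open>ev_cong\<close> it depends only on the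
  class. The target is a finite permutation group for covers and \<open>fg\<close> for maps of
  graphs.\<close>

definition ev :: "(nat \<Rightarrow> 'h::group_add) \<Rightarrow> letter list \<Rightarrow> 'h" where
  "ev s w = sum_list (map (lw s) w)"

lemma lw_flip [simp]: "lw s (flip d) = - lw s d"
  by (simp add: lw_def flip_def)
lemma ev_simps [simp]: "ev s [] = 0" "ev s (d # w) = lw s d + ev s w" "ev s (u @ v) = ev s u + ev s v"
  by (simp_all add: ev_def)
lemma ev_iword [simp]: "ev s (iword w) = - ev s w"
  by (induction w) (auto simp: minus_add)
lemma ev_push: "ev s (push d w) = lw s d + ev s w"
  by (cases w) (auto simp flip: add.assoc)
lemma ev_foldr_push: "ev s (foldr push u v) = ev s u + ev s v"
  by (induction u) (auto simp: ev_push add.assoc)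
lemma ev_word_of_cls [simp]: "ev s (word_of (cls w)) = ev s w"
  using ev_foldr_push [of s w "[]"] by (simp add: cls.rep_eq)
lemma ev_cong: "cls u = cls v \<Longrightarrow> ev s u = ev s v"
  by (metis ev_word_of_cls)
lemma ev_add [simp]: "ev s (word_of (a + b)) = ev s (word_of a) + ev s (word_of b)"
  using ev_word_of_cls [of s "word_of a @ word_of b"] by simp
lemma ev_zero [simp]: "ev s (word_of 0) = 0"
  using ev_word_of_cls [of s "[]"] by simp
lemma ev_uminus [simp]: "ev s (word_of (- a)) = - ev s (word_of a)"
  by (simp add: word_of_uminus)
lemma cls_ev: "cls w = ev (\<lambda>i. cls [(i, True)]) w"
proof (induction w)
  case (Cons d w)
  have "cls [d] = lw (\<lambda>i. cls [(i, True)]) d"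
  proof (cases d)
    case (Pair i b)
    then show ?thesis using cls_flip [of "(i, True)"] by (cases b) (auto simp: lw_def flip_def)
  qed
  then show ?case using Cons by (subst cls_Cons) simp
qed simp

lemma ev_ev: "ev s (word_of (ev t w)) = ev (\<lambda>i. ev s (word_of (t i))) w"
  by (induction w) (auto simp: lw_def)

lemma ev_restrict: "(\<And>d. d \<in> set w \<Longrightarrow> s (fst d) = t (fst d)) \<Longrightarrow> ev s w = ev t w"
  by (induction w) (auto simp: lw_def)

subsection \<open>Substitutions\<close>

text \<open>Images of letters are concatenated without free reduction. Iterating on a letter
  therefore records literally which edges the iterated image of an edge crosses, and positions
  inside images can be compared.\<close>

definition ext :: "(letter \<Rightarrow> letter list) \<Rightarrow> letter list \<Rightarrow> letter list" where
  "ext h w = concat (map h w)"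

lemma ext_simps [simp]: "ext h [] = []" "ext h (d # w) = h d @ ext h w" "ext h (u @ v) = ext h u @ ext h v"
  by (auto simp: ext_def)

lemma ext_pow_append: "(ext h ^^ n) (u @ v) = (ext h ^^ n) u @ (ext h ^^ n) v"
  by (induction n) auto
lemma ext_pow_Nil [simp]: "(ext h ^^ n) [] = []"
  by (induction n) auto
text \<open>A power of a substitution is again a substitution, so results about one substitution
  apply to its powers.\<close>

lemma ext_ext_pow: "ext (\<lambda>d. (ext h ^^ n) [d]) w = (ext h ^^ n) w"
proof (induction w)
  case (Cons d w)
  then show ?case using ext_pow_append [where h = h and n = n and u = "[d]" and v = w] by simp
qed simp

definition symmetric_subst :: "(letter \<Rightarrow> letter list) \<Rightarrow> bool" where
  "symmetric_subst h \<longleftrightarrow> (\<forall>d. h (flip d) = iword (h d))"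

lemma ext_iword: "symmetric_subst h \<Longrightarrow> ext h (iword w) = iword (ext h w)"
  by (induction w) (auto simp: symmetric_subst_def)
lemma ext_pow_iword: "symmetric_subst h \<Longrightarrow> (ext h ^^ n) (iword w) = iword ((ext h ^^ n) w)"
  by (induction n) (auto simp: ext_iword)
lemma symmetric_subst_pow: "symmetric_subst h \<Longrightarrow> symmetric_subst (\<lambda>d. (ext h ^^ n) [d])"
  unfolding symmetric_subst_def [of "\<lambda>d. (ext h ^^ n) [d]"]
  using ext_pow_iword [where h = h and n = n and w = "[_]"] by simp
lemma ev_ext:
  assumes "symmetric_subst h"
  shows "ev s (ext h w) = ev (\<lambda>i. ev s (h (i, True))) w"
proof (induction w)
  case (Cons d w)
  obtain i b where d: "d = (i, b)" by fastforce
  have "h (i, False) = iword (h (i, True))"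
    using assms [unfolded symmetric_subst_def, rule_format, of "(i, True)"] by (simp add: flip_def)
  then have "ev s (h d) = lw (\<lambda>i. ev s (h (i, True))) d"
    by (cases b) (simp_all add: d lw_def)
  then show ?case using Cons by simp
qed simp
lemma cls_ext_cong: "symmetric_subst h \<Longrightarrow> cls u = cls v \<Longrightarrow> cls (ext h u) = cls (ext h v)"
  by (metis cls_ev ev_ext ev_cong)
lemma cls_ext_pow_cong: "symmetric_subst h \<Longrightarrow> cls u = cls v \<Longrightarrow> cls ((ext h ^^ n) u) = cls ((ext h ^^ n) v)"
  by (induction n) (auto intro: cls_ext_cong)

section \<open>Cancellation in products of reduced words\<close>

lemma push_drop: "\<exists>k\<le>length u. \<exists>x. foldr push u w = x @ drop k w"
proof (induction u)
  case (Cons d u)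
  then obtain k x where k: "k \<le> length u" "foldr push u w = x @ drop k w" by auto
  show ?case
  proof (cases "x")
    case Nil
    show ?thesis
    proof (cases "drop k w")
      case Nil
      then show ?thesis using k \<open>x = []\<close>
        by (intro exI [of _ "k"] conjI exI [of _ "[d]"]) auto
    next
      case (Cons y ys)
      then have ys: "ys = drop (Suc k) w" by (metis drop_Suc tl_drop list.sel(3))
      show ?thesis
      proof (cases "y = flip d")
        case True
        then show ?thesis using k \<open>x = []\<close> Cons ys
          by (intro exI [of _ "Suc k"] conjI exI [of _ "[]"]) auto
      next
        case False
        then show ?thesis using k \<open>x = []\<close> Cons ys
          by (intro exI [of _ "k"] conjI exI [of _ "[d]"]) auto
      qed
    qed
  next
    case (Cons y ys)
    show ?thesis
    proof (cases "y = flip d")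
      case True
      then show ?thesis using k Cons
        by (intro exI [of _ "k"] conjI exI [of _ "ys"]) auto
    next
      case False
      then show ?thesis using k Cons
        by (intro exI [of _ "k"] conjI exI [of _ "d # x"]) auto
    qed
  qed
qed auto

lemma word_of_add_drop: "\<exists>k\<le>length (word_of a). \<exists>x. word_of (a + b) = x @ drop k (word_of b)"
  using push_drop [of "word_of a" "word_of b"] by transfer

lemma iword_take: "iword (drop k w) = take (length w - k) (iword w)"
  by (simp add: iword_def rev_drop rev_map drop_map take_map)

lemma word_of_add_take:
  "\<exists>k\<le>length (word_of b). \<exists>x. word_of (a + b) = take (length (word_of a) - k) (word_of a) @ x"
proof -
  obtain k x where k: "k \<le> length (word_of (- b))" "word_of (- b + - a) = x @ drop k (word_of (- a))"
    using word_of_add_drop by blast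
  have "word_of (a + b) = iword (word_of (- b + - a))"
    by (metis word_of_uminus minus_add minus_minus)
  also have "\<dots> = iword (drop k (iword (word_of a))) @ iword x"
    unfolding k(2) by (simp add: word_of_uminus)
  also have "iword (drop k (iword (word_of a))) = take (length (word_of a) - k) (word_of a)"
    by (simp add: iword_take)
  finally show ?thesis using k(1) by (auto simp: word_of_uminus)
qed

text \<open>A factor of length \<open>k\<close> cancels at most \<open>k\<close> letters of the word
  it is multiplied with. Margins \<open>x\<close> and \<open>y\<close> at least as long as the two
  outer factors therefore shield \<open>c\<close>.\<close>

lemma word_of_middle:
  assumes "word_of b = x @ c @ y" "length (word_of a) \<le> length x" "length (word_of d) \<le> length y"
  shows "\<exists>x' y'. word_of (a + b + d) = x' @ c @ y'"
proof -
  obtain k z where k: "k \<le> length (word_of a)" "word_of (a + b) = z @ drop k (word_of b)"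
    using word_of_add_drop by blast
  then have 1: "word_of (a + b) = (z @ drop k x) @ c @ y" using assms by simp
  obtain l z' where "l \<le> length (word_of d)"
     "word_of (a + b + d) = take (length (word_of (a + b)) - l) (word_of (a + b)) @ z'"
    using word_of_add_take by blast
  then have "word_of (a + b + d) = (z @ drop k x) @ c @ take (length y - l) y @ z'"
    using 1 assms by simp
  then show ?thesis by blast
qed

text \<open>If \<open>w @ w\<close> is not reduced, the first and last letters of \<open>w\<close>
  are mutually inverse and move into the conjugator \<open>u\<close>. Something remains between
  them, since two mutually inverse letters alone do not form a reduced word.\<close>

lemma cyclic_reduction:
  "reduced_word w \<Longrightarrow> w \<noteq> [] \<Longrightarrow> \<exists>u c. w = u @ c @ iword u \<and> c \<noteq> [] \<and> reduced_word (c @ c)"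
proof (induction w rule: length_induct)
  case (1 w)
  show ?case
  proof (cases "reduced_word (w @ w)")
    case True
    then show ?thesis using 1 by (intro exI [of _ "[]"] exI [of _ w]) auto
  next
    case False
    then have hl: "hd w = flip (last w)" using 1 by (auto simp: reduced_append)
    then have "tl w \<noteq> []" using 1(3) flip_neq by (cases w) (metis last.simps list.sel(1) list.sel(3), metis last.simps list.sel(1) list.sel(3))
    then obtain v where v: "w = hd w # v @ [last w]" "v = butlast (tl w)"
      using 1 by (metis append_butlast_last_id last_tl list.collapse)
    have "v \<noteq> []"
    proof
      assume "v = []"
      then have "w = [hd w, last w]" using v by simp
      then show False using 1(2) hl by (metis list.sel(1) flip_flip reduced_Cons list.discI)
    qed
    moreover have "reduced_word v" using 1(2) v(1)
      by (metis reduced_append reduced_Cons)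
    moreover have "length v < length w" using 1(3) v(2) by (cases w) auto
    ultimately obtain u c where "v = u @ c @ iword u \<and> c \<noteq> [] \<and> reduced_word (c @ c)"
      using 1(1) by blast
    then show ?thesis using v(1) hl
      by (intro exI [of _ "hd w # u"] exI [of _ c]) auto
  qed
qed

lemma reduced_power: "reduced_word (c @ c) \<Longrightarrow> reduced_word (concat (replicate n c))"
proof (induction n)
  case (Suc n)
  then show ?case
    by (cases n) (auto simp: reduced_append)
qed simp

section \<open>Powers and torsion\<close>

fun nmul :: "nat \<Rightarrow> 'a::monoid_add \<Rightarrow> 'a" where
  "nmul 0 a = 0" | "nmul (Suc n) a = a + nmul n a"

lemma nmul_add: "nmul (m + n) a = nmul m a + nmul n a"
  by (induction m) (auto simp: add.assoc)
lemma nmul_zero [simp]: "nmul n 0 = 0"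
  by (induction n) auto
lemma nmul_mult: "nmul (m * n) a = nmul n (nmul m a)"
  by (induction n) (auto simp: nmul_add)
lemma nmul_conj: "nmul n (u + c - u) = u + nmul n c - (u :: 'a :: group_add)"
proof (induction n)
  case (Suc n)
  have "u + c - u + (u + nmul n c - u) = u + (c + nmul n c) - u" by (simp add: add.assoc diff_conv_add_uminus del: add_uminus_conv_diff)
  then show ?case using Suc by simp
qed simp
lemma cls_power: "cls (concat (replicate n c)) = nmul n (cls c)"
  by (induction n) auto

text \<open>Up to conjugation the word is cyclically reduced; its powers are then reduced as they
  stand, hence nontrivial.\<close>

lemma fg_torsion_free:
  assumes "nmul n (a :: fg) = 0" "n > 0" shows "a = 0"
proof (rule ccontr)
  assume "a \<noteq> 0"
  then have "word_of a \<noteq> []" by (metis cls_Nil cls_word_of)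
  then obtain u c where uc: "word_of a = u @ c @ iword u" "c \<noteq> []" "reduced_word (c @ c)"
    using cyclic_reduction by (metis reduced_word_of)
  have "a = cls u + cls c - cls u"
    by (subst cls_word_of [symmetric]) (simp add: uc(1) add.assoc flip: add_uminus_conv_diff)
  then have "cls u + nmul n (cls c) - cls u = 0" using assms(1) by (metis nmul_conj)
  then have "nmul n (cls c) = 0" by (metis add.right_neutral add_left_cancel eq_iff_diff_eq_0)
  then have "concat (replicate n c) = []"
    using reduced_power [OF uc(3)] by (metis cls_power cls_eq_0_reduced)
  then show False using uc(2) assms(2) by simp
qed

section \<open>Residual finiteness\<close>

text \<open>The degree of the finite quotient is found only inside a proof, and a type cannot depend
  on it. Hence one type of all bijections of the naturals, with the finite symmetric groups as
  subsets \<open>sym_on n\<close>.\<close>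

typedef sym = "{f :: nat \<Rightarrow> nat. bij f}" morphisms sym_fun Abs_sym
  by (rule exI [of _ id]) simp

setup_lifting type_definition_sym

instantiation sym :: group_add
begin
lift_definition zero_sym :: sym is id by simp
lift_definition plus_sym :: "sym \<Rightarrow> sym \<Rightarrow> sym" is "(\<circ>)" by (rule bij_comp)
lift_definition uminus_sym :: "sym \<Rightarrow> sym" is "inv_into UNIV" by (rule bij_imp_bij_inv)
definition minus_sym :: "sym \<Rightarrow> sym \<Rightarrow> sym" where "minus_sym a b = a + - b"
instance
proof
  fix a b c :: sym
  show "a + b + c = a + (b + c)" by transfer (rule comp_assoc)
  show "0 + a = a" by transfer simp
  show "a + 0 = a" by transfer simp
  show "- a + a = 0" by transfer (simp add: bij_is_inj)
  show "a + - b = a - b" by (simp add: minus_sym_def)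
qed
end

definition sym_on :: "nat \<Rightarrow> sym set" where
  "sym_on n = {a. sym_fun a permutes {..<n}}"

lemma finite_sym_on: "finite (sym_on n)"
proof (rule finite_imageD)
  show "finite (sym_fun ` sym_on n)"
    by (rule finite_subset [OF _ finite_permutations [of "{..<n}"]]) (auto simp: sym_on_def)
  show "inj_on sym_fun (sym_on n)" by (simp add: inj_on_def sym_fun_inject)
qed

lemma sym_on_subgroup:
  "0 \<in> sym_on n" "a \<in> sym_on n \<Longrightarrow> b \<in> sym_on n \<Longrightarrow> a + b \<in> sym_on n"
  "a \<in> sym_on n \<Longrightarrow> - a \<in> sym_on n"
  unfolding sym_on_def zero_sym.rep_eq plus_sym.rep_eq uminus_sym.rep_eq mem_Collect_eq
  by (rule permutes_id, rule permutes_compose, assumption+, rule permutes_inv)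

text \<open>Domain and image have complements of equal size in the finite set \<open>S\<close>; any
  bijection between these completes \<open>f\<close>.\<close>

lemma extend_partial_injection:
  assumes "finite S" "A \<subseteq> S" "inj_on f A" "f ` A \<subseteq> S"
  shows "\<exists>p. p permutes S \<and> (\<forall>x\<in>A. p x = f x)"
proof -
  have "card (S - A) = card (S - f ` A)"
    using assms finite_subset [OF assms(2,1)] by (simp add: card_Diff_subset card_image)
  then obtain h where h: "bij_betw h (S - A) (S - f ` A)"
    using assms(1) finite_same_card_bij [of "S - A" "S - f ` A"] by blast
  define p where "p x = (if x \<in> A then f x else if x \<in> S then h x else x)" for x
  have "bij_betw p A (f ` A)"
    using assms(3) by (auto simp: bij_betw_def p_def inj_on_def)
  moreover have "bij_betw p (S - A) (S - f ` A) = bij_betw h (S - A) (S - f ` A)"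
    by (rule bij_betw_cong) (simp add: p_def)
  then have "bij_betw p (S - A) (S - f ` A)" using h by simp
  ultimately have "bij_betw p (A \<union> (S - A)) (f ` A \<union> (S - f ` A))"
    by (rule bij_betw_combine) auto
  then have "bij_betw p S S" using assms by (simp add: Un_absorb1)
  then have "p permutes S"
    by (rule bij_imp_permutes) (use assms(2) in \<open>auto simp: p_def\<close>)
  then show ?thesis by (auto simp: p_def)
qed

text \<open>The word is traced along the points \<open>n, n - 1, \<dots>, 0\<close>: its letter number \<open>i\<close> moves the
  point \<open>Suc i\<close> to \<open>i\<close>. Reducedness says exactly that these conditions on a generator define a
  partial injection.\<close>

lemma residually_finite:
  assumes "reduced_word w" "w \<noteq> []"
  shows "\<exists>n s. (\<forall>i. s i \<in> sym_on n) \<and> ev s w \<noteq> 0"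
proof -
  define n where "n = length w"
  \<comment> \<open>The points at which generator \<open>j\<close> is prescribed:
    \<open>Suc i\<close>, to be sent to \<open>i\<close>, if letter number \<open>i\<close> is
    positive, and \<open>i\<close>, to be sent to \<open>Suc i\<close>, if it is negative.\<close>
  define A where "A j = {Suc i | i. i < n \<and> w ! i = (j, True)} \<union> {i. i < n \<and> w ! i = (j, False)}" for j
  define f where "f j x = (if x < n \<and> w ! x = (j, False) then Suc x else x - 1)" for j x
  have red: "w ! Suc i \<noteq> flip (w ! i)" if "Suc i < n" for i
    using assms(1) that unfolding reduced_word_def successively_conv_nth n_def by simp
  have f1: "f j (Suc i) = i" if "i < n" "w ! i = (j, True)" for i j
    using red [of i] that by (auto simp: f_def flip_def)
  have ex: "\<exists>p. p permutes {..<Suc n} \<and> (\<forall>x\<in>A j. p x = f j x)" for j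
  proof (rule extend_partial_injection)
    show "inj_on (f j) (A j)"
    proof (rule inj_onI)
      \<comment> \<open>Two prescriptions can collide only between a negative letter and a positive
        letter right after it, and such a pair would cancel.\<close>
      have TF: False if "i < n" "w ! i = (j, True)" "y < n" "w ! y = (j, False)" "i = Suc y" for i y
        using red [of y] that by (simp add: flip_def)
      have f2: "f j y = Suc y" if "y < n" "w ! y = (j, False)" for y
        using that by (simp add: f_def)
      fix x y assume xy: "x \<in> A j" "y \<in> A j" and eq: "f j x = f j y"
      consider i k where "x = Suc i" "y = Suc k" "i < n" "k < n" "w ! i = (j, True)" "w ! k = (j, True)"
        | i where "x = Suc i" "i < n" "w ! i = (j, True)" "y < n" "w ! y = (j, False)"
        | i where "y = Suc i" "i < n" "w ! i = (j, True)" "x < n" "w ! x = (j, False)"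
        | "x < n" "w ! x = (j, False)" "y < n" "w ! y = (j, False)"
        using xy unfolding A_def by blast
      then show "x = y"
      proof cases
        case 1 then show ?thesis using eq f1 by metis
      next
        case 2 then show ?thesis using eq f1 f2 TF by metis
      next
        case 3 then show ?thesis using eq f1 f2 TF by metis
      next
        case 4 then show ?thesis using eq f2 by simp
      qed
    qed
    show "A j \<subseteq> {..<Suc n}" "f j ` A j \<subseteq> {..<Suc n}"
      by (auto simp: A_def f_def)
  qed simp
  define p where "p j = (SOME p. p permutes {..<Suc n} \<and> (\<forall>x\<in>A j. p x = f j x))" for j
  have p: "p j permutes {..<Suc n}" "\<And>x. x \<in> A j \<Longrightarrow> p j x = f j x" for j
    using someI_ex [OF ex [of j]] unfolding p_def by blast+
  define s where "s j = Abs_sym (p j)" for j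
  have sf: "sym_fun (s j) = p j" for j
    unfolding s_def using p(1) [of j] by (simp add: Abs_sym_inverse permutes_bij)
  have trace: "sym_fun (lw s (w ! i)) (Suc i) = i" if "i < n" for i
  proof (cases "w ! i")
    case (Pair j b)
    show ?thesis
    proof (cases b)
      case True
      then have "Suc i \<in> A j" using Pair that by (auto simp: A_def)
      then show ?thesis using Pair True f1 that by (simp add: lw_def sf p(2))
    next
      case False
      then have "i \<in> A j" using Pair that by (auto simp: A_def)
      then have "p j i = Suc i" using p(2) Pair False that by (simp add: f_def)
      then have "inv_into UNIV (p j) (Suc i) = i" using p(1) by (metis permutes_inverses(2))
      then show ?thesis using Pair False by (simp add: lw_def uminus_sym.rep_eq sf)
    qed
  qed
  \<comment> \<open>Addition in \<open>sym\<close> is composition, so the last letter acts first and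
    the suffixes of the word are traced downwards from the point \<open>n\<close>.\<close>
  have "sym_fun (ev s (drop i w)) n = i" if "i \<le> n" for i
    using that
  proof (induction i rule: inc_induct)
    case base
    then show ?case by (simp add: n_def zero_sym.rep_eq)
  next
    case (step i)
    then have "drop i w = w ! i # drop (Suc i) w" by (simp add: n_def Cons_nth_drop_Suc)
    then show ?case using step trace by (simp add: plus_sym.rep_eq)
  qed
  from this [of 0] have "sym_fun (ev s w) n = 0" by simp
  then have "ev s w \<noteq> 0" using assms(2) by (auto simp: zero_sym.rep_eq n_def)
  moreover have "\<forall>j. s j \<in> sym_on (Suc n)" using p(1) by (simp add: sym_on_def sf)
  ultimately have "(\<forall>i. s i \<in> sym_on (Suc n)) \<and> ev s w \<noteq> 0" by simp
  then show ?thesis by (rule exI [of _ s, THEN exI [of _ "Suc n"]])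
qed

lemma ev_in_subgroup:
  assumes "0 \<in> Q" "\<And>a b. a \<in> Q \<Longrightarrow> b \<in> Q \<Longrightarrow> a + b \<in> Q" "\<And>a. a \<in> Q \<Longrightarrow> - a \<in> Q"
    "\<And>d. d \<in> set w \<Longrightarrow> s (fst d) \<in> Q"
  shows "ev s w \<in> Q"
  using assms(4)
proof (induction w)
  case (Cons d w)
  have "s (fst d) \<in> Q" by (rule Cons.prems) simp
  then have "lw s d \<in> Q" using assms(3) by (simp add: lw_def)
  moreover have "ev s w \<in> Q" by (rule Cons.IH) (rule Cons.prems, simp)
  ultimately show ?case using assms(2) by simp
qed (simp add: assms(1))

section \<open>Projections of an internal free product\<close>

definition syllables :: "('i \<Rightarrow> 'a set) \<Rightarrow> ('i \<times> 'a) list \<Rightarrow> bool" where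
  "syllables F xs \<longleftrightarrow> (\<forall>(i, x)\<in>set xs. x \<in> F i)"

text \<open>With \<open>P\<close> constantly true this is the element represented by the list; with
  \<open>P\<close> selecting one factor it is the candidate for the projection to that
  factor.\<close>

definition (in Group.group) eval_part :: "('i \<Rightarrow> bool) \<Rightarrow> ('i \<times> 'a) list \<Rightarrow> 'a" where
  "eval_part P xs = foldr (\<otimes>) (map snd (filter (\<lambda>p. P (fst p)) xs)) \<one>"

context Group.group
begin

lemma eval_part_simps [simp]:
  "eval_part P [] = \<one>"
  "eval_part P (p # xs) = (if P (fst p) then snd p \<otimes> eval_part P xs else eval_part P xs)"
  by (auto simp: eval_part_def)

context
  fixes F :: "'i \<Rightarrow> 'a set"
  assumes sub: "\<And>i. subgroup (F i) G"
begin

lemma factor_closed [simp, intro]: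
  "x \<in> F i \<Longrightarrow> x \<in> carrier G" "x \<in> F i \<Longrightarrow> y \<in> F i \<Longrightarrow> x \<otimes> y \<in> F i" "x \<in> F i \<Longrightarrow> inv x \<in> F i"
  using sub by (auto dest: subgroup.mem_carrier subgroup.m_closed subgroup.m_inv_closed)

lemma eval_part_closed: "syllables F xs \<Longrightarrow> eval_part P xs \<in> carrier G"
  by (induction xs) (auto simp: syllables_def)

lemma eval_part_append:
  "syllables F xs \<Longrightarrow> syllables F ys \<Longrightarrow> eval_part P (xs @ ys) = eval_part P xs \<otimes> eval_part P ys"
proof (induction xs)
  case Nil
  then show ?case using eval_part_closed [of ys] by simp
next
  case (Cons p xs)
  then have "syllables F xs" "snd p \<in> carrier G" by (auto simp: syllables_def)
  then show ?case
    using Cons eval_part_closed [of xs P] eval_part_closed [of ys P] by (simp add: m_assoc)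
qed

lemma eval_part_inv:
  "syllables F xs \<Longrightarrow> syllables F (rev (map (\<lambda>(i, x). (i, inv x)) xs)) \<and>
     eval_part P (rev (map (\<lambda>(i, x). (i, inv x)) xs)) = inv (eval_part P xs)"
proof (induction xs)
  case (Cons p xs)
  let ?ys = "rev (map (\<lambda>(i, x). (i, inv x)) xs)"
  have xs: "syllables F xs" "snd p \<in> F (fst p)" using Cons.prems by (auto simp: syllables_def)
  then have 1: "syllables F ?ys" "syllables F [(fst p, inv (snd p))]"
    using Cons.IH by (auto simp: syllables_def)
  then have "eval_part P (?ys @ [(fst p, inv (snd p))])
      = inv (eval_part P xs) \<otimes> eval_part P [(fst p, inv (snd p))]"
    using Cons.IH xs by (simp only: eval_part_append)
  also have "\<dots> = inv (eval_part P (p # xs))"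
    using xs eval_part_closed [OF xs(1), of P] by (auto simp: inv_mult_group factor_closed(1))
  finally show ?case using 1 by (cases p) (auto simp: syllables_def)
qed (simp add: syllables_def)

text \<open>Dropping a trivial syllable or merging two neighbours from the same factor changes no
  partial product and shortens the list. If neither is possible and the list is nonempty, freeness
  makes the full product nontrivial.\<close>

lemma eval_part_trivial:
  assumes alt: "\<And>xs. xs \<noteq> [] \<Longrightarrow> \<forall>(i, x)\<in>set xs. x \<in> F i \<and> x \<noteq> \<one> \<Longrightarrow>
      successively (\<lambda>p q. fst p \<noteq> fst q) xs \<Longrightarrow> eval_part (\<lambda>_. True) xs \<noteq> \<one>"
  shows "syllables F xs \<Longrightarrow> eval_part (\<lambda>_. True) xs = \<one> \<Longrightarrow> eval_part P xs = \<one>"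
proof (induction xs rule: length_induct)
  case (1 xs)
  note syl = \<open>syllables F xs\<close>
  consider "xs = []" | ys i zs where "xs = ys @ (i, \<one>) # zs"
    | ys i x y zs where "xs = ys @ (i, x) # (i, y) # zs"
  proof (rule ccontr)
    assume "\<not> thesis"
    then have no: "xs \<noteq> []" "\<And>ys i zs. xs \<noteq> ys @ (i, \<one>) # zs"
      "\<And>ys i x y zs. xs \<noteq> ys @ (i, x) # (i, y) # zs" using that by blast+
    have "\<forall>(i, x)\<in>set xs. x \<in> F i \<and> x \<noteq> \<one>"
      using syl no(2) by (auto simp: syllables_def) (metis split_list)
    moreover have "successively (\<lambda>p q. fst p \<noteq> fst q) xs"
    proof (rule ccontr)
      assume "\<not> ?thesis"
      then obtain n where n: "Suc n < length xs" "fst (xs ! n) = fst (xs ! Suc n)"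
        by (auto simp: successively_conv_nth)
      then have "xs = take n xs @ xs ! n # xs ! Suc n # drop (Suc (Suc n)) xs"
        by (metis Cons_nth_drop_Suc Suc_lessD append_take_drop_id)
      then show False using no(3) [of "take n xs" "fst (xs ! n)" "snd (xs ! n)" "snd (xs ! Suc n)"]
        n(2) by (metis prod.collapse)
    qed
    ultimately show False using alt no(1) 1(3) by blast
  qed
  then show ?case
  proof cases
    case 2
    have yz: "syllables F ys" "syllables F zs" using syl 2 by (auto simp: syllables_def)
    have sl: "syllables F [(i, \<one>)]" "syllables F (ys @ zs)"
      using syl 2 by (auto simp: syllables_def)
    have "eval_part Q xs = eval_part Q (ys @ zs)" for Q
      using yz sl eval_part_append [of ys "(i, \<one>) # zs" Q] eval_part_append [of ys zs Q]
        eval_part_closed [of zs Q] syl 2 by (auto simp: syllables_def)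
    then show ?thesis using 1 sl 2 by simp
  next
    case 3
    have yz: "syllables F ys" "syllables F zs" "x \<in> F i" "y \<in> F i"
      using syl 3 by (auto simp: syllables_def)
    have sl: "syllables F (ys @ (i, x \<otimes> y) # zs)" using yz by (auto simp: syllables_def)
    have "eval_part Q xs = eval_part Q (ys @ (i, x \<otimes> y) # zs)" for Q
      using yz sl eval_part_append [of ys "(i, x \<otimes> y) # zs" Q]
        eval_part_append [of ys "(i, x) # (i, y) # zs" Q]
        eval_part_closed [of zs Q] syl 3 by (auto simp: syllables_def m_assoc)
    then show ?thesis using 1 sl 3 by simp
  qed simp
qed

lemma generate_eval_part:
  assumes "x \<in> generate G (\<Union>i. F i)"
  shows "\<exists>xs. syllables F xs \<and> eval_part (\<lambda>_. True) xs = x"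
  using assms
proof (induction rule: generate.induct)
  case one
  show ?case by (rule exI [of _ "[]"]) (simp add: syllables_def)
next
  case (incl h)
  then obtain i where "h \<in> F i" by blast
  then show ?case by (intro exI [of _ "[(i, h)]"]) (auto simp: syllables_def)
next
  case (inv h)
  then obtain i where "h \<in> F i" by blast
  then show ?case by (intro exI [of _ "[(i, inv h)]"]) (auto simp: syllables_def)
next
  case (eng h1 h2)
  then obtain xs ys where "syllables F xs" "eval_part (\<lambda>_. True) xs = h1"
    "syllables F ys" "eval_part (\<lambda>_. True) ys = h2" by blast
  then show ?case
    by (intro exI [of _ "xs @ ys"]) (auto simp: eval_part_append, auto simp: syllables_def)
qed

end

text \<open>An element is written as a product of syllables, and only those from factor
  \<open>b\<close> are kept. This is well defined: \<open>eval_part_trivial\<close>, applied to one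
  expression followed by the inverse of another, shows that their partial products agree.\<close>

theorem free_product_projection:
  fixes F :: "bool \<Rightarrow> 'a set"
  assumes "internal_free_product G UNIV F (carrier G)"
  shows "\<exists>p. p \<in> hom G G \<and> p ` carrier G \<subseteq> F b \<and> (\<forall>x\<in>F b. p x = x) \<and> (\<forall>x\<in>F (\<not> b). p x = \<one>)"
proof -
  have sub: "\<And>i. subgroup (F i) G" and gen: "carrier G = generate G (\<Union>i. F i)"
    and alt: "\<And>xs. xs \<noteq> [] \<Longrightarrow> \<forall>(i, x)\<in>set xs. x \<in> F i \<and> x \<noteq> \<one> \<Longrightarrow>
      successively (\<lambda>p q. fst p \<noteq> fst q) xs \<Longrightarrow> eval_part (\<lambda>_. True) xs \<noteq> \<one>"
    using assms unfolding internal_free_product_def eval_part_def by auto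
  define R where "R x = (SOME xs. syllables F xs \<and> eval_part (\<lambda>_. True) xs = x)" for x
  have R: "syllables F (R x)" "eval_part (\<lambda>_. True) (R x) = x" if "x \<in> carrier G" for x
    using someI_ex [OF generate_eval_part [of F x]] sub that gen unfolding R_def by auto
  let ?P = "\<lambda>i. i = b"
  have eq: "eval_part ?P xs = eval_part ?P ys"
    if "syllables F xs" "syllables F ys" "eval_part (\<lambda>_. True) xs = eval_part (\<lambda>_. True) ys" for xs ys
  proof -
    let ?zs = "rev (map (\<lambda>(i, x). (i, inv x)) ys)"
    note i = eval_part_inv [of F, OF sub that(2)]
    have zs: "syllables F ?zs" using i by blast
    then have zs2: "syllables F (xs @ ?zs)" using that(1) by (auto simp: syllables_def)
    have "eval_part (\<lambda>_. True) (xs @ ?zs) = \<one>"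
      using i zs that eval_part_closed [of F, OF sub that(2)]
      by (subst eval_part_append [of F, OF sub that(1) zs]) simp
    then have "eval_part ?P (xs @ ?zs) = \<one>"
      using eval_part_trivial [of F, OF sub alt zs2] by blast
    then have "eval_part ?P xs \<otimes> inv (eval_part ?P ys) = \<one>"
      using eval_part_append [of F, OF sub that(1) zs] i by simp
    then show ?thesis
      using eval_part_closed [of F, OF sub that(2)] eval_part_closed [of F, OF sub that(1)]
      by (metis inv_equality inv_inv inv_closed)
  qed
  define p where "p x = eval_part ?P (R x)" for x
  have p: "p (eval_part (\<lambda>_. True) xs) = eval_part ?P xs" if "syllables F xs" for xs
    unfolding p_def using that R eval_part_closed [of F, OF sub that] by (intro eq) auto
  have "p \<in> hom G G"
  proof (rule homI)
    fix x y assume xy: "x \<in> carrier G" "y \<in> carrier G"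
    then have s: "syllables F (R x @ R y)" using R by (auto simp: syllables_def)
    have e: "eval_part Q (R x @ R y) = eval_part Q (R x) \<otimes> eval_part Q (R y)" for Q
      using eval_part_append [of F, OF sub] R xy by blast
    show "p (x \<otimes> y) = p x \<otimes> p y" using p [OF s] e R xy by (simp add: p_def)
  next
    fix x assume "x \<in> carrier G"
    then show "p x \<in> carrier G" unfolding p_def using eval_part_closed [of F, OF sub] R by blast
  qed
  moreover have "eval_part ?P xs \<in> F b" if "syllables F xs" for xs
    using that
  proof (induction xs)
    case Nil then show ?case using sub by (simp add: subgroup.one_closed)
  next
    case (Cons q xs)
    then show ?case using sub [of b] by (auto simp: syllables_def subgroup.m_closed)
  qed
  then have "p ` carrier G \<subseteq> F b" using R by (auto simp: p_def)
  moreover have "p x = x" if "x \<in> F b" for x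
    using p [of "[(b, x)]"] that subgroup.mem_carrier [OF sub] by (simp add: syllables_def)
  moreover have "p x = \<one>" if "x \<in> F (\<not> b)" for x
    using p [of "[(\<not> b, x)]"] that subgroup.mem_carrier [OF sub] by (simp add: syllables_def)
  ultimately show ?thesis by blast
qed

end

section \<open>Iterating a train track substitution\<close>

text \<open>The abstract graph has \<open>E\<close> edges and is given by the initial vertex
  \<open>tail d\<close> of each oriented edge; the terminal vertex is \<open>tail (flip d)\<close>.
  Backtracking is allowed.\<close>

fun epath :: "nat \<Rightarrow> (letter \<Rightarrow> 'v) \<Rightarrow> 'v \<Rightarrow> letter list \<Rightarrow> 'v \<Rightarrow> bool" where
  "epath E tail u [] v \<longleftrightarrow> u = v"
| "epath E tail u (d # w) v \<longleftrightarrow> fst d < E \<and> tail d = u \<and> epath E tail (tail (flip d)) w v"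

lemma epath_append: "epath E tail u (a @ b) v \<longleftrightarrow> (\<exists>x. epath E tail u a x \<and> epath E tail x b v)"
  by (induction a arbitrary: u) auto

lemma epath_iword: "epath E tail v (iword w) u \<longleftrightarrow> epath E tail u w v"
  by (induction w arbitrary: u) (auto simp: epath_append)

lemma epath_det: "epath E tail u w v \<Longrightarrow> epath E tail u w v' \<Longrightarrow> v = v'"
  by (induction w arbitrary: u) auto

lemma epath_letters: "epath E tail u w v \<Longrightarrow> d \<in> set w \<Longrightarrow> fst d < E"
  by (induction w arbitrary: u) auto

text \<open>It lets a position in an image be described by a letter and an offset, of which there
  are only finitely many combinations.\<close>

lemma ext_position:
  "i < length (ext h w) \<Longrightarrow>
    \<exists>k m. k < length w \<and> m < length (h (w ! k)) \<and> i = length (ext h (take k w)) + m \<and>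
      take i (ext h w) = ext h (take k w) @ take m (h (w ! k))"
proof (induction w arbitrary: i)
  case (Cons d w)
  show ?case
  proof (cases "i < length (h d)")
    case True
    then show ?thesis by (intro exI [of _ 0] exI [of _ i]) auto
  next
    case False
    then have "i - length (h d) < length (ext h w)" using Cons.prems by auto
    then obtain k m where "k < length w" "m < length (h (w ! k))"
      "i - length (h d) = length (ext h (take k w)) + m"
      "take (i - length (h d)) (ext h w) = ext h (take k w) @ take m (h (w ! k))"
      using Cons.IH by blast
    then show ?thesis using False by (intro exI [of _ "Suc k"] exI [of _ m]) auto
  qed
qed simp

lemma length_ext_take_mono: "k \<le> l \<Longrightarrow> length (ext h (take k w)) \<le> length (ext h (take l w))"
  by (metis append_take_drop_id ext_simps(3) length_append le_add1 min.absorb1 take_take)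

lemma reduced_iword_append:
  "reduced_word x \<Longrightarrow> reduced_word y \<Longrightarrow> (x \<noteq> [] \<Longrightarrow> y \<noteq> [] \<Longrightarrow> hd x \<noteq> hd y) \<Longrightarrow> reduced_word (iword x @ y)"
  by (auto simp: reduced_append last_iword)

lemma add_diff_add_right: "(a + s) - (b + s) = a - (b :: 'a :: group_add)"
  by (simp add: diff_conv_add_uminus minus_add add.assoc del: add_uminus_conv_diff)

text \<open>A train track map reduced to combinatorics: \<open>gw\<close> gives the image path of
  each edge, \<open>gw_reduced\<close> says that no iterate of an edge backtracks, and
  \<open>gw_inj\<close> is injectivity on fundamental groups, which is what limits cancellation
  between images.\<close>

locale graph_map =
  fixes E :: nat and tail :: "letter \<Rightarrow> 'v" and gw :: "letter \<Rightarrow> letter list" and gv :: "'v \<Rightarrow> 'v"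
  assumes gw_sym: "symmetric_subst gw"
    and gw_epath: "\<And>d. fst d < E \<Longrightarrow> epath E tail (gv (tail d)) (gw d) (gv (tail (flip d)))"
    and gw_nonempty: "\<And>d. fst d < E \<Longrightarrow> gw d \<noteq> []"
    and gw_reduced: "\<And>d n. fst d < E \<Longrightarrow> reduced_word ((ext gw ^^ n) [d])"
    and gw_inj: "\<And>v w. epath E tail v w v \<Longrightarrow> cls (ext gw w) = 0 \<Longrightarrow> cls w = 0"
begin

abbreviation "ep \<equiv> epath E tail"

lemma ext_epath: "ep u w v \<Longrightarrow> ep (gv u) (ext gw w) (gv v)"
  by (induction w arbitrary: u) (use gw_epath in \<open>auto simp: epath_append\<close>)

lemma ext_pow_inj: "ep v w v \<Longrightarrow> cls ((ext gw ^^ n) w) = 0 \<Longrightarrow> cls w = 0"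
proof (induction n arbitrary: v w)
  case (Suc n)
  have "cls ((ext gw ^^ n) (ext gw w)) = 0" using Suc.prems(2) by (simp add: funpow_swap1)
  then have "cls (ext gw w) = 0" using Suc.IH ext_epath [OF Suc.prems(1)] by blast
  then show ?case using gw_inj Suc.prems(1) by blast
qed simp

lemma ext_pow_letters:
  assumes "\<And>d. d \<in> set w \<Longrightarrow> fst d < E" "d \<in> set ((ext gw ^^ n) w)"
  shows "fst d < E"
proof -
  have "(\<And>d. d \<in> set w \<Longrightarrow> fst d < E) \<Longrightarrow> (\<And>d. d \<in> set ((ext gw ^^ n) w) \<Longrightarrow> fst d < E)"
  proof (induction n)
    case (Suc n)
    then obtain e where "e \<in> set ((ext gw ^^ n) w)" "d \<in> set (gw e)"
      by (auto simp: ext_def [of _ "(ext gw ^^ n) w"])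
    then show ?case using Suc gw_epath epath_letters by metis
  qed simp
  then show ?thesis using assms by blast
qed

lemma ext_length: "(\<And>d. d \<in> set w \<Longrightarrow> fst d < E) \<Longrightarrow> length w \<le> length (ext gw w)"
proof (induction w)
  case (Cons d w)
  then have "gw d \<noteq> []" using gw_nonempty by simp
  then have "1 \<le> length (gw d)" by (cases "gw d") auto
  then show ?case using Cons by simp
qed simp

lemma ext_pow_length:
  assumes "\<And>d. d \<in> set w \<Longrightarrow> fst d < E" shows "length w \<le> length ((ext gw ^^ n) w)"
proof (induction n)
  case (Suc n)
  have "length ((ext gw ^^ n) w) \<le> length (ext gw ((ext gw ^^ n) w))"
    by (rule ext_length) (use ext_pow_letters assms in blast)
  then show ?case using Suc by simp
qed simp

definition legal :: "letter list \<Rightarrow> bool" where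
  "legal w \<longleftrightarrow> (\<forall>n. reduced_word ((ext gw ^^ n) w))"

lemma legal_sub: "legal (a @ b @ c) \<Longrightarrow> legal b"
  unfolding legal_def by (simp add: ext_pow_append reduced_append)
lemma legal_reduced: "legal w \<Longrightarrow> reduced_word w"
  unfolding legal_def by (metis funpow_0)
lemma legal_ext: "legal w \<Longrightarrow> legal (ext gw w)"
  unfolding legal_def by (metis comp_apply funpow_Suc_right)
text \<open>If the images agreed for too long, then by the pigeonhole principle the same pair of positions
  inside the images of letters would occur twice, producing two different loops with
  the same image.\<close>

lemma bounded_cancellation:
  "\<exists>C. \<forall>v a b \<alpha> \<beta> p x y. ep v \<alpha> a \<longrightarrow> ep v \<beta> b \<longrightarrow> reduced_word \<alpha> \<longrightarrow> reduced_word \<beta> \<longrightarrow>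
     hd \<alpha> \<noteq> hd \<beta> \<longrightarrow> (ext gw ^^ N) \<alpha> = p @ x \<longrightarrow> (ext gw ^^ N) \<beta> = p @ y \<longrightarrow> length p \<le> C"
proof -
  define h where "h d = (ext gw ^^ N) [d]" for d
  define L :: "letter set" where "L = {..<E} \<times> UNIV"
  define B where "B = Max (insert 0 ((length \<circ> h) ` L))"
  have fL: "finite L" by (simp add: L_def)
  have B: "length (h d) \<le> B" if "d \<in> L" for d
    unfolding B_def using fL that by (intro Max_ge) auto
  \<comment> \<open>The possible states of a position: a letter of \<open>\<alpha>\<close> with an
    offset inside its image, and likewise for \<open>\<beta>\<close>. The number of states is the
    constant claimed.\<close>
  define T where "T = (L \<times> {..<B}) \<times> (L \<times> {..<B})"
  have fT: "finite T" using fL by (simp add: T_def)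
  show ?thesis
  proof (rule exI [of _ "card T"], intro allI impI, rule ccontr)
    fix v a b \<alpha> \<beta> p x y
    assume \<alpha>: "ep v \<alpha> a" and \<beta>: "ep v \<beta> b" and red: "reduced_word \<alpha>" "reduced_word \<beta>"
      and hd: "hd \<alpha> \<noteq> hd \<beta>" and pa: "(ext gw ^^ N) \<alpha> = p @ x" and pb: "(ext gw ^^ N) \<beta> = p @ y"
      and "\<not> length p \<le> card T"
    then have pT: "card T < length p" by simp
    have ha: "ext h \<alpha> = p @ x" and hb: "ext h \<beta> = p @ y"
      using pa pb unfolding h_def by (simp_all add: ext_ext_pow)
    have inL: "w ! k \<in> L" if "ep u w u'" "k < length w" for u w u' k
      using epath_letters [OF that(1) nth_mem [OF that(2)]] by (cases "w ! k") (auto simp: L_def)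
    have "\<exists>k m l m'. k < length \<alpha> \<and> l < length \<beta> \<and> m < length (h (\<alpha> ! k)) \<and> m' < length (h (\<beta> ! l)) \<and>
       i = length (ext h (take k \<alpha>)) + m \<and> i = length (ext h (take l \<beta>)) + m' \<and>
       take i p = ext h (take k \<alpha>) @ take m (h (\<alpha> ! k)) \<and>
       take i p = ext h (take l \<beta>) @ take m' (h (\<beta> ! l))" if "i < length p" for i
      using ext_position [of i h \<alpha>] ext_position [of i h \<beta>] that by (simp add: ha hb) blast
    then obtain k m l m' where pos: "\<And>i. i < length p \<Longrightarrow> k i < length \<alpha> \<and> l i < length \<beta> \<and>
       m i < length (h (\<alpha> ! k i)) \<and> m' i < length (h (\<beta> ! l i)) \<and>
       i = length (ext h (take (k i) \<alpha>)) + m i \<and> i = length (ext h (take (l i) \<beta>)) + m' i \<and>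
       take i p = ext h (take (k i) \<alpha>) @ take (m i) (h (\<alpha> ! k i)) \<and>
       take i p = ext h (take (l i) \<beta>) @ take (m' i) (h (\<beta> ! l i))"
      by metis
    define st where "st i = ((\<alpha> ! k i, m i), (\<beta> ! l i, m' i))" for i
    have "st ` {..<length p} \<subseteq> T"
    proof
      fix z assume "z \<in> st ` {..<length p}"
      then obtain i where i: "i < length p" "z = st i" by auto
      have "\<alpha> ! k i \<in> L" "\<beta> ! l i \<in> L" using pos [OF i(1)] inL \<alpha> \<beta> by blast+
      moreover have "m i < B" "m' i < B"
        using pos [OF i(1)] B calculation by (meson less_le_trans)+
      ultimately show "z \<in> T" unfolding i(2) st_def T_def by simp
    qed
    then have "card (st ` {..<length p}) < card {..<length p}"
      using pT card_mono [OF fT] by (metis card_lessThan le_less_trans)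
    then have "\<not> inj_on st {..<length p}" by (metis card_image less_irrefl)
    then obtain i j where ij: "i < j" "j < length p" "st i = st j"
      unfolding inj_on_def by (metis lessThan_iff linorder_neqE_nat)
    then have i: "i < length p" by simp
    note pi = pos [OF i] and pj = pos [OF ij(2)]
    have same: "\<alpha> ! k i = \<alpha> ! k j" "m i = m j" "\<beta> ! l i = \<beta> ! l j" "m' i = m' j"
      using ij(3) by (auto simp: st_def)
    \<comment> \<open>Equal offsets at different positions force different letter numbers, so both
      prefixes genuinely grow.\<close>
    have kk: "k i < k j"
    proof (rule ccontr)
      assume "\<not> k i < k j"
      then have "length (ext h (take (k j) \<alpha>)) \<le> length (ext h (take (k i) \<alpha>))"
        by (intro length_ext_take_mono) simp
      then show False using pi pj same(2) ij(1) by linarith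
    qed
    have ll: "l i < l j"
    proof (rule ccontr)
      assume "\<not> l i < l j"
      then have "length (ext h (take (l j) \<beta>)) \<le> length (ext h (take (l i) \<beta>))"
        by (intro length_ext_take_mono) simp
      then show False using pi pj same(4) ij(1) by linarith
    qed
    have split: "\<exists>x. ep u (take n w) x \<and> x = tail (w ! n)" if "ep u w u'" "n < length w" for u w u' n
    proof -
      have "w = take n w @ w ! n # drop (Suc n) w" using that(2) by (rule id_take_nth_drop)
      then have "ep u (take n w @ w ! n # drop (Suc n) w) u'" using that(1) by simp
      then show ?thesis by (auto simp: epath_append)
    qed
    have e1: "ep v (take (k i) \<alpha>) (tail (\<alpha> ! k j))" "ep v (take (k j) \<alpha>) (tail (\<alpha> ! k j))"
      "ep v (take (l i) \<beta>) (tail (\<beta> ! l j))" "ep v (take (l j) \<beta>) (tail (\<beta> ! l j))"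
      using split [OF \<alpha>, of "k i"] split [OF \<alpha>, of "k j"] split [OF \<beta>, of "l i"] split [OF \<beta>, of "l j"]
        pi pj same by simp_all
    define a1 a2 b1 b2 where "a1 = take (k i) \<alpha>" and "a2 = take (k j) \<alpha>"
      and "b1 = take (l i) \<beta>" and "b2 = take (l j) \<beta>"
    \<comment> \<open>At the two positions \<open>\<alpha>\<close> is at one and the same vertex,
      and so is \<open>\<beta>\<close>; hence the four prefixes close up to a loop at
      \<open>v\<close>.\<close>
    define loop where "loop = a2 @ iword a1 @ b1 @ iword b2"
    have "ep v loop v"
      unfolding loop_def a1_def a2_def b1_def b2_def
      by (intro epath_append [THEN iffD2] exI conjI epath_iword [THEN iffD2]) (rule e1)+
    moreover have "cls ((ext gw ^^ N) loop) = 0"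
    proof -
      let ?h = "\<lambda>w. cls (ext h w)"
      \<comment> \<open>The images of the prefixes of \<open>\<alpha>\<close> and
        \<open>\<beta>\<close> agree after adding the same partial images \<open>s\<close> and
        \<open>t\<close> at both positions, so the image of the loop is trivial.\<close>
      define s t where "s = cls (take (m i) (h (\<alpha> ! k i)))" and "t = cls (take (m' i) (h (\<beta> ! l i)))"
      have 1: "?h a1 + s = ?h b1 + t"
        using pi unfolding s_def t_def a1_def b1_def by (metis cls_append)
      have 2: "?h a2 + s = ?h b2 + t"
        using pj same unfolding s_def t_def a2_def b2_def by (metis cls_append)
      have "?h a2 - ?h a1 = (?h a2 + s) - (?h a1 + s)" by (simp add: add_diff_add_right)
      also have "\<dots> = (?h b2 + t) - (?h b1 + t)" using 1 2 by simp
      also have "\<dots> = ?h b2 - ?h b1" by (simp add: add_diff_add_right)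
      finally have eq: "?h a2 - ?h a1 = ?h b2 - ?h b1" .
      have hi: "?h (iword w) = - ?h w" for w
        unfolding h_def ext_ext_pow by (simp add: ext_pow_iword gw_sym)
      have "cls (ext h loop) = (?h a2 - ?h a1) - (?h b2 - ?h b1)"
        unfolding loop_def by (simp add: hi add.assoc diff_conv_add_uminus minus_add
            del: add_uminus_conv_diff)
      then show ?thesis using eq unfolding h_def ext_ext_pow by simp
    qed
    ultimately have "cls loop = 0" using ext_pow_inj by blast
    moreover have "cls loop = (cls a2 - cls a1) - (cls b2 - cls b1)"
      unfolding loop_def by (simp add: add.assoc diff_conv_add_uminus minus_add
          del: add_uminus_conv_diff)
    ultimately have "cls a2 - cls a1 = cls b2 - cls b1" by simp
    then have "- cls b2 + (cls a2 - cls a1) + cls a1 = - cls b2 + (cls b2 - cls b1) + cls a1"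
      by simp
    \<comment> \<open>Regrouped in this way, both words are reduced because \<open>\<alpha>\<close>
      and \<open>\<beta>\<close> start differently. So they are equal as words, which their lengths
      forbid.\<close>
    then have eq: "cls (iword b2 @ a2) = cls (iword b1 @ a1)"
      by (simp add: add.assoc diff_conv_add_uminus del: add_uminus_conv_diff)
    have hds: "hd (take n \<alpha>) \<noteq> hd (take n' \<beta>)" if "take n \<alpha> \<noteq> []" "take n' \<beta> \<noteq> []" for n n'
      using hd that by (cases \<alpha>; cases \<beta>; cases n; cases n') auto
    have rt: "reduced_word (take n w)" if "reduced_word w" for n w
      using that by (metis append_take_drop_id reduced_append)
    have "reduced_word (iword b2 @ a2)" "reduced_word (iword b1 @ a1)"
      unfolding a1_def a2_def b1_def b2_def
      by (intro reduced_iword_append rt red; use hds in metis)+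
    then have "iword b2 @ a2 = iword b1 @ a1" using eq cls_inj_reduced by blast
    then have "length b2 + length a2 = length b1 + length a1"
      by (metis iword_simps(4) length_append)
    then show False using kk ll pi pj by (simp add: a1_def a2_def b1_def b2_def)
  qed
qed

end

section \<open>Cyclic products of paths\<close>

definition seqprod :: "(nat \<Rightarrow> letter list) \<Rightarrow> nat \<Rightarrow> nat \<Rightarrow> letter list" where
  "seqprod s a b = concat (map s [a..<b])"

lemma seqprod_split: "a \<le> b \<Longrightarrow> b \<le> c \<Longrightarrow> seqprod s a c = seqprod s a b @ seqprod s b c"
proof -
  assume "a \<le> b" "b \<le> c"
  then have "[a..<c] = [a..<b] @ [b..<c]" using upt_add_eq_append [of a b "c - b"] by simp
  then show ?thesis by (simp add: seqprod_def)
qed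

lemma seqprod_Suc: "a \<le> b \<Longrightarrow> seqprod s a (Suc b) = seqprod s a b @ s b"
  by (simp add: seqprod_def)

lemma seqprod_empty [simp]: "seqprod s a a = []"
  by (simp add: seqprod_def)

text \<open>The end of each factor cancels the beginning of the next. Over a full period the outer
  terms form a conjugation, so trimming the pieces does not change the conjugacy class.\<close>

lemma seqprod_telescope:
  assumes "\<And>i. w i = P i @ t i @ iword (P (Suc i))" "a \<le> b"
  shows "cls (seqprod w a b) = cls (P a) + cls (seqprod t a b) - cls (P b)"
  using assms(2)
proof (induction b rule: dec_induct)
  case (step n)
  have "cls (w n) = cls (P n) + cls (t n) - cls (P (Suc n))"
    unfolding assms(1) [of n] by (simp add: add.assoc diff_conv_add_uminus del: add_uminus_conv_diff)
  then have "cls (seqprod w a (Suc n)) =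
     (cls (P a) + cls (seqprod t a n) - cls (P n)) + (cls (P n) + cls (t n) - cls (P (Suc n)))"
    using step by (simp add: seqprod_Suc)
  then show ?case using step by (simp add: seqprod_Suc add.assoc diff_conv_add_uminus del: add_uminus_conv_diff)
qed simp

lemma ext_seqprod: "ext h (seqprod w a b) = seqprod (\<lambda>i. ext h (w i)) a b"
  by (induction b) (auto simp: seqprod_def)

lemma ext_pow_seqprod: "(ext h ^^ n) (seqprod w a b) = seqprod (\<lambda>i. (ext h ^^ n) (w i)) a b"
  by (induction n) (auto simp: ext_seqprod)

text \<open>A discrete intermediate value theorem. If a word reappears in its own image after
  \<open>c\<close> letters and \<open>pos l\<close> is where the image of letter number
  \<open>l\<close> begins, then some letter has its copy inside its own image.\<close>

lemma discrete_fixed_point: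
  fixes pos :: "nat \<Rightarrow> nat"
  assumes "pos 0 \<le> c" "c + n \<le> pos n" "n > 0"
  shows "\<exists>l<n. pos l \<le> c + l \<and> c + l < pos (Suc l)"
proof -
  define l where "l = (LEAST l. c + l < pos (Suc l))"
  have ex: "c + (n - 1) < pos (Suc (n - 1))" using assms by simp
  then have l: "c + l < pos (Suc l)" unfolding l_def by (rule LeastI)
  have "l \<le> n - 1" unfolding l_def using ex by (rule Least_le)
  moreover have "pos l \<le> c + l"
  proof (cases l)
    case 0 then show ?thesis using assms by simp
  next
    case (Suc k)
    then have "\<not> c + k < pos (Suc k)" using not_less_Least [of k "\<lambda>l. c + l < pos (Suc l)"] l_def by simp
    then show ?thesis using Suc by simp
  qed
  ultimately show ?thesis using l assms(3) by (intro exI [of _ l]) auto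
qed

lemma append_middle:
  assumes "a @ b @ c = p @ t @ q" "length p \<le> length a" "length q \<le> length c"
  shows "\<exists>x y. t = x @ b @ y"
proof -
  have "take (length p) (a @ b @ c) = p" unfolding assms(1) by simp
  then have "take (length p) a = p" using assms(2) by simp
  then have "a = p @ drop (length p) a" by (metis append_take_drop_id)
  then have "p @ t @ q = p @ (drop (length p) a @ b) @ c" using assms(1) by (metis append.assoc)
  then have "t @ q = (drop (length p) a @ b) @ c" by (simp only: same_append_eq)
  then consider us where "t = (drop (length p) a @ b) @ us"
    | us where "t @ us = drop (length p) a @ b" "q = us @ c"
    unfolding append_eq_append_conv2 by blast
  then show ?thesis
  proof cases
    case 2
    then have "us = []" using assms(3) by simp
    then show ?thesis using 2 by (intro exI [of _ "drop (length p) a"] exI [of _ "[]"]) simp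
  qed auto
qed

text \<open>\<open>J n\<close> follows one conjugacy class under iteration. \<open>no_pnp\<close>
  excludes that the image of the loop \<open>d # z\<close> is its conjugate by \<open>X\<close>: the
  occurrence of \<open>d\<close> in its own image gives a fixed point inside the edge, and read from
  there such a loop would be preserved up to homotopy.\<close>

locale graph_map_orbit = graph_map E tail gw gv
  for E and tail :: "letter \<Rightarrow> 'v" and gw gv +
  fixes J :: "nat \<Rightarrow> fg"
  assumes J_step: "\<And>n. \<exists>y. J (Suc n) = y + cls (ext gw (word_of (J n))) - y"
    and J_closed: "\<exists>v. ep v (word_of (J 0)) v"
    and J_nonzero: "\<And>n. J n \<noteq> 0"
    and no_pnp: "\<And>K d X Y z. K \<ge> 1 \<Longrightarrow> (ext gw ^^ K) [d] = X @ d # Y \<Longrightarrow>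
       ep (tail d) (d # z) (tail d) \<Longrightarrow> cls (d # z) \<noteq> 0 \<Longrightarrow>
       cls ((ext gw ^^ K) z) \<noteq> - cls Y + cls z - cls X"
begin

definition closed_seq :: "nat \<Rightarrow> (nat \<Rightarrow> letter list) \<Rightarrow> bool" where
  "closed_seq q w \<longleftrightarrow> (\<exists>v. (\<forall>i. v (i + q) = v i) \<and> (\<forall>i. ep (v i) (w i) (v (Suc i))))"

lemma closed_seq_ep:
  assumes "\<And>i. ep (v i) (w i) (v (Suc i))" "a \<le> b" shows "ep (v a) (seqprod w a b) (v b)"
  using assms(2) by (induction b rule: dec_induct) (auto simp: seqprod_Suc epath_append intro: assms(1))

text \<open>\<open>pieces n q w\<close>: the circuit of \<open>J n\<close> is the cyclic product of the legal paths
  \<open>w 0, \<dots>, w (q - 1)\<close>; \<open>w\<close> is indexed periodically.\<close>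

definition pieces :: "nat \<Rightarrow> nat \<Rightarrow> (nat \<Rightarrow> letter list) \<Rightarrow> bool" where
  "pieces n q w \<longleftrightarrow> (\<forall>i. w (i + q) = w i) \<and> (\<forall>i. legal (w i)) \<and> closed_seq q w \<and>
     (\<exists>u. J n = u + cls (seqprod w 0 q) - u)"

definition pieces_list :: "nat \<Rightarrow> letter list list \<Rightarrow> bool" where
  "pieces_list n ss \<longleftrightarrow> (\<forall>s\<in>set ss. legal s) \<and> (\<exists>v. ep v (concat ss) v) \<and>
     (\<exists>u. J n = u + cls (concat ss) - u)"

text \<open>The minimum runs over all iterates at once. Images of legal paths are legal, so the
  number of pieces never has to grow and the minimum persists once attained; from then on no piece
  can be cancelled entirely.\<close>

definition q :: nat where
  "q = (LEAST q. \<exists>n ss. pieces_list n ss \<and> length ss = q)"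

lemma exists_minimal: "\<exists>n ss. pieces_list n ss \<and> length ss = q"
proof -
  let ?ss = "map (\<lambda>d. [d]) (word_of (J 0))"
  obtain v where v: "ep v (word_of (J 0)) v" using J_closed by blast
  have c: "concat ?ss = word_of (J 0)" by (simp add: concat_map_singleton)
  have "legal [d]" if "d \<in> set (word_of (J 0))" for d
    unfolding legal_def using gw_reduced epath_letters [OF v that] by blast
  then have "\<forall>s\<in>set ?ss. legal s" by simp
  moreover have "J 0 = 0 + cls (concat ?ss) - 0" unfolding c by simp
  moreover have "ep v (concat ?ss) v" using v by (simp only: c)
  ultimately have "pieces_list 0 ?ss"
    unfolding pieces_list_def by (intro conjI exI)
  then have "\<exists>q n ss. pieces_list n ss \<and> length ss = q" by blast
  then show ?thesis unfolding q_def by (rule LeastI_ex)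
qed

lemma minimal: "pieces_list n ss \<Longrightarrow> q \<le> length ss"
  unfolding q_def by (rule Least_le) blast

lemma q_pos: "q > 0"
proof (rule ccontr)
  assume "\<not> q > 0"
  then obtain n where "pieces_list n []" using exists_minimal by auto
  then show False using J_nonzero by (auto simp: pieces_list_def)
qed

text \<open>An empty piece could be left out, against the minimality of \<open>q\<close>.\<close>

lemma pieces_nonempty:
  assumes "pieces n q w" shows "w i \<noteq> []"
proof
  assume "w i = []"
  have per: "w (i mod q) = w i" for i
  proof -
    have "w (j + k * q) = w j" for j k
    proof (induction k)
      case (Suc k)
      have "w (j + Suc k * q) = w (j + k * q + q)" by (simp add: algebra_simps)
      then show ?case using Suc assms by (simp add: pieces_def)
    qed simp
    from this [of "i mod q" "i div q"] show ?thesis by simp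
  qed
  let ?ss = "map w [0..<q]" let ?tt = "filter (\<lambda>s. s \<noteq> []) ?ss"
  have "concat (filter (\<lambda>s. s \<noteq> []) xs) = concat xs" for xs :: "letter list list"
    by (induction xs) auto
  note c = this [of ?ss]
  obtain v where v: "\<And>i. v (i + q) = v i" "\<And>i. ep (v i) (w i) (v (Suc i))"
    using assms by (auto simp: pieces_def closed_seq_def)
  have "ep (v 0) (concat ?ss) (v 0)"
    using closed_seq_ep [of v w 0 q] v(1) [of 0] v(2) by (simp add: seqprod_def)
  then have "pieces_list n ?tt"
    unfolding pieces_list_def c using assms by (auto simp: pieces_def seqprod_def)
  then have "q \<le> length ?tt" by (rule minimal)
  moreover have "[] \<in> set ?ss"
    using \<open>w i = []\<close> per [of i] q_pos by (auto intro!: image_eqI [of _ _ "i mod q"])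
  then have "length ?tt < length ?ss" by (intro length_filter_less) auto
  ultimately show False by simp
qed

definition tight :: "(nat \<Rightarrow> letter list) \<Rightarrow> bool" where
  "tight w \<longleftrightarrow> (\<forall>i. hd (w (Suc i)) \<noteq> flip (last (w i)))"

lemma reduced_seqprod:
  assumes "\<And>i. reduced_word (w i)" "\<And>i. w i \<noteq> []" "tight w"
  shows "reduced_word (seqprod w a b) \<and> (a < b \<longrightarrow> seqprod w a b \<noteq> [] \<and> last (seqprod w a b) = last (w (b - 1)))"
proof (induction b)
  case 0
  then show ?case by (simp add: seqprod_def)
next
  case (Suc b)
  show ?case
  proof (cases "a \<le> b")
    case True
    show ?thesis
    proof (cases "a = b")
      case True
      then show ?thesis using assms by (simp add: seqprod_def)
    next
      case False
      then obtain c where c: "b = Suc c" using True by (cases b) auto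
      then have "hd (w b) \<noteq> flip (last (seqprod w a b))"
        using Suc False True assms(3) by (simp add: tight_def)
      then show ?thesis using Suc True False assms by (auto simp: seqprod_Suc reduced_append)
    qed
  next
    case False
    then show ?thesis by (simp add: seqprod_def)
  qed
qed

text \<open>\<open>P i\<close> is the path cancelled at the junction before piece \<open>i\<close>.
  Among all ways of cutting matching ends off the pieces, one that leaves the least total length has
  no cancelling junction. By \<open>pieces_nonempty\<close> the pieces never vanish on the
  way.\<close>

lemma trim:
  assumes w: "pieces n q w"
  shows "\<exists>t P. pieces n q t \<and> tight t \<and> (\<forall>i. P (i + q) = P i) \<and>
    (\<forall>i. w i = P i @ t i @ iword (P (Suc i)))"
proof -
  define dec where "dec P t \<longleftrightarrow> (\<forall>i. P (i + q) = P i) \<and> (\<forall>i. t (i + q) = t i) \<and>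
    (\<forall>i. w i = P i @ t i @ iword (P (Suc i)))" for P t
  \<comment> \<open>Cutting off matching ends conjugates the circuit by \<open>P 0\<close> and
    leaves subpaths of legal paths.\<close>
  have dp: "pieces n q t" if "dec P t" for P t
  proof -
    have eq: "w i = P i @ t i @ iword (P (Suc i))" and pp: "P (i + q) = P i" "t (i + q) = t i" for i
      using that by (auto simp: dec_def)
    obtain v where v: "\<And>i. v (i + q) = v i" "\<And>i. ep (v i) (w i) (v (Suc i))"
      using w by (auto simp: pieces_def closed_seq_def)
    have "\<exists>x. ep (v i) (P i) x" for i using v(2) [of i] by (auto simp: eq epath_append)
    then obtain x where x: "\<And>i. ep (v i) (P i) (x i)" by metis
    have "x (i + q) = x i" for i
      using x [of "i + q"] epath_det [OF x [of i]] by (simp add: v pp)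
    moreover have "ep (x i) (t i) (x (Suc i))" for i
    proof -
      obtain y z where "ep (v i) (P i) y" "ep y (t i) z" "ep z (iword (P (Suc i))) (v (Suc i))"
        using v(2) [of i] by (auto simp: eq epath_append)
      moreover have "y = x i" using calculation(1) x [of i] by (rule epath_det)
      moreover have "z = x (Suc i)"
        using calculation(3) x [of "Suc i"] unfolding epath_iword by (rule epath_det)
      ultimately show ?thesis by simp
    qed
    ultimately have "closed_seq q t" by (auto simp: closed_seq_def)
    moreover have "legal (t i)" for i
      using w legal_sub [of "P i" "t i" "iword (P (Suc i))"] by (simp add: pieces_def flip: eq)
    moreover obtain u where "J n = u + cls (seqprod w 0 q) - u" using w by (auto simp: pieces_def)
    then have "J n = (u + cls (P 0)) + cls (seqprod t 0 q) - (u + cls (P 0))"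
      using seqprod_telescope [of w P t 0 q, OF eq] pp(1) [of 0]
      by (simp add: add.assoc diff_conv_add_uminus minus_add del: add_uminus_conv_diff)
    ultimately show ?thesis using pp by (auto simp: pieces_def)
  qed
  define siz where "siz t = (\<Sum>i<q. length (t i))" for t :: "nat \<Rightarrow> letter list"
  have "dec (\<lambda>_. []) w" using w by (simp add: dec_def pieces_def)
  then obtain Pt0 where "dec (fst Pt0) (snd Pt0)"
      "\<forall>y. dec (fst y) (snd y) \<longrightarrow> siz (snd Pt0) \<le> siz (snd y)"
    using ex_has_least_nat [of "\<lambda>y. dec (fst y) (snd y)" "(\<lambda>_. [], w)" "\<lambda>y. siz (snd y)"] by auto
  then obtain P t where Pt: "dec P t" and least: "\<And>P' t'. dec P' t' \<Longrightarrow> siz t \<le> siz t'"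
    by (metis fst_conv snd_conv)
  have eq: "w i = P i @ t i @ iword (P (Suc i))" and pp: "P (i + q) = P i" "t (i + q) = t i" for i
      using Pt by (auto simp: dec_def)
  have pm: "P (i mod q) = P i" "t (i mod q) = t i" for i
  proof -
    have "P (j + k * q) = P j \<and> t (j + k * q) = t j" for j k
    proof (induction k)
      case (Suc k)
      have "j + Suc k * q = j + k * q + q" by (simp add: algebra_simps)
      then show ?case using Suc pp by (metis)
    qed simp
    from this [of "i mod q" "i div q"] show "P (i mod q) = P i" "t (i mod q) = t i" by simp_all
  qed
  have "tight t"
  proof (rule ccontr)
    assume "\<not> tight t"
    then obtain j where j: "hd (t (Suc j)) = flip (last (t j))" by (auto simp: tight_def)
    note ne = pieces_nonempty [OF dp [OF Pt]]
    define x where "x = hd (t (Suc j))"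
    define P' where "P' i = (if i mod q = Suc j mod q then P i @ [x] else P i)" for i
    \<comment> \<open>One more letter is cut at junction \<open>j\<close> and its periodic copies:
      \<open>F\<close> from the front of the later piece, \<open>L\<close> from the end of the
      earlier one. For \<open>q = 1\<close> both come off the same piece.\<close>
    define F where "F i = (if i mod q = Suc j mod q then [x] else [])" for i
    define L where "L i = (if i mod q = j mod q then [flip x] else [])" for i
    have FL: "L i = iword (F (Suc i))" for i
      unfolding L_def F_def by (auto simp: mod_Suc split: if_splits)
    have P': "P' i = P i @ F i" for i by (simp add: P'_def F_def)
    have "\<exists>t'. t i = F i @ t' @ L i" for i
    proof -
      have cong: "t i = t k" if "i mod q = k mod q" for k
        using pm(2) [of i] pm(2) [of k] that by simp
      have h: "t i = x # tl (t i)" if "i mod q = Suc j mod q"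
        using ne [of i] cong [OF that] unfolding x_def by (cases "t i") auto
      have l: "last (t i) = flip x" if "i mod q = j mod q"
        using cong [OF that] j unfolding x_def by simp
      show ?thesis
      proof (cases "i mod q = Suc j mod q")
        case True
        note 1 = h [OF True]
        have F: "F i = [x]" using True by (simp add: F_def)
        show ?thesis
        proof (cases "i mod q = j mod q")
          case True2: True
          have L: "L i = [flip x]" using True2 by (simp add: L_def)
          \<comment> \<open>A letter is never its own inverse, so a piece that loses both ends has
            at least two letters.\<close>
          have "tl (t i) \<noteq> []"
          proof
            assume "tl (t i) = []"
            then have "last (t i) = x" using 1 by (metis last.simps)
            then show False using l [OF True2] by (metis flip_neq)
          qed
          moreover from this have "last (tl (t i)) = flip x" using l [OF True2] by (simp add: last_tl)
          ultimately have "tl (t i) = butlast (tl (t i)) @ [flip x]"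
            using append_butlast_last_id [of "tl (t i)"] by simp
          then have "t i = [x] @ butlast (tl (t i)) @ [flip x]" using 1 by simp
          then show ?thesis unfolding F L by (rule exI)
        next
          case False
          then have L: "L i = []" by (simp add: L_def)
          have "t i = [x] @ tl (t i) @ []" using 1 by simp
          then show ?thesis unfolding F L by (rule exI)
        qed
      next
        case False
        then have F: "F i = []" by (simp add: F_def)
        show ?thesis
        proof (cases "i mod q = j mod q")
          case True
          have "t i = [] @ butlast (t i) @ [flip x]"
            using append_butlast_last_id [OF ne [of i]] l [OF True] by simp
          moreover have "L i = [flip x]" using True by (simp add: L_def)
          ultimately show ?thesis unfolding F by metis
        next
          case False
          then show ?thesis unfolding F by (simp add: L_def)
        qed
      qed
    qed
    then have "\<forall>i. \<exists>t'. t i = F i @ t' @ L i" by blast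
    from choice [OF this] obtain t0 where t0: "\<And>i. t i = F i @ t0 i @ L i" by blast
    define t' where "t' i = t0 (i mod q)" for i
    have FLm: "F (i mod q) = F i" "L (i mod q) = L i" for i by (simp_all add: F_def L_def)
    have t': "t i = F i @ t' i @ L i" for i
      using t0 [of "i mod q"] pm(2) FLm by (simp add: t'_def)
    have "P' (i + q) = P' i" for i by (simp add: P'_def pp)
    moreover have "t' (i + q) = t' i" for i by (simp add: t'_def)
    moreover have "w i = P' i @ t' i @ iword (P' (Suc i))" for i
      by (simp add: eq P' t' [of i] FL)
    ultimately have "dec P' t'" by (simp add: dec_def)
    then have "siz t \<le> siz t'" by (rule least)
    moreover have "siz t' < siz t"
      unfolding siz_def
    proof (rule sum_strict_mono_ex1)
      show "\<exists>i\<in>{..<q}. length (t' i) < length (t i)"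
        using q_pos by (intro bexI [of _ "j mod q"]) (auto simp: t' L_def)
    qed (auto simp: t')
    ultimately show False by simp
  qed
  then show ?thesis using dp [OF Pt] eq pp by (intro exI [of _ t] exI [of _ P]) auto
qed

lemma pieces_step:
  assumes "pieces n q w" shows "pieces (Suc n) q (\<lambda>i. ext gw (w i))"
proof -
  obtain v where v: "\<And>i. v (i + q) = v i" "\<And>i. ep (v i) (w i) (v (Suc i))"
    using assms by (auto simp: pieces_def closed_seq_def)
  have "closed_seq q (\<lambda>i. ext gw (w i))"
    unfolding closed_seq_def using v ext_epath by (intro exI [of _ "gv \<circ> v"]) auto
  moreover obtain u where u: "J n = u + cls (seqprod w 0 q) - u" using assms by (auto simp: pieces_def)
  have "J n = cls (word_of u @ seqprod w 0 q @ iword (word_of u))"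
    unfolding u by (simp add: add.assoc diff_conv_add_uminus del: add_uminus_conv_diff)
  then have "cls (ext gw (word_of (J n))) = cls (ext gw (word_of u @ seqprod w 0 q @ iword (word_of u)))"
    by (intro cls_ext_cong gw_sym) simp
  moreover obtain y where y: "J (Suc n) = y + cls (ext gw (word_of (J n))) - y" using J_step by blast
  moreover have "ext gw (seqprod w 0 q) = seqprod (\<lambda>i. ext gw (w i)) 0 q"
    by (rule ext_seqprod)
  ultimately have "J (Suc n) = (y + cls (ext gw (word_of u))) + cls (seqprod (\<lambda>i. ext gw (w i)) 0 q)
     - (y + cls (ext gw (word_of u)))"
    by (simp add: ext_iword gw_sym add.assoc diff_conv_add_uminus minus_add del: add_uminus_conv_diff)
  then have "\<exists>u. J (Suc n) = u + cls (seqprod (\<lambda>i. ext gw (w i)) 0 q) - u" by (rule exI)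
  moreover have "\<forall>i. legal (ext gw (w i))" using assms by (simp add: pieces_def legal_ext)
  moreover have "\<forall>i. ext gw (w (i + q)) = ext gw (w i)" using assms by (simp add: pieces_def)
  ultimately show ?thesis
    using \<open>closed_seq q (\<lambda>i. ext gw (w i))\<close> by (simp add: pieces_def)
qed

lemma exists_pieces: "\<exists>n w. pieces n q w"
proof -
  obtain n ss v u where ss: "length ss = q" "\<forall>s\<in>set ss. legal s" "ep v (concat ss) v"
     "J n = u + cls (concat ss) - u"
    using exists_minimal by (auto simp: pieces_list_def)
  define w where "w i = ss ! (i mod q)" for i
  have "\<exists>x. ep v (concat (take k ss)) x" for k
    using ss(3) by (metis append_take_drop_id concat_append epath_append)
  then obtain x where x: "\<And>k. ep v (concat (take k ss)) (x k)" by metis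
  have x0: "x 0 = v" using x [of 0] by simp
  have xq: "x q = v" using x [of q] ss(1) epath_det [OF ss(3), of "x q"] by simp
  have st: "ep (x k) (ss ! k) (x (Suc k))" if "k < q" for k
  proof -
    have "concat (take (Suc k) ss) = concat (take k ss) @ ss ! k"
      using that ss(1) by (simp add: take_Suc_conv_app_nth)
    then obtain z where "ep v (concat (take k ss)) z" "ep z (ss ! k) (x (Suc k))"
      using x [of "Suc k"] by (auto simp: epath_append)
    then show ?thesis using epath_det [OF x [of k]] by simp
  qed
  have "ep (x (i mod q)) (w i) (x (Suc i mod q))" for i
  proof (cases "Suc (i mod q) = q")
    case True
    then have "Suc i mod q = 0" by (metis mod_Suc)
    then show ?thesis using st [of "i mod q"] q_pos True xq x0 by (simp add: w_def)
  next
    case False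
    then have "Suc i mod q = Suc (i mod q)" by (metis mod_Suc)
    then show ?thesis using st [of "i mod q"] q_pos by (simp add: w_def)
  qed
  then have "closed_seq q w" unfolding closed_seq_def by (intro exI [of _ "\<lambda>i. x (i mod q)"]) auto
  moreover have "legal (w i)" for i using ss(1,2) q_pos by (simp add: w_def)
  moreover have "seqprod w 0 q = concat ss"
    unfolding seqprod_def w_def using ss(1) by (intro arg_cong [of _ _ concat] nth_equalityI) auto
  ultimately have "pieces n q w" using ss(4) by (auto simp: pieces_def w_def)
  then show ?thesis by blast
qed

end

section \<open>Recurrence of circuits and growth of legal pieces\<close>

context graph_map_orbit begin

lemma pieces_good:
  assumes "pieces n q w"
  shows "w i \<noteq> []" "reduced_word (w i)"
  using pieces_nonempty [OF assms] assms legal_reduced by (simp_all add: pieces_def)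

lemma periodic_mod:
  assumes "\<And>i. w (i + q) = w i" shows "w (i mod q) = w i"
proof -
  have "w (j + k * q) = w j" for j k
  proof (induction k)
    case (Suc k)
    have e: "j + Suc k * q = (j + k * q) + q" by simp
    show ?case unfolding e assms by (rule Suc)
  qed simp
  from this [of "i mod q" "i div q"] show ?thesis by simp
qed

text \<open>A repetition in the sequence of circuits yields a legal piece that occurs inside its own
  image, hence a fixed point inside one of its letters, hence a periodic Nielsen loop.\<close>

lemma no_periodic_pieces:
  assumes s: "pieces n q s" and K: "K \<ge> 1" and P: "\<And>i. P (i + q) = P i"
    and img: "\<And>i. (ext gw ^^ K) (s i) = P i @ s i @ iword (P (Suc i))"
  shows False
proof -
  let ?g = "ext gw ^^ K"
  define l0 where "l0 = length (s 0)"
  have l0: "l0 > 0" using pieces_nonempty [OF s, of 0] by (simp add: l0_def)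
  \<comment> \<open>The position at which the image of letter number \<open>l\<close> begins; the
    piece itself reappears in its image after \<open>length (P 0)\<close> letters.\<close>
  define pos where "pos l = length (?g (take l (s 0)))" for l
  have "\<exists>l<l0. pos l \<le> length (P 0) + l \<and> length (P 0) + l < pos (Suc l)"
    using l0 img [of 0] by (intro discrete_fixed_point) (auto simp: pos_def l0_def)
  then obtain l where l: "l < l0" "pos l \<le> length (P 0) + l" "length (P 0) + l < pos (Suc l)" by blast
  define d a b where "d = s 0 ! l" and "a = take l (s 0)" and "b = drop (Suc l) (s 0)"
  have s0: "s 0 = a @ d # b" using l(1) id_take_nth_drop [of l "s 0"] by (simp add: a_def b_def d_def l0_def)
  have gd: "?g (s 0) = ?g a @ ?g [d] @ ?g b"
    unfolding s0 using ext_pow_append [where u = a and v = "[d] @ b"]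
      ext_pow_append [where u = "[d]" and v = b] by simp
  define m where "m = length (P 0) + l - pos l"
  have tk: "take (Suc l) (s 0) = a @ [d]"
    using l(1) by (simp add: a_def d_def l0_def take_Suc_conv_app_nth)
  have m: "m < length (?g [d])" "length (?g a) + m = length (P 0) + l"
    using l(2,3) unfolding m_def pos_def tk ext_pow_append by (auto simp: a_def)
  define X Y where "X = take m (?g [d])" and "Y = drop (Suc m) (?g [d])"
  have eq: "(?g a @ X) @ (?g [d] ! m) # (Y @ ?g b) = (P 0 @ a) @ d # (b @ iword (P (Suc 0)))"
  proof -
    have "?g [d] = X @ ?g [d] ! m # Y" unfolding X_def Y_def by (rule id_take_nth_drop [OF m(1)])
    then have "?g (s 0) = (?g a @ X) @ (?g [d] ! m) # (Y @ ?g b)" unfolding gd by (metis append.assoc append_Cons)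
    then show ?thesis using img [of 0] s0 by simp
  qed
  have "length (?g a @ X) = length (P 0 @ a)"
    using m l(1) by (simp add: X_def a_def l0_def)
  then have 1: "?g a @ X = P 0 @ a" and 2: "?g [d] ! m = d" and 3: "Y @ ?g b = b @ iword (P (Suc 0))"
    using eq unfolding append_eq_append_conv [OF disjI1, OF \<open>length (?g a @ X) = length (P 0 @ a)\<close>]
    by auto
  have gdXY: "?g [d] = X @ d # Y"
    using id_take_nth_drop [OF m(1)] 2 by (simp add: X_def Y_def)
  \<comment> \<open>The remainder of the circuit: the rest of the piece after \<open>d\<close>, the
    other pieces, and the beginning of the piece up to \<open>d\<close>.\<close>
  define z where "z = b @ seqprod s 1 q @ a"
  obtain v where v: "\<And>i. v (i + q) = v i" "\<And>i. ep (v i) (s i) (v (Suc i))"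
    using s by (auto simp: pieces_def closed_seq_def)
  have "ep (tail d) (d # z) (tail d)"
  proof -
    have "ep (v 0) (a @ d # b) (v 1)" using v(2) [of 0] s0 by simp
    then have "ep (v 0) a (tail d)" "ep (tail d) (d # b) (v 1)" by (auto simp: epath_append)
    moreover have "ep (v 1) (seqprod s 1 q) (v 0)"
      using closed_seq_ep [of v s 1 q, OF v(2)] q_pos v(1) [of 0] by simp
    ultimately show ?thesis unfolding z_def by (auto simp: epath_append)
  qed
  moreover have sq: "seqprod s 0 q = a @ d # b @ seqprod s 1 q"
    using seqprod_split [of 0 1 q s] q_pos s0 by (simp add: seqprod_def)
  then have "cls (seqprod s 0 q) = cls a + cls (d # z) - cls a"
    unfolding z_def by (subst cls_Cons) (simp add: cls_Cons [of d "b @ _"] add.assoc diff_conv_add_uminus del: add_uminus_conv_diff)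
  then have "cls (d # z) \<noteq> 0"
    using s J_nonzero [of n] by (auto simp: pieces_def)
  \<comment> \<open>The images of the three stretches of \<open>z\<close> are known from the two
    sides of the copy of \<open>d\<close> and from the telescoping of the \<open>P i\<close>;
    together they give the equation excluded by \<open>no_pnp\<close>.\<close>
  moreover have "cls (?g z) = - cls Y + cls z - cls X"
  proof -
    have "cls Y + cls (?g b) = cls b - cls (P 1)" using arg_cong [OF 3, of cls] by simp
    then have gb: "cls (?g b) = - cls Y + (cls b - cls (P 1))" by (metis add_uminus_conv_diff minus_add_cancel)
    have "cls (?g a) + cls X = cls (P 0) + cls a" using arg_cong [OF 1, of cls] by simp
    then have ga: "cls (?g a) = cls (P 0) + cls a - cls X" by (metis add_diff_cancel)
    have gs: "cls (?g (seqprod s 1 q)) = cls (P 1) + cls (seqprod s 1 q) - cls (P 0)"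
      unfolding ext_pow_seqprod using seqprod_telescope [of "\<lambda>i. ?g (s i)" P s 1 q, OF img] q_pos P [of 0]
      by simp
    show ?thesis unfolding z_def ext_pow_append cls_append ga gb gs
      by (simp add: add.assoc diff_conv_add_uminus del: add_uminus_conv_diff)
  qed
  ultimately show False using no_pnp [OF K gdXY] by blast
qed

text \<open>Mapping and trimming alternate. What is removed accumulates: the image of the earlier
  removals followed by the new one. So \<open>N\<close> rounds still have the form of a single
  trimming of the \<open>N\<close>-th image.\<close>

lemma exists_sequence:
  "\<exists>n0 S. (\<forall>n. pieces (n0 + n) q (S n) \<and> tight (S n)) \<and>
    (\<forall>n N. \<exists>P. (\<forall>i. P (i + q) = P i) \<and> (\<forall>i. (ext gw ^^ N) (S n i) = P i @ S (n + N) i @ iword (P (Suc i))))"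
proof -
  obtain n0 w where "pieces n0 q w" using exists_pieces by blast
  then obtain t where t: "pieces n0 q t" "tight t" using trim by blast
  let ?R = "\<lambda>s t. \<exists>P. (\<forall>i. P (i + q) = P i) \<and> (\<forall>i. ext gw (s i) = P i @ t i @ iword (P (Suc i)))"
  have "\<exists>S. \<forall>n. (pieces (n0 + n) q (S n) \<and> tight (S n)) \<and> ?R (S n) (S (Suc n))"
  proof (rule dependent_nat_choice)
    show "\<exists>s. pieces (n0 + 0) q s \<and> tight s" using t by auto
    fix s n assume "pieces (n0 + n) q s \<and> tight s"
    then have "pieces (n0 + Suc n) q (\<lambda>i. ext gw (s i))" using pieces_step by simp
    from trim [OF this] show "\<exists>t. (pieces (n0 + Suc n) q t \<and> tight t) \<and> ?R s t" by blast
  qed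
  then obtain S where S0: "\<forall>n. (pieces (n0 + n) q (S n) \<and> tight (S n)) \<and> ?R (S n) (S (Suc n))"
    by (rule exE)
  have S: "pieces (n0 + n) q (S n) \<and> tight (S n)" "?R (S n) (S (Suc n))" for n
    using spec [OF S0, of n] by (rule conjunct1, rule conjunct2)
  have "\<exists>P. (\<forall>i. P (i + q) = P i) \<and> (\<forall>i. (ext gw ^^ N) (S n i) = P i @ S (n + N) i @ iword (P (Suc i)))" for n N
  proof (induction N)
    case 0
    show ?case by (intro exI [of _ "\<lambda>_. []"]) simp
  next
    case (Suc N)
    then obtain P where P: "\<And>i. P (i + q) = P i"
      "\<And>i. (ext gw ^^ N) (S n i) = P i @ S (n + N) i @ iword (P (Suc i))" by blast
    obtain R where R: "\<And>i. R (i + q) = R i"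
      "\<And>i. ext gw (S (n + N) i) = R i @ S (Suc (n + N)) i @ iword (R (Suc i))" using S(2) [of "n + N"] by (elim exE conjE) (rule that, auto)
    show ?case
      by (intro exI [of _ "\<lambda>i. ext gw (P i) @ R i"]) (simp add: P R ext_iword gw_sym)
  qed
  then show ?thesis
    by (intro exI [of _ n0] exI [of _ S] conjI allI S(1) [THEN conjunct1] S(1) [THEN conjunct2])
qed

text \<open>Bounded pieces over finitely many edges form finitely many tuples, so two families in
  the sequence would coincide, against \<open>no_periodic_pieces\<close>.\<close>

lemma unbounded_pieces:
  assumes S: "\<And>n. pieces (n0 + n) q (S n)"
    and img: "\<And>n N. \<exists>P. (\<forall>i. P (i + q) = P i) \<and>
      (\<forall>i. (ext gw ^^ N) (S n i) = P i @ S (n + N) i @ iword (P (Suc i)))"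
  shows "\<exists>n i. B < length (S n i)"
proof (rule ccontr)
  assume "\<not> ?thesis"
  then have B: "length (S n i) \<le> B" for n i by (meson not_le)
  define W where "W = {w :: letter list. set w \<subseteq> {..<E} \<times> UNIV \<and> length w \<le> B}"
  have fW: "finite W" unfolding W_def by (rule finite_lists_length_le) simp
  have "set (S n i) \<subseteq> {..<E} \<times> UNIV" for n i
  proof
    fix d assume "d \<in> set (S n i)"
    moreover obtain u v where "ep u (S n i) v"
      using S [of n] unfolding pieces_def closed_seq_def by blast
    ultimately have "fst d < E" using epath_letters by metis
    then show "d \<in> {..<E} \<times> UNIV" by (cases d) auto
  qed
  then have "S n i \<in> W" for n i using B by (simp add: W_def)
  then have "range (\<lambda>n. map (S n) [0..<q]) \<subseteq> {xs. set xs \<subseteq> W \<and> length xs = q}" by auto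
  then have "finite (range (\<lambda>n. map (S n) [0..<q]))"
    using finite_lists_length_eq [OF fW] finite_subset by blast
  then have "\<not> inj (\<lambda>n. map (S n) [0..<q])" using finite_imageD infinite_UNIV_nat by blast
  then obtain n n' where nn: "n < n'" "map (S n) [0..<q] = map (S n') [0..<q]"
    unfolding inj_def by (metis linorder_neqE_nat)
  have "S n i = S n' i" for i
  proof -
    have "S n (i mod q) = S n' (i mod q)"
      using arg_cong [OF nn(2), of "\<lambda>xs. xs ! (i mod q)"] q_pos by simp
    then show ?thesis using S by (simp add: periodic_mod pieces_def)
  qed
  then have eq: "S n' = S n" by auto
  obtain P where P: "\<And>i. P (i + q) = P i"
      "\<And>i. (ext gw ^^ (n' - n)) (S n i) = P i @ S (n + (n' - n)) i @ iword (P (Suc i))"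
    using img [of "n' - n" n] by blast
  show False
    by (rule no_periodic_pieces [OF S, of "n' - n" P n]) (use nn eq P in auto)
qed

text \<open>A letter deep inside a long piece is out of reach of the cancellation at the junctions,
  so its whole image survives in a later circuit.\<close>

theorem circuit_contains_iterate:
  assumes "\<And>n. n \<ge> n1 \<Longrightarrow> \<forall>j<E. e0 \<in> fst ` set ((ext gw ^^ n) [(j, True)])"
  shows "\<exists>n u c x y b. J n = u + cls c - u \<and> reduced_word (c @ c) \<and> c = x @ (ext gw ^^ M) [(e0, b)] @ y"
proof -
  obtain n0 S where S: "\<And>n. pieces (n0 + n) q (S n)" "\<And>n. tight (S n)"
    and img: "\<And>n N. \<exists>P. (\<forall>i. P (i + q) = P i) \<and>
      (\<forall>i. (ext gw ^^ N) (S n i) = P i @ S (n + N) i @ iword (P (Suc i)))"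
    using exists_sequence by (elim exE conjE) (rule that, auto)
  \<comment> \<open>The first \<open>n1\<close> steps make the image of any edge contain
    \<open>e0\<close>; the remaining \<open>M\<close> steps turn this occurrence into the wanted
    iterate.\<close>
  define N where "N = M + n1"
  obtain C where C: "\<And>v a b \<alpha> \<beta> p x y. ep v \<alpha> a \<Longrightarrow> ep v \<beta> b \<Longrightarrow> reduced_word \<alpha> \<Longrightarrow> reduced_word \<beta> \<Longrightarrow>
     hd \<alpha> \<noteq> hd \<beta> \<Longrightarrow> (ext gw ^^ N) \<alpha> = p @ x \<Longrightarrow> (ext gw ^^ N) \<beta> = p @ y \<Longrightarrow> length p \<le> C"
    using bounded_cancellation [of N] by blast
  obtain n i0 where "2 * C + 1 < length (S n i0)" using unbounded_pieces [OF S(1) img] by blast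
  moreover define i where "i = i0 mod q"
  have per: "S n (j + q) = S n j" for j using S(1) [of n] by (simp add: pieces_def)
  ultimately have len: "2 * C + 1 < length (S n i)" and i: "i < q"
    using periodic_mod [of "S n" i0, OF per] q_pos by (auto simp: i_def)
  let ?s = "S n" let ?g = "ext gw ^^ N"
  note good = pieces_good [OF S(1)]
  obtain P where P: "\<And>i. P (i + q) = P i"
      "\<And>i. ?g (?s i) = P i @ S (n + N) i @ iword (P (Suc i))" using img by blast
  obtain v where v: "\<And>i. ep (v i) (?s i) (v (Suc i))"
    using S(1) [of n] by (auto simp: pieces_def closed_seq_def)
  \<comment> \<open>By tightness the reversed piece and its successor start with different letters,
    and the removed path is a common prefix of their images.\<close>
  have PC: "length (P (Suc j)) \<le> C" for j
  proof (rule C)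
    show "ep (v (Suc j)) (iword (?s j)) (v j)" "ep (v (Suc j)) (?s (Suc j)) (v (Suc (Suc j)))"
      using v by (auto simp: epath_iword)
    show "reduced_word (iword (?s j))" "reduced_word (?s (Suc j))" using good by simp_all
    show "hd (iword (?s j)) \<noteq> hd (?s (Suc j))"
      using S(2) [of n] good(1) by (auto simp: hd_iword tight_def) metis
    show "?g (iword (?s j)) = P (Suc j) @ iword (S (n + N) j) @ iword (P j)"
      by (simp add: ext_pow_iword gw_sym P(2))
    show "?g (?s (Suc j)) = P (Suc j) @ S (n + N) (Suc j) @ iword (P (Suc (Suc j)))" by (rule P(2))
  qed
  have Pi: "length (P i) \<le> C" using PC [of "i + q - 1"] q_pos P(1) [of i] by simp
  \<comment> \<open>There are at least \<open>C\<close> letters on either side of position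
    \<open>C\<close>, and substitution does not shorten words; so the images of \<open>a\<close> and
    \<open>b\<close> absorb all that is removed.\<close>
  define d a b where "d = ?s i ! C" and "a = take C (?s i)" and "b = drop (Suc C) (?s i)"
  have si: "?s i = a @ [d] @ b" using len id_take_nth_drop [of C "?s i"] by (simp add: a_def b_def d_def)
  have lt: "e \<in> set (?s i) \<Longrightarrow> fst e < E" for e using epath_letters v by metis
  have "length a \<le> length (?g a)" "length b \<le> length (?g b)"
    by (intro ext_pow_length lt; simp add: si)+
  then have l: "length (P i) \<le> length (?g a)" "length (iword (P (Suc i))) \<le> length (?g b)"
    using Pi PC [of i] len by (simp_all add: a_def b_def)
  have "?g a @ ?g [d] @ ?g b = P i @ S (n + N) i @ iword (P (Suc i))"
    using P(2) [of i] unfolding si ext_pow_append .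
  from append_middle [OF this l] obtain x1 y1 where 1: "S (n + N) i = x1 @ ?g [d] @ y1" by blast
  have dE: "fst d < E" using lt by (simp add: si)
  have "e0 \<in> fst ` set ((ext gw ^^ n1) [(fst d, True)])" using assms [of n1] dE by simp
  then have "e0 \<in> fst ` set ((ext gw ^^ n1) [d])"
  proof (cases "snd d")
    case True then show ?thesis using \<open>e0 \<in> _\<close> by (metis prod.collapse)
  next
    case False
    then have "[d] = iword [(fst d, True)]" by (cases d) (simp add: flip_def)
    then have "(ext gw ^^ n1) [d] = iword ((ext gw ^^ n1) [(fst d, True)])"
      using ext_pow_iword [OF gw_sym] by metis
    then show ?thesis using \<open>e0 \<in> _\<close> by (simp add: iword_def image_image)
  qed
  then obtain b0 where "(e0, b0) \<in> set ((ext gw ^^ n1) [d])" by auto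
  then obtain x2 y2 where "(ext gw ^^ n1) [d] = x2 @ [(e0, b0)] @ y2" by (metis split_list append_Cons append_Nil)
  then have 2: "?g [d] = (ext gw ^^ M) x2 @ (ext gw ^^ M) [(e0, b0)] @ (ext gw ^^ M) y2"
    unfolding N_def funpow_add comp_def by (simp only: ext_pow_append)
  let ?c = "seqprod (S (n + N)) 0 q"
  obtain u where u: "J (n0 + (n + N)) = u + cls ?c - u" using S(1) [of "n + N"] by (auto simp: pieces_def)
  have "?c = seqprod (S (n + N)) 0 i @ S (n + N) i @ seqprod (S (n + N)) (Suc i) q"
    using seqprod_split [of 0 i q "S (n + N)"] seqprod_split [of i "Suc i" q "S (n + N)"] i
    by (simp add: seqprod_Suc)
  then have c: "?c = (seqprod (S (n + N)) 0 i @ x1 @ (ext gw ^^ M) x2) @ (ext gw ^^ M) [(e0, b0)] @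
      ((ext gw ^^ M) y2 @ y1 @ seqprod (S (n + N)) (Suc i) q)"
    unfolding 1 2 by simp
  have "seqprod (S (n + N)) q (q + q) = ?c"
  proof -
    have "seqprod w k (k + j) = seqprod (\<lambda>i. w (i + k)) 0 j" for w k j
      by (induction j) (auto simp: seqprod_Suc add.commute)
    moreover have "(\<lambda>i. S (n + N) (i + q)) = S (n + N)"
      using S(1) [of "n + N"] by (auto simp: pieces_def)
    ultimately show ?thesis by metis
  qed
  then have "?c @ ?c = seqprod (S (n + N)) 0 (q + q)" using seqprod_split [of 0 q "q + q"] by simp
  moreover have "reduced_word (seqprod (S (n + N)) 0 (q + q))"
    using reduced_seqprod [of "S (n + N)" 0 "q + q"] good S(2) by blast
  ultimately have "reduced_word (?c @ ?c)" by simp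
  then show ?thesis using u c by blast
qed

end

section \<open>Finite covers\<close>

text \<open>A weight \<open>s\<close> on the edges defines a cover of the graph whose sheets are the group elements: a letter
  \<open>d\<close> leads from sheet \<open>x\<close> to sheet \<open>x + lw s d\<close>. Lifts of edges are labelled by
  the edge and the initial sheet of its positive orientation.\<close>

definition lift :: "(nat \<Rightarrow> 'q::group_add) \<Rightarrow> 'q \<Rightarrow> letter \<Rightarrow> nat \<times> 'q" where
  "lift s x d = (fst d, if snd d then x else x + lw s d)"

fun crossed :: "(nat \<Rightarrow> 'q::group_add) \<Rightarrow> 'q \<Rightarrow> letter list \<Rightarrow> (nat \<times> 'q) set" where
  "crossed s x [] = {}"
| "crossed s x (d # w) = insert (lift s x d) (crossed s (x + lw s d) w)"

text \<open>A lifted edge keeps its label when traversed backwards from its other end; this is why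
  labels refer to the positive orientation.\<close>

lemma lift_flip: "lift s (x + lw s d) (flip d) = lift s x d"
  by (auto simp: lift_def lw_def flip_def add.assoc)

lemma crossed_append: "crossed s x (u @ v) = crossed s x u \<union> crossed s (x + ev s u) v"
  by (induction u arbitrary: x) (auto simp: add.assoc)

lemma crossed_iword: "crossed s (x + ev s w) (iword w) = crossed s x w"
proof (induction w arbitrary: x)
  case (Cons d w)
  have e: "x + ev s (d # w) = (x + lw s d) + ev s w" by (simp add: add.assoc)
  have "x + lw s d + ev s w + ev s (iword w) = x + lw s d" by simp
  then show ?case
    using Cons [of "x + lw s d"] unfolding e iword_simps crossed_append by (simp add: lift_flip)
qed simp

text \<open>Free reduction only deletes backtracks, so it may lose lifted edges but never gains
  any.\<close>

lemma crossed_push: "crossed s x (push d w) \<subseteq> crossed s x (d # w)"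
proof (cases w)
  case (Cons e v)
  then show ?thesis
    by (cases "e = flip d") (auto simp: add.assoc)
qed simp

lemma crossed_foldr_push: "crossed s x (foldr push u v) \<subseteq> crossed s x (u @ v)"
proof (induction u arbitrary: x)
  case (Cons d u)
  have "crossed s x (push d (foldr push u v)) \<subseteq> insert (lift s x d) (crossed s (x + lw s d) (foldr push u v))"
    using crossed_push [of s x d "foldr push u v"] by simp
  then show ?case using Cons [of "x + lw s d"] by auto
qed simp

lemma crossed_word_of_add:
  "crossed s x (word_of (a + b)) \<subseteq> crossed s x (word_of a) \<union> crossed s (x + ev s (word_of a)) (word_of b)"
  using crossed_foldr_push [of s x "word_of a" "word_of b"] by (simp add: plus_fg.rep_eq crossed_append)

text \<open>Left translation by a group element is a deck transformation of the cover.\<close>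

lemma crossed_shift: "crossed s (y + x) w = (\<lambda>(i, z). (i, y + z)) ` crossed s x w"
  by (induction w arbitrary: x) (auto simp: lift_def add.assoc)

lemma card_crossed_shift: "card (crossed s y w) = card (crossed s x w)"
proof -
  have "crossed s y w = (\<lambda>(i, z). (i, (y - x) + z)) ` crossed s x w"
    using crossed_shift [of s "y - x" x w] by simp
  moreover have "inj (\<lambda>(i, z). (i, (y - x) + z))" by (auto simp: inj_def)
  ultimately show ?thesis by (metis card_image inj_on_subset subset_UNIV)
qed

lemma finite_crossed [simp]: "finite (crossed s x w)"
  by (induction w arbitrary: x) auto
lemma card_crossed: "card (crossed s x w) \<le> length w"
  by (induction w arbitrary: x) (auto simp: card_insert_if le_SucI)

text \<open>The hypothesis on \<open>s\<close> says that the substitution preserves the weight. It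
  then lifts to the cover without moving sheets, so the image of a lifted path is composed of the
  images of its lifted edges.\<close>

lemma crossed_ext:
  assumes h: "symmetric_subst h" and s: "\<And>i. i < E \<Longrightarrow> ev s (h (i, True)) = s i"
    and w: "\<And>d. d \<in> set w \<Longrightarrow> fst d < E"
  shows "crossed s x (ext h w) = (\<Union>(i, z)\<in>crossed s x w. crossed s z (h (i, True)))"
  using w
proof (induction w arbitrary: x)
  case (Cons d w)
  obtain i b where d: "d = (i, b)" by fastforce
  have i: "i < E" using Cons.prems [of d] d by simp
  have neg: "h (i, False) = iword (h (i, True))"
    using h [unfolded symmetric_subst_def, rule_format, of "(i, True)"] by (simp add: flip_def)
  have e: "ev s (h d) = lw s d" using s [OF i] neg by (cases b) (auto simp: d lw_def)
  have "crossed s x (h d) = crossed s (snd (lift s x d)) (h (i, True))"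
  proof (cases b)
    case False
    then show ?thesis using crossed_iword [of s "x + lw s d" "h (i, True)"] s [OF i] neg
      by (simp add: d lift_def lw_def add.assoc)
  qed (simp add: d lift_def)
  then have "crossed s x (ext h (d # w)) =
      crossed s (snd (lift s x d)) (h (i, True)) \<union> crossed s (x + lw s d) (ext h w)"
    by (simp add: crossed_append e)
  then show ?case using Cons by (simp add: lift_def d)
qed simp

lemma crossed_in:
  assumes "0 \<in> Q" "\<And>a b. a \<in> Q \<Longrightarrow> b \<in> Q \<Longrightarrow> a + b \<in> Q" "\<And>a. a \<in> Q \<Longrightarrow> - a \<in> Q"
    "\<And>d. d \<in> set w \<Longrightarrow> s (fst d) \<in> Q \<and> fst d < E" "x \<in> Q"
  shows "crossed s x w \<subseteq> {..<E} \<times> Q"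
  using assms(4,5)
proof (induction w arbitrary: x)
  case (Cons d w)
  have d: "s (fst d) \<in> Q" "fst d < E" using Cons.prems(1) [of d] by simp_all
  then have l: "lw s d \<in> Q" using assms(3) by (simp add: lw_def)
  then have "crossed s (x + lw s d) w \<subseteq> {..<E} \<times> Q"
    using Cons.prems assms(2) by (intro Cons.IH) auto
  moreover have "lift s x d \<in> {..<E} \<times> Q" using d l Cons.prems(2) assms(2) by (simp add: lift_def)
  ultimately show ?case by simp
qed simp

locale pf_graph_map = graph_map E tail gw gv
  for E and tail :: "letter \<Rightarrow> 'v" and gw gv +
  assumes pf: "\<exists>n0. \<forall>n\<ge>n0. \<forall>i<E. \<forall>j<E. i \<in> fst ` set ((ext gw ^^ n) [(j, True)])"
    and lw_connected: "\<And>d d'. fst d < E \<Longrightarrow> fst d' < E \<Longrightarrow> tail d = tail d' \<Longrightarrow>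
      (d, d') \<in> {(d1, d2). \<exists>n j x a b y. j < E \<and> (ext gw ^^ n) [(j, True)] = x @ [a, b] @ y \<and>
         {d1, d2} = {flip a, b}}\<^sup>*"
begin

section \<open>Reachability between lifted edges\<close>

context
  fixes s :: "nat \<Rightarrow> 'q::group_add" and Q :: "'q set" and h :: "letter \<Rightarrow> letter list" and m p :: nat
  assumes Q: "0 \<in> Q" "\<And>a b. a \<in> Q \<Longrightarrow> b \<in> Q \<Longrightarrow> a + b \<in> Q" "\<And>a. a \<in> Q \<Longrightarrow> - a \<in> Q"
    and m: "m > 0" "\<And>a. a \<in> Q \<Longrightarrow> nmul m a = 0"
    and sQ: "\<And>i. i < E \<Longrightarrow> s i \<in> Q"
    and h: "h = (\<lambda>d. (ext gw ^^ p) [d])" "p > 0"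
    and s: "\<And>i. i < E \<Longrightarrow> ev s (h (i, True)) = s i"
    and hpf: "\<And>i j. i < E \<Longrightarrow> j < E \<Longrightarrow> i \<in> fst ` set (h (j, True))"
begin

lemma h_sym: "symmetric_subst h"
  unfolding h by (rule symmetric_subst_pow [OF gw_sym])

lemma ext_h: "(ext h ^^ k) w = (ext gw ^^ (p * k)) w"
  by (induction k) (auto simp: h ext_ext_pow funpow_add)

lemma h_letters: "(\<And>d. d \<in> set w \<Longrightarrow> fst d < E) \<Longrightarrow> d \<in> set ((ext h ^^ k) w) \<Longrightarrow> fst d < E"
  unfolding ext_h by (rule ext_pow_letters)

lemma ev_in_Q: "(\<And>d. d \<in> set w \<Longrightarrow> fst d < E) \<Longrightarrow> ev s w \<in> Q"
  using Q sQ by (intro ev_in_subgroup) auto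

text \<open>The transition graph of the lift of \<open>h\<close> to the cover, over the sheets in
  \<open>Q\<close>.\<close>

definition succ :: "((nat \<times> 'q) \<times> (nat \<times> 'q)) set" where
  "succ = {((i, z), (j, y)). i < E \<and> z \<in> Q \<and> (j, y) \<in> crossed s z (h (i, True))}"

lemma succ_E: "((i, z), (j, y)) \<in> succ \<Longrightarrow> i < E \<and> z \<in> Q \<and> j < E \<and> y \<in> Q"
proof -
  assume a: "((i, z), (j, y)) \<in> succ"
  have "i < E" using a by (simp add: succ_def)
  then have "d \<in> set (h (i, True)) \<Longrightarrow> fst d < E" for d
    using ext_pow_letters [of "[(i, True)]" d p] by (simp add: h)
  then show ?thesis
    using crossed_in [OF Q, of "h (i, True)" s E z] a sQ by (auto simp: succ_def)
qed

lemma succ_star_E: "((i, z), (j, y)) \<in> succ\<^sup>* \<Longrightarrow> i < E \<Longrightarrow> z \<in> Q \<Longrightarrow> j < E \<and> y \<in> Q"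
  by (induction rule: rtrancl_induct2) (auto dest: succ_E)

lemma succ_shift: "((i, z), (j, y)) \<in> succ\<^sup>* \<Longrightarrow> a \<in> Q \<Longrightarrow> ((i, a + z), (j, a + y)) \<in> succ\<^sup>*"
proof (induction rule: rtrancl_induct2)
  case (step k x j y)
  then have "((k, a + x), (j, a + y)) \<in> succ"
    using Q by (auto simp: succ_def crossed_shift)
  then show ?case using step by (meson rtrancl.rtrancl_into_rtrancl)
qed simp

lemma crossed_iff_succ:
  assumes "i < E" "z \<in> Q"
  shows "crossed s z ((ext h ^^ k) [(i, True)]) = (succ ^^ k) `` {(i, z)}"
proof (induction k)
  case 0
  then show ?case by (auto simp: lift_def)
next
  case (Suc k)
  let ?w = "(ext h ^^ k) [(i, True)]"
  have l: "d \<in> set ?w \<Longrightarrow> fst d < E" for d using h_letters [of "[(i, True)]" d k] assms by simp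
  have "crossed s z (ext h ?w) = (\<Union>(i, z)\<in>crossed s z ?w. crossed s z (h (i, True)))"
    by (rule crossed_ext [OF h_sym s l])
  moreover have "crossed s z ?w \<subseteq> {..<E} \<times> Q"
    by (rule crossed_in [OF Q]) (use l sQ assms in auto)
  ultimately show ?case using Suc by (auto simp: succ_def relcomp_unfold)
qed

text \<open>Up to translation the connection leads from sheet \<open>0\<close> to sheet
  \<open>a\<close>. Its translates lead on to all multiples of \<open>a\<close>, and
  \<open>- a\<close> is one of them because \<open>a\<close> has finite order.\<close>

lemma succ_back: "((e, x), (e, y)) \<in> succ\<^sup>* \<Longrightarrow> e < E \<Longrightarrow> x \<in> Q \<Longrightarrow> ((e, y), (e, x)) \<in> succ\<^sup>*"
proof -
  assume xy: "((e, x), (e, y)) \<in> succ\<^sup>*" and e: "e < E" "x \<in> Q"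
  define a where "a = - x + y"
  have yQ: "y \<in> Q" using succ_star_E [OF xy e] by simp
  have aQ: "a \<in> Q" using yQ e Q unfolding a_def by simp
  have 0: "((e, 0), (e, a)) \<in> succ\<^sup>*"
    using succ_shift [OF xy, of "- x"] e Q by (simp add: a_def)
  have k: "((e, 0), (e, nmul k a)) \<in> succ\<^sup>* \<and> nmul k a \<in> Q" for k
  proof (induction k)
    case (Suc k)
    then have "((e, a), (e, a + nmul k a)) \<in> succ\<^sup>*" using succ_shift [of e 0 e "nmul k a" a] aQ by simp
    then have "((e, 0), (e, a + nmul k a)) \<in> succ\<^sup>*" by (rule rtrancl_trans [OF 0])
    then show ?case using Suc aQ Q(2) by simp
  qed (simp add: Q)
  obtain m' where m': "m = Suc m'" using m(1) by (cases m) auto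
  then have "a + nmul m' a = 0" using m(2) [OF aQ] by simp
  then have "nmul m' a = - a" by (rule minus_unique [symmetric])
  then have "((e, 0), (e, - a)) \<in> succ\<^sup>*" using k [of m'] by simp
  then have "((e, y), (e, y - a)) \<in> succ\<^sup>*" using succ_shift [of e 0 e "- a" y] yQ by simp
  moreover have "y - a = x" by (simp add: a_def diff_conv_add_uminus minus_add del: add_uminus_conv_diff)
  ultimately show ?thesis by simp
qed

text \<open>By positivity the connection continues to some lift of the edge it started from, and
  from there \<open>succ_back\<close> leads home.\<close>

lemma succ_sym: "(c, c') \<in> succ\<^sup>* \<Longrightarrow> c \<in> {..<E} \<times> Q \<Longrightarrow> (c', c) \<in> succ\<^sup>*"
proof -
  assume cc: "(c, c') \<in> succ\<^sup>*" and cE: "c \<in> {..<E} \<times> Q"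
  obtain e x e' y where c: "c = (e, x)" "c' = (e', y)" by fastforce
  have e: "e < E" "x \<in> Q" "e' < E" "y \<in> Q" using cE succ_star_E [of e x e' y] cc by (auto simp: c)
  obtain b where "(e, b) \<in> set (h (e', True))" using hpf [OF e(1,3)] by auto
  then obtain u v where "h (e', True) = u @ (e, b) # v" by (meson split_list)
  then have "\<exists>z. (e, z) \<in> crossed s y (h (e', True))" by (auto simp: crossed_append lift_def)
  then obtain z where z: "((e', y), (e, z)) \<in> succ" using e by (auto simp: succ_def)
  then have "((e, x), (e, z)) \<in> succ\<^sup>*" using cc unfolding c by (rule rtrancl.rtrancl_into_rtrancl [rotated])
  then have "((e, z), (e, x)) \<in> succ\<^sup>*" using succ_back e by blast
  then show ?thesis using z unfolding c by (rule converse_rtrancl_into_rtrancl [rotated])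
qed

lemma lift_in: "fst d < E \<Longrightarrow> x \<in> Q \<Longrightarrow> lift s x d \<in> {..<E} \<times> Q"
  using Q sQ by (auto simp: lift_def lw_def simp flip: add_uminus_conv_diff)

text \<open>Both edges of a lifted turn are crossed by an iterate of one lifted edge. They are
  reachable from it, hence from each other by symmetry.\<close>

lemma turn_connected:
  assumes "j < E" "(ext gw ^^ n) [(j, True)] = u @ [a, b] @ v" "{d1, d2} = {flip a, b}" "x \<in> Q"
  shows "(lift s x d1, lift s x d2) \<in> succ\<^sup>*"
proof -
  obtain n0 where n0: "\<And>n i j. n \<ge> n0 \<Longrightarrow> i < E \<Longrightarrow> j < E \<Longrightarrow> i \<in> fst ` set ((ext gw ^^ n) [(j, True)])"
    using pf by blast
  \<comment> \<open>The turn is taken by the \<open>n\<close>-th iterate, whereas reachability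
    concerns powers of \<open>h\<close>. With this \<open>k\<close> the surplus
    \<open>p * k - n\<close> is at least \<open>n0\<close>, so the surplus iterate of edge
    \<open>j\<close> contains \<open>j\<close> again.\<close>
  define k where "k = n + n0"
  have pk: "p * k = n + (p * k - n)" "p * k - n \<ge> n0"
  proof -
    have "n + n0 \<le> p * k" using h(2) unfolding k_def by (cases p) auto
    then show "p * k = n + (p * k - n)" "p * k - n \<ge> n0" by simp_all
  qed
  obtain c where "(j, c) \<in> set ((ext gw ^^ (p * k - n)) [(j, True)])" using n0 [OF pk(2) assms(1,1)] by auto
  then obtain u' v' where "(ext gw ^^ (p * k - n)) [(j, True)] = u' @ [(j, c)] @ v'" by (metis split_list append_Cons append_Nil)
  then have w: "(ext h ^^ k) [(j, True)] = (ext gw ^^ n) u' @ (ext gw ^^ n) [(j, c)] @ (ext gw ^^ n) v'"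
    unfolding ext_h by (subst pk(1)) (simp only: funpow_add comp_def ext_pow_append)
  have "\<exists>u a b v. (ext gw ^^ n) [(j, c)] = u @ [a, b] @ v \<and> {d1, d2} = {flip a, b}"
  proof (cases c)
    case True
    then have "(ext gw ^^ n) [(j, c)] = u @ [a, b] @ v" using assms(2) by simp
    then show ?thesis using assms(3) by blast
  next
    case False
    have "(ext gw ^^ n) (iword [(j, True)]) = iword (u @ [a, b] @ v)"
      by (simp only: ext_pow_iword gw_sym assms(2))
    then have "(ext gw ^^ n) [(j, c)] = iword v @ [flip b, flip a] @ iword u"
      using False by (simp add: flip_def)
    moreover have "{d1, d2} = {flip (flip b), flip a}" using assms(3) by auto
    ultimately show ?thesis by blast
  qed
  then obtain U A B V where ab: "(ext h ^^ k) [(j, True)] = U @ [A, B] @ V" "{d1, d2} = {flip A, B}"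
    unfolding w by (metis append.assoc)
  have l: "d \<in> set (U @ [A, B] @ V) \<Longrightarrow> fst d < E" for d
    using h_letters [of "[(j, True)]" d k] assms(1) unfolding ab by simp
  \<comment> \<open>The starting sheet from which the lifted path meets the turn on sheet
    \<open>x\<close>.\<close>
  define z where "z = x - ev s (U @ [A])"
  have "ev s (U @ [A]) \<in> Q" using l by (intro ev_in_Q) auto
  then have zQ: "z \<in> Q" using assms(4) Q unfolding z_def diff_conv_add_uminus by blast
  have zx: "z + ev s U + lw s A = x" by (simp add: z_def add.assoc)
  have "lift s x (flip A) = lift s (z + ev s U) A" using lift_flip [of s "z + ev s U" A] zx by simp
  moreover have "lift s (z + ev s U) A \<in> crossed s z (U @ [A, B] @ V)"
    "lift s x B \<in> crossed s z (U @ [A, B] @ V)"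
    by (simp_all add: crossed_append zx [symmetric])
  ultimately have "((j, z), lift s x (flip A)) \<in> succ\<^sup>*" "((j, z), lift s x B) \<in> succ\<^sup>*"
    using crossed_iff_succ [OF assms(1) zQ, of k] unfolding ab by (auto simp: rtrancl_power)
  then have "(lift s x (flip A), lift s x B) \<in> succ\<^sup>*" "(lift s x B, lift s x (flip A)) \<in> succ\<^sup>*"
    using succ_sym assms(1) zQ by (meson SigmaI lessThan_iff rtrancl_trans)+
  then show ?thesis using ab(2) by (auto simp: doubleton_eq_iff)
qed

lemma vertex_connected:
  assumes "fst d < E" "fst d' < E" "tail d = tail d'" "x \<in> Q"
  shows "(lift s x d, lift s x d') \<in> succ\<^sup>*"
  using lw_connected [OF assms(1-3)]
proof (induction rule: rtrancl_induct)
  case (step y z)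
  then have "(lift s x y, lift s x z) \<in> succ\<^sup>*" using turn_connected assms(4) by blast
  then show ?case using step by (meson rtrancl_trans)
qed simp

text \<open>At each vertex of the path the connection passes between edges leaving that vertex.
  Moving along an edge costs nothing, since both of its directions name the same lifted
  edge.\<close>

lemma path_connected_lifts:
  "ep u w v \<Longrightarrow> fst d < E \<Longrightarrow> tail d = u \<Longrightarrow> fst d' < E \<Longrightarrow> tail d' = v \<Longrightarrow> x \<in> Q \<Longrightarrow>
     (lift s x d, lift s (x + ev s w) d') \<in> succ\<^sup>*"
proof (induction w arbitrary: u x d)
  case Nil
  then show ?case using vertex_connected by simp
next
  case (Cons e w)
  then have e: "fst e < E" "tail e = u" "ep (tail (flip e)) w v" by auto
  have x: "x + lw s e \<in> Q" using Cons.prems e Q sQ by (simp add: lw_def)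
  have "(lift s x d, lift s x e) \<in> succ\<^sup>*" using vertex_connected e Cons.prems by simp
  moreover have "(lift s (x + lw s e) (flip e), lift s (x + lw s e + ev s w) d') \<in> succ\<^sup>*"
    using Cons.IH [OF e(3) _ refl] e Cons.prems x by simp
  ultimately show ?case unfolding lift_flip by (simp add: add.assoc)
qed

text \<open>The lifts of \<open>d\<close> at the sheets that loops lead to are all reachable. As
  every lifted edge is its own successor, what is reached in \<open>k\<close> steps is reached in
  any larger number, so a maximum over the finitely many sheets serves them all.\<close>

lemma many_lifts:
  assumes refl: "\<And>e. e < E \<Longrightarrow> (e, 0) \<in> crossed s 0 (h (e, True))" and d: "fst d < E" and fQ: "finite Q"
  shows "\<exists>k. card {ev s w | w. ep (tail d) w (tail d)} \<le> card (crossed s z ((ext gw ^^ (p * k)) [(fst d, True)]))"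
proof -
  define T where "T = {ev s w | w. ep (tail d) w (tail d)}"
  have "T \<subseteq> Q"
  proof
    fix t assume "t \<in> T"
    then obtain w where "t = ev s w" "ep (tail d) w (tail d)" by (auto simp: T_def)
    then show "t \<in> Q" using ev_in_Q epath_letters by metis
  qed
  then have fT: "finite T" using fQ finite_subset by blast
  obtain x where l0: "lift s 0 d = (fst d, x)" by (simp add: lift_def)
  have xQ: "x \<in> Q" using lift_in [OF d Q(1)] l0 by simp
  have "((fst d, x), lift s t d) \<in> succ\<^sup>*" if "t \<in> T" for t
    using that path_connected_lifts [OF _ d HOL.refl d HOL.refl Q(1)] unfolding T_def l0 [symmetric] by auto
  then have "\<forall>t. \<exists>k. t \<in> T \<longrightarrow> ((fst d, x), lift s t d) \<in> succ ^^ k" by (auto simp: rtrancl_power)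
  then obtain k where k: "\<And>t. t \<in> T \<Longrightarrow> ((fst d, x), lift s t d) \<in> succ ^^ (k t)" by metis
  have self: "((e, y), (e, y)) \<in> succ" if "e < E" "y \<in> Q" for e y
    using refl [OF that(1)] that crossed_shift [of s y 0 "h (e, True)"] by (force simp: succ_def)
  have mono: "((fst d, x), c) \<in> succ ^^ (a + b)" if "((fst d, x), c) \<in> succ ^^ b" for a b c
  proof (induction a)
    case (Suc a)
    then show ?case using relpow_Suc_I2 [OF self [OF d xQ]] by simp
  qed (use that in simp)
  define K where "K = Max (insert 0 (k ` T))"
  have "((fst d, x), lift s t d) \<in> succ ^^ K" if "t \<in> T" for t
  proof -
    have "k t \<le> K" unfolding K_def using fT that by (intro Max_ge) auto
    then show ?thesis using mono [OF k [OF that], of "K - k t"] by simp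
  qed
  then have "(\<lambda>t. lift s t d) ` T \<subseteq> crossed s x ((ext h ^^ K) [(fst d, True)])"
    unfolding crossed_iff_succ [OF d xQ] by auto
  moreover have "inj_on (\<lambda>t. lift s t d) T" by (auto simp: inj_on_def lift_def split: if_splits)
  ultimately have "card T \<le> card (crossed s x ((ext h ^^ K) [(fst d, True)]))"
    by (metis card_image card_mono finite_crossed)
  also have "\<dots> = card (crossed s z ((ext gw ^^ (p * K)) [(fst d, True)]))"
    unfolding ext_h by (rule card_crossed_shift)
  finally show ?thesis unfolding T_def by blast
qed

end

text \<open>Two replacements of the power prepare \<open>many_lifts\<close>: a multiple of
  \<open>p\<close> above \<open>n0\<close> gives positivity, and a further factor \<open>m\<close>,
  an exponent of \<open>Q\<close>, makes the image of each lifted edge cross that edge again. Deck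
  translation and reversal give independence of \<open>z\<close> and \<open>b\<close>.\<close>

theorem many_lifts_crossed:
  fixes s :: "nat \<Rightarrow> 'q::group_add"
  assumes Q: "0 \<in> Q" "\<And>a b. a \<in> Q \<Longrightarrow> b \<in> Q \<Longrightarrow> a + b \<in> Q" "\<And>a. a \<in> Q \<Longrightarrow> - a \<in> Q"
    and m: "m > 0" "\<And>a. a \<in> Q \<Longrightarrow> nmul m a = 0" and fQ: "finite Q"
    and sQ: "\<And>i. i < E \<Longrightarrow> s i \<in> Q"
    and s: "p > 0" "\<And>i. i < E \<Longrightarrow> ev s ((ext gw ^^ p) [(i, True)]) = s i"
    and d: "fst d < E"
  shows "\<exists>M. \<forall>z b. card {ev s w | w. ep (tail d) w (tail d)} \<le> card (crossed s z ((ext gw ^^ M) [(fst d, b)]))"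
proof -
  obtain n0 where n0: "\<And>n i j. n \<ge> n0 \<Longrightarrow> i < E \<Longrightarrow> j < E \<Longrightarrow> i \<in> fst ` set ((ext gw ^^ n) [(j, True)])"
    using pf by blast
  define p1 where "p1 = p * Suc n0"
  define h1 where "h1 = (\<lambda>d. (ext gw ^^ p1) [d])"
  have inv: "ev s ((ext gw ^^ (p * k)) w) = ev s w" if "\<And>d. d \<in> set w \<Longrightarrow> fst d < E" for k w
  proof (induction k)
    case (Suc k)
    let ?w = "(ext gw ^^ (p * k)) w"
    have "ev s ((ext gw ^^ p) ?w) = ev (\<lambda>i. ev s ((ext gw ^^ p) [(i, True)])) ?w"
      unfolding ext_ext_pow [symmetric, where h = gw and n = p and w = ?w] by (rule ev_ext [OF symmetric_subst_pow [OF gw_sym]])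
    also have "\<dots> = ev s ?w"
      by (rule ev_restrict) (use s(2) ext_pow_letters [OF that] in blast)
    finally show ?case using Suc by (simp add: funpow_add)
  qed simp
  have "Suc n0 \<le> p1" using s(1) unfolding p1_def by (cases p) auto
  then have p1: "p1 > 0" "n0 \<le> p1" by simp_all
  have s1: "ev s (h1 (i, True)) = s i" if "i < E" for i
    using inv [of "[(i, True)]" "Suc n0"] that by (simp add: h1_def p1_def lw_def)
  have pf1: "i \<in> fst ` set (h1 (j, True))" if "i < E" "j < E" for i j
    using n0 [OF p1(2) that] by (simp add: h1_def)
  have "\<exists>a\<in>Q. (e, a) \<in> crossed s 0 (h1 (e, True))" if e: "e < E" for e
  proof -
    obtain b where "(e, b) \<in> set (h1 (e, True))" using pf1 [OF e e] by auto
    then obtain u v where uv: "h1 (e, True) = u @ (e, b) # v" by (meson split_list)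
    then obtain a where a: "(e, a) \<in> crossed s 0 (h1 (e, True))" by (auto simp: crossed_append lift_def)
    have "crossed s 0 (h1 (e, True)) \<subseteq> {..<E} \<times> Q"
      using ext_pow_letters [of "[(e, True)]" _ p1] e sQ
      by (intro crossed_in [OF Q]) (auto simp: h1_def Q(1))
    then show ?thesis using a by auto
  qed
  note base = this
  define h where "h = (\<lambda>d. (ext gw ^^ (p1 * m)) [d])"
  have "(e, 0) \<in> crossed s 0 (h (e, True))" if e: "e < E" for e
  proof -
    obtain a where a: "a \<in> Q" "(e, a) \<in> crossed s 0 (h1 (e, True))" using base e by blast
    \<comment> \<open>If \<open>h1\<close> takes the lift of \<open>e\<close> at sheet
      \<open>0\<close> across the one at sheet \<open>a\<close>, its \<open>k\<close>-th power takes
      it across the one at \<open>nmul k a\<close>; for \<open>k = m\<close> this is sheet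
      \<open>0\<close>.\<close>
    have "(e, nmul k a) \<in> crossed s 0 ((ext gw ^^ (p1 * k)) [(e, True)])" for k
    proof (induction k)
      case (Suc k)
      let ?w = "(ext gw ^^ (p1 * k)) [(e, True)]"
      have "(e, a) \<in> crossed s 0 (h1 (e, True))" by (rule a)
      have "(e, nmul k a + a) \<in> crossed s (nmul k a + 0) (h1 (e, True))"
        unfolding crossed_shift using a(2) by force
      then have "(e, nmul k a + a) \<in> (\<Union>(i, z)\<in>crossed s 0 ?w. crossed s z (h1 (i, True)))"
        using Suc by force
      also have "\<dots> = crossed s 0 (ext h1 ?w)"
        by (rule crossed_ext [symmetric, where E = E])
          (use s1 ext_pow_letters [of "[(e, True)]"] e in \<open>auto simp: h1_def symmetric_subst_pow gw_sym\<close>)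
      also have "ext h1 ?w = (ext gw ^^ (p1 * Suc k)) [(e, True)]"
        by (simp add: h1_def ext_ext_pow funpow_add)
      finally show ?case using nmul_add [of k 1 a] nmul_add [of 1 k a] by simp
    qed (simp add: lift_def)
    from this [of m] show ?thesis using m(2) [OF a(1)] by (simp add: h_def)
  qed
  note refl = this
  have pm: "0 < p1 * m" "n0 \<le> p1 * m" using p1 m(1) by (auto intro: le_trans)
  have "ev s (h (i, True)) = s i" if "i < E" for i
    using inv [of "[(i, True)]" "Suc n0 * m"] that by (simp add: h_def p1_def lw_def mult.assoc del: mult_Suc mult_Suc_right)
  then obtain k where k: "card {ev s w | w. ep (tail d) w (tail d)}
      \<le> card (crossed s 0 ((ext gw ^^ (p1 * m * k)) [(fst d, True)]))"
    using many_lifts [OF Q m sQ h_def pm(1) _ _ refl d fQ, of 0] n0 [OF pm(2)] by (auto simp: h_def)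
  show ?thesis
  proof (intro exI allI)
    fix z b
    let ?w = "(ext gw ^^ (p1 * m * k)) [(fst d, True)]"
    have "card (crossed s z ((ext gw ^^ (p1 * m * k)) [(fst d, b)])) = card (crossed s 0 ?w)"
    proof (cases b)
      case False
      then have "[(fst d, b)] = iword [(fst d, True)]" by (simp add: flip_def)
      then have "crossed s (0 + ev s ?w) ((ext gw ^^ (p1 * m * k)) [(fst d, b)]) = crossed s 0 ?w"
        using crossed_iword [of s 0 ?w] by (simp only: ext_pow_iword gw_sym)
      then show ?thesis using card_crossed_shift by metis
    qed (simp add: card_crossed_shift [of s z _ 0])
    then show "card {ev s w | w. ep (tail d) w (tail d)}
      \<le> card (crossed s z ((ext gw ^^ (p1 * m * k)) [(fst d, b)]))" using k by simp
  qed
qed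

end

section \<open>No invariant free factor\<close>

lemma carrier_free_group: "w \<in> carrier (free_group r) \<longleftrightarrow> reduced_word w \<and> fst ` set w \<subseteq> {..<r}"
  by (simp add: free_group_def)

lemma one_free_group: "\<one>\<^bsub>free_group r\<^esub> = []"
  by (simp add: free_group_def)

lemma cls_mult:
  "u \<in> carrier (free_group r) \<Longrightarrow> v \<in> carrier (free_group r) \<Longrightarrow> cls (u \<otimes>\<^bsub>free_group r\<^esub> v) = cls u + cls v"
  by (simp add: free_group_def) (metis cls_word_of plus_fg.rep_eq word_of_cls)

lemma self_add_cancel: "a = a + b \<Longrightarrow> b = (0 :: 'a :: group_add)"
  using add_left_cancel [of a b 0] by simp

lemma additive_one:
  fixes \<psi> :: "'a \<Rightarrow> 'h::group_add"
  assumes "Group.group G" "\<And>u v. u \<in> carrier G \<Longrightarrow> v \<in> carrier G \<Longrightarrow> \<psi> (u \<otimes>\<^bsub>G\<^esub> v) = \<psi> u + \<psi> v"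
  shows "\<psi> \<one>\<^bsub>G\<^esub> = 0" "u \<in> carrier G \<Longrightarrow> \<psi> (inv\<^bsub>G\<^esub> u) = - \<psi> u"
proof -
  interpret Group.group G by (rule assms(1))
  show one: "\<psi> \<one>\<^bsub>G\<^esub> = 0" using assms(2) [of "\<one>\<^bsub>G\<^esub>" "\<one>\<^bsub>G\<^esub>"] self_add_cancel [of "\<psi> \<one>\<^bsub>G\<^esub>"] by simp
  assume u: "u \<in> carrier G"
  then have "\<psi> u + \<psi> (inv\<^bsub>G\<^esub> u) = 0" using assms(2) [of u "inv\<^bsub>G\<^esub> u"] one by simp
  then show "\<psi> (inv\<^bsub>G\<^esub> u) = - \<psi> u" by (rule minus_unique [symmetric])
qed

text \<open>The universal property of \<open>free_group r\<close>: it passes from homomorphisms on a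
  carrier to evaluation of words.\<close>

lemma additive_conv_ev:
  fixes \<psi> :: "letter list \<Rightarrow> 'h::group_add"
  assumes "\<And>u v. u \<in> carrier (free_group r) \<Longrightarrow> v \<in> carrier (free_group r) \<Longrightarrow>
    \<psi> (u \<otimes>\<^bsub>free_group r\<^esub> v) = \<psi> u + \<psi> v"
  shows "w \<in> carrier (free_group r) \<Longrightarrow> \<psi> w = ev (\<lambda>i. \<psi> [(i, True)]) w"
proof (induction w)
  case Nil
  then show ?case using additive_one(1) [OF group_free_group assms] by (simp add: one_free_group)
next
  case (Cons d w)
  have c: "[d] \<in> carrier (free_group r)" "w \<in> carrier (free_group r)" "[flip d] \<in> carrier (free_group r)"
    using Cons.prems by (auto simp: carrier_free_group reduced_Cons)
  have "[d] \<otimes>\<^bsub>free_group r\<^esub> w = d # w"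
    using Cons.prems by (cases w) (auto simp: free_group_def reduced_Cons)
  then have 1: "\<psi> (d # w) = \<psi> [d] + \<psi> w" using assms [OF c(1,2)] by simp
  have "[d] \<otimes>\<^bsub>free_group r\<^esub> [flip d] = []" by (simp add: free_group_def)
  then have "\<psi> [d] + \<psi> [flip d] = 0"
    using assms [OF c(1,3)] additive_one(1) [OF group_free_group assms] by (simp add: one_free_group)
  then have 2: "\<psi> [flip d] = - \<psi> [d]" by (rule minus_unique [symmetric])
  have "\<psi> [d] = lw (\<lambda>i. \<psi> [(i, True)]) d"
    using 2 by (cases d; cases "snd d") (auto simp: lw_def flip_def)
  then show ?case using 1 Cons.IH [OF c(2)] by simp
qed

lemma nmul_neg_left: "nmul i a = nmul j a \<Longrightarrow> i < j \<Longrightarrow> nmul (j - i) (a :: 'a :: group_add) = 0"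
  using nmul_add [of i "j - i" a] self_add_cancel [of "nmul j a"] by simp

lemma nmul_dvd: "nmul i a = 0 \<Longrightarrow> i dvd j \<Longrightarrow> nmul j a = (0 :: 'a :: monoid_add)"
  by (auto simp: dvd_def nmul_mult)

text \<open>The pigeonhole principle gives each element a period of at most \<open>card Q\<close>,
  and the factorial is a multiple of all of these.\<close>

lemma finite_group_exponent:
  fixes Q :: "'q::group_add set"
  assumes "finite Q" "0 \<in> Q" "\<And>a b. a \<in> Q \<Longrightarrow> b \<in> Q \<Longrightarrow> a + b \<in> Q"
  shows "\<exists>m>0. \<forall>a\<in>Q. nmul m a = 0"
proof (intro exI conjI ballI)
  show "fact (card Q) > (0 :: nat)" by simp
  fix a assume a: "a \<in> Q"
  have "nmul i a \<in> Q" for i using a assms by (induction i) auto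
  then have "(\<lambda>i. nmul i a) ` {..card Q} \<subseteq> Q" by auto
  then have "card ((\<lambda>i. nmul i a) ` {..card Q}) < card {..card Q}"
    using card_mono [OF assms(1)] by (metis card_atMost less_Suc_eq_le)
  then have "\<not> inj_on (\<lambda>i. nmul i a) {..card Q}" by (metis card_image less_irrefl)
  then obtain i j where ij: "i \<le> card Q" "j \<le> card Q" "i < j" "nmul i a = nmul j a"
    unfolding inj_on_def by (metis atMost_iff linorder_neqE_nat)
  then have "nmul (j - i) a = 0" by (simp add: nmul_neg_left)
  moreover have "(j - i) dvd fact (card Q)" using ij by (intro dvd_fact) auto
  ultimately show "nmul (fact (card Q)) a = 0" by (rule nmul_dvd)
qed

lemma nmul_reps: "reduced_word (c @ c) \<Longrightarrow> word_of (nmul k (cls c)) = concat (replicate k c)"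
  by (metis cls_power reduced_power word_of_cls)

text \<open>Powers of \<open>a\<close> are conjugates of powers of \<open>c\<close>. With
  \<open>length (word_of u)\<close> copies of \<open>c\<close> on either side, the middle copy is
  out of reach of the conjugator.\<close>

lemma conjugate_power_contains:
  assumes "a = u + cls c - u" "reduced_word (c @ c)" "c \<noteq> []"
  shows "\<exists>k x y. word_of (nmul k a) = x @ c @ y"
proof -
  let ?l = "length (word_of u)"
  let ?r = "\<lambda>k. concat (replicate k c)"
  have len: "k \<le> length (?r k)" for k
  proof (induction k)
    case (Suc k)
    have "1 \<le> length c" using assms(3) by (cases c) auto
    then show ?case using Suc by simp
  qed simp
  have "replicate (?l + Suc ?l) c = replicate ?l c @ c # replicate ?l c"
    by (simp only: replicate_add replicate_Suc)
  then have r: "word_of (nmul (?l + Suc ?l) (cls c)) = ?r ?l @ c @ ?r ?l"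
    using nmul_reps [OF assms(2), of "?l + Suc ?l"] by simp
  have "\<exists>x y. word_of (u + nmul (?l + Suc ?l) (cls c) + - u) = x @ c @ y"
    by (rule word_of_middle [OF r]) (simp_all add: len word_of_uminus)
  moreover have "nmul (?l + Suc ?l) a = u + nmul (?l + Suc ?l) (cls c) - u"
    unfolding assms(1) by (rule nmul_conj)
  ultimately show ?thesis by (metis add_uminus_conv_diff)
qed

text \<open>Loops \<open>t i\<close> of trivial weight lift to loops at sheet \<open>0\<close>, so
  products of them and their inverses never leave the union of these lifts, however long
  \<open>w\<close> is.\<close>

lemma crossed_word_of_ev:
  assumes "\<And>i. i < r \<Longrightarrow> ev s (word_of (t i)) = 0" "\<And>d. d \<in> set w \<Longrightarrow> fst d < r"
  shows "crossed s 0 (word_of (ev t w)) \<subseteq> (\<Union>i<r. crossed s 0 (word_of (t i)))"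
  using assms(2)
proof (induction w)
  case Nil
  then show ?case by (simp add: zero_fg.rep_eq)
next
  case (Cons d w)
  have i: "fst d < r" using Cons.prems by simp
  have z: "ev s (word_of (lw t d)) = 0" using assms(1) [OF i] by (simp add: lw_def)
  have "crossed s 0 (word_of (lw t d)) = crossed s 0 (word_of (t (fst d)))"
    using crossed_iword [of s 0 "word_of (t (fst d))"] assms(1) [OF i] by (simp add: lw_def word_of_uminus)
  then have "crossed s 0 (word_of (lw t d)) \<subseteq> (\<Union>i<r. crossed s 0 (word_of (t i)))" using i by auto
  moreover have "crossed s 0 (word_of (ev t w)) \<subseteq> (\<Union>i<r. crossed s 0 (word_of (t i)))"
    using Cons by simp
  ultimately show ?case
    using crossed_word_of_add [of s 0 "lw t d" "ev t w"] z by simp blast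
qed

context pf_graph_map
begin

text \<open>\<open>J\<close> represents elements of \<open>F\<close> by loops of the graph at
  \<open>v0\<close>; \<open>\<theta>\<close> recovers an element from its loop up to conjugation by
  \<open>c\<close>, as a homotopy inverse of the marking does. In this form the counting argument
  involves no topology.\<close>

theorem no_invariant_free_factor:
  fixes r :: nat and A K :: "letter list set" and f :: "letter list \<Rightarrow> letter list"
    and J :: "letter list \<Rightarrow> fg" and \<theta> :: "nat \<Rightarrow> fg"
  defines "F \<equiv> free_group r"
  assumes prod: "internal_free_product F UNIV (\<lambda>b. if b then A else K) (carrier F)"
    and A: "A \<noteq> {\<one>\<^bsub>F\<^esub>}" and K: "K \<noteq> {\<one>\<^bsub>F\<^esub>}"
    and f: "f \<in> hom F F" "bij_betw f (carrier F) (carrier F)"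
    and fA: "b \<in> carrier F" "\<And>a. a \<in> A \<Longrightarrow> \<exists>a'\<in>A. f a = b \<otimes>\<^bsub>F\<^esub> a' \<otimes>\<^bsub>F\<^esub> inv\<^bsub>F\<^esub> b"
    and J_mult: "\<And>u v. u \<in> carrier F \<Longrightarrow> v \<in> carrier F \<Longrightarrow> J (u \<otimes>\<^bsub>F\<^esub> v) = J u + J v"
    and J_closed: "\<And>w. w \<in> carrier F \<Longrightarrow> ep v0 (word_of (J w)) v0"
    and J_f: "\<And>w. w \<in> carrier F \<Longrightarrow> J (f w) = y + cls (ext gw (word_of (J w))) - y"
    and \<theta>: "\<And>w. w \<in> carrier F \<Longrightarrow> ev \<theta> (word_of (J w)) = c + cls w - c"
    and no_pnp: "\<And>K d X Y z. K \<ge> 1 \<Longrightarrow> (ext gw ^^ K) [d] = X @ d # Y \<Longrightarrow>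
       ep (tail d) (d # z) (tail d) \<Longrightarrow> cls (d # z) \<noteq> 0 \<Longrightarrow>
       cls ((ext gw ^^ K) z) \<noteq> - cls Y + cls z - cls X"
  shows False
proof -
  interpret F: Group.group F unfolding F_def by (rule group_free_group)
  have "subgroup (if i then A else K) F" for i
    using prod unfolding internal_free_product_def by blast
  from this [of True] this [of False] have subA: "subgroup A F" and subK: "subgroup K F" by simp_all
  have Ac: "\<And>a. a \<in> A \<Longrightarrow> a \<in> carrier F" "\<And>a. a \<in> K \<Longrightarrow> a \<in> carrier F"
    by (erule subgroup.mem_carrier [OF subA], erule subgroup.mem_carrier [OF subK])
  obtain pA where pA: "pA \<in> hom F F" "pA ` carrier F \<subseteq> A" "\<And>a. a \<in> A \<Longrightarrow> pA a = a"
    using F.free_product_projection [OF prod, of True] by auto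
  obtain pK where pK: "pK \<in> hom F F" "pK ` carrier F \<subseteq> K" "\<And>a. a \<in> K \<Longrightarrow> pK a = a" "\<And>a. a \<in> A \<Longrightarrow> pK a = \<one>\<^bsub>F\<^esub>"
    using F.free_product_projection [OF prod, of False] by auto
  have gen: "[(i, True)] \<in> carrier F" if "i < r" for i
    using that by (simp add: F_def carrier_free_group reduced_word_def)
  have letters: "fst d < r" if "w \<in> carrier F" "d \<in> set w" for w d
    using that by (auto simp: F_def carrier_free_group)
  have one: "\<one>\<^bsub>F\<^esub> = []" by (simp add: F_def one_free_group)
  have clsm: "cls (u \<otimes>\<^bsub>F\<^esub> v) = cls u + cls v" if "u \<in> carrier F" "v \<in> carrier F" for u v
    using that unfolding F_def by (rule cls_mult)
  note conv = additive_conv_ev [where r = r, folded F_def]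
  have J_inv: "J (inv\<^bsub>F\<^esub> u) = - J u" "J \<one>\<^bsub>F\<^esub> = 0" if "u \<in> carrier F" for u
    using additive_one [OF F.is_group J_mult] that by auto
  have cls_inv: "cls (inv\<^bsub>F\<^esub> u) = - cls u" if "u \<in> carrier F" for u
    using additive_one(2) [OF F.is_group clsm that] .
  have J_zero: "w = \<one>\<^bsub>F\<^esub>" if "w \<in> carrier F" "J w = 0" for w
  proof -
    have "c + cls w - c = 0" using \<theta> [OF that(1)] that(2) by simp
    then have "cls w = 0" by (metis add.right_neutral add_left_cancel eq_iff_diff_eq_0)
    then have "w = []" using that(1) unfolding F_def carrier_free_group by (simp add: cls_eq_0_reduced)
    then show ?thesis using one by simp
  qed
  have fc: "f w \<in> carrier F" if "w \<in> carrier F" for w using f(1) that by (auto simp: hom_def)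
  have fnb: "bij_betw (f ^^ n) (carrier F) (carrier F)" for n
    using f(2) by (induction n) (auto intro: bij_betw_trans simp: bij_betw_id [unfolded id_def])
  then have fn: "(f ^^ n) w \<in> carrier F" if "w \<in> carrier F" for n w using that bij_betwE by blast
  have fm: "f (u \<otimes>\<^bsub>F\<^esub> v) = f u \<otimes>\<^bsub>F\<^esub> f v" if "u \<in> carrier F" "v \<in> carrier F" for u v
    using f(1) that by (simp add: hom_mult)
  interpret fh: group_hom F F f using f(1) by unfold_locales
  have fnA: "\<exists>b'\<in>carrier F. \<exists>a'\<in>A. (f ^^ n) a = b' \<otimes>\<^bsub>F\<^esub> a' \<otimes>\<^bsub>F\<^esub> inv\<^bsub>F\<^esub> b'" if "a \<in> A" for n a
  proof (induction n)
    case 0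
    then show ?case using that Ac by (intro bexI [of _ "\<one>\<^bsub>F\<^esub>"] bexI [of _ a]) auto
  next
    case (Suc n)
    then obtain b' a' where 1: "b' \<in> carrier F" "a' \<in> A" "(f ^^ n) a = b' \<otimes>\<^bsub>F\<^esub> a' \<otimes>\<^bsub>F\<^esub> inv\<^bsub>F\<^esub> b'" by blast
    obtain a'' where 2: "a'' \<in> A" "f a' = b \<otimes>\<^bsub>F\<^esub> a'' \<otimes>\<^bsub>F\<^esub> inv\<^bsub>F\<^esub> b" using fA(2) 1(2) by blast
    have "(f ^^ Suc n) a = (f b' \<otimes>\<^bsub>F\<^esub> b) \<otimes>\<^bsub>F\<^esub> a'' \<otimes>\<^bsub>F\<^esub> inv\<^bsub>F\<^esub> (f b' \<otimes>\<^bsub>F\<^esub> b)"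
      using 1 2 Ac fA(1) by (simp add: F.m_assoc F.inv_mult_group)
    then show ?case using 1 2 fA(1) by (intro bexI [of _ "f b' \<otimes>\<^bsub>F\<^esub> b"] bexI [of _ a'']) auto
  qed
  \<comment> \<open>The total length of the loops of the projected generators. For every weight that
    kills them it bounds the number of lifted edges crossed by a loop of \<open>A\<close>.\<close>
  define C where "C = (\<Sum>i<r. length (word_of (J (pA [(i, True)]))))"
  obtain x where x: "x \<in> K" "x \<noteq> \<one>\<^bsub>F\<^esub>"
    using K subgroup.one_closed [OF subK] by auto
  have "cls x \<noteq> 0" using x Ac by (auto simp: F_def carrier_free_group cls_eq_0_reduced one_free_group)
  \<comment> \<open>If the image of \<open>x\<close> had order at most \<open>C\<close>, its
    \<open>C!\<close>-th multiple would vanish. Detecting this multiple in a finite quotient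
    therefore forces a large order.\<close>
  then have "nmul (fact C) (cls x) \<noteq> 0" using fg_torsion_free [of "fact C" "cls x"] by auto
  then have "word_of (nmul (fact C) (cls x)) \<noteq> []" by (metis cls_Nil cls_word_of)
  then obtain N \<sigma> where \<sigma>: "\<And>i. \<sigma> i \<in> sym_on N" "ev \<sigma> (word_of (nmul (fact C) (cls x))) \<noteq> 0"
    using residually_finite [OF reduced_word_of] by blast
  have ev_nmul: "ev \<sigma> (word_of (nmul k a)) = nmul k (ev \<sigma> (word_of a))" for k a
    by (induction k) auto
  \<comment> \<open>Projecting to \<open>K\<close> before applying \<open>\<sigma>\<close> kills
    \<open>A\<close>, while on \<open>K\<close> the map is still \<open>\<sigma>\<close>, so
    \<open>x\<close> keeps its large order.\<close>
  define \<rho> where "\<rho> w = ev \<sigma> (pK w)" for w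
  define \<rho>0 where "\<rho>0 i = \<rho> [(i, True)]" for i
  have evm: "ev \<sigma> (u \<otimes>\<^bsub>F\<^esub> v) = ev \<sigma> u + ev \<sigma> v" for u v
    by (simp add: F_def free_group_def ev_foldr_push)
  have \<rho>_mult: "\<rho> (u \<otimes>\<^bsub>F\<^esub> v) = \<rho> u + \<rho> v" if "u \<in> carrier F" "v \<in> carrier F" for u v
    using pK(1) that by (simp add: \<rho>_def hom_mult evm)
  have \<rho>_conv: "\<rho> w = ev \<rho>0 w" if "w \<in> carrier F" for w
    unfolding \<rho>0_def by (rule conv [OF \<rho>_mult that])
  have \<rho>A: "\<rho> a = 0" if "a \<in> A" for a using pK(4) [OF that] by (simp add: \<rho>_def one)
  have \<rho>_inv: "\<rho> (inv\<^bsub>F\<^esub> u) = - \<rho> u" if "u \<in> carrier F" for u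
    using additive_one(2) [OF F.is_group \<rho>_mult that] .
  note Q = sym_on_subgroup [where n = N]
  have \<rho>0Q: "\<rho>0 i \<in> sym_on N" for i
    unfolding \<rho>0_def \<rho>_def by (rule ev_in_subgroup) (use Q \<sigma> in auto)
  have evQ: "ev t w \<in> sym_on N" if "\<And>i. t i \<in> sym_on N" for t w
    by (rule ev_in_subgroup) (use Q that in auto)
  have finim: "finite (\<rho> ` carrier F)"
    by (rule finite_subset [OF _ finite_sym_on [of N]]) (use \<rho>_conv evQ \<rho>0Q in auto)
  have many: "C < card (\<rho> ` carrier F)"
  proof -
    define e where "e = ev \<sigma> x"
    have xp: "nmul i e \<in> \<rho> ` carrier F" for i
    proof (induction i)
      case 0
      have "\<rho> \<one>\<^bsub>F\<^esub> = 0" by (rule additive_one(1) [OF F.is_group \<rho>_mult])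
      then show ?case by (metis F.one_closed imageI nmul.simps(1))
    next
      case (Suc i)
      then obtain u where "u \<in> carrier F" "nmul i e = \<rho> u" by auto
      moreover have "\<rho> x = e" using pK(3) [OF x(1)] by (simp add: \<rho>_def e_def)
      ultimately have "nmul (Suc i) e = \<rho> (x \<otimes>\<^bsub>F\<^esub> u)" using \<rho>_mult Ac x(1) by simp
      then show ?case using Ac x(1) \<open>u \<in> carrier F\<close> by (metis F.m_closed imageI)
    qed
    have ne: "nmul (fact C) e \<noteq> 0" using \<sigma>(2) by (simp add: ev_nmul e_def)
    have ij: "nmul i e \<noteq> nmul j e" if "i < j" "j \<le> C" for i j
    proof
      assume "nmul i e = nmul j e"
      then have "nmul (j - i) e = 0" using that by (simp add: nmul_neg_left)
      moreover have "(j - i) dvd fact C" using that by (intro dvd_fact) auto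
      ultimately show False using nmul_dvd ne by blast
    qed
    have "inj_on (\<lambda>i. nmul i e) {..C}"
      by (rule inj_onI) (metis atMost_iff ij linorder_neqE_nat)
    then have "Suc C = card ((\<lambda>i. nmul i e) ` {..C})" by (simp add: card_image)
    also have "\<dots> \<le> card (\<rho> ` carrier F)" using xp finim by (intro card_mono) auto
    finally show ?thesis by simp
  qed
  \<comment> \<open>The quotient becomes a weight on edges through \<open>\<theta>\<close>; on the
    loops \<open>J w\<close> it agrees with \<open>\<rho>\<close> up to conjugation by
    \<open>c'\<close>.\<close>
  define s0 where "s0 i = ev \<rho>0 (word_of (\<theta> i))" for i
  define c' where "c' = ev \<rho>0 (word_of c)"
  have s0: "ev s0 (word_of (J w)) = c' + \<rho> w - c'" if "w \<in> carrier F" for w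
  proof -
    have "ev s0 (word_of (J w)) = ev \<rho>0 (word_of (c + cls w + - c))"
      unfolding s0_def ev_ev [symmetric] \<theta> [OF that] by simp
    also have "\<dots> = c' + ev \<rho>0 w - c'"
      unfolding ev_add ev_uminus ev_word_of_cls c'_def by simp
    finally show ?thesis using \<rho>_conv [OF that] by simp
  qed
  \<comment> \<open>The weight pulled back along the \<open>n\<close>-th iterate. Only finitely many
    weights on \<open>E\<close> edges have values in \<open>sym_on N\<close>, so two of these agree
    on the edges.\<close>
  define sn where "sn n i = ev s0 ((ext gw ^^ n) [(i, True)])" for n i
  have sn: "ev (sn n) w = ev s0 ((ext gw ^^ n) w)" for n w
    unfolding sn_def ext_ext_pow [symmetric, where h = gw and n = n and w = w]
    by (rule ev_ext [OF symmetric_subst_pow [OF gw_sym], symmetric])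
  have Jfn: "\<exists>z. \<forall>w\<in>carrier F. J ((f ^^ n) w) = z + cls ((ext gw ^^ n) (word_of (J w))) - z" for n
  proof (induction n)
    case 0
    show ?case by (intro exI [of _ 0]) simp
  next
    case (Suc n)
    then obtain z where z: "\<And>w. w \<in> carrier F \<Longrightarrow> J ((f ^^ n) w) = z + cls ((ext gw ^^ n) (word_of (J w))) - z"
      by blast
    show ?case
    proof (intro exI [of _ "y + cls (ext gw (word_of z))"] ballI)
      fix w assume w: "w \<in> carrier F"
      let ?u = "(ext gw ^^ n) (word_of (J w))"
      have "J ((f ^^ n) w) = cls (word_of z @ ?u @ iword (word_of z))"
        unfolding z [OF w] by (simp add: add.assoc diff_conv_add_uminus del: add_uminus_conv_diff)
      then have "cls (ext gw (word_of (J ((f ^^ n) w)))) = cls (ext gw (word_of z @ ?u @ iword (word_of z)))"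
        by (intro cls_ext_cong gw_sym) simp
      then show "J ((f ^^ Suc n) w) = y + cls (ext gw (word_of z)) + cls ((ext gw ^^ Suc n) (word_of (J w)))
          - (y + cls (ext gw (word_of z)))"
        using J_f [OF fn [OF w, of n]]
        by (simp add: ext_iword gw_sym add.assoc diff_conv_add_uminus minus_add del: add_uminus_conv_diff)
    qed
  qed
  have s0Q: "s0 i \<in> sym_on N" for i unfolding s0_def using evQ \<rho>0Q by blast
  have snQ: "sn n i \<in> sym_on N" for n i unfolding sn_def using evQ s0Q by blast
  have "\<exists>n p. p > 0 \<and> (\<forall>i<E. sn (n + p) i = sn n i)"
  proof -
    have "range (\<lambda>n. map (sn n) [0..<E]) \<subseteq> {xs. set xs \<subseteq> sym_on N \<and> length xs = E}" using snQ by auto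
    then have "finite (range (\<lambda>n. map (sn n) [0..<E]))"
      using finite_lists_length_eq [OF finite_sym_on] finite_subset by blast
    then have "\<not> inj (\<lambda>n. map (sn n) [0..<E])" using finite_imageD infinite_UNIV_nat by blast
    then obtain n n' where nn: "n < n'" "map (sn n) [0..<E] = map (sn n') [0..<E]"
      unfolding inj_def by (metis linorder_neqE_nat)
    then have "\<forall>i<E. sn (n + (n' - n)) i = sn n i" by simp
    then show ?thesis using nn(1) by (intro exI [of _ n] exI [of _ "n' - n"]) simp
  qed
  then obtain n p where np: "p > 0" "\<And>i. i < E \<Longrightarrow> sn (n + p) i = sn n i" by blast
  define s where "s = sn n"
  obtain z where z: "\<And>w. w \<in> carrier F \<Longrightarrow> J ((f ^^ n) w) = z + cls ((ext gw ^^ n) (word_of (J w))) - z"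
    using Jfn by blast
  define e where "e = - ev s0 (word_of z) + c'"
  \<comment> \<open>The pulled-back weight corresponds to \<open>\<rho>\<close> composed with
    \<open>f ^^ n\<close>.\<close>
  have sJ: "ev s (word_of (J w)) = e + \<rho> ((f ^^ n) w) - e" if w: "w \<in> carrier F" for w
  proof -
    have "cls ((ext gw ^^ n) (word_of (J w))) = - z + J ((f ^^ n) w) + z"
      unfolding z [OF w] by (simp add: add.assoc diff_conv_add_uminus del: add_uminus_conv_diff)
    then have "ev s0 ((ext gw ^^ n) (word_of (J w))) = ev s0 (word_of (- z + J ((f ^^ n) w) + z))"
      by (metis ev_word_of_cls)
    then show ?thesis unfolding s_def sn e_def ev_add ev_uminus s0 [OF fn [OF w]]
      by (simp add: add.assoc diff_conv_add_uminus minus_add del: add_uminus_conv_diff)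
  qed
  have inv: "ev s ((ext gw ^^ p) [(i, True)]) = s i" if "i < E" for i
    using np(2) [OF that] unfolding s_def sn by (simp add: sn_def funpow_add)
  obtain a where a: "a \<in> A" "a \<noteq> \<one>\<^bsub>F\<^esub>" using A subgroup.one_closed [OF subA] by auto
  have aF: "a \<in> carrier F" using a Ac by blast
  have f_inj: "(f ^^ n) a \<noteq> \<one>\<^bsub>F\<^esub>" for n
  proof
    assume "(f ^^ n) a = \<one>\<^bsub>F\<^esub>"
    moreover have "(f ^^ n) \<one>\<^bsub>F\<^esub> = \<one>\<^bsub>F\<^esub>" by (induction n) simp_all
    ultimately show False using fnb [of n] aF a(2) F.one_closed unfolding bij_betw_def inj_on_def by metis
  qed
  interpret orb: graph_map_orbit E tail gw gv "\<lambda>n. J ((f ^^ n) a)"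
  proof
    fix n
    show "\<exists>y. J ((f ^^ Suc n) a) = y + cls (ext gw (word_of (J ((f ^^ n) a)))) - y"
      using J_f [OF fn [OF aF, of n]] by auto
    show "J ((f ^^ n) a) \<noteq> 0" using J_zero [OF fn [OF aF]] f_inj by blast
  next
    show "\<exists>v. ep v (word_of (J ((f ^^ 0) a))) v" using J_closed aF by auto
  qed (rule no_pnp)
  \<comment> \<open>The nontrivial loop \<open>J a\<close> supplies an edge leaving
    \<open>v0\<close>; the lifts of this edge are the ones counted.\<close>
  have "word_of (J a) \<noteq> []" using J_zero [OF aF] a(2) by (metis cls_Nil cls_word_of)
  then obtain d w' where d: "word_of (J a) = d # w'" by (cases "word_of (J a)") auto
  then have dE: "fst d < E" "tail d = v0" using J_closed [OF aF] by auto
  obtain m where m: "m > 0" "\<And>q. q \<in> sym_on N \<Longrightarrow> nmul m q = 0"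
    using finite_group_exponent [OF finite_sym_on Q(1,2)] by blast
  have sQ: "s i \<in> sym_on N" for i unfolding s_def by (rule snQ)
  obtain M where M: "\<And>z b. card {ev s w | w. ep v0 w v0} \<le> card (crossed s z ((ext gw ^^ M) [(fst d, b)]))"
    using many_lifts_crossed [OF Q m finite_sym_on sQ np(1) inv dE(1)] dE(2) by auto
  \<comment> \<open>Since \<open>f ^^ n\<close> is bijective, every element of the quotient occurs
    up to the fixed conjugation as the weight of a loop at \<open>v0\<close>. So there are more than
    \<open>C\<close> such weights.\<close>
  have im: "\<rho> ` carrier F = (\<lambda>q. - e + q + e) ` (\<lambda>w. ev s (word_of (J w))) ` carrier F"
  proof -
    have "\<rho> ` carrier F = \<rho> ` (f ^^ n) ` carrier F" using fnb by (metis bij_betw_imp_surj_on)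
    also have "\<dots> = (\<lambda>q. - e + q + e) ` (\<lambda>w. ev s (word_of (J w))) ` carrier F"
      unfolding image_image
      by (rule image_cong [OF HOL.refl])
        (simp add: sJ add.assoc diff_conv_add_uminus del: add_uminus_conv_diff)
    finally show ?thesis .
  qed
  have fJ: "(\<lambda>w. ev s (word_of (J w))) ` carrier F \<subseteq> {ev s w | w. ep v0 w v0}"
    using J_closed by blast
  have fin: "finite {ev s w | w. ep v0 w v0}"
    by (rule finite_subset [OF _ finite_sym_on [of N]]) (use evQ sQ in auto)
  have "card (\<rho> ` carrier F) \<le> card ((\<lambda>w. ev s (word_of (J w))) ` carrier F)"
    unfolding im by (rule card_image_le) (rule finite_subset [OF fJ fin])
  also have "\<dots> \<le> card {ev s w | w. ep v0 w v0}"
    by (rule card_mono [OF fin fJ])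
  finally have "card (\<rho> ` carrier F) \<le> card {ev s w | w. ep v0 w v0}" .
  then have big: "C < card (crossed s z ((ext gw ^^ M) [(fst d, b)]))" for z b
    using many M [of z b] by linarith
  obtain n0 where "\<forall>n\<ge>n0. \<forall>i<E. \<forall>j<E. i \<in> fst ` set ((ext gw ^^ n) [(j, True)])" using pf by blast
  then obtain k u cc X b' Y where cc: "J ((f ^^ k) a) = u + cls cc - u" "reduced_word (cc @ cc)"
      "cc = X @ (ext gw ^^ M) [(fst d, b')] @ Y"
    using orb.circuit_contains_iterate [of n0 "fst d" M] dE(1) by blast
  obtain g a' where ga: "g \<in> carrier F" "a' \<in> A" "(f ^^ k) a = g \<otimes>\<^bsub>F\<^esub> a' \<otimes>\<^bsub>F\<^esub> inv\<^bsub>F\<^esub> g"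
    using fnA [OF a(1)] by blast
  then have "J ((f ^^ k) a) = J g + J a' - J g" using Ac J_inv by (simp add: J_mult)
  then have Ja': "J a' = (- J g + u) + cls cc - (- J g + u)"
    using cc(1) by (simp add: add.assoc diff_conv_add_uminus minus_add del: add_uminus_conv_diff) (metis add.assoc minus_add_cancel add_minus_cancel add.right_neutral left_minus right_minus)
  have "length ((ext gw ^^ M) [(fst d, b')]) \<ge> length [(fst d, b')]" by (rule ext_pow_length) (use dE in auto)
  then have "cc \<noteq> []" unfolding cc(3) by auto
  \<comment> \<open>\<open>J a'\<close> is only conjugate to the circuit, but a high power of it
    contains the cyclically reduced circuit literally, and this power still comes from an element of
    \<open>A\<close>.\<close>
  then obtain j x1 y1 where x1: "word_of (nmul j (J a')) = x1 @ cc @ y1"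
    using conjugate_power_contains [OF Ja' cc(2)] by blast
  have "\<exists>a''\<in>A. J a'' = nmul j (J a')" for j
  proof (induction j)
    case 0
    show ?case using subgroup.one_closed [OF subA] J_inv F.one_closed by (intro bexI [of _ "\<one>\<^bsub>F\<^esub>"]) auto
  next
    case (Suc j)
    then obtain a'' where "a'' \<in> A" "J a'' = nmul j (J a')" by blast
    then show ?case using ga(2) subgroup.m_closed [OF subA] J_mult Ac
      by (intro bexI [of _ "a' \<otimes>\<^bsub>F\<^esub> a''"]) auto
  qed
  then obtain a'' where a'': "a'' \<in> A" "J a'' = nmul j (J a')" by blast
  have wa: "word_of (J a'') = (x1 @ X) @ (ext gw ^^ M) [(fst d, b')] @ (Y @ y1)"
    unfolding a''(2) x1 cc(3) by simp
  have "card (crossed s (0 + ev s (x1 @ X)) ((ext gw ^^ M) [(fst d, b')])) \<le> card (crossed s 0 (word_of (J a'')))"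
    unfolding wa crossed_append by (rule card_mono) auto
  also have "\<dots> \<le> C"
  proof -
    define t where "t i = J (pA [(i, True)])" for i
    have pAm: "J (pA (u \<otimes>\<^bsub>F\<^esub> v)) = J (pA u) + J (pA v)" if "u \<in> carrier F" "v \<in> carrier F" for u v
    proof -
      have "pA u \<in> carrier F" "pA v \<in> carrier F" using pA(1) that by (auto simp: hom_def)
      then show ?thesis using pA(1) that by (simp add: hom_mult J_mult)
    qed
    have "J a'' = J (pA a'')" using pA(3) a''(1) by simp
    also have "\<dots> = ev t a''" unfolding t_def using conv [of "\<lambda>w. J (pA w)", OF pAm] a''(1) Ac(1) by simp
    finally have Jt: "J a'' = ev t a''" .
    \<comment> \<open>\<open>f ^^ n\<close> takes elements of \<open>A\<close> to conjugates of
      elements of \<open>A\<close>, and these are killed by \<open>\<rho>\<close>.\<close>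
    have "ev s (word_of (t i)) = 0" if "i < r" for i
    proof -
      have pi: "pA [(i, True)] \<in> A" using pA(2) gen [OF that] by blast
      obtain g a1 where "g \<in> carrier F" "a1 \<in> A" "(f ^^ n) (pA [(i, True)]) = g \<otimes>\<^bsub>F\<^esub> a1 \<otimes>\<^bsub>F\<^esub> inv\<^bsub>F\<^esub> g"
        using fnA [OF pi] by blast
      then have "\<rho> ((f ^^ n) (pA [(i, True)])) = 0" using Ac by (simp add: \<rho>_mult \<rho>_inv \<rho>A)
      then show ?thesis unfolding t_def using sJ [OF Ac(1) [OF pi]] by simp
    qed
    then have "crossed s 0 (word_of (J a'')) \<subseteq> (\<Union>i<r. crossed s 0 (word_of (t i)))"
      unfolding Jt by (rule crossed_word_of_ev) (use letters Ac(1) a''(1) in auto)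
    then have "card (crossed s 0 (word_of (J a''))) \<le> card (\<Union>i<r. crossed s 0 (word_of (t i)))"
      by (intro card_mono) auto
    also have "\<dots> \<le> (\<Sum>i<r. card (crossed s 0 (word_of (t i))))" by (rule card_UN_le) simp
    also have "\<dots> \<le> C" unfolding C_def t_def by (intro sum_mono card_crossed)
    finally show ?thesis .
  qed
  finally show False using big by (meson not_le)
qed

end

section \<open>Words of paths in a finite graph\<close>

lemma add_eq_self_zero_fg: "a + a = a \<Longrightarrow> a = (0 :: 'h :: group_add)"
  using add_left_cancel [of a a 0] by simp

locale fin_graph =
  fixes G :: "'a::t2_space fgraph"
  assumes fin: "finite_graph G"
begin

abbreviation "S \<equiv> graph_space G"
abbreviation "n \<equiv> nedges G"

lemma finite_verts: "finite (verts G)"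
  using fin by (auto simp: finite_graph_def)

lemma edge_cont: "i < n \<Longrightarrow> continuous_on {0..1} (edge G i)"
  using fin by (auto simp: finite_graph_def path_def)

lemma edge_ends: "i < n \<Longrightarrow> edge G i 0 \<in> verts G" "i < n \<Longrightarrow> edge G i 1 \<in> verts G"
  using fin by (auto simp: finite_graph_def pathstart_def pathfinish_def)

lemma edge_interior: "i < n \<Longrightarrow> 0 < t \<Longrightarrow> t < 1 \<Longrightarrow> edge G i t \<notin> verts G"
proof -
  assume i: "i < n" and t: "0 < t" "t < 1"
  have "open_edge G i \<inter> verts G = {}" using fin i unfolding finite_graph_def by blast
  moreover have "edge G i t \<in> open_edge G i" unfolding open_edge_def using t by (intro imageI) simp
  ultimately show ?thesis by blast
qed

lemma edge_in_S: "i < n \<Longrightarrow> 0 \<le> t \<Longrightarrow> t \<le> 1 \<Longrightarrow> edge G i t \<in> S"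
  unfolding graph_space_def path_image_def by (intro UnI2 UN_I [of i] imageI) auto

lemma verts_S: "verts G \<subseteq> S"
  by (auto simp: graph_space_def)

lemma edge_eq:
  assumes "i < n" "j < n" "edge G i s = edge G j t" "0 < s" "s < 1" "0 \<le> t" "t \<le> 1"
  shows "i = j \<and> s = t"
proof -
  have "edge G j t \<notin> verts G" using edge_interior assms by metis
  then have "t \<noteq> 0" "t \<noteq> 1" using edge_ends assms(2) by auto
  then have t: "0 < t" "t < 1" using assms by auto
  have "open_edge G i \<inter> open_edge G j \<noteq> {}"
    using assms t unfolding open_edge_def by (metis IntI empty_iff greaterThanLessThan_iff imageI)
  then have "i = j" using fin assms(1,2) unfolding finite_graph_def by blast
  moreover have "inj_on (edge G i) {0<..<1}" using fin assms(1) by (auto simp: finite_graph_def)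
  ultimately show ?thesis using assms t by (auto dest: inj_onD)
qed

lemma S_cases:
  assumes "x \<in> S"
  obtains "x \<in> verts G" | i t where "i < n" "0 < t" "t < 1" "x = edge G i t"
proof (cases "x \<in> verts G")
  case False
  then obtain i t where "i < n" "0 \<le> t" "t \<le> 1" "x = edge G i t"
    using assms by (auto simp: graph_space_def path_image_def)
  moreover then have "t \<noteq> 0" "t \<noteq> 1" using False edge_ends by auto
  ultimately show ?thesis using that(2) [of i t] by auto
qed (use that in blast)

lemma closed_edge_part:
  assumes "i < n" "closed T" "T \<subseteq> {0..1}" shows "closed (edge G i ` T)"
proof -
  have "compact T"
    using closed_Int_compact [OF assms(2) compact_Icc, of 0 1] assms(3) by (simp add: Int_absorb2)
  then show ?thesis
    by (intro compact_imp_closed compact_continuous_image continuous_on_subset [OF edge_cont] assms)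
qed

definition region :: "'a set \<Rightarrow> real set \<Rightarrow> 'a set" where
  "region V T = S - (V \<union> (\<Union>i<n. edge G i ` T))"

lemma openin_region:
  assumes "V \<subseteq> verts G" "closed T" "T \<subseteq> {0..1}"
  shows "openin (top_of_set S) (region V T)"
proof -
  have "closed (\<Union>i<n. edge G i ` T)"
    by (intro closed_UN ballI closed_edge_part assms(2,3)) auto
  then have "closed (V \<union> (\<Union>i<n. edge G i ` T))"
    by (rule closed_Un [OF finite_imp_closed [OF finite_subset [OF assms(1) finite_verts]]])
  then show ?thesis unfolding region_def by (metis Diff_eq openin_open_Int open_Compl)
qed

text \<open>The closed edge through \<open>x\<close>, and the vertices together with the other
  closed edges, are two closed sets meeting only in vertices. A connected \<open>C\<close> without
  vertices lies in the first.\<close>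

lemma connected_in_edge:
  assumes C: "connected C" "C \<subseteq> S" "C \<inter> verts G = {}" and x: "x \<in> C"
  obtains i where "i < n" "C \<subseteq> edge G i ` {0<..<1}"
proof -
  obtain i t where i: "i < n" "x = edge G i t" "0 < t" "t < 1"
    using x C by (metis S_cases disjoint_iff subsetD)
  define A where "A = edge G i ` {0..1}"
  define B where "B = verts G \<union> (\<Union>j\<in>{..<n} - {i}. edge G j ` {0..1})"
  have "closed A" unfolding A_def using i closed_edge_part by simp
  moreover have "closed B" unfolding B_def
    by (rule closed_Un [OF finite_imp_closed [OF finite_verts]])
      (intro closed_UN ballI closed_edge_part, auto)
  moreover have "C \<subseteq> A \<union> B"
  proof
    fix y assume "y \<in> C"
    then have "y \<in> S" using C(2) by blast
    then show "y \<in> A \<union> B"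
    proof (cases rule: S_cases)
      case (2 j u)
      then have "y \<in> edge G j ` {0..1}" by auto
      then show ?thesis using 2(1) by (cases "j = i") (auto simp: A_def B_def)
    qed (simp add: B_def)
  qed
  moreover have "A \<inter> B \<inter> C = {}"
  proof -
    have False if y: "y \<in> C" "y \<in> A" "y \<in> B" for y
    proof -
      have "y \<notin> verts G" using y(1) C(3) by blast
      then have "y \<in> (\<Union>j\<in>{..<n} - {i}. edge G j ` {0..1})" using y(3) by (simp add: B_def)
      then obtain j where "j \<in> {..<n} - {i}" "y \<in> edge G j ` {0..1}" by blast
      then obtain u where j: "j < n" "j \<noteq> i" "y = edge G j u" "0 \<le> u" "u \<le> 1" by auto
      obtain s where s: "y = edge G i s" "0 \<le> s" "s \<le> 1" using y(2) by (auto simp: A_def)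
      then have "s \<noteq> 0" "s \<noteq> 1" using \<open>y \<notin> verts G\<close> edge_ends i(1) by auto
      then show False using edge_eq [of i j s u] i(1) j s by auto
    qed
    then show ?thesis by blast
  qed
  moreover have "x \<in> A" using i unfolding A_def by (simp only: i(2)) (intro imageI, simp)
  then have "A \<inter> C \<noteq> {}" using x by blast
  ultimately have "B \<inter> C = {}" using C(1) unfolding connected_closed by blast
  then have "C \<subseteq> A" using \<open>C \<subseteq> A \<union> B\<close> by blast
  have "C \<subseteq> edge G i ` {0<..<1}"
  proof
    fix y assume y: "y \<in> C"
    then obtain s where s: "y = edge G i s" "0 \<le> s" "s \<le> 1" using \<open>C \<subseteq> A\<close> by (auto simp: A_def)
    have "y \<notin> verts G" using y C(3) by blast
    then have "s \<noteq> 0" "s \<noteq> 1" using s edge_ends i(1) by auto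
    then show "y \<in> edge G i ` {0<..<1}" using s by auto
  qed
  then show ?thesis using that i(1) by blast
qed

text \<open>\<open>kap x y\<close> records the passage through the midpoint of an edge on the way between two nearby
  points. Points on the same edge whose parameters differ by at least \<open>1/2\<close> do not count as nearby inside
  the edge: in case of a loop they may be close to its base point.\<close>

definition up :: "'a \<Rightarrow> 'a \<Rightarrow> nat \<Rightarrow> bool" where
  "up x y i \<longleftrightarrow> i < n \<and> (\<exists>s t. 0 < s \<and> s < 1/2 \<and> 1/2 \<le> t \<and> t < 1 \<and> t - s < 1/2 \<and>
     x = edge G i s \<and> y = edge G i t)"

definition kap :: "'a \<Rightarrow> 'a \<Rightarrow> fg" where
  "kap x y = (if \<exists>i. up x y i then cls [(SOME i. up x y i, True)]
     else if \<exists>i. up y x i then - cls [(SOME i. up y x i, True)] else 0)"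

text \<open>A primitive of \<open>kap\<close> along one edge: it jumps by the generator at the
  midpoint.\<close>

definition side :: "nat \<Rightarrow> real \<Rightarrow> fg" where
  "side i t = (if t < 1/2 then 0 else cls [(i, True)])"

lemma up_edge:
  assumes "i < n" "0 < s" "s < 1" "0 < t" "t < 1"
  shows "up (edge G i s) (edge G i t) j \<longleftrightarrow> j = i \<and> s < 1/2 \<and> 1/2 \<le> t \<and> t - s < 1/2"
proof
  assume "up (edge G i s) (edge G i t) j"
  then obtain s' t' where "j < n" "0 < s'" "s' < 1/2" "1/2 \<le> t'" "t' < 1" "t' - s' < 1/2"
     "edge G i s = edge G j s'" "edge G i t = edge G j t'" by (auto simp: up_def)
  then show "j = i \<and> s < 1/2 \<and> 1/2 \<le> t \<and> t - s < 1/2"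
    using edge_eq [of i j s s'] edge_eq [of i j t t'] assms by auto
next
  assume "j = i \<and> s < 1/2 \<and> 1/2 \<le> t \<and> t - s < 1/2"
  then show "up (edge G i s) (edge G i t) j"
    unfolding up_def using assms by (intro conjI exI [of _ s] exI [of _ t]) auto
qed

lemma kap_edge:
  assumes "i < n" "0 < s" "s < 1" "0 < t" "t < 1" "\<bar>s - t\<bar> < 1/2"
  shows "kap (edge G i s) (edge G i t) = - side i s + side i t"
  using assms(6) unfolding kap_def up_edge [OF assms(1-5)] up_edge [OF assms(1,4,5,2,3)]
  by (auto simp: side_def)

lemma kap_0:
  assumes "\<And>i. \<not> up x y i" "\<And>i. \<not> up y x i" shows "kap x y = 0"
  using assms by (auto simp: kap_def)

text \<open>On such a set \<open>kap\<close> is a coboundary and hence additive along triples of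
  points. This local property makes products along paths independent of the subdivision.\<close>

definition flat :: "'a set \<Rightarrow> bool" where
  "flat C \<longleftrightarrow> (\<exists>\<sigma>. \<forall>x\<in>C. \<forall>y\<in>C. kap x y = - \<sigma> x + \<sigma> y)"

lemma flat_vertex_part:
  assumes "C \<subseteq> region {} {1/4..3/4}" shows "flat C"
proof -
  have no: "\<not> up x y i" if "x \<in> C" "y \<in> C" for x y i
  proof
    assume "up x y i"
    then obtain s t where st: "i < n" "0 < s" "s < 1/2" "1/2 \<le> t" "t < 1" "t - s < 1/2"
      "x = edge G i s" "y = edge G i t" by (auto simp: up_def)
    have "\<not> (1/4 \<le> u \<and> u \<le> 3/4)" if "edge G i u \<in> C" for u
    proof
      assume "1/4 \<le> u \<and> u \<le> 3/4"
      then have "edge G i u \<in> (\<Union>i<n. edge G i ` {1/4..3/4})" using st(1) by (intro UN_I [of i] imageI) auto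
      then show False using that assms by (auto simp: region_def)
    qed
    then have "\<not> (1/4 \<le> s \<and> s \<le> 3/4)" "\<not> (1/4 \<le> t \<and> t \<le> 3/4)" using that st(7,8) by blast+
    then show False using st by auto
  qed
  show ?thesis unfolding flat_def by (rule exI [of _ "\<lambda>_. 0"]) (use no kap_0 in auto)
qed

text \<open>In a window of width at most \<open>1/2\<close> any two parameters differ by less than
  \<open>1/2\<close>, so \<open>kap\<close> is the difference of values of
  \<open>side\<close>.\<close>

lemma flat_edge_part:
  assumes C: "connected C" "C \<subseteq> region (verts G) ({0..a} \<union> {b..1})"
    and ab: "0 \<le> a" "b \<le> 1" "b - a \<le> 1/2"
  shows "flat C"
proof (cases "C = {}")
  case True
  then show ?thesis by (simp add: flat_def)
next
  case False
  then obtain x where "x \<in> C" by blast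
  then obtain i where i: "i < n" "C \<subseteq> edge G i ` {0<..<1}"
    using connected_in_edge [of C x] C by (auto simp: region_def)
  have "\<exists>t. 0 < t \<and> t < 1 \<and> y = edge G i t" if "y \<in> C" for y
  proof -
    have "y \<in> edge G i ` {0<..<1}" using i(2) that by blast
    then show ?thesis by auto
  qed
  then obtain t where t: "\<And>y. y \<in> C \<Longrightarrow> 0 < t y \<and> t y < 1 \<and> y = edge G i (t y)" by metis
  have tab: "a < t y \<and> t y < b" if "y \<in> C" for y
  proof -
    have "t y \<notin> {0..a} \<union> {b..1}" using C(2) that t [OF that] i(1) unfolding region_def by blast
    then show ?thesis using t [OF that] by auto
  qed
  have "kap x y = - side i (t x) + side i (t y)" if "x \<in> C" "y \<in> C" for x y
  proof -
    have "\<bar>t x - t y\<bar> < 1/2"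
      using tab [OF that(1)] tab [OF that(2)] ab unfolding abs_less_iff by linarith
    then show ?thesis using kap_edge [OF i(1), of "t x" "t y"] t [OF that(1)] t [OF that(2)] by metis
  qed
  then show ?thesis unfolding flat_def by (intro exI [of _ "\<lambda>y. side i (t y)"]) simp
qed

lemma flat_uniform:
  fixes f :: "'b::real_normed_vector \<Rightarrow> 'a"
  assumes K: "compact K" "convex K" and f: "continuous_on K f" "f ` K \<subseteq> S"
  shows "\<exists>\<delta>>0. \<forall>x\<in>K. flat (f ` (K \<inter> ball x \<delta>))"
proof (cases "K = {}")
  case True then show ?thesis by (intro exI [of _ 1]) auto
next
  case False
  \<comment> \<open>A cover of the graph: the part outside the middle halves of all edges, and
    inside the edges the two windows from \<open>1/8\<close> to \<open>5/8\<close> and from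
    \<open>3/8\<close> to \<open>7/8\<close>, whose width \<open>1/2\<close> is the most that
    \<open>flat_edge_part\<close> admits.\<close>
  define R where "R = {region {} {1/4..3/4}, region (verts G) ({0..1/8} \<union> {5/8..1}),
     region (verts G) ({0..3/8} \<union> {7/8..1})}"
  have "openin (top_of_set K) (K \<inter> f -` U)" if "U \<in> R" for U
  proof -
    have "openin (top_of_set S) U"
      using that unfolding R_def by (auto intro!: openin_region closed_Un)
    then show ?thesis using continuous_openin_preimage [OF f(1)] f(2) by blast
  qed
  then have "\<forall>U\<in>R. \<exists>T. open T \<and> K \<inter> f -` U = K \<inter> T" by (auto simp: openin_open)
  then obtain T where T: "\<And>U. U \<in> R \<Longrightarrow> open (T U) \<and> K \<inter> f -` U = K \<inter> T U" by metis
  have "K \<subseteq> \<Union>(T ` R)"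
  proof
    fix x assume x: "x \<in> K"
    then have "f x \<in> S" using f(2) by blast
    then have "\<exists>U\<in>R. f x \<in> U"
    proof (cases rule: S_cases)
      case 1
      have "f x \<noteq> edge G i u" if "i < n" "u \<in> {1/4..3/4}" for i u
        using edge_interior [OF that(1), of u] that(2) 1 by auto
      then have "f x \<in> region {} {1/4..3/4}"
        using \<open>f x \<in> S\<close> unfolding region_def by blast
      then show ?thesis by (auto simp: R_def)
    next
      case (2 i t)
      have reg: "f x \<in> region V X" if V: "V \<subseteq> verts G" and X: "X \<subseteq> {0..1}" and tX: "t \<notin> X" for V X
      proof -
        have "f x \<noteq> edge G j u" if "j < n" "u \<in> X" for j u
        proof
          assume "f x = edge G j u"
          then have "edge G i t = edge G j u" using 2(4) by simp
          moreover have "0 \<le> u" "u \<le> 1" using that(2) X by auto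
          ultimately have "t = u" using edge_eq [of i j t u] 2 that(1) by simp
          then show False using that(2) tX by simp
        qed
        moreover have "f x \<notin> V" using edge_interior [OF 2(1-3)] 2(4) V by auto
        ultimately show ?thesis using \<open>f x \<in> S\<close> unfolding region_def by blast
      qed
      consider "t < 1/4 \<or> t > 3/4" | "1/4 \<le> t" "t \<le> 1/2" | "1/2 \<le> t" "t \<le> 3/4" by linarith
      then show ?thesis
      proof cases
        case 1 then show ?thesis using reg [of "{}" "{1/4..3/4}"] by (auto simp: R_def)
      next
        case 2 then show ?thesis using reg [of "verts G" "{0..1/8} \<union> {5/8..1}"] by (auto simp: R_def)
      next
        case 3 then show ?thesis using reg [of "verts G" "{0..3/8} \<union> {7/8..1}"] by (auto simp: R_def)
      qed
    qed
    then show "x \<in> \<Union>(T ` R)" using T x by blast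
  qed
  moreover have "open B" if "B \<in> T ` R" for B using that T by blast
  ultimately obtain \<delta> where \<delta>: "\<delta> > 0" "\<And>x. x \<in> K \<Longrightarrow> \<exists>B\<in>T ` R. ball x \<delta> \<subseteq> B"
    using Heine_Borel_lemma [OF K(1)] by blast
  have "flat (f ` (K \<inter> ball x \<delta>))" if x: "x \<in> K" for x
  proof -
    obtain U where U: "U \<in> R" "ball x \<delta> \<subseteq> T U" using \<delta>(2) [OF x] by auto
    then have sub: "f ` (K \<inter> ball x \<delta>) \<subseteq> U" using T [OF U(1)] by blast
    have "connected (f ` (K \<inter> ball x \<delta>))"
      by (intro connected_continuous_image convex_connected convex_Int K(2) convex_ball
          continuous_on_subset [OF f(1)]) auto
    note con = this
    consider "U = region {} {1/4..3/4}" | "U = region (verts G) ({0..1/8} \<union> {5/8..1})"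
      | "U = region (verts G) ({0..3/8} \<union> {7/8..1})" using U(1) unfolding R_def by blast
    then show ?thesis
    proof cases
      case 1 then show ?thesis using flat_vertex_part sub by simp
    next
      case 2 then show ?thesis using flat_edge_part [OF con, of "1/8" "5/8"] sub by simp
    next
      case 3 then show ?thesis using flat_edge_part [OF con, of "3/8" "7/8"] sub by simp
    qed
  qed
  then show ?thesis using \<delta>(1) by blast
qed

text \<open>A developing map: a primitive, valid at a uniform scale, of the cocycle
  \<open>kap\<close> pulled back along \<open>f\<close>.\<close>

definition is_dev :: "('b::real_normed_vector \<Rightarrow> 'a) \<Rightarrow> 'b set \<Rightarrow> ('b \<Rightarrow> fg) \<Rightarrow> bool" where
  "is_dev f K F \<longleftrightarrow> (\<exists>\<delta>>0. \<forall>x\<in>K. \<forall>y\<in>K. dist x y < \<delta> \<longrightarrow> F y = F x + kap (f x) (f y))"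

text \<open>The value at \<open>x\<close> is the product along a fine subdivision of the segment from a base point to \<open>x\<close>;
  nearby segments give compatible products by the cocycle identity on small sets.\<close>

lemma dev_exists:
  fixes f :: "'b::real_normed_vector \<Rightarrow> 'a"
  assumes K: "compact K" "convex K" and f: "continuous_on K f" "f ` K \<subseteq> S"
  shows "\<exists>F. is_dev f K F"
proof (cases "K = {}")
  case True then show ?thesis unfolding is_dev_def by (intro exI [of _ "\<lambda>_. 0"] exI [of _ 1]) simp
next
  case False
  then obtain a where a: "a \<in> K" by blast
  obtain \<delta> where \<delta>: "\<delta> > 0" "\<And>x. x \<in> K \<Longrightarrow> flat (f ` (K \<inter> ball x \<delta>))"
    using flat_uniform [OF assms] by blast
  have coc: "kap (f x) (f y) + kap (f y) (f z) = kap (f x) (f z)"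
    if "x \<in> K" "y \<in> K" "z \<in> K" "dist x y < \<delta>" "dist x z < \<delta>" for x y z
  proof -
    note flat = \<delta>(2) [OF that(1)]
    obtain \<sigma> where \<sigma>: "\<And>u v. u \<in> f ` (K \<inter> ball x \<delta>) \<Longrightarrow> v \<in> f ` (K \<inter> ball x \<delta>) \<Longrightarrow> kap u v = - \<sigma> u + \<sigma> v"
      using flat unfolding flat_def by blast
    have "f x \<in> f ` (K \<inter> ball x \<delta>)" "f y \<in> f ` (K \<inter> ball x \<delta>)" "f z \<in> f ` (K \<inter> ball x \<delta>)"
      using that \<delta>(1) by auto
    note e = \<sigma> [OF this(1,2)] \<sigma> [OF this(2,3)] \<sigma> [OF this(1,3)]
    show ?thesis unfolding e by (simp add: add.assoc)
  qed
  have kxx: "kap (f x) (f x) = 0" if "x \<in> K" for x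
  proof (rule add_eq_self_zero_fg)
    show "kap (f x) (f x) + kap (f x) (f x) = kap (f x) (f x)" using coc [of x x x] that \<delta>(1) by simp
  qed
  obtain B where B: "\<And>x. x \<in> K \<Longrightarrow> norm (x - a) \<le> B"
    using bounded_any_center [of K a] compact_imp_bounded [OF K(1)] by (auto simp: dist_norm norm_minus_commute)
  \<comment> \<open>Steps shorter than a quarter of \<open>\<delta>\<close> leave room for the
    triangle inequality when neighbouring segments are compared.\<close>
  obtain N where N: "of_nat N > 4 * (\<bar>B\<bar> + 1) / \<delta>" using reals_Archimedean2 by blast
  then have N0: "N > 0" using \<delta>(1) by (cases N) (auto simp: divide_less_0_iff)
  define pt where "pt x i = a + (of_nat i / of_nat N) *\<^sub>R (x - a)" for x and i :: nat
  have ptK: "pt x i \<in> K" if "x \<in> K" "i \<le> N" for x i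
  proof -
    have "(1 - of_nat i / of_nat N) *\<^sub>R a + (of_nat i / of_nat N) *\<^sub>R x \<in> K"
      by (rule convexD_alt [OF K(2) a that(1)]) (use that N0 in auto)
    then show ?thesis by (simp add: pt_def algebra_simps)
  qed
  have d1: "dist (pt x i) (pt x (Suc i)) < \<delta> / 4" if "x \<in> K" for x i
  proof -
    have "pt x (Suc i) = pt x i + (1 / of_nat N) *\<^sub>R (x - a)"
      by (simp add: pt_def add_divide_distrib scaleR_left_distrib)
    then have "dist (pt x i) (pt x (Suc i)) = norm (x - a) / of_nat N" by (simp add: dist_norm)
    also have "\<dots> \<le> (\<bar>B\<bar> + 1) / of_nat N" using B [OF that] N0 by (intro divide_right_mono) auto
    also have "\<dots> < \<delta> / 4" using N \<delta>(1) N0 by (simp add: field_simps)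
    finally show ?thesis .
  qed
  have d2: "dist (pt x i) (pt y i) \<le> dist x y" if "i \<le> N" for x y i
  proof -
    have "pt x i - pt y i = (of_nat i / of_nat N) *\<^sub>R (x - y)" by (simp add: pt_def algebra_simps)
    then have "dist (pt x i) (pt y i) = (of_nat i / of_nat N) * dist x y" by (simp add: dist_norm)
    also have "\<dots> \<le> 1 * dist x y" using that N0 by (intro mult_right_mono) auto
    finally show ?thesis by simp
  qed
  define P where "P x i = sum_list (map (\<lambda>j. kap (f (pt x j)) (f (pt x (Suc j)))) [0..<i])" for x i
  have "P y i = P x i + kap (f (pt x i)) (f (pt y i))"
    if "x \<in> K" "y \<in> K" "dist x y < \<delta> / 4" "i \<le> N" for x y i
    using that(4)
  proof (induction i)
    case 0
    have "pt x 0 = a" "pt y 0 = a" by (simp_all add: pt_def)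
    then show ?case using kxx a by (simp add: P_def)
  next
    case (Suc i)
    let ?x = "pt x i" and ?y = "pt y i" and ?x' = "pt x (Suc i)" and ?y' = "pt y (Suc i)"
    have K: "?x \<in> K" "?y \<in> K" "?x' \<in> K" "?y' \<in> K" using ptK that Suc by auto
    have xy: "dist ?x ?y < \<delta> / 4" "dist ?x' ?y' < \<delta> / 4"
      using le_less_trans [OF d2 that(3)] Suc.prems by simp_all
    have xx: "dist ?x ?x' < \<delta> / 4" using d1 that by blast
    have xy': "dist ?x ?y' < \<delta>"
      using xx xy(2) dist_triangle [of ?x ?y' ?x'] \<delta>(1) by linarith
    have "P y (Suc i) = P x i + (kap (f ?x) (f ?y) + kap (f ?y) (f ?y'))"
      using Suc by (simp add: P_def add.assoc)
    also have "kap (f ?x) (f ?y) + kap (f ?y) (f ?y') = kap (f ?x) (f ?y')"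
      by (rule coc) (use K xy xy' \<delta>(1) in auto)
    also have "\<dots> = kap (f ?x) (f ?x') + kap (f ?x') (f ?y')"
      by (rule coc [symmetric]) (use K xx xy' \<delta>(1) in auto)
    finally show ?case by (simp add: P_def add.assoc)
  qed
  moreover have "pt x N = x" for x using N0 by (simp add: pt_def)
  ultimately have step: "P y N = P x N + kap (f x) (f y)" if "x \<in> K" "y \<in> K" "dist x y < \<delta> / 4" for x y
    using that by simp
  have "is_dev f K (\<lambda>x. P x N)"
    unfolding is_dev_def
    by (intro exI [of _ "\<delta> / 4"] conjI ballI impI step) (use \<delta>(1) in simp_all)
  then show ?thesis by blast
qed

text \<open>Increments are added on the right, so \<open>F' - F\<close> is locally constant on the
  connected set \<open>K\<close>.\<close>

lemma dev_unique:
  assumes "is_dev f K F" "is_dev f K F'" "connected K" "x \<in> K" "y \<in> K"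
  shows "- F x + F y = - F' x + F' y"
proof -
  obtain d where d: "d > 0" "\<And>x y. x \<in> K \<Longrightarrow> y \<in> K \<Longrightarrow> dist x y < d \<Longrightarrow> F y = F x + kap (f x) (f y)"
    using assms(1) by (auto simp: is_dev_def)
  obtain d' where d': "d' > 0" "\<And>x y. x \<in> K \<Longrightarrow> y \<in> K \<Longrightarrow> dist x y < d' \<Longrightarrow> F' y = F' x + kap (f x) (f y)"
    using assms(2) by (auto simp: is_dev_def)
  have "F' x - F x = F' y - F y"
  proof (rule connected_local_const [OF assms(3-5)], intro ballI)
    fix u assume u: "u \<in> K"
    show "\<forall>\<^sub>F v in at u within K. F' u - F u = F' v - F v"
      unfolding eventually_at
    proof (intro exI conjI ballI impI)
      show "min d d' > 0" using d d' by simp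
      fix v assume v: "v \<in> K" "v \<noteq> u \<and> dist v u < min d d'"
      have "F v = F u + kap (f u) (f v)" using d(2) [OF u v(1)] v(2) by (simp add: dist_commute)
      moreover have "F' v = F' u + kap (f u) (f v)" using d'(2) [OF u v(1)] v(2) by (simp add: dist_commute)
      ultimately show "F' u - F u = F' v - F v" by (simp add: diff_conv_add_uminus minus_add add.assoc del: add_uminus_conv_diff)
    qed
  qed
  then have "F' y = (F' x - F x) + F y" by simp
  then show ?thesis by (simp add: diff_conv_add_uminus add.assoc del: add_uminus_conv_diff)
qed

end

section \<open>The free group element spelled by a path\<close>

context fin_graph
begin

definition good_on :: "(real \<Rightarrow> 'a) \<Rightarrow> real \<Rightarrow> real \<Rightarrow> bool" where
  "good_on p a b \<longleftrightarrow> continuous_on {a..b} p \<and> p ` {a..b} \<subseteq> S"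

text \<open>Only passages through midpoints of edges contribute, so the end points need not be
  vertices. The choice is immaterial by \<open>dev_unique\<close>.\<close>

definition V :: "(real \<Rightarrow> 'a) \<Rightarrow> real \<Rightarrow> real \<Rightarrow> fg" where
  "V p a b = (SOME v. \<exists>F. is_dev p {a..b} F \<and> v = - F a + F b)"

lemma is_dev_subset: "is_dev f K F \<Longrightarrow> L \<subseteq> K \<Longrightarrow> is_dev f L F"
  unfolding is_dev_def by blast

lemma good_on_subset: "good_on p a b \<Longrightarrow> a \<le> c \<Longrightarrow> d \<le> b \<Longrightarrow> good_on p c d"
  unfolding good_on_def
  by (intro conjI continuous_on_subset [of "{a..b}" p "{c..d}"]) (force intro: image_mono)+

lemma good_on_dev: "good_on p a b \<Longrightarrow> \<exists>F. is_dev p {a..b} F"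
  unfolding good_on_def by (intro dev_exists) (auto simp: convex_real_interval)

lemma V_dev:
  assumes "is_dev p {a..b} F" "a \<le> b" shows "V p a b = - F a + F b"
proof -
  have "\<exists>F. is_dev p {a..b} F \<and> V p a b = - F a + F b"
    unfolding V_def by (rule someI) (use assms in blast)
  then obtain F' where "is_dev p {a..b} F'" "V p a b = - F' a + F' b" by blast
  then show ?thesis using dev_unique [of p "{a..b}" F' F a b] assms by simp
qed

lemma V_add:
  assumes "good_on p a c" "a \<le> b" "b \<le> c" shows "V p a c = V p a b + V p b c"
proof -
  obtain F where F: "is_dev p {a..c} F" using good_on_dev assms(1) by blast
  have "is_dev p {a..b} F" "is_dev p {b..c} F" using assms by (auto intro: is_dev_subset [OF F])
  then show ?thesis using V_dev F assms by (simp add: add.assoc)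
qed

lemma kap_refl [simp]: "kap x x = 0"
proof (rule kap_0)
  show "\<not> up x x i" for i
  proof
    assume "up x x i"
    then obtain s t where "i < n" "0 < s" "s < 1/2" "1/2 \<le> t" "t < 1" "edge G i s = edge G i t"
      by (auto simp: up_def)
    then show False using edge_eq [of i i s t] by simp
  qed
  then show "\<not> up x x i" for i .
qed

lemma V_const:
  assumes "a \<le> b" "\<And>t. t \<in> {a..b} \<Longrightarrow> p t = x" shows "V p a b = 0"
proof -
  have "is_dev p {a..b} (\<lambda>_. 0)"
    unfolding is_dev_def by (intro exI [of _ 1]) (simp add: assms(2))
  then show ?thesis using V_dev assms(1) by force
qed

lemma dev_compose:
  fixes h :: "'b::real_normed_vector \<Rightarrow> 'c::real_normed_vector"
  assumes F: "is_dev p K F" and h: "continuous_on L h" "h ` L \<subseteq> K" and L: "compact L"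
    and eq: "\<And>x. x \<in> L \<Longrightarrow> f x = p (h x)"
  shows "is_dev f L (F \<circ> h)"
proof -
  obtain \<delta> where \<delta>: "\<delta> > 0" "\<And>x y. x \<in> K \<Longrightarrow> y \<in> K \<Longrightarrow> dist x y < \<delta> \<Longrightarrow> F y = F x + kap (p x) (p y)"
    using F by (auto simp: is_dev_def)
  obtain d where d: "d > 0" "\<And>x y. x \<in> L \<Longrightarrow> y \<in> L \<Longrightarrow> dist y x < d \<Longrightarrow> dist (h y) (h x) < \<delta>"
    using compact_uniformly_continuous [OF h(1) L] \<delta>(1) unfolding uniformly_continuous_on_def by metis
  show ?thesis unfolding is_dev_def
  proof (intro exI conjI ballI impI)
    fix x y assume xy: "x \<in> L" "y \<in> L" "dist x y < d"
    have "F (h y) = F (h x) + kap (p (h x)) (p (h y))"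
      by (rule \<delta>(2)) (use xy h(2) d(2) [OF xy(2,1,3)] in auto)
    then show "(F \<circ> h) y = (F \<circ> h) x + kap (f x) (f y)" using eq xy by simp
  qed (rule d(1))
qed

text \<open>Here \<open>h\<close> need not be monotone: a primitive composed with \<open>h\<close>
  is again a primitive, and only its values at the ends matter.\<close>

lemma V_reparam:
  assumes p: "good_on p a b" and h: "continuous_on {c..d} h" "h ` {c..d} \<subseteq> {a..b}" "c \<le> d" "h c \<le> h d"
    and eq: "\<And>x. x \<in> {c..d} \<Longrightarrow> f x = p (h x)"
  shows "V f c d = V p (h c) (h d)"
proof -
  obtain F where F: "is_dev p {a..b} F" using good_on_dev p by blast
  have "is_dev f {c..d} (F \<circ> h)" using dev_compose [OF F h(1,2) _ eq] by simp
  then have 1: "V f c d = - F (h c) + F (h d)" using V_dev h(3) by force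
  have "h c \<in> {a..b}" "h d \<in> {a..b}" using h(2,3) by (auto simp: image_subset_iff)
  then have "{h c..h d} \<subseteq> {a..b}" by auto
  then show ?thesis using 1 V_dev [OF is_dev_subset [OF F] h(4)] by simp
qed

lemma V_reparam_rev:
  assumes p: "good_on p a b" and h: "continuous_on {c..d} h" "h ` {c..d} \<subseteq> {a..b}" "c \<le> d" "h d \<le> h c"
    and eq: "\<And>x. x \<in> {c..d} \<Longrightarrow> f x = p (h x)"
  shows "V f c d = - V p (h d) (h c)"
proof -
  obtain F where F: "is_dev p {a..b} F" using good_on_dev p by blast
  have "is_dev f {c..d} (F \<circ> h)" using dev_compose [OF F h(1,2) _ eq] by simp
  then have 1: "V f c d = - F (h c) + F (h d)" using V_dev h(3) by force
  have "h c \<in> {a..b}" "h d \<in> {a..b}" using h(2,3) by (auto simp: image_subset_iff)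
  then have "{h d..h c} \<subseteq> {a..b}" by auto
  then show ?thesis using 1 V_dev [OF is_dev_subset [OF F] h(4)] by (simp add: minus_add)
qed

lemma V_cong: "(\<And>x. a \<le> x \<Longrightarrow> x \<le> b \<Longrightarrow> f x = p x) \<Longrightarrow> good_on p a b \<Longrightarrow> a \<le> b \<Longrightarrow> V f a b = V p a b"
  by (rule V_reparam [where h = "\<lambda>x. x" and a = a and b = b]) auto

abbreviation "W p \<equiv> V p 0 1"
abbreviation "gpath p \<equiv> path p \<and> path_image p \<subseteq> S"

lemma gpath_good: "gpath p \<Longrightarrow> good_on p 0 1"
  by (simp add: good_on_def path_def path_image_def)

lemma W_join:
  assumes "gpath p" "gpath q" "pathfinish p = pathstart q"
  shows "W (p +++ q) = W p + W q"
proof -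
  have g: "good_on (p +++ q) 0 1"
    using assms by (intro gpath_good conjI path_join_imp subset_path_image_join) auto
  have "W (p +++ q) = V (p +++ q) 0 (1/2) + V (p +++ q) (1/2) 1" by (rule V_add [OF g]) auto
  also have "V (p +++ q) 0 (1/2) = V p (2 * 0) (2 * (1/2))"
    by (rule V_reparam [OF gpath_good [OF assms(1)]]) (auto intro!: continuous_intros simp: joinpaths_def)
  also have "V (p +++ q) (1/2) 1 = V q (2 * (1/2) - 1) (2 * 1 - 1)"
  proof (rule V_reparam [OF gpath_good [OF assms(2)]])
    fix x :: real assume "x \<in> {1/2..1}"
    then show "(p +++ q) x = q (2 * x - 1)"
    proof (cases "x = 1/2")
      case True
      show ?thesis unfolding True using assms(3) by (simp add: joinpaths_def pathstart_def pathfinish_def)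
    qed (auto simp: joinpaths_def)
  qed (auto intro!: continuous_intros)
  finally show ?thesis by simp
qed

lemma W_reversepath: "gpath p \<Longrightarrow> W (reversepath p) = - W p"
  using V_reparam_rev [OF gpath_good, of p 0 1 "\<lambda>x. 1 - x" "reversepath p"]
    continuous_on_diff [OF continuous_on_const continuous_on_id, of "{0..1}" "1 :: real"]
  by (auto simp: reversepath_def)

lemma gpath_edge: "i < n \<Longrightarrow> gpath (edge G i)"
  using edge_cont edge_in_S by (auto simp: path_def path_image_def)

lemma gpath_oriented: "fst d < n \<Longrightarrow> gpath (oriented_edge G d)"
  using gpath_edge by (simp add: oriented_edge_def)

text \<open>\<open>side\<close> is a primitive along the whole closed edge: \<open>kap\<close>
  vanishes at vertices, and a parameter closer than \<open>1/2\<close> to an end lies on the same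
  side of the midpoint as that end.\<close>

lemma W_edge: "i < n \<Longrightarrow> W (edge G i) = cls [(i, True)]"
proof -
  assume i: "i < n"
  define F where "F t = side i t" for t :: real
  have k: "kap (edge G i s) (edge G i t) = - F s + F t" if st: "s \<in> {0..1}" "t \<in> {0..1}" "\<bar>s - t\<bar> < 1/2" for s t
  proof (cases "0 < s \<and> s < 1 \<and> 0 < t \<and> t < 1")
    case True
    then show ?thesis unfolding F_def using kap_edge [OF i] st(3) by blast
  next
    case False
    have e: "edge G i u \<in> verts G" if "\<not> (0 < u \<and> u < 1)" "u \<in> {0..1}" for u
    proof -
      have "u = 0 \<or> u = 1" using that by (simp add: not_less) linarith
      then show ?thesis using edge_ends [OF i] by auto
    qed
    have "edge G i s \<in> verts G \<or> edge G i t \<in> verts G"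
    proof (cases "0 < s \<and> s < 1")
      case True then show ?thesis using e [of t] False st by blast
    next
      case False then show ?thesis using e [of s] st by blast
    qed
    note vert = this
    have nv: "x \<notin> verts G \<and> y \<notin> verts G" if up: "up x y j" for x y j
    proof -
      obtain s t where "j < n" "0 < s" "s < 1/2" "1/2 \<le> t" "t < 1" "x = edge G j s" "y = edge G j t"
        using up by (auto simp: up_def)
      then show ?thesis using edge_interior [of j s] edge_interior [of j t] by simp
    qed
    have "\<not> up (edge G i s) (edge G i t) j" "\<not> up (edge G i t) (edge G i s) j" for j
      using nv [of "edge G i s" "edge G i t" j] nv [of "edge G i t" "edge G i s" j] vert by blast+
    then have "kap (edge G i s) (edge G i t) = 0" by (rule kap_0)
    moreover have "F s = F t"
    proof (cases "s < 1/2")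
      case True
      then have "t < 1/2" using False st unfolding abs_less_iff by simp linarith
      then show ?thesis using True by (simp add: F_def side_def)
    next
      case False2: False
      then have "\<not> t < 1/2" using False st unfolding abs_less_iff by simp linarith
      then show ?thesis using False2 by (simp add: F_def side_def)
    qed
    ultimately show ?thesis by simp
  qed
  have "is_dev (edge G i) {0..1} F"
    unfolding is_dev_def
  proof (intro exI [of _ "1/2"] conjI ballI impI)
    fix s t :: real assume "s \<in> {0..1}" "t \<in> {0..1}" "dist s t < 1/2"
    then have "kap (edge G i s) (edge G i t) = - F s + F t" by (intro k) (simp_all add: dist_real_def)
    then show "F t = F s + kap (edge G i s) (edge G i t)" by simp
  qed simp
  then have "W (edge G i) = - F 0 + F 1" by (rule V_dev) simp
  then show ?thesis by (simp add: F_def side_def)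
qed

lemma W_oriented: "fst d < n \<Longrightarrow> W (oriented_edge G d) = cls [d]"
proof -
  assume d: "fst d < n"
  obtain i b where db: "d = (i, b)" by fastforce
  show ?thesis
  proof (cases b)
    case True then show ?thesis using W_edge d by (simp add: db oriented_edge_def)
  next
    case False
    then show ?thesis
      using W_reversepath [OF gpath_edge] W_edge d cls_flip [of "(i, True)"]
      by (simp add: db oriented_edge_def flip_def)
  qed
qed

text \<open>A primitive on the whole square has the same increment along both ways between opposite
  corners.\<close>

lemma square:
  fixes H :: "real \<times> real \<Rightarrow> 'a"
  assumes "continuous_on ({0..1} \<times> {0..1}) H" "H ` ({0..1} \<times> {0..1}) \<subseteq> S"
  shows "W (\<lambda>t. H (0, t)) + W (\<lambda>s. H (s, 1)) = W (\<lambda>s. H (s, 0)) + W (\<lambda>t. H (1, t))"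
proof -
  have "compact ({0..1::real} \<times> {0..1::real})" "convex ({0..1::real} \<times> {0..1::real})"
    by (auto intro: compact_Times convex_Times)
  then obtain F where F: "is_dev H ({0..1} \<times> {0..1}) F" using dev_exists assms by blast
  have "is_dev (\<lambda>t. H (0, t)) {0..1} (F \<circ> (\<lambda>t. (0, t)))" "is_dev (\<lambda>t. H (1, t)) {0..1} (F \<circ> (\<lambda>t. (1, t)))"
    "is_dev (\<lambda>s. H (s, 0)) {0..1} (F \<circ> (\<lambda>s. (s, 0)))" "is_dev (\<lambda>s. H (s, 1)) {0..1} (F \<circ> (\<lambda>s. (s, 1)))"
    by (rule dev_compose [OF F]; auto intro!: continuous_intros)+
  from this [THEN V_dev] show ?thesis by (simp add: add.assoc)
qed

lemma homotopic_W:
  assumes "homotopic_paths S p q" shows "W p = W q"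
proof -
  obtain h :: "real \<times> real \<Rightarrow> 'a" where h: "continuous_on ({0..1} \<times> {0..1}) h" "h \<in> ({0..1} \<times> {0..1}) \<rightarrow> S"
    "\<And>t. t \<in> {0..1} \<Longrightarrow> h (0, t) = p t" "\<And>t. t \<in> {0..1} \<Longrightarrow> h (1, t) = q t"
    "\<And>s. s \<in> {0..1} \<Longrightarrow> h (s, 0) = pathstart p" "\<And>s. s \<in> {0..1} \<Longrightarrow> h (s, 1) = pathfinish p"
    using assms unfolding homotopic_paths by (auto simp: pathstart_def pathfinish_def)
  have gp: "gpath p" "gpath q" using assms homotopic_paths_imp_path homotopic_paths_imp_subset by blast+
  have "W (\<lambda>s. h (s, 1)) = 0" "W (\<lambda>s. h (s, 0)) = 0"
    by (rule V_const; use h(5,6) in simp)+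
  moreover have "W (\<lambda>t. h (0, t)) = W p" "W (\<lambda>t. h (1, t)) = W q"
    using gp h(3,4) by (auto intro!: V_cong gpath_good)
  ultimately show ?thesis using square [OF h(1)] h(2) by (auto simp: image_subset_iff_funcset)
qed

text \<open>In the square swept out by a loop, two opposite sides are the track of the base point
  \<open>x\<close>. This track is the conjugator, the same for all loops at
  \<open>x\<close>.\<close>

lemma homotopic_id_W:
  assumes k: "homotopic_with_canon (\<lambda>_. True) S S k id"
  shows "\<exists>u. \<forall>p. gpath p \<longrightarrow> pathstart p = x \<longrightarrow> pathfinish p = x \<longrightarrow> W (k \<circ> p) = u + W p - u"
proof -
  obtain h :: "real \<times> 'a \<Rightarrow> 'a" where h: "continuous_on ({0..1} \<times> S) h" "h ` ({0..1} \<times> S) \<subseteq> S"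
    "\<And>x. h (0, x) = k x" "\<And>x. h (1, x) = x"
    using k unfolding homotopic_with_def by (auto simp: continuous_map_in_subtopology prod_topology_subtopology_eu image_subset_iff_funcset Pi_iff)
  show ?thesis
  proof (intro exI [of _ "W (\<lambda>s. h (s, x))"] allI impI)
    fix p assume p: "gpath p" "pathstart p = x" "pathfinish p = x"
    have pc: "continuous_on {0..1} p" "\<And>t. t \<in> {0..1} \<Longrightarrow> p t \<in> S"
      using p(1) by (auto simp: path_def path_image_def)
    define H where "H = (\<lambda>(s, t). h (s, p t))"
    have "continuous_on ({0..1} \<times> {0..1}) (h \<circ> (\<lambda>z. (fst z, p (snd z))))"
    proof (rule continuous_on_compose)
      show "continuous_on ({0..1} \<times> {0..1}) (\<lambda>z. (fst z, p (snd z)))"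
        by (intro continuous_intros continuous_on_compose2 [OF pc(1)]) auto
      show "continuous_on ((\<lambda>z. (fst z, p (snd z))) ` ({0..1} \<times> {0..1})) h"
        by (rule continuous_on_subset [OF h(1)]) (use pc(2) in auto)
    qed
    then have "continuous_on ({0..1} \<times> {0..1}) H" by (simp add: H_def comp_def case_prod_beta)
    moreover have "H ` ({0..1} \<times> {0..1}) \<subseteq> S" using h(2) pc(2) by (force simp: H_def)
    ultimately have "W (\<lambda>t. H (0, t)) + W (\<lambda>s. H (s, 1)) = W (\<lambda>s. H (s, 0)) + W (\<lambda>t. H (1, t))"
      by (rule square)
    moreover have "(\<lambda>t. H (0, t)) = k \<circ> p" "(\<lambda>t. H (1, t)) = p" by (auto simp: H_def h(3,4))
    moreover have "(\<lambda>s. H (s, 0)) = (\<lambda>s. h (s, x))" "(\<lambda>s. H (s, 1)) = (\<lambda>s. h (s, x))"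
      using p(2,3) by (auto simp: H_def pathstart_def pathfinish_def)
    ultimately show "W (k \<circ> p) = W (\<lambda>s. h (s, x)) + W p - W (\<lambda>s. h (s, x))"
      by (metis add_diff_cancel)
  qed
qed

end

section \<open>Homotopy classes of paths\<close>

text \<open>A continuous map from a compact set to a Hausdorff space is closed, hence a quotient map
  onto its image. Continuity on an edge can thus be tested in its parameter.\<close>

lemma continuous_on_compact_image:
  fixes q :: "'b::topological_space \<Rightarrow> 'c::t2_space" and f :: "'c \<Rightarrow> 'd::topological_space"
  assumes "compact C" "continuous_on C q" "continuous_on C (\<lambda>x. f (q x))"
  shows "continuous_on (q ` C) f"
  unfolding continuous_on_closed_invariant
proof (intro allI impI)
  fix B :: "'d set" assume B: "closed B"
  obtain A where A: "closed A" "A \<inter> C = (\<lambda>x. f (q x)) -` B \<inter> C"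
    using assms(3) B unfolding continuous_on_closed_invariant by blast
  have "compact (A \<inter> C)" using A(1) assms(1) closed_Int_compact by blast
  then have "compact (q ` (A \<inter> C))" using assms(2) continuous_on_subset by (blast intro: compact_continuous_image)
  then have "closed (q ` (A \<inter> C))" by (rule compact_imp_closed)
  moreover have "q ` (A \<inter> C) \<inter> q ` C = f -` B \<inter> q ` C" unfolding A(2) by auto
  ultimately show "\<exists>A. closed A \<and> A \<inter> q ` C = f -` B \<inter> q ` C" by blast
qed

context fin_graph
begin

text \<open>Stretches the interval from \<open>1/4\<close> to \<open>3/4\<close> over the unit
  interval and sends the outer quarters to its ends.\<close>

definition squeeze :: "real \<Rightarrow> real" where
  "squeeze t = max 0 (min 1 (2 * t - 1/2))"

definition slide :: "real \<Rightarrow> real \<Rightarrow> real" where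
  "slide s t = (1 - s) * t + s * squeeze t"

text \<open>At time \<open>1\<close> the outer quarters of all edges are collapsed, so that a path is cut into pieces that are
  either constant or inside a single edge.\<close>

definition collapse :: "real \<times> 'a \<Rightarrow> 'a" where
  "collapse z = (if snd z \<in> verts G then snd z
     else let (i, t) = SOME (i, t). i < n \<and> 0 < t \<and> t < 1 \<and> snd z = edge G i t in edge G i (slide (fst z) t))"

lemma squeeze_01: "0 \<le> squeeze t" "squeeze t \<le> 1" by (auto simp: squeeze_def)

lemma slide_01: "0 \<le> s \<Longrightarrow> s \<le> 1 \<Longrightarrow> 0 \<le> t \<Longrightarrow> t \<le> 1 \<Longrightarrow> 0 \<le> slide s t \<and> slide s t \<le> 1"
  using convex_bound_le [of t 1 "squeeze t" "1 - s" s] squeeze_01 [of t] by (simp add: slide_def)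

lemma collapse_vert [simp]: "x \<in> verts G \<Longrightarrow> collapse (s, x) = x"
  by (simp add: collapse_def)

lemma collapse_edge:
  assumes "i < n" "0 \<le> t" "t \<le> 1" shows "collapse (s, edge G i t) = edge G i (slide s t)"
proof (cases "0 < t \<and> t < 1")
  case True
  define P where "P = (\<lambda>(j, u). j < n \<and> 0 < u \<and> u < 1 \<and> edge G i t = edge G j u)"
  have "P (i, t)" using True assms by (simp add: P_def)
  then have "P (SOME z. P z)" by (rule someI)
  moreover have "z = (i, t)" if "P z" for z
    using that edge_eq [OF assms(1), of "fst z" t "snd z"] True by (auto simp: P_def)
  ultimately have "(SOME z. P z) = (i, t)" by blast
  then show ?thesis using edge_interior [OF assms(1)] True by (simp add: collapse_def P_def)
next
  case False
  then have "t = 0 \<or> t = 1" using assms by auto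
  moreover have "slide s 0 = 0" "slide s 1 = 1" by (simp_all add: slide_def squeeze_def)
  ultimately show ?thesis using edge_ends [OF assms(1)] by auto
qed

lemma collapse_S: "s \<in> {0..1} \<Longrightarrow> x \<in> S \<Longrightarrow> collapse (s, x) \<in> S"
  by (erule S_cases) (use verts_S edge_in_S slide_01 in \<open>auto simp: collapse_edge\<close>)

lemma collapse_0: "x \<in> S \<Longrightarrow> collapse (0, x) = x"
  by (erule S_cases) (auto simp: collapse_edge slide_def)

lemma continuous_collapse: "continuous_on ({0..1} \<times> S) collapse"
proof -
  have e: "continuous_on ({0..1} \<times> edge G i ` {0..1}) collapse" if i: "i < n" for i
  proof -
    let ?q = "\<lambda>z :: real \<times> real. (fst z, edge G i (snd z))"
    have "continuous_on (?q ` ({0..1} \<times> {0..1})) collapse"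
    proof (rule continuous_on_compact_image)
      show "compact ({0..1::real} \<times> {0..1::real})" by (intro compact_Times) auto
      show "continuous_on ({0..1} \<times> {0..1}) ?q"
        by (intro continuous_intros continuous_on_compose2 [OF edge_cont [OF i]]) auto
      have "continuous_on ({0..1} \<times> {0..1}) (\<lambda>z :: real \<times> real. edge G i (slide (fst z) (snd z)))"
        unfolding slide_def squeeze_def
        by (intro continuous_on_compose2 [OF edge_cont [OF i]] continuous_intros)
          (use slide_01 in \<open>force simp: slide_def squeeze_def\<close>)
      then show "continuous_on ({0..1} \<times> {0..1}) (\<lambda>z. collapse (?q z))"
        by (rule continuous_on_eq) (auto simp: collapse_edge [OF i])
    qed
    moreover have "?q ` ({0..1} \<times> {0..1}) = {0..1} \<times> edge G i ` {0..1}" by force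
    ultimately show ?thesis by simp
  qed
  have "continuous_on (\<Union>i\<in>{..<n}. {0..1} \<times> edge G i ` {0..1}) collapse"
    by (rule continuous_on_closed_Union) (use e in \<open>auto intro!: closed_Times closed_edge_part\<close>)
  moreover have "continuous_on ({0..1} \<times> verts G) collapse"
    by (rule continuous_on_eq [of _ snd]) (auto intro: continuous_intros)
  moreover have "closed ({0..1::real} \<times> verts G)" "closed (\<Union>i\<in>{..<n}. {0..1::real} \<times> edge G i ` {0..1})"
    using finite_imp_closed [OF finite_verts]
    by (auto intro!: closed_Times closed_edge_part closed_UN)
  ultimately have "continuous_on (({0..1} \<times> verts G) \<union> (\<Union>i\<in>{..<n}. {0..1} \<times> edge G i ` {0..1})) collapse"
    by (intro continuous_on_closed_Un)
  moreover have "({0..1::real} \<times> verts G) \<union> (\<Union>i\<in>{..<n}. {0..1} \<times> edge G i ` {0..1}) = {0..1} \<times> S"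
    unfolding graph_space_def path_image_def by blast
  ultimately show ?thesis by (simp only:)
qed

lemma homotopic_collapse:
  assumes "gpath p" "pathstart p \<in> verts G" "pathfinish p \<in> verts G"
  shows "homotopic_paths S p (\<lambda>t. collapse (1, p t))"
  unfolding homotopic_paths
proof (intro exI conjI)
  let ?h = "\<lambda>z. collapse (fst z, p (snd z))"
  have pS: "p t \<in> S" if "t \<in> {0..1}" for t using assms(1) that by (auto simp: path_image_def)
  show "continuous_on ({0..1} \<times> {0..1}) ?h"
    by (rule continuous_on_compose2 [OF continuous_collapse])
      (use assms(1) pS in \<open>auto simp: path_def intro!: continuous_intros continuous_on_compose2 [of "{0..1}" p]\<close>)
  show "?h \<in> {0..1} \<times> {0..1} \<rightarrow> S" using collapse_S pS by auto
  show "\<forall>x\<in>{0..1}. ?h (0, x) = p x" using collapse_0 pS by auto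
  show "\<forall>x\<in>{0..1}. ?h (1, x) = collapse (1, p x)" by simp
  show "\<forall>t\<in>{0..1}. pathstart (?h \<circ> Pair t) = pathstart p \<and> pathfinish (?h \<circ> Pair t) = pathfinish p"
    using assms(2,3) by (auto simp: pathstart_def pathfinish_def)
qed

text \<open>Closed sets of parameters have closed images in the graph and interior parameters are
  unique, so preimages of closed sets under \<open>u\<close> are closed.\<close>

lemma edge_param:
  fixes f :: "'b::topological_space \<Rightarrow> 'a"
  assumes "continuous_on K f" "i < n" "f ` K \<subseteq> edge G i ` {0<..<1}"
  shows "\<exists>u. continuous_on K u \<and> (\<forall>x\<in>K. 0 < u x \<and> u x < 1 \<and> f x = edge G i (u x))"
proof -
  have "\<exists>t. 0 < t \<and> t < 1 \<and> f x = edge G i t" if "x \<in> K" for x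
  proof -
    have "f x \<in> edge G i ` {0<..<1}" using assms(3) that by blast
    then show ?thesis by auto
  qed
  then obtain u where u: "\<And>x. x \<in> K \<Longrightarrow> 0 < u x \<and> u x < 1 \<and> f x = edge G i (u x)" by metis
  have "continuous_on K u"
    unfolding continuous_on_closed_invariant
  proof (intro allI impI)
    fix B :: "real set" assume "closed B"
    then have "closed (edge G i ` (B \<inter> {0..1}))" using assms(2) by (intro closed_edge_part) auto
    then obtain A where A: "closed A" "A \<inter> K = f -` (edge G i ` (B \<inter> {0..1})) \<inter> K"
      using assms(1) unfolding continuous_on_closed_invariant by blast
    have "f x \<in> edge G i ` (B \<inter> {0..1}) \<longleftrightarrow> u x \<in> B" if x: "x \<in> K" for x
    proof
      note ux = u [OF x]
      assume "f x \<in> edge G i ` (B \<inter> {0..1})"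
      then obtain t where "t \<in> B" "0 \<le> t" "t \<le> 1" "f x = edge G i t" by auto
      then show "u x \<in> B" using edge_eq [OF assms(2,2), of "u x" t] ux by simp
    next
      assume "u x \<in> B"
      then show "f x \<in> edge G i ` (B \<inter> {0..1})" using u [OF x] by (intro image_eqI [of _ _ "u x"]) auto
    qed
    then have "A \<inter> K = u -` B \<inter> K" using A(2) by blast
    then show "\<exists>A. closed A \<and> A \<inter> K = u -` B \<inter> K" using A(1) by blast
  qed
  then show ?thesis using u by blast
qed

subsection \<open>Edge paths\<close>

definition tl_v :: "letter \<Rightarrow> 'a" where "tl_v d = oriented_edge G d 0"

lemma oriented_flip: "oriented_edge G (flip d) = reversepath (oriented_edge G d)"
  by (auto simp: oriented_edge_def flip_def)

lemma oriented_ends [simp]: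
  "pathstart (oriented_edge G d) = tl_v d" "pathfinish (oriented_edge G d) = tl_v (flip d)"
  by (simp_all add: tl_v_def oriented_flip pathstart_def pathfinish_def reversepath_def)

lemma tl_v_verts: "fst d < n \<Longrightarrow> tl_v d \<in> verts G"
  using edge_ends by (auto simp: tl_v_def oriented_edge_def reversepath_def)

abbreviation "ep \<equiv> epath n tl_v"

definition word_path :: "'a \<Rightarrow> letter list \<Rightarrow> real \<Rightarrow> 'a" where
  "word_path v w = foldr (\<lambda>d p. oriented_edge G d +++ p) w (\<lambda>_. v)"

lemma word_path_simps [simp]:
  "word_path v [] = (\<lambda>_. v)" "word_path v (d # w) = oriented_edge G d +++ word_path v w"
  by (simp_all add: word_path_def)

lemma word_path:
  "ep u w v \<Longrightarrow> v \<in> S \<Longrightarrow>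
    gpath (word_path v w) \<and> pathstart (word_path v w) = u \<and> pathfinish (word_path v w) = v \<and> W (word_path v w) = cls w"
proof (induction w arbitrary: u)
  case Nil
  then show ?case by (auto simp: path_image_def pathstart_def pathfinish_def path_def intro!: V_const)
next
  case (Cons d w)
  then have d: "fst d < n" "tl_v d = u" and
    w: "gpath (word_path v w)" "pathstart (word_path v w) = tl_v (flip d)" "pathfinish (word_path v w) = v"
      "W (word_path v w) = cls w" by auto
  have g: "gpath (oriented_edge G d)" using gpath_oriented d by blast
  have "gpath (word_path v (d # w))"
    using g w(1,2) by (simp add: path_join_imp subset_path_image_join)
  moreover have "W (word_path v (d # w)) = cls [d] + cls w"
    using W_join [OF g w(1)] w(2,4) W_oriented [OF d(1)] by simp
  ultimately show ?case using d w by (simp add: cls_Cons [of d w])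
qed

lemma gpath_join: "gpath p \<Longrightarrow> gpath q \<Longrightarrow> pathfinish p = pathstart q \<Longrightarrow> gpath (p +++ q)"
  by (simp add: path_join_imp subset_path_image_join)

text \<open>The straight line homotopy takes place in the convex parameter interval. Unit and
  inverse laws for paths follow by suitable choices of \<open>u\<close> and
  \<open>v\<close>.\<close>

lemma homotopic_compose:
  fixes u v :: "real \<Rightarrow> real"
  assumes p: "gpath p" and u: "path u" "path_image u \<subseteq> {0..1}" and v: "path v" "path_image v \<subseteq> {0..1}"
    and uv: "pathstart u = pathstart v" "pathfinish u = pathfinish v"
  shows "homotopic_paths S (p \<circ> u) (p \<circ> v)"
proof (rule homotopic_paths_continuous_image)
  show "homotopic_paths {0..1} u v"
  proof (rule homotopic_paths_linear)
    fix t :: real assume "t \<in> {0..1}"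
    then have "u t \<in> path_image u" "v t \<in> path_image v" by (auto simp: path_image_def)
    then have "u t \<in> {0..1}" "v t \<in> {0..1}" using u(2) v(2) by blast+
    then show "closed_segment (u t) (v t) \<subseteq> {0..1}" by (intro closed_segment_subset) auto
  qed (use u v uv in auto)
  show "continuous_on {0..1} p" "p \<in> {0..1} \<rightarrow> S" using p by (auto simp: path_def path_image_def)
qed

lemma path_real: "path (\<lambda>t. t :: real)" "path_image (\<lambda>t. t :: real) = {0..1}"
  "pathstart (\<lambda>t. t :: real) = 0" "pathfinish (\<lambda>t. t :: real) = 1"
  by (auto simp: path_def path_image_def pathstart_def pathfinish_def)

lemma path_const: "path (\<lambda>t. c)" "path_image (\<lambda>t. c) = {c}" "pathstart (\<lambda>t. c) = c" "pathfinish (\<lambda>t. c) = c"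
  by (auto simp: path_def path_image_def pathstart_def pathfinish_def)

lemma homotopic_rid: "gpath p \<Longrightarrow> pathfinish p = v \<Longrightarrow> homotopic_paths S (p +++ (\<lambda>_. v)) p"
proof -
  assume p: "gpath p" "pathfinish p = v"
  have "homotopic_paths S (p \<circ> ((\<lambda>t. t) +++ (\<lambda>_. 1))) (p \<circ> (\<lambda>t. t))"
    using p(1) by (intro homotopic_compose) (simp_all add: path_real path_const path_image_join)
  moreover have "p \<circ> ((\<lambda>t. t) +++ (\<lambda>_. 1)) = p +++ (\<lambda>_. v)" "p \<circ> (\<lambda>t. t) = p"
    using p(2) by (auto simp: joinpaths_def pathfinish_def fun_eq_iff)
  ultimately show ?thesis by simp
qed

lemma homotopic_lid: "gpath p \<Longrightarrow> pathstart p = v \<Longrightarrow> homotopic_paths S ((\<lambda>_. v) +++ p) p"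
proof -
  assume p: "gpath p" "pathstart p = v"
  have "homotopic_paths S (p \<circ> ((\<lambda>_. 0) +++ (\<lambda>t. t))) (p \<circ> (\<lambda>t. t))"
    using p(1) by (intro homotopic_compose) (simp_all add: path_real path_const path_image_join)
  moreover have "p \<circ> ((\<lambda>_. 0) +++ (\<lambda>t. t)) = (\<lambda>_. v) +++ p" "p \<circ> (\<lambda>t. t) = p"
    using p(2) by (auto simp: joinpaths_def pathstart_def fun_eq_iff)
  ultimately show ?thesis by simp
qed

lemma homotopic_rinv: "gpath p \<Longrightarrow> pathstart p = v \<Longrightarrow> homotopic_paths S (p +++ reversepath p) (\<lambda>_. v)"
proof -
  assume p: "gpath p" "pathstart p = v"
  have "homotopic_paths S (p \<circ> ((\<lambda>t. t) +++ reversepath (\<lambda>t. t))) (p \<circ> (\<lambda>_. 0))"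
    using p(1) by (intro homotopic_compose) (simp_all add: path_real path_const path_image_join)
  moreover have "p \<circ> ((\<lambda>t. t) +++ reversepath (\<lambda>t. t)) = p +++ reversepath p" "p \<circ> (\<lambda>_::real. 0) = (\<lambda>_. v)"
    using p(2) by (auto simp: joinpaths_def reversepath_def pathstart_def fun_eq_iff)
  ultimately show ?thesis by simp
qed

lemma homotopic_cancel:
  assumes "gpath p" "gpath q" "pathfinish p = pathstart q"
  shows "homotopic_paths S ((p +++ q) +++ reversepath q) p"
proof -
  have "homotopic_paths S ((p +++ q) +++ reversepath q) (p +++ (q +++ reversepath q))"
    using assms by (intro homotopic_paths_sym [OF homotopic_paths_assoc]) auto
  also have "homotopic_paths S \<dots> (p +++ (\<lambda>_. pathstart q))"
    using assms by (intro homotopic_paths_join) (auto intro: homotopic_rinv)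
  also have "homotopic_paths S \<dots> p"
    using homotopic_rid assms by auto
  finally show ?thesis .
qed

lemma word_path_snoc:
  "ep u (w @ [d]) v \<Longrightarrow>
    homotopic_paths S (word_path v (w @ [d])) (word_path (tl_v d) w +++ oriented_edge G d)"
proof (induction w arbitrary: u)
  case Nil
  then have d: "fst d < n" "v = pathfinish (oriented_edge G d)" by auto
  have g: "gpath (oriented_edge G d)" using gpath_oriented d by blast
  have "homotopic_paths S (oriented_edge G d +++ (\<lambda>_. v)) (oriented_edge G d)"
    using homotopic_rid g d by blast
  also have "homotopic_paths S (oriented_edge G d) ((\<lambda>_. tl_v d) +++ oriented_edge G d)"
    by (rule homotopic_paths_sym [OF homotopic_lid]) (use g in auto)
  finally show ?case by simp
next
  case (Cons c w)
  then have c: "fst c < n" "ep (tl_v (flip c)) (w @ [d]) v" by auto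
  then obtain z where z: "ep (tl_v (flip c)) w z" "ep z [d] v" by (auto simp: epath_append)
  then have zd: "z = tl_v d" "fst d < n" by auto
  have vS: "v \<in> S" "tl_v d \<in> S"
    using z(2) tl_v_verts [of d] tl_v_verts [of "flip d"] verts_S by auto
  have w1: "gpath (word_path (tl_v d) w)" "pathstart (word_path (tl_v d) w) = tl_v (flip c)"
    "pathfinish (word_path (tl_v d) w) = tl_v d"
    using word_path [OF z(1)] zd vS by auto
  have w2: "gpath (word_path v (w @ [d]))" "pathstart (word_path v (w @ [d])) = tl_v (flip c)"
    using word_path [OF c(2) vS(1)] by auto
  have gc: "gpath (oriented_edge G c)" and gd: "gpath (oriented_edge G d)" using gpath_oriented c zd by blast+
  have "homotopic_paths S (oriented_edge G c +++ word_path v (w @ [d]))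
      (oriented_edge G c +++ (word_path (tl_v d) w +++ oriented_edge G d))"
    using Cons.IH [OF c(2)] gc w2 by (intro homotopic_paths_join) auto
  also have "homotopic_paths S \<dots> ((oriented_edge G c +++ word_path (tl_v d) w) +++ oriented_edge G d)"
    using gc gd w1 by (intro homotopic_paths_assoc) auto
  finally show ?case by simp
qed

lemma word_of_snoc:
  "word_of (a + cls [d]) = (if word_of a \<noteq> [] \<and> last (word_of a) = flip d then butlast (word_of a) else word_of a @ [d])"
proof (cases "word_of a \<noteq> [] \<and> last (word_of a) = flip d")
  case True
  then have w: "word_of a = butlast (word_of a) @ [flip d]" by (metis append_butlast_last_id)
  then have r: "reduced_word (butlast (word_of a))" by (metis reduced_append reduced_word_of)
  have "a = cls (butlast (word_of a) @ [flip d])" using w by (metis cls_word_of)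
  then have "a + cls [d] = (cls (butlast (word_of a)) - cls [d]) + cls [d]" by simp
  then have "a + cls [d] = cls (butlast (word_of a))" by (simp only: diff_add_cancel)
  then show ?thesis using True r by simp
next
  case False
  then have "reduced_word (word_of a @ [d])"
    by (auto simp: reduced_append reduced_word_def [of "[d]"] flip_eq_iff)
  moreover have "a + cls [d] = cls (word_of a @ [d])" by simp
  ultimately show ?thesis using False by (simp only: word_of_cls if_False)
qed

text \<open>The property that makes the word \<open>W p\<close>, together with the ends, determine
  the homotopy class of \<open>p\<close>.\<close>

definition normal :: "(real \<Rightarrow> 'a) \<Rightarrow> bool" where
  "normal p \<longleftrightarrow> pathfinish p \<in> verts G \<and> ep (pathstart p) (word_of (W p)) (pathfinish p) \<and>
     homotopic_paths S p (word_path (pathfinish p) (word_of (W p)))"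

lemma normal_gpath: "normal p \<Longrightarrow> gpath p"
  unfolding normal_def using homotopic_paths_imp_path homotopic_paths_imp_subset by blast

lemma normal_homotopic: "normal p \<Longrightarrow> homotopic_paths S p q \<Longrightarrow> normal q"
  unfolding normal_def
  by (metis homotopic_W homotopic_paths_imp_pathfinish homotopic_paths_imp_pathstart homotopic_paths_sym homotopic_paths_trans)

lemma normal_const: "v \<in> verts G \<Longrightarrow> normal (\<lambda>_. v)"
  using verts_S V_const [of 0 1 "\<lambda>_. v" v]
  by (auto simp: normal_def zero_fg.rep_eq pathstart_def pathfinish_def path_def path_image_def)

text \<open>Either the new letter extends the reduced word, or it cancels the last letter, and then
  the two traversals of the edge cancel up to homotopy.\<close>

lemma normal_snoc:
  assumes p: "normal p" and d: "fst d < n" "pathfinish p = tl_v d"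
  shows "normal (p +++ oriented_edge G d)"
proof -
  let ?w = "word_of (W p)" and ?o = "oriented_edge G d"
  have g: "gpath p" "gpath ?o" using normal_gpath p gpath_oriented d by blast+
  have end': "pathfinish ?o \<in> verts G" using tl_v_verts [of "flip d"] d by simp
  have ends: "pathfinish p = pathstart ?o" using d by simp
  have Wd: "W (p +++ ?o) = W p + cls [d]" using W_join g ends W_oriented d by simp
  have e: "ep (pathstart p) ?w (tl_v d)" and h: "homotopic_paths S p (word_path (tl_v d) ?w)"
    using p d by (auto simp: normal_def)
  show ?thesis
  proof (cases "?w \<noteq> [] \<and> last ?w = flip d")
    case False
    then have W': "word_of (W (p +++ ?o)) = ?w @ [d]" unfolding Wd word_of_snoc by (rule if_not_P)
    have e': "ep (pathstart p) (?w @ [d]) (pathfinish ?o)"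
      using e d by (auto simp: epath_append)
    have "homotopic_paths S (p +++ ?o) (word_path (tl_v d) ?w +++ ?o)"
      using h g ends by (intro homotopic_paths_join) auto
    also have "homotopic_paths S \<dots> (word_path (pathfinish ?o) (?w @ [d]))"
      using word_path_snoc [OF e'] by (rule homotopic_paths_sym)
    finally show ?thesis using e' end' W' by (simp add: normal_def)
  next
    case True
    define w' where "w' = butlast ?w"
    have w: "?w = w' @ [flip d]" using True by (metis append_butlast_last_id w'_def)
    have W': "word_of (W (p +++ ?o)) = w'" unfolding Wd word_of_snoc using True by (simp add: w'_def)
    have e': "ep (pathstart p) w' (pathfinish ?o)"
      using e unfolding w by (auto simp: epath_append)
    let ?q = "word_path (pathfinish ?o) w'"
    have q: "gpath ?q" "pathfinish ?q = pathfinish ?o" using word_path [OF e'] end' verts_S by auto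
    have "homotopic_paths S p (?q +++ oriented_edge G (flip d))"
      using homotopic_paths_trans [OF h] word_path_snoc [of "pathstart p" w' "flip d" "tl_v d"] e
      unfolding w by simp
    then have "homotopic_paths S (p +++ ?o) ((?q +++ reversepath ?o) +++ ?o)"
      using g ends by (intro homotopic_paths_join) (auto simp: oriented_flip)
    also have "homotopic_paths S \<dots> ?q"
      using homotopic_cancel [of ?q "reversepath ?o"] q g by simp
    finally show ?thesis using e' end' W' by (simp add: normal_def)
  qed
qed

end

section \<open>Immersed paths and edge paths\<close>

text \<open>On both sides of an interior maximum the function passes through the greater of the two
  end values.\<close>

lemma real_max_fold:
  fixes u :: "real \<Rightarrow> real"
  assumes c: "continuous_on {a..b} u" and z: "a < z" "z < b" and m: "\<And>t. t \<in> {a..b} \<Longrightarrow> u t \<le> u z"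
  shows "\<exists>s t. a \<le> s \<and> s < t \<and> t \<le> b \<and> u s = u t"
proof -
  define v where "v = max (u a) (u b)"
  show ?thesis
  proof (cases "u a = u z \<or> u b = u z")
    case True
    then show ?thesis using z by (metis less_eq_real_def order_refl)
  next
    case False
    then have v: "u a \<le> v" "u b \<le> v" "v < u z" using m [of a] m [of b] z by (auto simp: v_def)
    have "\<exists>s. a \<le> s \<and> s \<le> z \<and> u s = v"
      by (rule IVT') (use v z continuous_on_subset [OF c] in auto)
    then obtain s where s: "a \<le> s" "s \<le> z" "u s = v" by blast
    have "\<exists>t. z \<le> t \<and> t \<le> b \<and> u t = v"
      by (rule IVT2') (use v z continuous_on_subset [OF c] in auto)
    then obtain t where t: "z \<le> t" "t \<le> b" "u t = v" by blast
    have "s \<noteq> z" "t \<noteq> z" using s t v by auto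
    then have "s < t" using s t by simp
    then show ?thesis using s t by (intro exI [of _ s] exI [of _ t]) simp
  qed
qed

text \<open>If \<open>u s = u t\<close>, there is a maximum or minimum strictly between, near which
  the function folds; in the remaining case it is constant and the midpoint serves.\<close>

lemma locally_inj_interval:
  fixes u :: "real \<Rightarrow> real"
  assumes c: "continuous_on {a<..<b} u"
    and l: "\<And>z. a < z \<Longrightarrow> z < b \<Longrightarrow> \<exists>e>0. {z - e<..<z + e} \<subseteq> {a<..<b} \<and> inj_on u {z - e<..<z + e}"
  shows "inj_on u {a<..<b}"
proof -
  have no_max: False if st: "a < s" "s < z" "z < t" "t < b" and m: "\<And>x. x \<in> {s..t} \<Longrightarrow> v x \<le> v z"
    and v: "v = u \<or> v = (\<lambda>x. - u x)" for s t z and v :: "real \<Rightarrow> real"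
  proof -
    obtain e where e: "e > 0" "{z - e<..<z + e} \<subseteq> {a<..<b}" "inj_on u {z - e<..<z + e}" using l [of z] st by force
    define s' t' where "s' = max s (z - e/2)" and "t' = min t (z + e/2)"
    have st': "s \<le> s'" "s' < z" "z < t'" "t' \<le> t" "z - e < s'" "t' < z + e" using e st by (auto simp: s'_def t'_def)
    have "continuous_on {a<..<b} v" using v c continuous_on_minus [OF c] by blast
    then have "continuous_on {s'..t'} v" by (rule continuous_on_subset) (use st st' in auto)
    then obtain x y where xy: "s' \<le> x" "x < y" "y \<le> t'" "v x = v y"
      using real_max_fold [of s' t' v z] st' m by (meson atLeastAtMost_iff order_trans)
    then have "u x = u y" using v by (elim disjE) simp_all
    moreover have "x \<in> {z - e<..<z + e}" "y \<in> {z - e<..<z + e}" using xy st' by simp_all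
    ultimately have "x = y" using inj_onD [OF e(3)] by blast
    then show False using xy by simp
  qed
  show ?thesis
  proof (rule linorder_inj_onI')
    fix s t assume st0: "s \<in> {a<..<b}" "t \<in> {a<..<b}" "s < t"
    then have st: "a < s" "s < t" "t < b" by simp_all
    show "u s \<noteq> u t"
    proof
      assume eq: "u s = u t"
      have cst: "continuous_on {s..t} u" by (rule continuous_on_subset [OF c]) (use st in auto)
      obtain M where M: "M \<in> {s..t}" "\<And>x. x \<in> {s..t} \<Longrightarrow> u x \<le> u M"
        using continuous_attains_sup [OF compact_Icc _ cst] st by auto
      obtain m where m: "m \<in> {s..t}" "\<And>x. x \<in> {s..t} \<Longrightarrow> u m \<le> u x"
        using continuous_attains_inf [OF compact_Icc _ cst] st by auto
      consider "s < M" "M < t" | "s < m" "m < t" | "(M = s \<or> M = t) \<and> (m = s \<or> m = t)"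
        using M(1) m(1) unfolding atLeastAtMost_iff by linarith
      then show False
      proof cases
        case 1
        show ?thesis by (rule no_max [of s M t u]) (use 1 st M(2) in simp_all)
      next
        case 2
        show ?thesis by (rule no_max [of s m t "\<lambda>x. - u x"]) (use 2 st m(2) in simp_all)
      next
        case 3
        then have "u M = u s" and "u m = u s" using eq by metis+
        define z where "z = (s + t) / 2"
        have z: "s < z" "z < t" using st by (simp_all add: z_def)
        then have "u m \<le> u z" by (intro m(2)) simp
        then have le: "u x \<le> u z" if "x \<in> {s..t}" for x
          using M(2) [OF that] \<open>u M = u s\<close> \<open>u m = u s\<close> by linarith
        show ?thesis by (rule no_max [of s z t u]) (use st z le in simp_all)
      qed
    qed
  qed
qed

lemma inj_interval_mono:
  fixes u :: "real \<Rightarrow> real"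
  assumes c: "continuous_on {a<..<b} u" and i: "inj_on u {a<..<b}"
  shows "strict_mono_on {a<..<b} u \<or> strict_mono_on {a<..<b} (\<lambda>x. - u x)"
proof -
  have "strict_mono_on {a<..<b} u \<or> strict_antimono_on {a<..<b} u"
    using injective_eq_monotone_map [of "{a<..<b}" u] c i by (simp add: is_interval_oo)
  then show ?thesis by (auto simp: monotone_on_def)
qed

lemma strict_mono_extend:
  fixes u :: "real \<Rightarrow> real"
  assumes ab: "a < b" and c: "continuous_on {a<..<b} u" and m: "strict_mono_on {a<..<b} u"
    and b01: "\<And>t. t \<in> {a<..<b} \<Longrightarrow> 0 < u t \<and> u t < 1"
    and lo: "\<And>e. e > 0 \<Longrightarrow> \<exists>t\<in>{a<..<b}. u t < e" and hi: "\<And>e. e > 0 \<Longrightarrow> \<exists>t\<in>{a<..<b}. 1 - e < u t"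
  defines "h \<equiv> (\<lambda>t. if t \<le> a then 0 else if b \<le> t then 1 else u t)"
  shows "continuous_on {a..b} h" "strict_mono_on {a..b} h" "h a = 0" "h b = 1"
proof -
  show "h a = 0" "h b = 1" using ab by (auto simp: h_def)
  have hu: "h t = u t" if "t \<in> {a<..<b}" for t using that by (auto simp: h_def)
  show "strict_mono_on {a..b} h"
  proof (rule strict_mono_onI)
    fix s t assume "s \<in> {a..b}" "t \<in> {a..b}" "s < t"
    then show "h s < h t"
      using b01 [of s] b01 [of t] strict_mono_onD [OF m, of s t] by (auto simp: h_def)
  qed
  have mu: "u s < u t" if "a < s" "s < t" "t < b" for s t using strict_mono_onD [OF m, of s t] that by simp
  show "continuous_on {a..b} h"
    unfolding continuous_on_iff
  proof (intro ballI allI impI)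
    fix x e :: real assume x: "x \<in> {a..b}" and e: "e > 0"
    consider "x = a" | "x = b" | "a < x" "x < b" using x by fastforce
    then show "\<exists>d>0. \<forall>x'\<in>{a..b}. dist x' x < d \<longrightarrow> dist (h x') (h x) < e"
    proof cases
      case 1
      obtain t where t: "t \<in> {a<..<b}" "u t < e" using lo e by blast
      have "dist (h x') (h x) < e" if x': "x' \<in> {a..b}" "dist x' x < t - a" for x'
      proof -
        have "x' < t" using x' 1 by (auto simp: dist_real_def)
        then show ?thesis using 1 x' t e mu [of x' t] b01 [of x'] by (auto simp: h_def dist_real_def)
      qed
      then show ?thesis using t(1) by (intro exI [of _ "t - a"]) auto
    next
      case 2
      obtain t where t: "t \<in> {a<..<b}" "1 - e < u t" using hi e by blast
      have "dist (h x') (h x) < e" if x': "x' \<in> {a..b}" "dist x' x < b - t" for x'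
      proof -
        have "t < x'" using x' 2 by (auto simp: dist_real_def)
        then show ?thesis using 2 x' t e mu [of t x'] b01 [of x'] by (auto simp: h_def dist_real_def)
      qed
      then show ?thesis using t(1) by (intro exI [of _ "b - t"]) auto
    next
      case 3
      then obtain d where d: "d > 0" "\<And>x'. x' \<in> {a<..<b} \<Longrightarrow> dist x' x < d \<Longrightarrow> dist (u x') (u x) < e"
        using c e unfolding continuous_on_iff by (metis greaterThanLessThan_iff)
      show ?thesis
      proof (intro exI [of _ "min d (min (x - a) (b - x))"] conjI ballI impI)
        fix x' assume "x' \<in> {a..b}" "dist x' x < min d (min (x - a) (b - x))"
        then have "x' \<in> {a<..<b}" "dist x' x < d" by (auto simp: dist_real_def)
        then show "dist (h x') (h x) < e" using d(2) hu 3 by simp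
      qed (use d 3 in auto)
    qed
  qed
qed

section \<open>Running through edge paths\<close>

context fin_graph
begin

lemma finite_image_const:
  fixes f :: "real \<Rightarrow> 'a"
  assumes "continuous_on {a..b} f" "f ` {a..b} \<subseteq> verts G" "a \<le> x" "x \<le> b"
  shows "f x = f a"
proof -
  have "connected (f ` {a..b})" using assms(1) by (intro connected_continuous_image) auto
  moreover have "finite (f ` {a..b})" using assms(2) finite_verts finite_subset by blast
  ultimately have c: "connected (f ` {a..b})" "closed {f a}" "closed (f ` {a..b} - {f a})"
    by (auto intro: finite_imp_closed)
  have "f ` {a..b} - {f a} = {} \<or> {f a} \<inter> f ` {a..b} = {}"
    using c unfolding connected_closed by blast
  moreover have "f x \<in> f ` {a..b}" "f a \<in> f ` {a..b}" using assms(3,4) by auto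
  ultimately show ?thesis by blast
qed

definition piece :: "(real \<Rightarrow> 'a) \<Rightarrow> real \<Rightarrow> real \<Rightarrow> letter \<Rightarrow> bool" where
  "piece p a c d \<longleftrightarrow> fst d < n \<and> a < c \<and>
     (\<exists>h. continuous_on {a..c} h \<and> strict_mono_on {a..c} h \<and> h a = 0 \<and> h c = 1 \<and>
        (\<forall>t\<in>{a..c}. p t = oriented_edge G d (h t)))"

text \<open>A recursive form of \<open>runs_through\<close> on arbitrary intervals, which can be
  cut, joined, reversed and substituted by induction on the word.\<close>

fun seg :: "(real \<Rightarrow> 'a) \<Rightarrow> real \<Rightarrow> letter list \<Rightarrow> real \<Rightarrow> bool" where
  "seg p a [] b \<longleftrightarrow> a = b"
| "seg p a (d # w) b \<longleftrightarrow> (\<exists>c. piece p a c d \<and> seg p c w b)"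

lemma seg_append: "seg p a (u @ v) b \<longleftrightarrow> (\<exists>c. seg p a u c \<and> seg p c v b)"
  by (induction u arbitrary: a) auto

lemma seg_le: "seg p a w b \<Longrightarrow> a \<le> b"
  by (induction w arbitrary: a) (auto simp: piece_def, fastforce)

lemma runs_through_seg: "runs_through G p w \<longleftrightarrow> seg p 0 w 1"
proof
  assume "runs_through G p w"
  then obtain \<tau> where \<tau>: "\<tau> 0 = 0" "\<tau> (length w) = 1" "\<And>l. l < length w \<Longrightarrow> piece p (\<tau> l) (\<tau> (Suc l)) (w ! l)"
    unfolding runs_through_def piece_def by blast
  have "seg p (\<tau> l) (drop l w) (\<tau> (length w))" if "l \<le> length w" for l
    using that
  proof (induction l rule: inc_induct)
    case (step l)
    then have "drop l w = w ! l # drop (Suc l) w" by (simp add: Cons_nth_drop_Suc)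
    then show ?case using step \<tau>(3) [of l] by auto
  qed simp
  from this [of 0] show "seg p 0 w 1" using \<tau> by simp
next
  assume "seg p 0 w 1"
  moreover have "seg p a w b \<Longrightarrow> \<exists>\<tau>. \<tau> 0 = a \<and> \<tau> (length w) = b \<and> (\<forall>l<length w. piece p (\<tau> l) (\<tau> (Suc l)) (w ! l))" for a b
  proof (induction w arbitrary: a)
    case Nil
    then show ?case by (intro exI [of _ "\<lambda>_. a"]) simp
  next
    case (Cons d w)
    then obtain c where c: "piece p a c d" "seg p c w b" by auto
    then obtain \<tau> where \<tau>: "\<tau> 0 = c" "\<tau> (length w) = b" "\<And>l. l < length w \<Longrightarrow> piece p (\<tau> l) (\<tau> (Suc l)) (w ! l)"
      using Cons.IH by blast
    show ?case
      by (rule exI [of _ "case_nat a \<tau>"]) (use c \<tau> in \<open>auto split: nat.split simp: less_Suc_eq_0_disj\<close>)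
  qed
  ultimately obtain \<tau> where "\<tau> 0 = 0" "\<tau> (length w) = 1" "\<forall>l<length w. piece p (\<tau> l) (\<tau> (Suc l)) (w ! l)"
    by blast
  then show "runs_through G p w" unfolding runs_through_def piece_def by blast
qed

lemma mono_range:
  assumes "strict_mono_on {a..c} h" "h a = (0::real)" "h c = 1" "t \<in> {a..c}" "a < (c::real)"
  shows "0 \<le> h t" "h t \<le> 1" "a < t \<Longrightarrow> 0 < h t" "t < c \<Longrightarrow> h t < 1"
proof -
  show 1: "0 < h t" if "a < t" using strict_mono_onD [OF assms(1), of a t] assms that by simp
  show 2: "h t < 1" if "t < c" using strict_mono_onD [OF assms(1), of t c] assms that by simp
  show "0 \<le> h t" using 1 assms(2,4) by (cases "t = a") auto
  show "h t \<le> 1" using 2 assms(3,4) by (cases "t = c") auto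
qed

lemma piece_V:
  assumes "piece p a c d" shows "good_on p a c" "V p a c = cls [d]" "p a = tl_v d" "p c = tl_v (flip d)"
proof -
  obtain h where h: "fst d < n" "a < c" "continuous_on {a..c} h" "strict_mono_on {a..c} h" "h a = 0" "h c = 1"
      "\<And>t. t \<in> {a..c} \<Longrightarrow> p t = oriented_edge G d (h t)" using assms unfolding piece_def by blast
  note r = mono_range [OF h(4-6) _ h(2)]
  have im: "h ` {a..c} \<subseteq> {0..1}" using r by (intro image_subsetI) simp
  have o: "good_on (oriented_edge G d) 0 1" using gpath_oriented [OF h(1)] gpath_good by blast
  have "continuous_on {a..c} (\<lambda>t. oriented_edge G d (h t))"
    by (rule continuous_on_compose2 [OF _ h(3) im]) (use o in \<open>simp add: good_on_def\<close>)
  moreover have "oriented_edge G d (h t) \<in> S" if "t \<in> {a..c}" for t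
    using o im that unfolding good_on_def by blast
  ultimately show "good_on p a c" unfolding good_on_def
    by (intro conjI image_subsetI continuous_on_eq [of "{a..c}" "\<lambda>t. oriented_edge G d (h t)" p]) (simp_all add: h(7))
  have "V p a c = V (oriented_edge G d) (h a) (h c)"
    by (rule V_reparam [OF o h(3) im]) (use h in auto)
  then show "V p a c = cls [d]" using h W_oriented by simp
  show "p a = tl_v d" using h by (simp add: tl_v_def)
  show "p c = tl_v (flip d)" using h by (simp add: tl_v_def oriented_flip reversepath_def)
qed

lemma good_on_join: "good_on p a c \<Longrightarrow> good_on p c b \<Longrightarrow> a \<le> c \<Longrightarrow> c \<le> b \<Longrightarrow> good_on p a b"
proof -
  assume p: "good_on p a c" "good_on p c b" "a \<le> c" "c \<le> b"
  have "continuous_on ({a..c} \<union> {c..b}) p"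
    by (rule continuous_on_closed_Un) (use p in \<open>auto simp: good_on_def\<close>)
  moreover have "{a..c} \<union> {c..b} = {a..b}" using p by auto
  ultimately show ?thesis using p(1,2) unfolding good_on_def by (metis image_Un Un_least)
qed

lemma seg_V:
  "seg p a w b \<Longrightarrow> w \<noteq> [] \<Longrightarrow> good_on p a b \<and> V p a b = cls w \<and> ep (p a) w (p b)"
proof (induction w arbitrary: a)
  case (Cons d w)
  then obtain c where c: "piece p a c d" "seg p c w b" by auto
  note P = piece_V [OF c(1)]
  have d: "fst d < n" "a < c" using c(1) by (auto simp: piece_def)
  show ?case
  proof (cases "w = []")
    case True
    then show ?thesis using P d c(2) by simp
  next
    case False
    have w: "good_on p c b" "V p c b = cls w" "ep (p c) w (p b)" using Cons.IH [OF c(2) False] by auto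
    have cb: "c \<le> b" using seg_le c(2) by blast
    have g: "good_on p a b" using good_on_join P(1) w(1) d(2) cb by simp
    have "V p a b = V p a c + V p c b" by (rule V_add [OF g]) (use d cb in auto)
    then show ?thesis using g P w d by (simp add: cls_Cons [of d w])
  qed
qed simp

lemma seg_reparam:
  assumes "seg f (h a) w (h b)" "a \<le> b" "continuous_on {a..b} h" "strict_mono_on {a..b} h"
    "\<And>t. t \<in> {a..b} \<Longrightarrow> p t = f (h t)"
  shows "seg p a w b"
  using assms
proof (induction w arbitrary: a)
  case Nil
  then show ?case using strict_mono_onD [of "{a..b}" h a b] by force
next
  case (Cons d w)
  then obtain c where c: "piece f (h a) c d" "seg f c w (h b)" by auto
  obtain k where k: "fst d < n" "h a < c" "continuous_on {h a..c} k" "strict_mono_on {h a..c} k" "k (h a) = 0" "k c = 1"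
      "\<And>t. t \<in> {h a..c} \<Longrightarrow> f t = oriented_edge G d (k t)" using c(1) unfolding piece_def by blast
  have "c \<le> h b" using seg_le c(2) by blast
  then obtain c' where c': "a \<le> c'" "c' \<le> b" "h c' = c"
    using IVT' [of h a c b] Cons.prems(2,3) k(2) by auto
  have ac: "a < c'" using c' k(2) by (cases "a = c'") auto
  have sm: "h s < h t" if "a \<le> s" "s < t" "t \<le> b" for s t using strict_mono_onD [OF Cons.prems(4), of s t] that by simp
  have hr: "h t \<in> {h a..c}" if "t \<in> {a..c'}" for t
  proof -
    have "h a \<le> h t" using sm [of a t] that c' by (cases "a = t") auto
    moreover have "h t \<le> h c'" using sm [of t c'] that c' by (cases "t = c'") auto
    ultimately show ?thesis using c' by simp
  qed
  have "piece p a c' d" unfolding piece_def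
  proof (intro conjI exI [of _ "\<lambda>t. k (h t)"] ballI)
    show "continuous_on {a..c'} (\<lambda>t. k (h t))"
    proof (rule continuous_on_compose2 [OF k(3)])
      show "continuous_on {a..c'} h" by (rule continuous_on_subset [OF Cons.prems(3)]) (use c' in auto)
      show "h ` {a..c'} \<subseteq> {h a..c}" using hr by (rule image_subsetI)
    qed
    show "strict_mono_on {a..c'} (\<lambda>t. k (h t))"
    proof (rule strict_mono_onI)
      fix s t assume st: "s \<in> {a..c'}" "t \<in> {a..c'}" "s < t"
      then have "h s < h t" using sm c' by simp
      then show "k (h s) < k (h t)" using strict_mono_onD [OF k(4) hr hr] st by blast
    qed
    fix t assume t: "t \<in> {a..c'}"
    then show "p t = oriented_edge G d (k (h t))" using k(7) [OF hr [OF t]] Cons.prems(5) [of t] c' by simp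
  qed (use k c' ac in auto)
  moreover have "seg p c' w b"
  proof (rule Cons.IH)
    show "seg f (h c') w (h b)" using c(2) c' by simp
    show "continuous_on {c'..b} h" by (rule continuous_on_subset [OF Cons.prems(3)]) (use c' in auto)
    show "strict_mono_on {c'..b} h" by (rule monotone_on_subset [OF Cons.prems(4)]) (use c' in auto)
  qed (use c' Cons.prems(5) in auto)
  ultimately show ?case by auto
qed

lemma piece_reverse: "piece p a c d \<Longrightarrow> piece (\<lambda>t. p (1 - t)) (1 - c) (1 - a) (flip d)"
proof -
  assume "piece p a c d"
  then obtain h where h: "fst d < n" "a < c" "continuous_on {a..c} h" "strict_mono_on {a..c} h" "h a = 0" "h c = 1"
      "\<And>t. t \<in> {a..c} \<Longrightarrow> p t = oriented_edge G d (h t)" unfolding piece_def by blast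
  show ?thesis unfolding piece_def
  proof (intro conjI exI [of _ "\<lambda>t. 1 - h (1 - t)"] ballI)
    have "continuous_on {1 - c..1 - a} (\<lambda>t. h (1 - t))"
      by (rule continuous_on_compose2 [OF h(3)]) (auto intro!: continuous_intros)
    then show "continuous_on {1 - c..1 - a} (\<lambda>t. 1 - h (1 - t))" by (intro continuous_intros)
    show "strict_mono_on {1 - c..1 - a} (\<lambda>t. 1 - h (1 - t))"
    proof (rule strict_mono_onI)
      fix s t assume "s \<in> {1 - c..1 - a}" "t \<in> {1 - c..1 - a}" "s < t"
      then show "1 - h (1 - s) < 1 - h (1 - t)" using strict_mono_onD [OF h(4), of "1 - t" "1 - s"] by simp
    qed
    fix t assume "t \<in> {1 - c..1 - a}"
    then show "p (1 - t) = oriented_edge G (flip d) (1 - h (1 - t))"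
      using h(7) [of "1 - t"] by (simp add: oriented_flip reversepath_def)
  qed (use h in auto)
qed

lemma seg_reverse: "seg p a w b \<Longrightarrow> seg (\<lambda>t. p (1 - t)) (1 - b) (iword w) (1 - a)"
proof (induction w arbitrary: a)
  case (Cons d w)
  then obtain c where "piece p a c d" "seg p c w b" by auto
  then have "seg (\<lambda>t. p (1 - t)) (1 - b) (iword w) (1 - c)" "piece (\<lambda>t. p (1 - t)) (1 - c) (1 - a) (flip d)"
    using Cons.IH piece_reverse by blast+
  then show ?case unfolding iword_simps seg_append by auto
qed simp

text \<open>On each piece \<open>p\<close> is a reparametrised edge, so \<open>g \<circ> p\<close>
  runs through \<open>gw d\<close> there. Iterates of the map thus follow the iterated substitution,
  without any reduction.\<close>

lemma seg_subst:
  assumes g: "\<And>d. fst d < n \<Longrightarrow> seg (g \<circ> oriented_edge G d) 0 (gw d) 1"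
  shows "seg p a w b \<Longrightarrow> seg (g \<circ> p) a (ext gw w) b"
proof (induction w arbitrary: a)
  case (Cons d w)
  then obtain c where c: "piece p a c d" "seg p c w b" by auto
  then obtain h where h: "fst d < n" "a < c" "continuous_on {a..c} h" "strict_mono_on {a..c} h" "h a = 0" "h c = 1"
      "\<And>t. t \<in> {a..c} \<Longrightarrow> p t = oriented_edge G d (h t)" unfolding piece_def by blast
  have "seg (g \<circ> p) a (gw d) c"
    by (rule seg_reparam [of "g \<circ> oriented_edge G d" h]) (use g [OF h(1)] h in auto)
  then show ?case unfolding ext_simps seg_append using Cons.IH [OF c(2)] by blast
qed simp

lemma seg_edge: "i < n \<Longrightarrow> seg (edge G i) 0 [(i, True)] 1"
  by (auto simp: piece_def oriented_edge_def strict_mono_on_def intro!: exI [of _ "\<lambda>t. t"])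

end

section \<open>Deforming arbitrary paths to edge paths\<close>

context fin_graph
begin

definition edge_seg :: "nat \<Rightarrow> real \<Rightarrow> real \<Rightarrow> 'a" where
  "edge_seg i s = edge G i \<circ> (\<lambda>t. t * s)"

lemma edge_seg: "i < n \<Longrightarrow> s \<in> {0..1} \<Longrightarrow>
   gpath (edge_seg i s) \<and> pathstart (edge_seg i s) = edge G i 0 \<and> pathfinish (edge_seg i s) = edge G i s"
proof -
  assume i: "i < n" and s: "s \<in> {0..1}"
  have ts: "0 \<le> t * s \<and> t * s \<le> 1" if "0 \<le> t" "t \<le> 1" for t
    using that s by (simp add: mult_le_one)
  have "continuous_on {0..1} (\<lambda>t. edge G i (t * s))"
  proof (rule continuous_on_compose2 [OF edge_cont [OF i]])
    show "(\<lambda>t. t * s) ` {0..1} \<subseteq> {0..1}" using ts by auto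
  qed (intro continuous_intros)
  then have "path (edge_seg i s)" by (simp add: edge_seg_def path_def comp_def)
  moreover have "path_image (edge_seg i s) \<subseteq> S"
    unfolding path_image_def edge_seg_def comp_def using edge_in_S [OF i] ts by (intro image_subsetI) simp
  ultimately show ?thesis by (simp add: edge_seg_def pathstart_def pathfinish_def)
qed

lemma oriented_edge_seg: "oriented_edge G (i, True) = edge_seg i 1"
  by (simp add: oriented_edge_def edge_seg_def fun_eq_iff)

text \<open>The invariant for following a path bit by bit: the path followed so far may stop inside
  an edge, and is then an edge path followed by an initial segment of that edge.\<close>

definition walk :: "(real \<Rightarrow> 'a) \<Rightarrow> bool" where
  "walk p \<longleftrightarrow> normal p \<or> (\<exists>q i s. i < n \<and> 0 < s \<and> s < 1 \<and> normal q \<and> pathfinish q = edge G i 0 \<and>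
     homotopic_paths S p (q +++ edge_seg i s))"

lemma walk_homotopic: "walk p \<Longrightarrow> homotopic_paths S p q \<Longrightarrow> walk q"
  unfolding walk_def by (metis normal_homotopic homotopic_paths_sym homotopic_paths_trans)

lemma walk_gpath: "walk p \<Longrightarrow> gpath p"
  unfolding walk_def using normal_gpath homotopic_paths_imp_path homotopic_paths_imp_subset by blast

lemma walk_normal:
  assumes "walk p" "pathfinish p \<in> verts G" shows "normal p"
proof (rule ccontr)
  assume "\<not> normal p"
  then obtain q i s where q: "i < n" "0 < s" "s < 1" "normal q" "pathfinish q = edge G i 0"
     "homotopic_paths S p (q +++ edge_seg i s)" using assms(1) unfolding walk_def by blast
  then have "pathfinish p = edge G i s"
    using edge_seg [of i s] homotopic_paths_imp_pathfinish [OF q(6)] by auto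
  then show False using assms(2) edge_interior [OF q(1-3)] by simp
qed

lemma tl_v_edge: "tl_v (i, True) = edge G i 0" "tl_v (i, False) = edge G i 1"
  unfolding tl_v_def oriented_edge_def reversepath_def by simp_all

lemma walk_edge_seg:
  assumes q: "normal q" "i < n" "pathfinish q = edge G i 0" and s: "s \<in> {0..1}"
  shows "walk (q +++ edge_seg i s)"
proof -
  have g: "gpath q" "gpath (edge_seg i s)" "pathstart (edge_seg i s) = edge G i 0"
    using normal_gpath q edge_seg s by auto
  consider "s = 0" | "s = 1" | "0 < s" "s < 1"
    using s unfolding atLeastAtMost_iff by linarith
  then show ?thesis
  proof cases
    case 1
    then have "edge_seg i s = (\<lambda>_. edge G i 0)" by (auto simp: edge_seg_def)
    then have "homotopic_paths S q (q +++ edge_seg i s)"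
      using homotopic_paths_sym [OF homotopic_rid [OF g(1) q(3)]] by simp
    then show ?thesis using normal_homotopic [OF q(1)] unfolding walk_def by blast
  next
    case 2
    then show ?thesis using normal_snoc [OF q(1), of "(i, True)"] q(2,3)
      by (simp add: walk_def oriented_edge_seg tl_v_edge)
  next
    case 3
    moreover have "homotopic_paths S (q +++ edge_seg i s) (q +++ edge_seg i s)"
      using gpath_join g q(3) by simp
    ultimately show ?thesis
      unfolding walk_def using q by (intro disjI2 exI [of _ q] exI [of _ i] exI [of _ s] conjI)
  qed
qed

text \<open>A position on edge \<open>i\<close> can be reached through the initial vertex of
  \<open>i\<close>; if it is the far end, this costs a detour along the reversed edge.\<close>

lemma walk_form:
  assumes p: "walk p" and i: "i < n" and s: "s \<in> {0..1}" "pathfinish p = edge G i s"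
  shows "\<exists>q. normal q \<and> pathfinish q = edge G i 0 \<and> homotopic_paths S p (q +++ edge_seg i s)"
proof (cases "pathfinish p \<in> verts G")
  case True
  then have N: "normal p" using walk_normal p by blast
  have g: "gpath p" using normal_gpath N by blast
  have "\<not> (0 < s \<and> s < 1)" using edge_interior [OF i, of s] True s(2) by auto
  then consider "s = 0" | "s = 1" using s(1) unfolding atLeastAtMost_iff by linarith
  then show ?thesis
  proof cases
    case 1
    then have "edge_seg i s = (\<lambda>_. edge G i 0)" by (auto simp: edge_seg_def)
    then have "homotopic_paths S p (p +++ edge_seg i s)"
      using homotopic_paths_sym [OF homotopic_rid [OF g s(2)]] 1 by simp
    moreover have "pathfinish p = edge G i 0" using s(2) 1 by simp
    ultimately show ?thesis using N by blast
  next
    case 2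
    let ?q = "p +++ oriented_edge G (i, False)"
    have e: "pathfinish p = tl_v (i, False)" using s 2 by (simp add: tl_v_edge)
    have "normal ?q" using normal_snoc [OF N, of "(i, False)"] i e by simp
    moreover have "homotopic_paths S p (?q +++ reversepath (oriented_edge G (i, False)))"
      by (rule homotopic_paths_sym [OF homotopic_cancel [OF g gpath_oriented]]) (use i e in simp_all)
    moreover have "reversepath (oriented_edge G (i, False)) = edge_seg i s"
      unfolding 2 oriented_edge_seg [symmetric] by (simp add: oriented_edge_def)
    moreover have "pathfinish ?q = edge G i 0" using tl_v_edge(1) [of i] by (simp add: flip_def)
    ultimately show ?thesis by (intro exI [of _ ?q]) simp
  qed
next
  case False
  then have "\<not> normal p" by (auto simp: normal_def)
  then obtain q j u where q: "j < n" "0 < u" "u < 1" "normal q" "pathfinish q = edge G j 0"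
     "homotopic_paths S p (q +++ edge_seg j u)" using p unfolding walk_def by blast
  then have "edge G j u = edge G i s"
    using edge_seg [OF q(1), of u] homotopic_paths_imp_pathfinish [OF q(6)] s(2) q(2,3) by simp
  then have "j = i" "u = s" using edge_eq [of j i u s] q(1-3) i s(1) by simp_all
  then show ?thesis using q by blast
qed

text \<open>Movement inside the edge is homotopic, within its parameter interval, to the direct
  segment to the parameter finally reached.\<close>

lemma walk_step:
  assumes p: "walk p" and i: "i < n" and u: "path u" "path_image u \<subseteq> {0..1}" "pathfinish p = edge G i (u 0)"
  shows "walk (p +++ (edge G i \<circ> u))"
proof -
  have u01: "u t \<in> {0..1}" if "t \<in> {0..1}" for t
  proof -
    have "u t \<in> path_image u" using that by (auto simp: path_image_def)
    then show ?thesis using u(2) by blast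
  qed
  then have u0: "u 0 \<in> {0..1}" and u1: "u 1 \<in> {0..1}" by simp_all
  obtain q where q: "normal q" "pathfinish q = edge G i 0" "homotopic_paths S p (q +++ edge_seg i (u 0))"
    using walk_form [OF p i u01 u(3)] by auto
  have gq: "gpath q" using normal_gpath q by blast
  have s0: "gpath (edge_seg i (u 0))" "pathstart (edge_seg i (u 0)) = edge G i 0" "pathfinish (edge_seg i (u 0)) = edge G i (u 0)"
    using edge_seg [OF i, of "u 0"] u01 [of 0] by auto
  have gu: "gpath (edge G i \<circ> u)"
  proof
    show "path (edge G i \<circ> u)"
      by (rule path_continuous_image [OF u(1)]) (rule continuous_on_subset [OF edge_cont [OF i] u(2)])
    show "path_image (edge G i \<circ> u) \<subseteq> S"
      unfolding path_image_def comp_def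
    proof (rule image_subsetI)
      fix t :: real assume "t \<in> {0..1}"
      then have "u t \<in> {0..1}" by (rule u01)
      then show "edge G i (u t) \<in> S" using edge_in_S [OF i] by simp
    qed
  qed
  have st: "pathstart (edge G i \<circ> u) = edge G i (u 0)" by (simp add: pathstart_def)
  have lin: "path (\<lambda>t. t * c)" "path_image (\<lambda>t. t * c) \<subseteq> {0..1}" if c: "c \<in> {0..1}" for c :: real
  proof -
    show "path (\<lambda>t. t * c)" unfolding path_def by (intro continuous_intros)
    show "path_image (\<lambda>t. t * c) \<subseteq> {0..1}"
      unfolding path_image_def using c by (intro image_subsetI) (simp add: mult_le_one)
  qed
  have "homotopic_paths S (p +++ (edge G i \<circ> u)) ((q +++ edge_seg i (u 0)) +++ (edge G i \<circ> u))"
    using q(3) gu st u(3) by (intro homotopic_paths_join) auto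
  also have "homotopic_paths S \<dots> (q +++ (edge_seg i (u 0) +++ (edge G i \<circ> u)))"
    using gq s0 gu st q(2) by (intro homotopic_paths_sym [OF homotopic_paths_assoc]) auto
  also have "homotopic_paths S \<dots> (q +++ edge_seg i (u 1))"
  proof (rule homotopic_paths_join)
    show "homotopic_paths S q q" using gq by simp
    show "pathfinish q = pathstart (edge_seg i (u 0) +++ (edge G i \<circ> u))" using q s0 by simp
    have "homotopic_paths S (edge G i \<circ> ((\<lambda>t. t * u 0) +++ u)) (edge G i \<circ> (\<lambda>t. t * u 1))"
    proof (rule homotopic_compose [OF gpath_edge [OF i]])
      show "path ((\<lambda>t. t * u 0) +++ u)"
        by (rule path_join_imp [OF lin(1) [OF u0] u(1)]) (simp add: pathstart_def pathfinish_def)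
      show "path_image ((\<lambda>t. t * u 0) +++ u) \<subseteq> {0..1}"
        by (rule subset_path_image_join [OF lin(2) [OF u0] u(2)])
      show "path (\<lambda>t. t * u 1)" "path_image (\<lambda>t. t * u 1) \<subseteq> {0..1}"
        by (rule lin [OF u1])+
    qed (auto simp: pathstart_def pathfinish_def joinpaths_def)
    then show "homotopic_paths S (edge_seg i (u 0) +++ (edge G i \<circ> u)) (edge_seg i (u 1))"
      unfolding edge_seg_def path_compose_join .
  qed
  finally have "homotopic_paths S (p +++ (edge G i \<circ> u)) (q +++ edge_seg i (u 1))" .
  moreover have "walk (q +++ edge_seg i (u 1))" using walk_edge_seg [OF q(1) i q(2)] u01 by simp
  ultimately show ?thesis using walk_homotopic homotopic_paths_sym by blast
qed

definition subp :: "real \<Rightarrow> real \<Rightarrow> (real \<Rightarrow> 'b) \<Rightarrow> real \<Rightarrow> 'b" where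
  "subp a b p = (\<lambda>t. p (a + (b - a) * t))"

lemma subp_in: "0 \<le> a \<Longrightarrow> a \<le> b \<Longrightarrow> b \<le> 1 \<Longrightarrow> 0 \<le> t \<Longrightarrow> t \<le> 1 \<Longrightarrow> a \<le> a + (b - a) * t \<and> a + (b - a) * t \<le> (b :: real)"
  using mult_left_le [of t "b - a"] by auto

lemma gpath_subp: "gpath p \<Longrightarrow> 0 \<le> a \<Longrightarrow> a \<le> b \<Longrightarrow> b \<le> 1 \<Longrightarrow> gpath (subp a b p)"
proof -
  assume p: "gpath p" and ab: "0 \<le> a" "a \<le> b" "b \<le> 1"
  have in01: "a + (b - a) * t \<in> {0..1}" if "t \<in> {0..1}" for t
    using subp_in [OF ab, of t] that ab by simp
  have "continuous_on {0..1} (subp a b p)"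
    unfolding subp_def
  proof (rule continuous_on_compose2 [of "{0..1}" p])
    show "continuous_on {0..1} p" using p by (simp add: path_def)
    show "(\<lambda>t. a + (b - a) * t) ` {0..1} \<subseteq> {0..1}" using in01 by (rule image_subsetI)
  qed (intro continuous_intros)
  moreover have "path_image (subp a b p) \<subseteq> path_image p"
    unfolding path_image_def subp_def using in01 by (intro image_subsetI imageI)
  ultimately show ?thesis using p unfolding path_def by blast
qed

lemma subp_ends: "pathstart (subp a b p) = p a" "pathfinish (subp a b p) = p b"
  by (simp_all add: subp_def pathstart_def pathfinish_def)

lemma subp_join:
  assumes p: "gpath p" and ab: "0 \<le> a" "a \<le> b" "b \<le> 1"
  shows "homotopic_paths S (subp 0 a p +++ subp a b p) (subp 0 b p)"
proof -
  have i: "path (\<lambda>t. c + (d - c) * t)" "path_image (\<lambda>t. c + (d - c) * t) \<subseteq> {0..1}"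
    if "0 \<le> c" "c \<le> d" "d \<le> 1" for c d :: real
    using subp_in [OF that] that by (force simp: path_def path_image_def intro!: continuous_intros)+
  have "homotopic_paths S (p \<circ> ((\<lambda>t. 0 + (a - 0) * t) +++ (\<lambda>t. a + (b - a) * t))) (p \<circ> (\<lambda>t. 0 + (b - 0) * t))"
  proof (rule homotopic_compose [OF p])
    show "path ((\<lambda>t. 0 + (a - 0) * t) +++ (\<lambda>t. a + (b - a) * t))"
      using ab by (intro path_join_imp i) (auto simp: pathstart_def pathfinish_def)
    show "path_image ((\<lambda>t. 0 + (a - 0) * t) +++ (\<lambda>t. a + (b - a) * t)) \<subseteq> {0..1}"
      using ab by (intro subset_path_image_join i) auto
    show "path (\<lambda>t. 0 + (b - 0) * t)" "path_image (\<lambda>t. 0 + (b - 0) * t) \<subseteq> {0..1}" using ab by (intro i; simp)+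
  qed (auto simp: pathstart_def pathfinish_def joinpaths_def)
  then show ?thesis unfolding path_compose_join by (simp add: subp_def comp_def)
qed

lemma walk_const_step:
  assumes p: "walk p" and c: "gpath c" "pathfinish p = pathstart c" "\<And>t. t \<in> {0..1} \<Longrightarrow> c t = pathstart c"
  shows "walk (p +++ c)"
proof -
  have g: "gpath p" using walk_gpath [OF p] .
  have "homotopic_paths S c (\<lambda>_. pathstart c)"
    using c by (intro homotopic_paths_eq) auto
  then have "homotopic_paths S (p +++ c) (p +++ (\<lambda>_. pathstart c))"
    using g c(2) by (intro homotopic_paths_join) auto
  also have "homotopic_paths S \<dots> p" by (rule homotopic_rid [OF g c(2)])
  finally show ?thesis using walk_homotopic [OF p] homotopic_paths_sym by blast
qed

lemma walk_edge_step:
  assumes p: "walk p" and c: "gpath c" "pathfinish p = pathstart c" and i: "i < n"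
    and u: "path u" "path_image u \<subseteq> {0..1}" "\<And>t. t \<in> {0..1} \<Longrightarrow> c t = edge G i (u t)"
  shows "walk (p +++ c)"
proof -
  have g: "gpath p" using walk_gpath [OF p] .
  have "pathfinish p = edge G i (u 0)" using c(2) u(3) [of 0] by (simp add: pathstart_def)
  then have w: "walk (p +++ (edge G i \<circ> u))" by (rule walk_step [OF p i u(1,2)])
  have "homotopic_paths S c (edge G i \<circ> u)" using c u(3) by (intro homotopic_paths_eq) auto
  then have "homotopic_paths S (p +++ c) (p +++ (edge G i \<circ> u))"
    using g c(2) by (intro homotopic_paths_join) auto
  then show ?thesis using walk_homotopic [OF w] homotopic_paths_sym by blast
qed

lemma collapse_outer:
  assumes "p ` K \<subseteq> region {} {1/4..3/4}"
  shows "(\<lambda>t. collapse (1, p t)) ` K \<subseteq> verts G"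
proof (rule image_subsetI)
  fix t assume "t \<in> K"
  then have pt: "p t \<in> region {} {1/4..3/4}" using assms by blast
  then have "p t \<in> S" by (simp add: region_def)
  then show "collapse (1, p t) \<in> verts G"
  proof (cases rule: S_cases)
    case (2 j u)
    have "\<not> (1/4 \<le> u \<and> u \<le> 3/4)"
    proof
      assume "1/4 \<le> u \<and> u \<le> 3/4"
      then have "p t \<in> (\<Union>i<n. edge G i ` {1/4..3/4})" using 2 by (intro UN_I [of j]) auto
      then show False using pt by (simp add: region_def)
    qed
    then have "slide 1 u = 0 \<or> slide 1 u = 1"
      unfolding slide_def squeeze_def by (auto simp: not_le)
    moreover have "collapse (1, p t) = edge G j (slide 1 u)" using 2 by (simp add: collapse_edge)
    ultimately show ?thesis using edge_ends [OF 2(1)] by auto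
  qed simp
qed

lemma inner_param:
  fixes p :: "real \<Rightarrow> 'a"
  assumes c: "continuous_on {a..b} p" and ab: "a \<le> b" and p: "p ` {a..b} \<subseteq> region (verts G) {}"
  shows "\<exists>j u. j < n \<and> continuous_on {a..b} u \<and> (\<forall>t\<in>{a..b}. 0 < u t \<and> u t < 1 \<and> p t = edge G j (u t))"
proof -
  have "connected (p ` {a..b})" using c by (intro connected_continuous_image) auto
  moreover have "p ` {a..b} \<subseteq> S" "p ` {a..b} \<inter> verts G = {}" using p by (auto simp: region_def)
  moreover have "p a \<in> p ` {a..b}" using ab by (intro imageI) simp
  ultimately obtain j where j: "j < n" "p ` {a..b} \<subseteq> edge G j ` {0<..<1}"
    using connected_in_edge by blast
  then show ?thesis using edge_param [OF c j] by blast
qed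

text \<open>After the collapse each small part of the path either rests at a vertex or moves inside
  one closed edge, and both preserve the \<open>walk\<close> property.\<close>

theorem path_normal:
  assumes p: "gpath p" "pathstart p \<in> verts G" "pathfinish p \<in> verts G"
  shows "normal p"
proof -
  have pS: "p t \<in> S" if "t \<in> {0..1}" for t using p(1) that by (auto simp: path_image_def)
  have pc: "continuous_on {0..1} p" using p(1) by (simp add: path_def)
  define y where "y t = collapse (1, p t)" for t
  have hy: "homotopic_paths S p y" unfolding y_def by (rule homotopic_collapse [OF p])
  then have gy: "gpath y" using homotopic_paths_imp_path homotopic_paths_imp_subset by blast
  have y0: "y 0 \<in> verts G" "y 1 \<in> verts G" using p by (auto simp: y_def pathstart_def pathfinish_def)
  \<comment> \<open>A part of \<open>p\<close> in \<open>U1\<close> avoids the middle halves, so its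
    collapse consists of vertices; a part in \<open>U2\<close> avoids the vertices and stays in one
    edge. Below, \<open>\<delta>\<close> is a Lebesgue number of this cover.\<close>
  define U1 where "U1 = region {} {1/4..3/4}"
  define U2 where "U2 = region (verts G) {}"
  have op: "openin (top_of_set S) U1" "openin (top_of_set S) U2"
    unfolding U1_def U2_def by (rule openin_region; simp)+
  obtain T1 where T1: "open T1" "{0..1} \<inter> p -` U1 = {0..1} \<inter> T1"
    using continuous_openin_preimage [OF pc _ op(1)] pS by (auto simp: openin_open)
  obtain T2 where T2: "open T2" "{0..1} \<inter> p -` U2 = {0..1} \<inter> T2"
    using continuous_openin_preimage [OF pc _ op(2)] pS by (auto simp: openin_open)
  have sub: "{0..1} \<subseteq> \<Union>{T1, T2}"
  proof
    fix t :: real assume t: "t \<in> {0..1}"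
    have "p t \<in> U1 \<or> p t \<in> U2"
    proof (cases "p t \<in> verts G")
      case True
      have "p t \<noteq> edge G i u" if iu: "i < n" "u \<in> {1/4..3/4}" for i u
      proof
        assume "p t = edge G i u"
        moreover have "0 < u" "u < 1" using iu(2) by simp_all
        ultimately show False using edge_interior [OF iu(1)] True by metis
      qed
      then have "p t \<notin> (\<Union>i<n. edge G i ` {1/4..3/4})" by blast
      then show ?thesis using pS [OF t] by (simp add: U1_def region_def)
    next
      case False
      then show ?thesis using pS [OF t] by (simp add: U2_def region_def)
    qed
    then have "t \<in> {0..1} \<inter> p -` U1 \<or> t \<in> {0..1} \<inter> p -` U2" using t by simp
    then show "t \<in> \<Union>{T1, T2}" unfolding T1(2) T2(2) by blast
  qed
  have opn: "open B" if "B \<in> {T1, T2}" for B using that T1(1) T2(1) by blast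
  obtain \<delta> where \<delta>: "\<delta> > 0" "\<And>t. t \<in> {0..1} \<Longrightarrow> \<exists>B\<in>{T1, T2}. ball t \<delta> \<subseteq> B"
    using Heine_Borel_lemma [OF compact_Icc sub opn] by blast
  obtain N where N: "real N > 1 / \<delta>" using reals_Archimedean2 by blast
  have "0 < 1 / \<delta>" using \<delta>(1) by simp
  then have "0 < real N" using N by linarith
  then have N0: "N > 0" by simp
  have "walk (subp 0 (real i / real N) y)" if "i \<le> N" for i
    using that
  proof (induction i)
    case 0
    have "subp 0 0 y = (\<lambda>_. y 0)" by (simp add: subp_def)
    then show ?case using normal_const y0 by (simp add: walk_def)
  next
    case (Suc i)
    define a b where "a = real i / real N" and "b = real (Suc i) / real N"
    have ab: "0 \<le> a" "a \<le> b" "b \<le> 1" using Suc.prems N0 by (auto simp: a_def b_def divide_right_mono)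
    have "b - a = 1 / real N" by (simp add: a_def b_def diff_divide_distrib [symmetric])
    moreover have "1 / real N < \<delta>" using N \<delta>(1) N0 by (simp add: field_simps)
    ultimately have "b - a < \<delta>" by simp
    then have abB: "{a..b} \<subseteq> ball a \<delta>" unfolding ball_def dist_real_def by auto
    have IH: "walk (subp 0 a y)" using Suc by (simp add: a_def)
    have "walk (subp 0 a y +++ subp a b y)"
    proof -
      have "a \<in> {0..1}" using ab by simp
      then obtain B where "B = T1 \<or> B = T2" "ball a \<delta> \<subseteq> B" using \<delta>(2) by blast
      then have B: "{a..b} \<subseteq> T1 \<or> {a..b} \<subseteq> T2" using abB by blast
      have sub01: "{a..b} \<subseteq> {0..1}" using ab by auto
      have cab: "continuous_on {a..b} p" using continuous_on_subset [OF pc sub01] .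
      have cy: "continuous_on {a..b} y" using continuous_on_subset [of "{0..1}" y, OF _ sub01] gy unfolding path_def by blast
      have g0: "gpath (subp a b y)" "pathfinish (subp 0 a y) = pathstart (subp a b y)"
        using gpath_subp [OF gy ab] by (simp_all add: subp_ends)
      have in': "a + (b - a) * t \<in> {a..b}" if "t \<in> {0..1}" for t using subp_in [OF ab, of t] that by simp
      from B show ?thesis
      proof
        assume "{a..b} \<subseteq> T1"
        then have U: "p ` {a..b} \<subseteq> U1" using T1(2) sub01 by blast
        have yv: "y ` {a..b} \<subseteq> verts G"
          unfolding y_def by (rule collapse_outer [OF U [unfolded U1_def]])
        have "subp a b y t = y a" if "t \<in> {0..1}" for t
          unfolding subp_def by (rule finite_image_const [OF cy yv]) (use in' [OF that] in simp_all)
        then have "subp a b y t = pathstart (subp a b y)" if "t \<in> {0..1}" for t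
          using that by (simp add: subp_ends)
        then show ?thesis by (rule walk_const_step [OF IH g0])
      next
        assume "{a..b} \<subseteq> T2"
        then have U: "p ` {a..b} \<subseteq> U2" using T2(2) sub01 by blast
        then obtain j u where j: "j < n" and u: "continuous_on {a..b} u"
            "\<And>t. t \<in> {a..b} \<Longrightarrow> 0 < u t \<and> u t < 1 \<and> p t = edge G j (u t)"
          using inner_param [OF cab ab(2)] unfolding U2_def by blast
        define w where "w t = squeeze (u (a + (b - a) * t))" for t
        have "continuous_on {0..1} (\<lambda>t. u (a + (b - a) * t))"
        proof (rule continuous_on_compose2 [OF u(1)])
          show "(\<lambda>t. a + (b - a) * t) ` {0..1} \<subseteq> {a..b}" using in' by (rule image_subsetI)
        qed (intro continuous_intros)
        then have "path w"
          unfolding path_def w_def squeeze_def by (intro continuous_intros)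
        moreover have "path_image w \<subseteq> {0..1}"
          unfolding path_image_def w_def using squeeze_01 by (intro image_subsetI) simp
        moreover have "subp a b y t = edge G j (w t)" if "t \<in> {0..1}" for t
          using u(2) [OF in' [OF that]] collapse_edge [OF j, of _ 1] unfolding subp_def y_def w_def
          by (simp add: slide_def)
        ultimately show ?thesis by (rule walk_edge_step [OF IH g0 j, where u = w])
      qed
    qed
    then show ?case using walk_homotopic [OF _ subp_join [OF gy ab]] by (simp add: b_def)
  qed
  from this [of N] have "walk (subp 0 1 y)" using N0 by simp
  moreover have "subp 0 1 y = y" by (simp add: subp_def)
  ultimately have "normal y" using walk_normal y0 by (simp add: pathfinish_def)
  then show ?thesis using normal_homotopic hy homotopic_paths_sym by blast
qed

text \<open>Paths with equal ends and equal reduced words are homotopic to the same edge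
  path.\<close>

theorem homotopic_iff_W:
  assumes p: "gpath p" "gpath q" "pathstart p = pathstart q" "pathfinish p = pathfinish q"
    and v: "pathstart p \<in> verts G" "pathfinish p \<in> verts G"
  shows "homotopic_paths S p q \<longleftrightarrow> W p = W q"
proof
  assume "W p = W q"
  moreover have "normal p" "normal q" using path_normal assms by auto
  ultimately show "homotopic_paths S p q"
    unfolding normal_def using p(4) by (metis homotopic_paths_sym homotopic_paths_trans)
qed (rule homotopic_W)

end

lemma tendsto_Icc_ends:
  fixes f :: "real \<Rightarrow> 'a::topological_space"
  assumes "continuous_on {a..b} f" "a < b"
  shows "(f \<longlongrightarrow> f a) (at_right a)" "(f \<longlongrightarrow> f b) (at_left b)"
proof -
  have "(f \<longlongrightarrow> f a) (at a within {a..b})" "(f \<longlongrightarrow> f b) (at b within {a..b})"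
    using assms by (auto simp: continuous_on_def)
  then show "(f \<longlongrightarrow> f a) (at_right a)" "(f \<longlongrightarrow> f b) (at_left b)"
    using at_within_Icc_at_right [OF assms(2)] at_within_Icc_at_left [OF assms(2)] by simp_all
qed

lemma agree_at_ends:
  fixes f k :: "real \<Rightarrow> 'a::t2_space"
  assumes f: "continuous_on {a..b} f" and k: "continuous_on {a..b} k" and ab: "a < b"
    and eq: "\<And>t. t \<in> {a<..<b} \<Longrightarrow> f t = k t" and t: "t \<in> {a..b}"
  shows "f t = k t"
proof -
  have "\<forall>\<^sub>F t in at_right a. f t = k t"
    unfolding eventually_at_right [OF ab] using eq ab by (intro exI [of _ b]) simp
  then have "(k \<longlongrightarrow> f a) (at_right a)" using tendsto_Icc_ends(1) [OF f ab] by (rule tendsto_cong [THEN iffD1])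
  then have fa: "f a = k a"
    using tendsto_Icc_ends(1) [OF k ab] by (rule tendsto_unique [OF trivial_limit_at_right_real])
  have "\<forall>\<^sub>F t in at_left b. f t = k t"
    unfolding eventually_at_left [OF ab] using eq ab by (intro exI [of _ a]) simp
  then have "(k \<longlongrightarrow> f b) (at_left b)" using tendsto_Icc_ends(2) [OF f ab] by (rule tendsto_cong [THEN iffD1])
  then have fb: "f b = k b"
    using tendsto_Icc_ends(2) [OF k ab] by (rule tendsto_unique [OF trivial_limit_at_left_real])
  consider "t = a" | "t = b" | "t \<in> {a<..<b}" using t by fastforce
  then show ?thesis using fa fb eq by cases simp_all
qed

section \<open>Locally injective paths are edge paths\<close>

context fin_graph
begin

definition loc_inj :: "(real \<Rightarrow> 'b) \<Rightarrow> real \<Rightarrow> real \<Rightarrow> bool" where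
  "loc_inj f a b \<longleftrightarrow> (\<forall>z. a < z \<longrightarrow> z < b \<longrightarrow> (\<exists>e>0. {z - e<..<z + e} \<subseteq> {a<..<b} \<and> inj_on f {z - e<..<z + e}))"

lemma loc_inj_subset:
  assumes "loc_inj f a b" "a \<le> c" "d \<le> b" shows "loc_inj f c d"
  unfolding loc_inj_def
proof (intro allI impI)
  fix z assume z: "c < z" "z < d"
  then obtain e where e: "e > 0" "inj_on f {z - e<..<z + e}"
    using assms unfolding loc_inj_def by (meson le_less_trans less_le_trans)
  define e' where "e' = min e (min (z - c) (d - z))"
  have "{z - e'<..<z + e'} \<subseteq> {z - e<..<z + e}" "{z - e'<..<z + e'} \<subseteq> {c<..<d}" by (auto simp: e'_def)
  moreover have "e' > 0" using e z by (simp add: e'_def)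
  ultimately show "\<exists>e>0. {z - e<..<z + e} \<subseteq> {c<..<d} \<and> inj_on f {z - e<..<z + e}"
    using e(2) inj_on_subset by blast
qed

lemma loc_inj_edge:
  assumes i: "i < n" and k: "locally_injective_on (open_edge G i) k"
  shows "loc_inj (k \<circ> edge G i) 0 1"
  unfolding loc_inj_def
proof (intro allI impI)
  fix z :: real assume z: "0 < z" "z < 1"
  have "edge G i z \<in> open_edge G i" using z unfolding open_edge_def by (intro imageI) simp
  then obtain U where U: "openin (top_of_set (open_edge G i)) U" "edge G i z \<in> U" "inj_on k U"
    using k unfolding locally_injective_on_def by blast
  have "continuous_on {0<..<1} (edge G i)" by (rule continuous_on_subset [OF edge_cont [OF i]]) auto
  then have "openin (top_of_set {0<..<1}) ({0<..<1} \<inter> edge G i -` U)"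
    using continuous_openin_preimage [of "{0<..<1}" "edge G i" "open_edge G i" U] U(1) by (auto simp: open_edge_def)
  then have "open ({0<..<1} \<inter> edge G i -` U)" by (rule openin_open_trans) simp
  moreover have "z \<in> {0<..<1} \<inter> edge G i -` U" using z U(2) by simp
  ultimately obtain e where e: "e > 0" "ball z e \<subseteq> {0<..<1} \<inter> edge G i -` U"
    unfolding open_contains_ball by blast
  have b: "{z - e<..<z + e} \<subseteq> {0<..<1} \<inter> edge G i -` U" using e(2) by (simp add: ball_eq_greaterThanLessThan)
  have "inj_on (edge G i) {z - e<..<z + e}"
    using fin i b unfolding finite_graph_def by (meson inj_on_subset le_inf_iff)
  moreover have "inj_on k (edge G i ` {z - e<..<z + e})" by (rule inj_on_subset [OF U(3)]) (use b in blast)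
  ultimately have "inj_on (k \<circ> edge G i) {z - e<..<z + e}" by (rule comp_inj_on)
  then show "\<exists>e>0. {z - e<..<z + e} \<subseteq> {0<..<1} \<and> inj_on (k \<circ> edge G i) {z - e<..<z + e}"
    using e(1) b by blast
qed

lemma oriented_interior: "fst d < n \<Longrightarrow> 0 < t \<Longrightarrow> t < 1 \<Longrightarrow> oriented_edge G d t \<notin> verts G"
  using edge_interior [of "fst d" t] edge_interior [of "fst d" "1 - t"]
  by (auto simp: oriented_edge_def reversepath_def)

lemma closed_oriented_part:
  assumes "fst d < n" "0 \<le> l" "r \<le> 1" shows "closed (oriented_edge G d ` {l..r})"
proof -
  have "continuous_on {l..r} (oriented_edge G d)"
    using gpath_oriented [OF assms(1)] assms(2,3) unfolding path_def
    by (metis atLeastatMost_subset_iff continuous_on_subset)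
  then show ?thesis by (intro compact_imp_closed compact_continuous_image) auto
qed

text \<open>Between the two vertex times the path stays in one open edge, and local injectivity
  makes its parameter strictly monotone. Towards the ends the parameter comes arbitrarily close to 0
  and 1, for otherwise an end point of the path would be interior to the edge.\<close>

lemma piece_exists:
  assumes f: "good_on f a b" and ab: "a < b" and v: "f a \<in> verts G" "f b \<in> verts G"
    and nv: "\<And>t. t \<in> {a<..<b} \<Longrightarrow> f t \<notin> verts G" and li: "loc_inj f a b"
  shows "\<exists>d. piece f a b d"
proof -
  let ?I = "{a<..<b}"
  have cf: "continuous_on {a..b} f" using f by (simp add: good_on_def)
  have cI: "continuous_on ?I f" by (rule continuous_on_subset [OF cf]) auto
  have "connected (f ` ?I)" using cI by (intro connected_continuous_image) auto
  moreover have "f ` ?I \<subseteq> S"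
  proof (rule image_subsetI)
    fix t assume "t \<in> ?I"
    then have "t \<in> {a..b}" by simp
    then show "f t \<in> S" using f unfolding good_on_def by blast
  qed
  moreover have "f ` ?I \<inter> verts G = {}" using nv by blast
  moreover have "f ((a + b) / 2) \<in> f ` ?I" using ab by (intro imageI) simp
  ultimately obtain j where j: "j < n" "f ` ?I \<subseteq> edge G j ` {0<..<1}" using connected_in_edge by blast
  obtain u where u: "continuous_on ?I u" "\<And>t. t \<in> ?I \<Longrightarrow> 0 < u t \<and> u t < 1 \<and> f t = edge G j (u t)"
    using edge_param [OF cI j] by blast
  have "inj_on u ?I"
  proof (rule locally_inj_interval [OF u(1)])
    fix z assume "a < z" "z < b"
    then obtain e where e: "e > 0" "{z - e<..<z + e} \<subseteq> ?I" "inj_on f {z - e<..<z + e}"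
      using li unfolding loc_inj_def by blast
    have "inj_on u {z - e<..<z + e}"
    proof (rule inj_onI)
      fix s t assume st: "s \<in> {z - e<..<z + e}" "t \<in> {z - e<..<z + e}" "u s = u t"
      then have "f s = f t" using u(2) [of s] u(2) [of t] e(2) by (metis subsetD)
      then show "s = t" using inj_onD [OF e(3)] st by blast
    qed
    then show "\<exists>e>0. {z - e<..<z + e} \<subseteq> ?I \<and> inj_on u {z - e<..<z + e}" using e by blast
  qed
  then have mono: "strict_mono_on ?I u \<or> strict_mono_on ?I (\<lambda>x. - u x)" by (rule inj_interval_mono [OF u(1)])
  have "\<exists>d w. fst d < n \<and> continuous_on ?I w \<and> strict_mono_on ?I w \<and>
      (\<forall>t\<in>?I. 0 < w t \<and> w t < 1 \<and> f t = oriented_edge G d (w t))"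
    using mono
  proof
    assume "strict_mono_on ?I u"
    then show ?thesis using u j(1)
      by (intro exI [of _ "(j, True)"] exI [of _ u]) (simp add: oriented_edge_def)
  next
    assume "strict_mono_on ?I (\<lambda>x. - u x)"
    then have "strict_mono_on ?I (\<lambda>t. 1 - u t)" by (simp add: strict_mono_on_def)
    moreover have "continuous_on ?I (\<lambda>t. 1 - u t)" using u(1) by (intro continuous_intros)
    ultimately show ?thesis using u(2) j(1)
      by (intro exI [of _ "(j, False)"] exI [of _ "\<lambda>t. 1 - u t"]) (simp add: oriented_edge_def reversepath_def)
  qed
  then obtain d w where d: "fst d < n" and w: "continuous_on ?I w" "strict_mono_on ?I w"
      and wf: "\<And>t. t \<in> ?I \<Longrightarrow> 0 < w t \<and> w t < 1 \<and> f t = oriented_edge G d (w t)" by blast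
  define c where "c = (a + b) / 2"
  have c: "a < c" "c < b" using ab by (simp_all add: c_def)
  have wm: "w s < w t" if "a < s" "s < t" "t < b" for s t using strict_mono_onD [OF w(2), of s t] that by simp
  have lo: "\<exists>t\<in>?I. w t < e" if e: "e > 0" for e
  proof (rule ccontr)
    assume "\<not> ?thesis"
    then have we: "e \<le> w t" if "t \<in> ?I" for t using that by (meson not_le)
    have "\<forall>\<^sub>F t in at_right a. f t \<in> oriented_edge G d ` {e..w c}"
      unfolding eventually_at_right [OF ab]
    proof (intro exI [of _ c] conjI allI impI)
      fix t assume t: "a < t" "t < c"
      then have "t \<in> ?I" using c by simp
      then show "f t \<in> oriented_edge G d ` {e..w c}"
        using wf [of t] we [of t] wm [of t c] t c by (intro image_eqI [of _ _ "w t"]) auto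
    qed (rule c)
    moreover have "w c < 1" using wf [of c] c by simp
    then have "closed (oriented_edge G d ` {e..w c})" using closed_oriented_part d e by simp
    ultimately have "f a \<in> oriented_edge G d ` {e..w c}"
      using tendsto_Icc_ends(1) [OF cf ab] Lim_in_closed_set trivial_limit_at_right_real by blast
    then show False using v(1) oriented_interior [OF d] e \<open>w c < 1\<close> by auto
  qed
  have hi: "\<exists>t\<in>?I. 1 - e < w t" if e: "e > 0" for e
  proof (rule ccontr)
    assume "\<not> ?thesis"
    then have we: "w t \<le> 1 - e" if "t \<in> ?I" for t using that by (meson not_le)
    have "\<forall>\<^sub>F t in at_left b. f t \<in> oriented_edge G d ` {w c..1 - e}"
      unfolding eventually_at_left [OF ab]
    proof (intro exI [of _ c] conjI allI impI)
      fix t assume t: "c < t" "t < b"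
      then have "t \<in> ?I" using c by simp
      then show "f t \<in> oriented_edge G d ` {w c..1 - e}"
        using wf [of t] we [of t] wm [of c t] t c by (intro image_eqI [of _ _ "w t"]) auto
    qed (rule c)
    moreover have "0 < w c" using wf [of c] c by simp
    then have "closed (oriented_edge G d ` {w c..1 - e})" using closed_oriented_part d e by simp
    ultimately have "f b \<in> oriented_edge G d ` {w c..1 - e}"
      using tendsto_Icc_ends(2) [OF cf ab] Lim_in_closed_set trivial_limit_at_left_real by blast
    then show False using v(2) oriented_interior [OF d] e \<open>0 < w c\<close> by auto
  qed
  define h where "h = (\<lambda>t. if t \<le> a then 0 else if b \<le> t then 1 else w t)"
  have w01: "0 < w t \<and> w t < 1" if "t \<in> ?I" for t using wf [OF that] by blast
  have H: "continuous_on {a..b} h" "strict_mono_on {a..b} h" "h a = 0" "h b = 1"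
    unfolding h_def by (rule strict_mono_extend [OF ab w]; (rule w01 lo hi; assumption))+
  have "continuous_on {a..b} (\<lambda>t. oriented_edge G d (h t))"
  proof (rule continuous_on_compose2 [OF _ H(1)])
    show "continuous_on {0..1} (oriented_edge G d)" using gpath_oriented [OF d] by (simp add: path_def)
    show "h ` {a..b} \<subseteq> {0..1}" using mono_range [OF H(2-4) _ ab] by (intro image_subsetI) simp
  qed
  then have "f t = oriented_edge G d (h t)" if "t \<in> {a..b}" for t
    using agree_at_ends [OF cf _ ab _ that, of "\<lambda>t. oriented_edge G d (h t)"] wf by (simp add: h_def)
  then have "piece f a b d" unfolding piece_def using d ab H by blast
  then show ?thesis ..
qed

text \<open>At a backtrack the edge parameter turns round, so arbitrarily near times on the two
  sides of the turning time share a point.\<close>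

lemma seg_reduced:
  assumes w: "seg p 0 w 1" and li: "loc_inj p 0 1" shows "reduced_word w"
proof (rule ccontr)
  assume "\<not> reduced_word w"
  then obtain l where l: "Suc l < length w" "w ! Suc l = flip (w ! l)"
    unfolding reduced_word_def successively_conv_nth by blast
  define d where "d = w ! l"
  have "w = take l w @ [d, flip d] @ drop (Suc (Suc l)) w"
    using l by (simp add: d_def Cons_nth_drop_Suc id_take_nth_drop flip: l(2))
  then obtain x y where "seg p 0 (take l w) x" "seg p x [d, flip d] y" "seg p y (drop (Suc (Suc l)) w) 1"
    using w by (metis seg_append)
  then obtain c where c: "piece p x c d" "piece p c y (flip d)" and xy: "0 \<le> x" "y \<le> 1" by (auto dest: seg_le)
  obtain h where h: "x < c" "continuous_on {x..c} h" "strict_mono_on {x..c} h" "h x = 0" "h c = 1"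
      "\<And>t. t \<in> {x..c} \<Longrightarrow> p t = oriented_edge G d (h t)" using c(1) unfolding piece_def by blast
  obtain k where k: "c < y" "continuous_on {c..y} k" "strict_mono_on {c..y} k" "k c = 0" "k y = 1"
      "\<And>t. t \<in> {c..y} \<Longrightarrow> p t = oriented_edge G (flip d) (k t)" using c(2) unfolding piece_def by blast
  obtain e where e: "e > 0" "inj_on p {c - e<..<c + e}"
    using li h(1) k(1) xy unfolding loc_inj_def by (meson le_less_trans less_le_trans)
  define s t where "s = max x (c - e/2)" and "t = min y (c + e/2)"
  have st: "x \<le> s" "s < c" "c < t" "t \<le> y" "c - e < s" "t < c + e" using e h(1) k(1) by (auto simp: s_def t_def)
  define u where "u = (\<lambda>r. if r \<le> c then h r else 1 - k r)"
  have "continuous_on ({s..c} \<union> {c..t}) u"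
    unfolding u_def
  proof (rule continuous_on_cases)
    show "continuous_on {s..c} h" by (rule continuous_on_subset [OF h(2)]) (use st in auto)
    have "continuous_on {c..t} k" by (rule continuous_on_subset [OF k(2)]) (use st in auto)
    then show "continuous_on {c..t} (\<lambda>r. 1 - k r)" by (intro continuous_intros)
  qed (use h k in auto)
  moreover have "{s..c} \<union> {c..t} = {s..t}" using st by auto
  ultimately have "continuous_on {s..t} u" by simp
  moreover have "u r \<le> u c" if "r \<in> {s..t}" for r
  proof (cases "r \<le> c")
    case True
    then show ?thesis using mono_range(2) [OF h(3-5) _ h(1), of r] that st h(5) by (simp add: u_def)
  next
    case False
    then show ?thesis using mono_range(1) [OF k(3-5) _ k(1), of r] that st h(5) by (simp add: u_def)
  qed
  ultimately obtain r r' where r: "s \<le> r" "r < r'" "r' \<le> t" "u r = u r'"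
    using real_max_fold st by blast
  have "p q = oriented_edge G d (u q)" if "q \<in> {s..t}" for q
    using h(6) [of q] k(6) [of q] that st by (simp add: u_def oriented_flip reversepath_def)
  then have "p r = p r'" using r by simp
  then have "r = r'" using inj_onD [OF e(2)] r st by simp
  then show False using r by simp
qed

text \<open>The point is finiteness of the subdivision. Each passage between vertex times crosses
  the midpoint of an edge, and the compact set \<open>Z\<close> of vertex times has positive
  distance from the closed set \<open>M\<close> of midpoint times.\<close>

theorem seg_exists:
  assumes f: "good_on f 0 1" and v: "f 0 \<in> verts G" "f 1 \<in> verts G" and li: "loc_inj f 0 1"
  shows "\<exists>w. seg f 0 w 1"
proof -
  define Z where "Z = {0..1} \<inter> f -` verts G"
  define M where "M = {0..1} \<inter> f -` ((\<lambda>i. edge G i (1/2)) ` {..<n})"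
  have cf: "continuous_on {0..1} f" using f by (simp add: good_on_def)
  have cl: "closed Z" "closed M" unfolding Z_def M_def
    by (rule continuous_closed_preimage [OF cf closed_atLeastAtMost]; simp add: finite_imp_closed finite_verts)+
  have cZ: "compact Z" using cl(1) closed_Int_compact [of Z "{0..1}"] by (simp add: Z_def Int_absorb2)
  have "Z \<inter> M = {}" using edge_interior [of _ "1/2"] by (auto simp: Z_def M_def)
  then obtain \<delta> where \<delta>: "\<delta> > 0" "\<And>x y. x \<in> Z \<Longrightarrow> y \<in> M \<Longrightarrow> \<delta> \<le> dist x y"
    using separate_compact_closed [OF cZ cl(2)] by blast
  have Z01: "0 \<in> Z" "1 \<in> Z" using v by (auto simp: Z_def)
  have Zi: "z \<in> {0..1}" "f z \<in> verts G" if "z \<in> Z" for z using that by (auto simp: Z_def)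
  have gap: "\<exists>a b d. a \<in> Z \<and> b \<in> Z \<and> a < t \<and> t < b \<and> a + \<delta> \<le> b \<and> (\<forall>z\<in>Z. z \<le> a \<or> b \<le> z) \<and> piece f a b d"
    if t: "t \<in> {0..1}" "t \<notin> Z" for t
  proof -
    define A B where "A = Z \<inter> {0..t}" and "B = Z \<inter> {t..1}"
    have AB: "closed A" "closed B" "A \<noteq> {}" "B \<noteq> {}" "bdd_above A" "bdd_below B"
      using cl(1) Z01 t by (auto simp: A_def B_def intro!: closed_Int bdd_belowI [of _ t] bdd_aboveI [of _ t])
    define a b where "a = Sup A" and "b = Inf B"
    have a: "a \<in> A" unfolding a_def using closed_contains_Sup AB by blast
    have b: "b \<in> B" unfolding b_def using closed_contains_Inf AB by blast
    have at: "a < t" "t < b" using a b t by (auto simp: A_def B_def less_le)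
    have zz: "z \<le> a \<or> b \<le> z" if z: "z \<in> Z" for z
    proof (cases "z \<le> t")
      case True
      then have "z \<in> A" using z Zi by (auto simp: A_def)
      then show ?thesis unfolding a_def using cSup_upper AB by blast
    next
      case False
      then have "z \<in> B" using z Zi by (auto simp: B_def)
      then show ?thesis unfolding b_def using cInf_lower AB by blast
    qed
    have abZ: "a \<in> Z" "b \<in> Z" using a b by (auto simp: A_def B_def)
    then have ab01: "0 \<le> a" "b \<le> 1" using Zi by auto
    have "\<exists>d. piece f a b d"
    proof (rule piece_exists)
      show "good_on f a b" using good_on_subset f ab01 by blast
      show "loc_inj f a b" using loc_inj_subset li ab01 by blast
      show "f t \<notin> verts G" if "t \<in> {a<..<b}" for t
      proof
        assume "f t \<in> verts G"
        then have "t \<in> Z" using that ab01 by (simp add: Z_def)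
        then show False using zz [of t] that by simp
      qed
    qed (use at abZ Zi in auto)
    then obtain d where d: "piece f a b d" by blast
    then obtain h where h: "fst d < n" "a < b" "continuous_on {a..b} h" "strict_mono_on {a..b} h" "h a = 0" "h b = 1"
      "\<And>t. t \<in> {a..b} \<Longrightarrow> f t = oriented_edge G d (h t)" unfolding piece_def by blast
    obtain m where m: "a \<le> m" "m \<le> b" "h m = 1/2" using IVT' [of h a "1/2" b] h by auto
    have "f m = oriented_edge G d (1/2)" using h(7) [of m] m by simp
    then have "f m = edge G (fst d) (1/2)" by (simp add: oriented_edge_def reversepath_def)
    then have "m \<in> M" using m ab01 h(1) unfolding M_def by auto
    then have "\<delta> \<le> dist a m" using \<delta>(2) abZ by blast
    then have "a + \<delta> \<le> b" using m by (simp add: dist_real_def)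
    then show ?thesis using abZ at zz d by blast
  qed
  \<comment> \<open>By local injectivity \<open>Z\<close> contains no interval, so a full passage
    lies between any two vertex times.\<close>
  have sep: "z + \<delta> \<le> z'" if z: "z \<in> Z" "z' \<in> Z" "z < z'" for z z'
  proof -
    have "\<exists>t\<in>{z..z'}. t \<notin> Z"
    proof (rule ccontr)
      assume "\<not> ?thesis"
      then have zz: "f ` {z..z'} \<subseteq> verts G" using Zi by blast
      define m where "m = (z + z') / 2"
      have m: "z < m" "m < z'" using z by (simp_all add: m_def)
      have czz: "continuous_on {z..z'} f" by (rule continuous_on_subset [OF cf]) (use z Zi in force)
      have const: "f t = f z" if "t \<in> {z..z'}" for t
        by (rule finite_image_const [OF czz zz]) (use that in simp_all)
      have "0 < m" "m < 1" using m Zi(1) [OF z(1)] Zi(1) [OF z(2)] by auto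
      then obtain e where e: "e > 0" "inj_on f {m - e<..<m + e}" using li unfolding loc_inj_def by blast
      define m' where "m' = min z' (m + e / 2)"
      have "m' \<in> {m - e<..<m + e}" "m \<in> {m - e<..<m + e}" "m' \<in> {z..z'}" "m \<in> {z..z'}" "m < m'"
        using e m by (auto simp: m'_def)
      then show False using inj_onD [OF e(2), of m m'] const [of m, symmetric] const [of m', symmetric] by (metis less_irrefl)
    qed
    then obtain t where t: "t \<in> {z..z'}" "t \<notin> Z" by blast
    then have "t \<in> {0..1}" using Zi(1) [OF z(1)] Zi(1) [OF z(2)] by simp
    then obtain a b where ab: "a < t" "t < b" "a + \<delta> \<le> b" "\<forall>z\<in>Z. z \<le> a \<or> b \<le> z" using gap t by blast
    then have "z \<le> a" "b \<le> z'" using z t by force+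
    then show ?thesis using ab by simp
  qed
  have "z \<in> Z \<Longrightarrow> z \<le> real k * \<delta> \<Longrightarrow> \<exists>w. seg f 0 w z" for k z
  proof (induction k arbitrary: z)
    case 0
    then have "z = 0" using Zi by force
    then show ?case by (intro exI [of _ "[]"]) simp
  next
    case (Suc k)
    show ?case
    proof (cases "z = 0")
      case True
      then show ?thesis by (intro exI [of _ "[]"]) simp
    next
      case False
      then have z: "0 < z" "z \<le> 1" using Zi Suc.prems(1) by force+
      define t where "t = max (z / 2) (z - \<delta> / 2)"
      have t: "0 < t" "t < z" "z < t + \<delta>" using z \<delta>(1) by (auto simp: t_def)
      have "t \<notin> Z" using sep [of t z] Suc.prems(1) t by auto
      then obtain a b d where ab: "a \<in> Z" "b \<in> Z" "a < t" "t < b" "a + \<delta> \<le> b" "\<forall>z\<in>Z. z \<le> a \<or> b \<le> z" "piece f a b d"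
        using gap [of t] t z by auto
      have "b \<le> z" using ab Suc.prems(1) t by force
      moreover have "\<not> b < z" using sep [of b z] ab Suc.prems(1) t by auto
      ultimately have bz: "b = z" by simp
      have "a \<le> real k * \<delta>" using Suc.prems(2) ab(5) bz by (simp add: algebra_simps)
      then obtain w where "seg f 0 w a" using Suc.IH ab(1) by blast
      then have "seg f 0 (w @ [d]) z" using ab(7) bz by (auto simp: seg_append)
      then show ?thesis ..
    qed
  qed
  moreover obtain k where "1 \<le> real k * \<delta>" using reals_Archimedean3 [OF \<delta>(1), THEN spec, of 1] by (auto intro: less_imp_le)
  ultimately show ?thesis using Z01(2) by blast
qed

end

section \<open>The rose\<close>

lemma cis_inj: "0 < s \<Longrightarrow> s < 1 \<Longrightarrow> 0 < t \<Longrightarrow> t < 1 \<Longrightarrow> cis (2 * pi * s) = cis (2 * pi * t) \<Longrightarrow> s = t"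
proof -
  assume st: "0 < s" "s < 1" "0 < t" "t < 1" and "cis (2 * pi * s) = cis (2 * pi * t)"
  then have "sin (2 * pi * s) = sin (2 * pi * t) \<and> cos (2 * pi * s) = cos (2 * pi * t)"
    by (simp add: complex_eq_iff)
  then obtain n :: int where "2 * pi * s = 2 * pi * t + 2 * pi * n" unfolding sin_cos_eq_iff by blast
  then have "2 * pi * s = 2 * pi * (t + n)" by (simp add: distrib_left)
  then have "s = t + n" by simp
  moreover from this have "real_of_int n < 1" "real_of_int n > -1" using st by linarith+
  then have "n = 0" by linarith
  ultimately show ?thesis by simp
qed

lemma cis_neq_1: "0 < t \<Longrightarrow> t < 1 \<Longrightarrow> cis (2 * pi * t) \<noteq> 1"
proof
  assume t: "0 < t" "t < 1" "cis (2 * pi * t) = 1"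
  then have "cos (2 * pi * t) = 1" by (simp add: complex_eq_iff)
  then obtain n :: int where "2 * pi * t = real_of_int n * 2 * pi" unfolding cos_one_2pi_int by blast
  then have "2 * pi * t = 2 * pi * n" by (simp add: mult_ac)
  then have "t = n" by simp
  then have "n < 1" "n > 0" using t by simp_all
  then show False by simp
qed

text \<open>The equation of the circle of radius \<open>R\<close> about \<open>R\<close>; through it
  a nonzero point determines its petal.\<close>

lemma petal_norm: "(cmod (of_nat R * (1 - cis a)))\<^sup>2 = 2 * real R * Re (of_nat R * (1 - cis a))"
proof -
  have "(cmod (1 - cis a))\<^sup>2 = (1 - cos a)\<^sup>2 + (sin a)\<^sup>2" by (simp add: cmod_power2)
  also have "\<dots> = 2 * (1 - cos a)" using sin_cos_squared_add3 [of a] by (simp add: power2_eq_square algebra_simps)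
  finally show ?thesis by (simp add: norm_mult power_mult_distrib power2_eq_square)
qed

lemma finite_graph_rose: "finite_graph (rose r)"
proof -
  let ?e = "\<lambda>i t. of_nat (i + 1) * (1 - cis (2 * pi * t))"
  have R: "(of_nat (i + 1) :: complex) \<noteq> 0" for i unfolding of_nat_eq_0_iff by simp
  have nz: "?e i t \<noteq> 0" if "t \<in> {0<..<1}" for i t
  proof
    assume "?e i t = 0"
    then have "cis (2 * pi * t) = 1" using R [of i] unfolding mult_eq_0_iff by (metis eq_iff_diff_eq_0)
    then show False using cis_neq_1 [of t] that by simp
  qed
  have cont: "path (?e i)" for i unfolding path_def cis_conv_exp by (intro continuous_intros)
  have inj: "inj_on (?e i) {0<..<1}" for i
  proof (rule inj_onI)
    fix s t :: real assume "s \<in> {0<..<1}" "t \<in> {0<..<1}" "?e i s = ?e i t"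
    moreover from this have "1 - cis (2 * pi * s) = 1 - cis (2 * pi * t)" using R [of i] mult_left_cancel by blast
    then have "cis (2 * pi * s) = cis (2 * pi * t)" by (metis diff_diff_eq2 add_diff_cancel_left' diff_add_cancel)
    ultimately show "s = t" using cis_inj [of s t] by simp
  qed
  have disj: "i = j" if st: "s \<in> {0<..<1}" "t \<in> {0<..<1}" and eq: "?e i s = ?e j t" for i j s t
  proof -
    have "2 * real (i + 1) * Re (?e i s) = 2 * real (j + 1) * Re (?e i s)"
      using petal_norm [of "i + 1" "2 * pi * s"] petal_norm [of "j + 1" "2 * pi * t"] unfolding eq by (rule subst)
    moreover have "Re (?e i s) \<noteq> 0"
    proof
      assume "Re (?e i s) = 0"
      then have "cmod (?e i s) = 0" using petal_norm [of "i + 1" "2 * pi * s"] by simp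
      then show False using nz st(1) unfolding norm_eq_zero by blast
    qed
    ultimately show ?thesis by simp
  qed
  have oe: "open_edge (rose r) i = ?e i ` {0<..<1}" for i by (simp add: open_edge_def rose_def)
  have "open_edge (rose r) i \<inter> {0} = {}" for i unfolding oe using nz by blast
  moreover have "open_edge (rose r) i \<inter> open_edge (rose r) j = {}" if "i \<noteq> j" for i j
  proof (rule ccontr)
    assume "\<not> ?thesis"
    then obtain z where z: "z \<in> ?e i ` {0<..<1}" "z \<in> ?e j ` {0<..<1}" unfolding oe by (auto simp only: disjoint_iff)
    obtain s where s: "s \<in> {0<..<1}" "z = ?e i s" using z(1) by (rule imageE)
    obtain t where t: "t \<in> {0<..<1}" "z = ?e j t" using z(2) by (rule imageE)
    have "i = j" by (rule disj [OF s(1) t(1)]) (use s t in simp)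
    then show False using that by blast
  qed
  ultimately show ?thesis
    unfolding finite_graph_def using cont inj by (auto simp: rose_def pathstart_def pathfinish_def)
qed

interpretation rose: fin_graph "rose r" for r by unfold_locales (rule finite_graph_rose)

lemma rose_simps: "verts (rose r) = {0}" "nedges (rose r) = r" "0 \<in> graph_space (rose r)"
  by (simp_all add: rose_def graph_space_def)

lemma rose_tl [simp]: "fst d < r \<Longrightarrow> rose.tl_v r d = 0"
  using rose.tl_v_verts [of d r] by (simp add: rose_simps)

lemma rose_ep: "fst ` set w \<subseteq> {..<r} \<Longrightarrow> epath r (rose.tl_v r) 0 w 0"
  by (induction w) auto

lemma rose_loop:
  assumes "fst ` set w \<subseteq> {..<r}"
  shows "path (rose_loop r w)" "path_image (rose_loop r w) \<subseteq> graph_space (rose r)"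
    "pathstart (rose_loop r w) = 0" "pathfinish (rose_loop r w) = 0" "rose.W r (rose_loop r w) = cls w"
proof -
  have "rose_loop r w = rose.word_path r 0 w" by (simp add: rose_loop_def rose.word_path_def)
  then show "path (rose_loop r w)" "path_image (rose_loop r w) \<subseteq> graph_space (rose r)"
    "pathstart (rose_loop r w) = 0" "pathfinish (rose_loop r w) = 0" "rose.W r (rose_loop r w) = cls w"
    using rose.word_path [where r = r and u = 0 and v = 0 and w = w] rose_ep [OF assms] by (simp_all add: rose_simps)
qed

section \<open>Reducible powers of outer automorphisms\<close>

lemma permutes_pow: "p permutes A \<Longrightarrow> (p ^^ j) permutes A"
  by (induction j) (simp_all add: permutes_id permutes_compose flip: id_def)

lemma permutes_return:
  assumes "p permutes {..<k :: nat}" "i < k" shows "\<exists>j>0. (p ^^ j) i = i"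
proof -
  have "range (\<lambda>j. (p ^^ j) i) \<subseteq> {..<k}"
    using assms by (intro image_subsetI) (metis lessThan_iff permutes_pow permutes_in_image)
  then have "finite (range (\<lambda>j. (p ^^ j) i))" by (rule finite_subset) simp
  then have "\<not> inj (\<lambda>j. (p ^^ j) i)" using finite_imageD infinite_UNIV_nat by blast
  then obtain a b where ab: "a < b" "(p ^^ a) i = (p ^^ b) i" unfolding inj_def by (metis linorder_neqE_nat)
  then have "(p ^^ a) ((p ^^ (b - a)) i) = (p ^^ a) i"
    by (metis funpow_add comp_apply le_add_diff_inverse less_imp_le)
  moreover have "inj (p ^^ a)" using permutes_inj [OF permutes_pow [OF assms(1)]] .
  ultimately have "(p ^^ (b - a)) i = i" by (rule injD [rotated])
  then show ?thesis using ab(1) by (intro exI [of _ "b - a"]) simp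
qed

context Group.group
begin

lemma Out_subset_auto: "\<phi> \<in> carrier (Out G) \<Longrightarrow> f \<in> \<phi> \<Longrightarrow> f \<in> auto G"
proof -
  assume "\<phi> \<in> carrier (Out G)" "f \<in> \<phi>"
  then have "\<phi> \<subseteq> carrier (AutoGroup G)"
    unfolding Out_def FactGroup_def
    using subgroup.rcosets_carrier [OF normal_imp_subgroup [OF normal_Inn] AutoGroup] by simp
  then show "f \<in> auto G" using \<open>f \<in> \<phi>\<close> by (auto simp: carrier_AutoGroup)
qed

lemma auto_pow:
  assumes f: "f \<in> auto G"
  shows "f ^^ k \<in> hom G G \<and> bij_betw (f ^^ k) (carrier G) (carrier G)"
proof (induction k)
  case 0
  then show ?case by (simp add: hom_def bij_betw_def)
next
  case (Suc k)
  have "f \<in> hom G G" "bij_betw f (carrier G) (carrier G)" using f by (auto simp: auto_def Bij_def)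
  then have "f \<circ> f ^^ k \<in> hom G G" "bij_betw (f \<circ> f ^^ k) (carrier G) (carrier G)"
    using Suc bij_betw_trans Group.hom_compose by blast+
  then show ?case by (simp only: funpow.simps)
qed

lemma auto_pow_restrict:
  assumes "f \<in> auto G" shows "restrict (f ^^ k) (carrier G) \<in> auto G"
proof -
  note f = auto_pow [OF assms, of k]
  have "restrict (f ^^ k) (carrier G) \<in> hom G G" by (rule hom_restrict [OF conjunct1 [OF f]]) simp
  moreover have "bij_betw (restrict (f ^^ k) (carrier G)) (carrier G) (carrier G)"
    by (rule bij_betw_cong [THEN iffD1, OF _ conjunct2 [OF f]]) simp
  ultimately show ?thesis by (simp add: auto_def Bij_def)
qed

lemma mult_Out: "A \<otimes>\<^bsub>Out G\<^esub> B = A <#>\<^bsub>AutoGroup G\<^esub> B"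
  by (simp add: Out_def FactGroup_def)

text \<open>Elements of \<open>auto G\<close> are extensional functions, so a power must be cut down
  to the carrier before it can lie in a coset.\<close>

lemma pow_in_Out:
  assumes \<phi>: "\<phi> \<in> carrier (Out G)" and f: "f \<in> \<phi>"
  shows "restrict (f ^^ k) (carrier G) \<in> \<phi> [^]\<^bsub>Out G\<^esub> k"
proof (induction k)
  case 0
  have "conjugation G \<one> = restrict (f ^^ 0) (carrier G)" by (auto simp: conjugation_def)
  moreover have "conjugation G \<one> \<in> Inn G" by (simp add: Inn_def)
  moreover have "\<phi> [^]\<^bsub>Out G\<^esub> (0::nat) = Inn G" by (simp add: Out_def FactGroup_def)
  ultimately show ?case by (simp only:)
next
  case (Suc k)
  have fa: "f \<in> auto G" using Out_subset_auto \<phi> f by blast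
  then have fc: "f x \<in> carrier G" if "x \<in> carrier G" for x using that by (auto simp: auto_def Bij_def bij_betw_def)
  have "restrict (f ^^ Suc k) (carrier G) = compose (carrier G) (restrict (f ^^ k) (carrier G)) f"
    using fc by (auto simp: compose_def funpow_swap1)
  also have "\<dots> = restrict (f ^^ k) (carrier G) \<otimes>\<^bsub>AutoGroup G\<^esub> f"
    using mult_AutoGroup [OF auto_pow_restrict [OF fa] fa] by simp
  also have "\<dots> \<in> (\<phi> [^]\<^bsub>Out G\<^esub> k) \<otimes>\<^bsub>Out G\<^esub> \<phi>"
    unfolding mult_Out set_mult_def using Suc f by blast
  also have "(\<phi> [^]\<^bsub>Out G\<^esub> k) \<otimes>\<^bsub>Out G\<^esub> \<phi> = \<phi> [^]\<^bsub>Out G\<^esub> Suc k"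
    by (simp add: nat_pow_def)
  finally show ?case .
qed

text \<open>The permutation returns to the factor \<open>F 0\<close> after \<open>j\<close> rounds,
  so \<open>f ^^ (k * j)\<close> preserves it up to conjugation. Its complement is nontrivial
  because \<open>F 0\<close> is proper.\<close>

lemma reducible_power_invariant_factor:
  assumes \<phi>: "\<phi> \<in> carrier (Out G)" and f: "f \<in> \<phi>" and k: "k > 0"
    and red: "reducible_out G (\<phi> [^]\<^bsub>Out G\<^esub> (k :: nat))"
  shows "\<exists>A K \<kappa> b. internal_free_product G UNIV (\<lambda>i. if i then A else K) (carrier G) \<and> A \<noteq> {\<one>} \<and> K \<noteq> {\<one>} \<and>
    \<kappa> > (0::nat) \<and> b \<in> carrier G \<and> (\<forall>a\<in>A. \<exists>a'\<in>A. (f ^^ \<kappa>) a = b \<otimes> a' \<otimes> inv b)"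
proof -
  obtain l :: nat and F \<pi> where l: "l > 0" and F: "\<And>i. i < l \<Longrightarrow> free_factor G (F i) \<and> F i \<noteq> {\<one>} \<and> F i \<noteq> carrier G"
    and \<pi>: "\<pi> permutes {..<l}"
    and conj: "\<And>i f'. i < l \<Longrightarrow> f' \<in> \<phi> [^]\<^bsub>Out G\<^esub> k \<Longrightarrow> conjugate_subgroups G (f' ` F i) (F (\<pi> i))"
    using red unfolding reducible_out_def by blast
  have fa: "f \<in> auto G" using Out_subset_auto \<phi> f by blast
  have fk: "f ^^ j \<in> hom G G" "\<And>x. x \<in> carrier G \<Longrightarrow> (f ^^ j) x \<in> carrier G" for j
    using auto_pow [OF fa, of j] by (auto simp: bij_betw_def)
  obtain K where K: "internal_free_product G UNIV (\<lambda>i. if i then F 0 else K) (carrier G)"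
    using F [OF l] unfolding free_factor_def by blast
  have sub: "F i \<subseteq> carrier G" if i: "i < l" for i
  proof -
    obtain L where "internal_free_product G UNIV (\<lambda>b. if b then F i else L) (carrier G)"
      using F [OF i] unfolding free_factor_def by blast
    then have "\<forall>b\<in>UNIV. subgroup (if b then F i else L) G" unfolding internal_free_product_def by blast
    from bspec [OF this, of True] show ?thesis by (simp add: subgroup.subset)
  qed
  have "K \<noteq> {\<one>}"
  proof
    assume "K = {\<one>}"
    have "\<forall>i\<in>UNIV. subgroup (if i then F 0 else K) G" and c: "carrier G = generate G (\<Union>i. if i then F 0 else K)"
      using K unfolding internal_free_product_def by blast+
    from bspec [OF this(1), of True] have s: "subgroup (F 0) G" by simp
    have "(\<Union>i. if i then F 0 else K) \<subseteq> F 0"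
      using subgroup.one_closed [OF s] \<open>K = {\<one>}\<close> by (auto split: if_splits)
    then have "carrier G \<subseteq> F 0" unfolding c using generate_subgroup_incl [OF _ s] by blast
    then show False using F [OF l] sub [OF l] by blast
  qed
  have "\<exists>c\<in>carrier G. \<forall>x\<in>F i. c \<otimes> (f ^^ (k * j)) x \<otimes> inv c \<in> F ((\<pi> ^^ j) i)" if "i < l" for i j
  proof (induction j)
    case 0
    show ?case using sub [OF that] by (intro bexI [of _ \<one>]) auto
  next
    case (Suc j)
    then obtain c where c: "c \<in> carrier G" "\<And>x. x \<in> F i \<Longrightarrow> c \<otimes> (f ^^ (k * j)) x \<otimes> inv c \<in> F ((\<pi> ^^ j) i)" by blast
    have i': "(\<pi> ^^ j) i < l" using that \<pi> by (metis lessThan_iff permutes_pow permutes_in_image)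
    obtain a where a: "a \<in> carrier G" "F (\<pi> ((\<pi> ^^ j) i)) = conjugation G a ` restrict (f ^^ k) (carrier G) ` F ((\<pi> ^^ j) i)"
      using conj [OF i' pow_in_Out [OF \<phi> f]] unfolding conjugate_subgroups_def by blast
    have "(a \<otimes> (f ^^ k) c) \<otimes> (f ^^ (k * Suc j)) x \<otimes> inv (a \<otimes> (f ^^ k) c) \<in> F (\<pi> ((\<pi> ^^ j) i))" if x: "x \<in> F i" for x
    proof -
      have xc: "x \<in> carrier G" using x sub \<open>i < l\<close> by blast
      let ?z = "(f ^^ (k * j)) x"
      interpret fh: group_hom G G "f ^^ k" by unfold_locales (rule fk)
      have "(f ^^ (k * Suc j)) x = (f ^^ k) ?z" by (simp add: funpow_add)
      then have "(a \<otimes> (f ^^ k) c) \<otimes> (f ^^ (k * Suc j)) x \<otimes> inv (a \<otimes> (f ^^ k) c) = a \<otimes> (f ^^ k) (c \<otimes> ?z \<otimes> inv c) \<otimes> inv a"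
        using a(1) c(1) fk(2) [OF xc] by (simp add: m_assoc inv_mult_group)
      also have "\<dots> \<in> F (\<pi> ((\<pi> ^^ j) i))"
        unfolding a(2)
        by (rule image_eqI [OF _ imageI [OF c(2) [OF x]]])
          (use fk(2) [OF xc] fk(2) c(1) in \<open>simp add: conjugation_def\<close>)
      finally show ?thesis .
    qed
    then show ?case using a(1) fk(2) [OF c(1)] by (intro bexI [of _ "a \<otimes> (f ^^ k) c"]) simp_all
  qed
  moreover obtain j where j: "j > 0" "(\<pi> ^^ j) 0 = 0" using permutes_return [OF \<pi> l] by blast
  ultimately obtain c where c: "c \<in> carrier G" "\<And>x. x \<in> F 0 \<Longrightarrow> c \<otimes> (f ^^ (k * j)) x \<otimes> inv c \<in> F 0"
    using l by (metis (no_types))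
  have "\<exists>a'\<in>F 0. (f ^^ (k * j)) a = inv c \<otimes> a' \<otimes> inv (inv c)" if "a \<in> F 0" for a
  proof (rule bexI [OF _ c(2) [OF that]])
    have "(f ^^ (k * j)) a \<in> carrier G" using fk(2) sub [OF l] that by blast
    then show "(f ^^ (k * j)) a = inv c \<otimes> (c \<otimes> (f ^^ (k * j)) a \<otimes> inv c) \<otimes> inv (inv c)"
      using c(1) by (simp add: m_assoc) (simp flip: m_assoc)
  qed
  then show ?thesis using K \<open>K \<noteq> {\<one>}\<close> F [OF l] k j(1) c(1)
    by (intro exI [of _ "F 0"] exI [of _ K] exI [of _ "k * j"] exI [of _ "inv c"]) simp
qed

end

section \<open>Maps of graphs acting on words\<close>

context fin_graph
begin

lemma path_from_vertex:
  assumes "x \<in> S" shows "\<exists>\<alpha>. gpath \<alpha> \<and> pathstart \<alpha> \<in> verts G \<and> pathfinish \<alpha> = x"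
proof -
  consider "x \<in> verts G" | i t where "i < n" "0 \<le> t" "t \<le> 1" "x = edge G i t"
    using assms by (auto simp: graph_space_def path_image_def)
  then show ?thesis
  proof cases
    case 1
    then show ?thesis using assms by (intro exI [of _ "\<lambda>_. x"]) (simp add: path_const)
  next
    case 2
    have "(\<lambda>s. s * t) ` {0..1} \<subseteq> {0..1}" using 2(2,3) by (auto intro: mult_nonneg_nonneg mult_le_one)
    moreover have "continuous_on {0..1} (\<lambda>s. s * t)" by (intro continuous_intros)
    ultimately have "continuous_on {0..1} (\<lambda>s. edge G i (s * t))" "(\<lambda>s. edge G i (s * t)) ` {0..1} \<subseteq> S"
      using gpath_edge [OF 2(1)] unfolding path_def path_image_def
      by (auto intro: continuous_on_compose2 simp: image_subset_iff)
    moreover have "edge G i 0 \<in> verts G" using edge_ends [OF 2(1)] by simp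
    ultimately show ?thesis using 2
      by (intro exI [of _ "\<lambda>s. edge G i (s * t)"]) (simp add: path_def path_image_def pathstart_def pathfinish_def)
  qed
qed

text \<open>Ends that are not vertices, such as those of a Nielsen path, are first joined to
  vertices by \<open>\<alpha>\<close> and \<open>\<beta>\<close>, and these tails are cancelled
  afterwards.\<close>

lemma homotopic_if_W:
  assumes p: "gpath p" and q: "gpath q" and ends: "pathstart p = pathstart q" "pathfinish p = pathfinish q"
    and W: "W p = W q"
  shows "homotopic_paths S p q"
proof -
  have "pathstart p \<in> S" "pathfinish p \<in> S" using p by (auto simp: path_image_def pathstart_def pathfinish_def)
  then obtain \<alpha> \<beta> where \<alpha>: "gpath \<alpha>" "pathstart \<alpha> \<in> verts G" "pathfinish \<alpha> = pathstart p"
    and \<beta>: "gpath \<beta>" "pathstart \<beta> \<in> verts G" "pathfinish \<beta> = pathfinish p"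
    using path_from_vertex by metis
  have r: "gpath (reversepath \<beta>)" using \<beta> by simp
  have refl: "homotopic_paths S (reversepath \<alpha>) (reversepath \<alpha>)" "homotopic_paths S \<beta> \<beta>"
    using \<alpha> \<beta> by (simp_all add: homotopic_paths_refl)
  have cancel: "homotopic_paths S (reversepath \<alpha> +++ (((\<alpha> +++ s) +++ reversepath \<beta>) +++ \<beta>)) s"
    if s: "gpath s" "pathstart s = pathstart p" "pathfinish s = pathfinish p" for s
  proof -
    have as: "gpath (\<alpha> +++ s)" using gpath_join \<alpha> s by simp
    have h: "homotopic_paths S (((\<alpha> +++ s) +++ reversepath \<beta>) +++ \<beta>) (\<alpha> +++ s)"
      using homotopic_cancel [OF as r] \<beta> s by simp
    have "homotopic_paths S (reversepath \<alpha> +++ (((\<alpha> +++ s) +++ reversepath \<beta>) +++ \<beta>)) (reversepath \<alpha> +++ (\<alpha> +++ s))"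
      by (rule homotopic_paths_join [OF refl(1) h]) (use \<alpha> in simp)
    also have "homotopic_paths S (reversepath \<alpha> +++ (\<alpha> +++ s)) s"
    proof -
      have "homotopic_paths S ((reversepath s +++ reversepath \<alpha>) +++ reversepath (reversepath \<alpha>)) (reversepath s)"
        by (rule homotopic_cancel) (use \<alpha> s in simp_all)
      then have "homotopic_paths S (reversepath ((reversepath s +++ reversepath \<alpha>) +++ \<alpha>)) (reversepath (reversepath s))"
        by (subst homotopic_paths_reversepath) simp
      then show ?thesis using \<alpha> s by (simp add: reversepath_joinpaths)
    qed
    finally show ?thesis .
  qed
  have h: "homotopic_paths S ((\<alpha> +++ p) +++ reversepath \<beta>) ((\<alpha> +++ q) +++ reversepath \<beta>)"
  proof (rule homotopic_iff_W [THEN iffD2])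
    show "W ((\<alpha> +++ p) +++ reversepath \<beta>) = W ((\<alpha> +++ q) +++ reversepath \<beta>)"
      using W \<alpha> \<beta> p q ends by (simp add: W_join gpath_join)
  qed (use \<alpha> \<beta> p q ends in \<open>simp_all add: gpath_join\<close>)
  have "homotopic_paths S (reversepath \<alpha> +++ (((\<alpha> +++ p) +++ reversepath \<beta>) +++ \<beta>))
      (reversepath \<alpha> +++ (((\<alpha> +++ q) +++ reversepath \<beta>) +++ \<beta>))"
    by (rule homotopic_paths_join [OF refl(1) homotopic_paths_join [OF h refl(2)]]) (use \<alpha> \<beta> in simp_all)
  then show ?thesis using cancel [OF p] cancel [OF q] ends
    by (metis homotopic_paths_sym homotopic_paths_trans)
qed

lemma map_gpath:
  assumes "continuous_on S f" "f ` S \<subseteq> T" "gpath p" shows "path (f \<circ> p)" "path_image (f \<circ> p) \<subseteq> T"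
proof -
  show "path (f \<circ> p)"
    by (rule path_continuous_image) (use assms continuous_on_subset in blast)+
  show "path_image (f \<circ> p) \<subseteq> T" using assms unfolding path_image_compose by blast
qed

lemma map_oriented:
  assumes H: "finite_graph H" and f: "continuous_on S f" "f ` S \<subseteq> graph_space H" and d: "fst d < n"
  shows "fin_graph.V H (f \<circ> oriented_edge G d) 0 1 = lw (\<lambda>i. fin_graph.V H (f \<circ> edge G i) 0 1) d"
proof -
  interpret H: fin_graph H by unfold_locales (rule H)
  show ?thesis
  proof (cases "snd d")
    case True
    then show ?thesis by (simp add: lw_def oriented_edge_def)
  next
    case False
    note e = map_gpath [OF f gpath_edge [OF d]]
    have "H.W (reversepath (f \<circ> edge G (fst d))) = - H.W (f \<circ> edge G (fst d))"
      by (rule H.W_reversepath) (use e in blast)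
    then show ?thesis using False by (simp add: lw_def oriented_edge_def path_compose_reversepath)
  qed
qed

lemma map_word_path:
  assumes H: "finite_graph H" and f: "continuous_on S f" "f ` S \<subseteq> graph_space H" and v: "v \<in> verts G"
  shows "ep u w v \<Longrightarrow> fin_graph.V H (f \<circ> word_path v w) 0 1 = ev (\<lambda>i. fin_graph.V H (f \<circ> edge G i) 0 1) w"
proof (induction w arbitrary: u)
  interpret H: fin_graph H by unfold_locales (rule H)
  case Nil
  then show ?case by (simp add: H.V_const)
next
  interpret H: fin_graph H by unfold_locales (rule H)
  case (Cons d w)
  then have d: "fst d < n" and w: "ep (tl_v (flip d)) w v" by simp_all
  have vS: "v \<in> S" using v verts_S by blast
  note wp = word_path [OF w vS]
  have "H.W ((f \<circ> oriented_edge G d) +++ (f \<circ> word_path v w)) = H.W (f \<circ> oriented_edge G d) + H.W (f \<circ> word_path v w)"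
  proof (rule H.W_join)
    show "H.gpath (f \<circ> oriented_edge G d)" using map_gpath [OF f gpath_oriented [OF d]] by blast
    show "H.gpath (f \<circ> word_path v w)" using map_gpath [OF f, of "word_path v w"] wp by blast
  qed (simp add: wp pathstart_compose pathfinish_compose)
  then show ?case
    unfolding word_path_simps path_compose_join ev_simps Cons.IH [OF w] map_oriented [OF H f d] .
qed

text \<open>A path between vertices is replaced by its edge path, whose image is a product of edge
  images. The target may be another graph: so the marking and its homotopy inverse also become
  homomorphisms of words.\<close>

lemma map_W:
  assumes H: "finite_graph H" and f: "continuous_on S f" "f ` S \<subseteq> graph_space H"
    and p: "gpath p" "pathstart p \<in> verts G" "pathfinish p \<in> verts G"
  shows "fin_graph.V H (f \<circ> p) 0 1 = ev (\<lambda>i. fin_graph.V H (f \<circ> edge G i) 0 1) (word_of (W p))"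
proof -
  interpret H: fin_graph H by unfold_locales (rule H)
  have N: "ep (pathstart p) (word_of (W p)) (pathfinish p)"
    "homotopic_paths S p (word_path (pathfinish p) (word_of (W p)))"
    using path_normal [OF p] unfolding normal_def by simp_all
  have "homotopic_paths (graph_space H) (f \<circ> p) (f \<circ> word_path (pathfinish p) (word_of (W p)))"
    by (rule homotopic_paths_continuous_image [OF N(2) f(1)]) (use f(2) in blast)
  then have "H.W (f \<circ> p) = H.W (f \<circ> word_path (pathfinish p) (word_of (W p)))" by (rule H.homotopic_W)
  also have "\<dots> = ev (\<lambda>i. H.W (f \<circ> edge G i)) (word_of (W p))"
    by (rule map_word_path [OF H f p(3) N(1)])
  finally show ?thesis .
qed

lemma subst_W:
  assumes f: "continuous_on S f" "f ` S \<subseteq> S" and sym: "symmetric_subst gw"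
    and seg: "\<And>i. i < n \<Longrightarrow> seg (f \<circ> edge G i) 0 (gw (i, True)) 1"
    and p: "gpath p" "pathstart p \<in> verts G" "pathfinish p \<in> verts G"
  shows "W (f \<circ> p) = cls (ext gw (word_of (W p)))"
proof -
  have e: "W (f \<circ> edge G i) = cls (gw (i, True))" if "i < n" for i
  proof -
    have "gw (i, True) \<noteq> []" using seg [OF that] by (cases "gw (i, True)") auto
    then show ?thesis using seg_V [OF seg [OF that]] by simp
  qed
  have "ep (pathstart p) (word_of (W p)) (pathfinish p)" using path_normal [OF p] unfolding normal_def by simp
  then have "fst d < n" if "d \<in> set (word_of (W p))" for d using epath_letters that by metis
  then have "ev (\<lambda>i. W (f \<circ> edge G i)) (word_of (W p)) = ev (\<lambda>i. cls (gw (i, True))) (word_of (W p))"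
    by (intro ev_restrict e)
  also have "\<dots> = cls (ext gw (word_of (W p)))"
    using ev_ext [OF sym, of "\<lambda>i. cls [(i, True)]"] by (simp flip: cls_ev)
  finally show ?thesis using map_W [OF fin f p] by simp
qed

end

section \<open>Train track maps\<close>

locale train_track = fin_graph G for G :: "'a::t2_space fgraph" +
  fixes g :: "'a \<Rightarrow> 'a"
  assumes g_equiv: "homotopy_equivalence (graph_space G) (graph_space G) g"
    and g_verts: "g ` verts G \<subseteq> verts G"
    and g_immersed: "\<And>k i. k > 0 \<Longrightarrow> i < nedges G \<Longrightarrow> locally_injective_on (open_edge G i) (g ^^ k)"
begin

lemma g_map: "continuous_on S g" "g ` S \<subseteq> S"
  using g_equiv unfolding homotopy_equivalence_def by blast+

lemma pow_map: "continuous_on S (g ^^ k)" "(g ^^ k) ` S \<subseteq> S"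
proof -
  have "continuous_on S (g ^^ k) \<and> (g ^^ k) ` S \<subseteq> S"
  proof (induction k)
    case (Suc k)
    have "continuous_on S (g \<circ> g ^^ k)"
      by (rule continuous_on_compose) (use Suc g_map(1) continuous_on_subset in blast)+
    moreover have "(g \<circ> g ^^ k) ` S \<subseteq> S" using Suc g_map(2) unfolding image_comp [symmetric] by blast
    ultimately show ?case by (simp only: funpow.simps)
  qed simp
  then show "continuous_on S (g ^^ k)" "(g ^^ k) ` S \<subseteq> S" by blast+
qed

lemma pow_verts: "v \<in> verts G \<Longrightarrow> (g ^^ k) v \<in> verts G"
  by (induction k) (use g_verts in auto)

text \<open>A word is chosen for each positive edge and inverted for the reversed edge; with the
  empty word as default, \<open>gw0_sym\<close> holds for all letters, including those that are no
  edges.\<close>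

definition gw0 :: "letter \<Rightarrow> letter list" where
  "gw0 d = (if fst d < n then
     let w = (SOME w. seg (g \<circ> edge G (fst d)) 0 w 1) in if snd d then w else iword w else [])"

lemma seg_gw0: "i < n \<Longrightarrow> seg (g \<circ> edge G i) 0 (gw0 (i, True)) 1"
proof -
  assume i: "i < n"
  have "\<exists>w. seg (g \<circ> edge G i) 0 w 1"
  proof (rule seg_exists)
    show "good_on (g \<circ> edge G i) 0 1" using map_gpath [OF g_map gpath_edge [OF i]] by (rule_tac gpath_good) blast
    show "(g \<circ> edge G i) 0 \<in> verts G" "(g \<circ> edge G i) 1 \<in> verts G" using edge_ends [OF i] g_verts by auto
    show "loc_inj (g \<circ> edge G i) 0 1" using g_immersed [of 1 i] by (intro loc_inj_edge i) (simp add: i)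
  qed
  then show ?thesis using i someI_ex [of "\<lambda>w. seg (g \<circ> edge G i) 0 w 1"] by (simp add: gw0_def)
qed

lemma gw0_sym: "symmetric_subst gw0"
  by (simp add: symmetric_subst_def gw0_def flip_def Let_def)

lemma seg_reversepath: "seg p 0 w 1 \<Longrightarrow> seg (reversepath p) 0 (iword w) 1"
  using seg_reverse [of p 0 w 1] by (simp add: reversepath_def)

lemma seg_letter:
  assumes "seg (f \<circ> edge G (fst d)) 0 (gw (fst d, True)) 1" "symmetric_subst gw"
  shows "seg (f \<circ> oriented_edge G d) 0 (gw d) 1"
proof (cases "snd d")
  case True
  then have "d = (fst d, True)" by (simp add: prod_eq_iff)
  then show ?thesis using assms True by (simp add: oriented_edge_def)
next
  case False
  then have "d = flip (fst d, True)" by (simp add: prod_eq_iff flip_def)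
  then have "gw d = iword (gw (fst d, True))" using assms(2) unfolding symmetric_subst_def by metis
  then show ?thesis using seg_reversepath [OF assms(1)] False by (simp add: oriented_edge_def path_compose_reversepath)
qed

lemma seg_pow: "i < n \<Longrightarrow> seg ((g ^^ k) \<circ> edge G i) 0 ((ext gw0 ^^ k) [(i, True)]) 1"
proof (induction k)
  case 0
  then show ?case using seg_edge by simp
next
  case (Suc k)
  have "seg (g \<circ> ((g ^^ k) \<circ> edge G i)) 0 (ext gw0 ((ext gw0 ^^ k) [(i, True)])) 1"
    by (rule seg_subst [OF _ Suc.IH [OF Suc.prems]]) (intro seg_letter seg_gw0 gw0_sym)
  moreover have "g \<circ> ((g ^^ k) \<circ> edge G i) = (g ^^ Suc k) \<circ> edge G i" by (simp add: fun_eq_iff)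
  moreover have "ext gw0 ((ext gw0 ^^ k) [(i, True)]) = (ext gw0 ^^ Suc k) [(i, True)]" by simp
  ultimately show ?case by (simp only:)
qed

lemma seg_pow_oriented: "fst d < n \<Longrightarrow> seg ((g ^^ k) \<circ> oriented_edge G d) 0 ((ext gw0 ^^ k) [d]) 1"
  using seg_letter [where gw = "\<lambda>d. (ext gw0 ^^ k) [d]" and f = "g ^^ k"] seg_pow symmetric_subst_pow [OF gw0_sym] by simp

lemma reduced_seg_pow:
  assumes "k > 0" "i < n" "seg ((g ^^ k) \<circ> edge G i) 0 w 1" shows "reduced_word w"
  by (rule seg_reduced [OF assms(3) loc_inj_edge [OF assms(2) g_immersed [OF assms(1,2)]]])

lemma reduced_pow:
  assumes "fst d < n" shows "reduced_word ((ext gw0 ^^ k) [d])"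
proof -
  have r: "reduced_word ((ext gw0 ^^ k) [(i, True)])" if "i < n" for i
    by (cases "k = 0") (use reduced_seg_pow [OF _ that seg_pow [OF that]] in \<open>simp_all add: reduced_Cons\<close>)
  have "d = (fst d, True) \<or> [d] = iword [(fst d, True)]" by (cases d) (auto simp: flip_def)
  then show ?thesis
  proof
    assume "[d] = iword [(fst d, True)]"
    then have "(ext gw0 ^^ k) [d] = iword ((ext gw0 ^^ k) [(fst d, True)])"
      using ext_pow_iword [OF gw0_sym] by metis
    then show ?thesis using r [OF assms] by simp
  qed (use r [OF assms] in metis)
qed

text \<open>Both words have the same class, and local injectivity makes both reduced. Crossings and
  turns, which are defined by \<open>runs_through\<close>, can thus be read off the iterated
  substitution.\<close>

lemma runs_through_pow:
  assumes k: "k > 0" and i: "i < n"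
  shows "runs_through G ((g ^^ k) \<circ> edge G i) w \<longleftrightarrow> w = (ext gw0 ^^ k) [(i, True)]"
proof
  assume "runs_through G ((g ^^ k) \<circ> edge G i) w"
  then have w: "seg ((g ^^ k) \<circ> edge G i) 0 w 1" by (simp add: runs_through_seg)
  have "w \<noteq> []" "(ext gw0 ^^ k) [(i, True)] \<noteq> []" using w seg_pow [OF i, of k] by (force, force)
  then have "cls w = cls ((ext gw0 ^^ k) [(i, True)])" using seg_V [OF w] seg_V [OF seg_pow [OF i, of k]] by simp
  then show "w = (ext gw0 ^^ k) [(i, True)]"
    using cls_inj_reduced reduced_seg_pow [OF k i w] reduced_seg_pow [OF k i seg_pow [OF i]] by blast
qed (simp add: runs_through_seg seg_pow [OF i])

lemma pow_letter_sub:
  assumes "(l, b) \<in> set w" "i \<in> fst ` set ((ext gw0 ^^ k) [(l, True)])" shows "i \<in> fst ` set ((ext gw0 ^^ k) w)"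
proof -
  obtain x y where w: "w = x @ [(l, b)] @ y" using split_list [OF assms(1)] by auto
  have f: "fst ` set (iword v) = fst ` set v" for v by (auto simp: iword_def image_image)
  have "[(l, b)] = [(l, True)] \<or> [(l, b)] = iword [(l, True)]" by (auto simp: flip_def)
  then have "fst ` set ((ext gw0 ^^ k) [(l, b)]) = fst ` set ((ext gw0 ^^ k) [(l, True)])"
    using ext_pow_iword [OF gw0_sym] f by metis
  then show ?thesis using assms(2) unfolding w ext_pow_append by auto
qed

text \<open>A nonzero entry of a matrix product has a nonzero term, so some edge \<open>l\<close> in
  the image of edge \<open>j\<close> has an iterate that contains \<open>i\<close>.\<close>

lemma transition_pow:
  assumes "i < n" "j < n" "(transition_matrix G g ^\<^sub>m k) $$ (i, j) \<noteq> 0"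
  shows "i \<in> fst ` set ((ext gw0 ^^ k) [(j, True)])"
  using assms
proof (induction k arbitrary: j)
  case 0
  then show ?case by (simp add: transition_matrix_def split: if_splits)
next
  case (Suc k)
  let ?A = "transition_matrix G g"
  have A: "?A \<in> carrier_mat n n" by (simp add: transition_matrix_def)
  have "(?A ^\<^sub>m Suc k) $$ (i, j) = (\<Sum>l\<in>{0..<n}. (?A ^\<^sub>m k) $$ (i, l) * ?A $$ (l, j))"
    using A pow_carrier_mat [OF A, of k] Suc.prems by (simp add: scalar_prod_def)
  then obtain l where l: "l < n" "(?A ^\<^sub>m k) $$ (i, l) \<noteq> 0" "?A $$ (l, j) \<noteq> 0"
    using Suc.prems(3) by (metis (no_types, lifting) atLeastLessThan_iff mult_eq_0_iff sum.neutral)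
  have "(THE ds. runs_through G (g \<circ> edge G j) ds) = gw0 (j, True)"
    using runs_through_pow [of 1 j] Suc.prems(2) by (intro the_equality) simp_all
  then have "count_list (map fst (gw0 (j, True))) l \<noteq> 0"
    using l Suc.prems(2) by (simp add: transition_matrix_def crossings_def)
  then have "l \<in> fst ` set (gw0 (j, True))" by (metis count_notin list.set_map)
  then obtain b where b: "(l, b) \<in> set (gw0 (j, True))" by auto
  have "i \<in> fst ` set ((ext gw0 ^^ k) (gw0 (j, True)))"
    by (rule pow_letter_sub [OF b Suc.IH [OF Suc.prems(1) l(1,2)]])
  then show ?case by (simp only: funpow_Suc_right) simp
qed

text \<open>A homotopy inverse \<open>h\<close> takes the image of a loop to a conjugate of the
  loop's own class.\<close>

lemma g_inj_W:
  assumes p: "gpath p" "pathstart p = v" "pathfinish p = v" "v \<in> verts G" and 0: "W ((g ^^ k) \<circ> p) = 0"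
  shows "W p = 0"
  using 0
proof (induction k)
  case (Suc k)
  obtain h where h: "continuous_on S h" "h ` S \<subseteq> S" "homotopic_with_canon (\<lambda>_. True) S S (h \<circ> g) id"
    using g_equiv unfolding homotopy_equivalence_def by blast
  let ?q = "(g ^^ k) \<circ> p"
  have q: "gpath ?q" "pathstart ?q = (g ^^ k) v" "pathfinish ?q = (g ^^ k) v"
    using map_gpath [OF pow_map p(1), of k] p by (simp_all add: pathstart_compose pathfinish_compose)
  have gq: "gpath (g \<circ> ?q)" "pathstart (g \<circ> ?q) \<in> verts G" "pathfinish (g \<circ> ?q) \<in> verts G"
    using map_gpath [OF g_map q(1)] pow_verts [OF p(4), of "Suc k"] p(2,3)
    by (simp_all add: pathstart_compose pathfinish_compose)
  have "W (g \<circ> ?q) = 0" using Suc.prems by (simp only: funpow.simps comp_assoc)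
  then have "W (h \<circ> (g \<circ> ?q)) = 0" using map_W [OF fin h(1,2) gq] by simp
  moreover obtain u where "W ((h \<circ> g) \<circ> ?q) = u + W ?q - u"
    using homotopic_id_W [OF h(3), of "(g ^^ k) v"] q by blast
  ultimately have "u + W ?q - u = 0" by (simp only: comp_assoc)
  then have "u + W ?q = 0 + u" by (simp only: diff_eq_eq)
  then have "W ?q = 0" using add_left_imp_eq [of u "W ?q" 0] by simp
  then show ?case by (rule Suc.IH)
qed simp

lemma W_pow:
  assumes p: "gpath p" "pathstart p \<in> verts G" "pathfinish p \<in> verts G"
  shows "W ((g ^^ k) \<circ> p) = cls ((ext gw0 ^^ k) (word_of (W p)))"
  using subst_W [OF pow_map symmetric_subst_pow [OF gw0_sym] _ p] seg_pow by (simp add: ext_ext_pow)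

end

text \<open>The hypotheses concern \<open>g\<close>, whereas a free factor is preserved up to
  conjugation only by a power of the automorphism; the properties are transferred here to
  \<open>g ^^ \<kappa>\<close>.\<close>

locale pf_train_track = train_track +
  fixes \<kappa> :: nat
  assumes \<kappa>: "\<kappa> > 0" and pf_matrix: "perron_frobenius (transition_matrix G g)"
    and lw_graph: "\<And>x. x \<in> verts G \<Longrightarrow> LW_connected G g x"
begin

abbreviation "gw \<equiv> \<lambda>d. (ext gw0 ^^ \<kappa>) [d]"

lemma ext_gw: "ext gw ^^ N = ext gw0 ^^ (\<kappa> * N)"
proof -
  have "ext gw = ext gw0 ^^ \<kappa>" by (rule ext) (rule ext_ext_pow)
  then show ?thesis by (simp add: funpow_mult)
qed

lemma pf_bound: "\<exists>n0. \<forall>k\<ge>n0. \<forall>i<n. \<forall>j<n. i \<in> fst ` set ((ext gw0 ^^ k) [(j, True)])"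
proof -
  have "dim_row (transition_matrix G g) = n" "dim_col (transition_matrix G g) = n" by (simp_all add: transition_matrix_def)
  then obtain n0 where "\<forall>k\<ge>n0. \<forall>i<n. \<forall>j<n. 0 < (transition_matrix G g ^\<^sub>m k) $$ (i, j)"
    using pf_matrix unfolding perron_frobenius_def eventually_sequentially by metis
  then show ?thesis using transition_pow by (metis less_irrefl)
qed

text \<open>High iterates of edge \<open>i\<close> contain \<open>i\<close> again, so a turn taken
  by the \<open>k\<close>-th iterate is also taken by a later one whose exponent is a multiple of
  \<open>\<kappa>\<close>.\<close>

lemma LW_edge_word:
  assumes "(d1, d2) \<in> LW_edges G g x"
  shows "\<exists>N j u a b v. j < n \<and> (ext gw ^^ N) [(j, True)] = u @ [a, b] @ v \<and> {d1, d2} = {flip a, b}"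
proof -
  obtain k i ds l where k: "k > 0" "i < n" "runs_through G ((g ^^ k) \<circ> edge G i) ds" "Suc l < length ds"
      "{d1, d2} = {flip (ds ! l), ds ! Suc l}"
    using assms unfolding LW_edges_def takes_turn_def by blast
  define a b where "a = ds ! l" and "b = ds ! Suc l"
  have "ds = take l ds @ [a, b] @ drop (Suc (Suc l)) ds"
    using k(4) by (simp add: a_def b_def Cons_nth_drop_Suc id_take_nth_drop)
  then obtain x y where ab: "(ext gw0 ^^ k) [(i, True)] = x @ [a, b] @ y"
    using runs_through_pow [OF k(1,2)] k(3) by metis
  obtain n0 where n0: "\<And>k. k \<ge> n0 \<Longrightarrow> i \<in> fst ` set ((ext gw0 ^^ k) [(i, True)])" using pf_bound k(2) by blast
  have "k + n0 \<le> \<kappa> * (k + n0)" using \<kappa> by simp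
  then obtain m where m: "\<kappa> * (k + n0) = k + m" "m \<ge> n0" by (metis add_le_cancel_left le_Suc_ex nat_add_left_cancel_le add.assoc le_add1)
  obtain c where "(i, c) \<in> set ((ext gw0 ^^ m) [(i, True)])" using n0 [OF m(2)] by auto
  then obtain u v where uv: "(ext gw0 ^^ m) [(i, True)] = u @ [(i, c)] @ v" by (auto dest: split_list)
  have N: "(ext gw ^^ (k + n0)) [(i, True)] = (ext gw0 ^^ k) u @ (ext gw0 ^^ k) [(i, c)] @ (ext gw0 ^^ k) v"
    unfolding ext_gw m(1) funpow_add comp_apply uv ext_pow_append ..
  show ?thesis
  proof (cases c)
    case True
    then show ?thesis using N ab k(2,5) unfolding a_def [symmetric] b_def [symmetric]
      by (intro exI [of _ "k + n0"] exI [of _ i] exI [of _ "(ext gw0 ^^ k) u @ x"] exI [of _ a] exI [of _ b]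
          exI [of _ "y @ (ext gw0 ^^ k) v"]) simp
  next
    case False
    then have "[(i, c)] = iword [(i, True)]" by (simp add: flip_def)
    then have "(ext gw0 ^^ k) [(i, c)] = iword y @ [flip b, flip a] @ iword x"
      using ext_pow_iword [OF gw0_sym] ab by (metis append.assoc append_Cons append_Nil iword_simps(1-3))
    then show ?thesis using N k(2,5) unfolding a_def [symmetric] b_def [symmetric]
      by (intro exI [of _ "k + n0"] exI [of _ i] exI [of _ "(ext gw0 ^^ k) u @ iword y"] exI [of _ "flip b"] exI [of _ "flip a"]
          exI [of _ "iword x @ (ext gw0 ^^ k) v"]) (simp add: insert_commute)
  qed
qed

sublocale pf: pf_graph_map n tl_v gw "g ^^ \<kappa>"
proof
  show "symmetric_subst gw" by (rule symmetric_subst_pow [OF gw0_sym])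
  show ne: "gw d \<noteq> []" if "fst d < n" for d using seg_pow_oriented [OF that, of \<kappa>] by force
  show "ep ((g ^^ \<kappa>) (tl_v d)) (gw d) ((g ^^ \<kappa>) (tl_v (flip d)))" if d: "fst d < n" for d
    using seg_V [OF seg_pow_oriented [OF d, of \<kappa>] ne [OF d]]
    by (simp add: tl_v_def oriented_flip reversepath_def)
  show "reduced_word ((ext gw ^^ N) [d])" if "fst d < n" for N d
    unfolding ext_gw by (rule reduced_pow [OF that])
  show "cls w = 0" if w: "ep v w v" and 0: "cls (ext gw w) = 0" for v w
  proof (cases "w = []")
    case False
    then have v: "v \<in> verts G" using w tl_v_verts by (cases w) auto
    have p: "gpath (word_path v w)" "pathstart (word_path v w) = v" "pathfinish (word_path v w) = v" "W (word_path v w) = cls w"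
      using word_path [OF w] v verts_S by blast+
    have "W ((g ^^ \<kappa>) \<circ> word_path v w) = cls ((ext gw0 ^^ \<kappa>) (word_of (cls w)))"
      using W_pow [of "word_path v w" \<kappa>] p v by simp
    also have "\<dots> = cls ((ext gw0 ^^ \<kappa>) w)" by (rule cls_ext_pow_cong [OF gw0_sym]) simp
    also have "\<dots> = 0" using 0 by (simp add: ext_ext_pow)
    finally show ?thesis using g_inj_W [OF p(1-3) v] p(4) by simp
  qed simp
  show "\<exists>n0. \<forall>N\<ge>n0. \<forall>i<n. \<forall>j<n. i \<in> fst ` set ((ext gw ^^ N) [(j, True)])"
  proof -
    obtain n0 where n0: "\<forall>k\<ge>n0. \<forall>i<n. \<forall>j<n. i \<in> fst ` set ((ext gw0 ^^ k) [(j, True)])" using pf_bound by blast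
    have "n0 \<le> \<kappa> * N" if "n0 \<le> N" for N using that \<kappa> by (metis One_nat_def Suc_leI mult_le_mono nat_mult_1)
    then show ?thesis using n0 unfolding ext_gw by blast
  qed
  show "(d, d') \<in> {(d1, d2). \<exists>N j x a b y. j < n \<and> (ext gw ^^ N) [(j, True)] = x @ [a, b] @ y \<and> {d1, d2} = {flip a, b}}\<^sup>*"
    if d: "fst d < n" "fst d' < n" "tl_v d = tl_v d'" for d d'
  proof -
    have "d \<in> directions G (tl_v d)" "d' \<in> directions G (tl_v d)" using d by (simp_all add: directions_def)
    then have "(d, d') \<in> (LW_edges G g (tl_v d))\<^sup>*"
      using lw_graph [OF tl_v_verts [OF d(1)]] unfolding LW_connected_def by blast
    then show ?thesis by (rule rtrancl_mono [THEN subsetD, rotated]) (use LW_edge_word in blast)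
  qed
qed

end

section \<open>A Nielsen loop from a repeated letter\<close>

lemma rotate_zero: "a + (z + b) = 0 \<Longrightarrow> b + a + z = (0 :: 'g::group_add)"
proof -
  assume "a + (z + b) = 0"
  moreover have "b + a + z = b + (a + (z + b)) + - b" by (simp only: add.assoc add.right_inverse add_0_right)
  ultimately show ?thesis by simp
qed

context fin_graph
begin

lemma V_seg: "seg p a w b \<Longrightarrow> V p a b = cls w"
  by (cases "w = []") (use seg_V V_const [of a b p "p a"] in auto)

lemma V_subp:
  assumes "gpath p" "0 \<le> a" "a \<le> b" "b \<le> 1" shows "W (subp a b p) = V p a b"
proof -
  have "W (subp a b p) = V p (a + (b - a) * 0) (a + (b - a) * 1)"
  proof (rule V_reparam [OF gpath_good [OF assms(1)]])
    show "(\<lambda>t. a + (b - a) * t) ` {0..1} \<subseteq> {0..1}" using subp_in [OF assms(2-4)] assms by (intro image_subsetI) fastforce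
  qed (use assms in \<open>auto simp: subp_def intro!: continuous_intros\<close>)
  then show ?thesis by simp
qed

end

context pf_train_track
begin

text \<open>The periodic Nielsen path is a loop based at the fixed point of the power inside the edge \<open>d\<close>.\<close>

lemma nielsen_word:
  assumes pnp: "\<nexists>\<rho>. periodic_nielsen_path G g \<rho>" and K: "K \<ge> 1"
    and X: "(ext gw ^^ K) [d] = X @ d # Y" and z: "ep (tl_v d) (d # z) (tl_v d)" and nz: "cls (d # z) \<noteq> 0"
  shows "cls ((ext gw ^^ K) z) \<noteq> - cls Y + cls z - cls X"
proof
  assume eq: "cls ((ext gw ^^ K) z) = - cls Y + cls z - cls X"
  define k where "k = \<kappa> * K"
  define f where "f = g ^^ k"
  define e where "e = oriented_edge G d"
  have k: "k \<ge> 1" using K \<kappa> by (simp add: k_def)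
  have d: "fst d < n" and z': "ep (tl_v (flip d)) z (tl_v d)" using z by auto
  have ge: "gpath e" and e_ends: "pathstart e = tl_v d" "pathfinish e = tl_v (flip d)" using gpath_oriented [OF d] by (simp_all add: e_def)
  have e01: "e 0 = tl_v d" "e 1 = tl_v (flip d)" using e_ends by (simp_all add: pathstart_def pathfinish_def)
  have fm: "continuous_on S f" "f ` S \<subseteq> S" using pow_map by (simp_all add: f_def)
  have gfe: "good_on (f \<circ> e) 0 1" using map_gpath [OF fm ge] gpath_good by blast
  have "seg (f \<circ> e) 0 (X @ d # Y) 1"
    using seg_pow_oriented [OF d, of k] X unfolding ext_gw k_def f_def e_def by simp
  then obtain a c where ac: "seg (f \<circ> e) 0 X a" "piece (f \<circ> e) a c d" "seg (f \<circ> e) c Y 1" by (auto simp: seg_append)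
  have a: "0 \<le> a" and c: "c \<le> 1" using seg_le ac by blast+
  obtain h where h: "a < c" "continuous_on {a..c} h" "strict_mono_on {a..c} h" "h a = 0" "h c = 1"
      "\<And>t. t \<in> {a..c} \<Longrightarrow> f (e t) = e (h t)" using ac(2) unfolding piece_def e_def by auto
  \<comment> \<open>\<open>h\<close> stretches the interval from \<open>a\<close> to
    \<open>c\<close> over the unit interval, so \<open>h t - t\<close> changes sign and the power
    \<open>f\<close> fixes the point \<open>e s\<close>.\<close>
  have "\<exists>s\<ge>a. s \<le> c \<and> h s - s = 0"
    by (rule IVT') (use h a c in \<open>auto intro!: continuous_intros\<close>)
  then obtain s where s: "a \<le> s" "s \<le> c" "h s = s" by auto
  have s01: "0 \<le> s" "s \<le> 1" using s a c by auto
  have fix_es: "f (e s) = e s" using h(6) [of s] s by simp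
  have hr: "h t \<in> {0..1}" if "t \<in> {a..c}" for t using mono_range [OF h(3-5) that h(1)] by simp
  have V1: "V (f \<circ> e) a s = V e 0 s"
  proof -
    have "V (f \<circ> e) a s = V e (h a) (h s)"
    proof (rule V_reparam [OF gpath_good [OF ge]])
      show "continuous_on {a..s} h" by (rule continuous_on_subset [OF h(2)]) (use s in auto)
      show "h ` {a..s} \<subseteq> {0..1}" using hr s by (intro image_subsetI) simp
    qed (use h s s01 in auto)
    then show ?thesis using h(4) s(3) by simp
  qed
  have V2: "V (f \<circ> e) s c = V e s 1"
  proof -
    have "V (f \<circ> e) s c = V e (h s) (h c)"
    proof (rule V_reparam [OF gpath_good [OF ge]])
      show "continuous_on {s..c} h" by (rule continuous_on_subset [OF h(2)]) (use s in auto)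
      show "h ` {s..c} \<subseteq> {0..1}" using hr s by (intro image_subsetI) simp
    qed (use h s s01 in auto)
    then show ?thesis using h(5) s(3) by simp
  qed
  \<comment> \<open>Because \<open>h\<close> fixes \<open>s\<close>, the image of the part of
    \<open>e\<close> before \<open>s\<close> reads \<open>X\<close> followed by that part, and the
    image of the part after \<open>s\<close> reads that part followed by \<open>Y\<close>.\<close>
  have V01: "V (f \<circ> e) 0 s = cls X + V e 0 s" "V (f \<circ> e) s 1 = V e s 1 + cls Y"
    using V_add [of "f \<circ> e" 0 s a] V_add [of "f \<circ> e" s 1 c] good_on_subset [OF gfe, of 0 s] good_on_subset [OF gfe, of s 1]
      V_seg [OF ac(1)] V_seg [OF ac(3)] V1 V2 s s01 a c by simp_all
  define \<zeta> where "\<zeta> = word_path (tl_v d) z"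
  have \<zeta>: "gpath \<zeta>" "pathstart \<zeta> = tl_v (flip d)" "pathfinish \<zeta> = tl_v d" "W \<zeta> = cls z"
    unfolding \<zeta>_def using word_path [OF z'] tl_v_verts [OF d] verts_S by blast+
  define \<alpha> \<beta> where "\<alpha> = subp s 1 e" and "\<beta> = subp 0 s e"
  have \<alpha>: "gpath \<alpha>" "pathstart \<alpha> = e s" "pathfinish \<alpha> = tl_v (flip d)" "W \<alpha> = V e s 1"
    using gpath_subp [OF ge s01 order_refl] V_subp [OF ge s01 order_refl]
    by (simp_all add: \<alpha>_def subp_ends e01)
  have \<beta>: "gpath \<beta>" "pathstart \<beta> = tl_v d" "pathfinish \<beta> = e s" "W \<beta> = V e 0 s"
    using gpath_subp [OF ge order_refl s01] V_subp [OF ge order_refl s01]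
    by (simp_all add: \<beta>_def subp_ends e01)
  have fW: "W (f \<circ> \<alpha>) = V (f \<circ> e) s 1" "W (f \<circ> \<beta>) = V (f \<circ> e) 0 s"
    using V_subp [of "f \<circ> e" s 1] V_subp [of "f \<circ> e" 0 s] map_gpath [OF fm ge] s01
    unfolding \<alpha>_def \<beta>_def subp_def by (simp_all add: comp_def)
  have fz: "W (f \<circ> \<zeta>) = cls ((ext gw ^^ K) z)"
  proof -
    have "W (f \<circ> \<zeta>) = cls ((ext gw0 ^^ k) (word_of (cls z)))"
      using W_pow [OF \<zeta>(1), of k] \<zeta> tl_v_verts d by (simp add: f_def)
    also have "\<dots> = cls ((ext gw0 ^^ k) z)" by (rule cls_ext_pow_cong [OF gw0_sym]) simp
    finally show ?thesis by (simp add: ext_gw k_def)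
  qed
  \<comment> \<open>From the fixed point through the rest of \<open>d\<close>, then along
    \<open>z\<close>, and back to it along the beginning of \<open>d\<close>.\<close>
  define \<rho> where "\<rho> = \<alpha> +++ (\<zeta> +++ \<beta>)"
  have \<rho>: "gpath \<rho>" "pathstart \<rho> = e s" "pathfinish \<rho> = e s"
    using \<alpha> \<beta> \<zeta> by (simp_all add: \<rho>_def gpath_join)
  have W\<rho>: "W \<rho> = V e s 1 + (cls z + V e 0 s)"
    using \<alpha> \<beta> \<zeta> by (simp add: \<rho>_def W_join gpath_join)
  have f\<rho>: "W (f \<circ> \<rho>) = W (f \<circ> \<alpha>) + (W (f \<circ> \<zeta>) + W (f \<circ> \<beta>))"
  proof -
    have "f \<circ> \<rho> = (f \<circ> \<alpha>) +++ ((f \<circ> \<zeta>) +++ (f \<circ> \<beta>))" by (simp add: \<rho>_def path_compose_join)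
    moreover have "gpath (f \<circ> \<alpha>)" "gpath (f \<circ> \<zeta>)" "gpath (f \<circ> \<beta>)"
      using map_gpath [OF fm] \<alpha>(1) \<beta>(1) \<zeta>(1) by blast+
    ultimately show ?thesis using \<alpha> \<beta> \<zeta>
      by (simp add: W_join gpath_join pathstart_compose pathfinish_compose)
  qed
  have "\<not> homotopic_paths S \<rho> (\<lambda>_. pathstart \<rho>)"
  proof
    assume "homotopic_paths S \<rho> (\<lambda>_. pathstart \<rho>)"
    then have "W \<rho> = W (\<lambda>_. pathstart \<rho>)" by (rule homotopic_W)
    also have "\<dots> = 0" by (rule V_const) auto
    finally have "V e s 1 + (cls z + V e 0 s) = 0" by (simp add: W\<rho>)
    then have "V e 0 s + V e s 1 + cls z = 0" by (rule rotate_zero)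
    moreover have "V e 0 s + V e s 1 = cls [d]"
      using V_add [OF gpath_good [OF ge] s01] W_oriented [OF d] by (simp add: e_def)
    ultimately show False using nz by (simp add: cls_Cons [of d z])
  qed
  moreover have "homotopic_paths S (f \<circ> \<rho>) \<rho>"
  proof (rule homotopic_if_W)
    show "gpath (f \<circ> \<rho>)" using map_gpath [OF fm \<rho>(1)] by blast
    \<comment> \<open>The \<open>Y\<close> at the end of the first part and the \<open>X\<close> at
      the beginning of the last one cancel against the two correction terms in the assumed
      equation.\<close>
    show "W (f \<circ> \<rho>) = W \<rho>"
      unfolding f\<rho> fW fz eq V01 W\<rho> by (simp add: add.assoc diff_conv_add_uminus del: add_uminus_conv_diff)
  qed (use \<rho> fix_es in \<open>simp_all add: pathstart_compose pathfinish_compose\<close>)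
  ultimately have "periodic_nielsen_path G g \<rho>"
    unfolding periodic_nielsen_path_def using \<rho> fix_es k unfolding f_def by (intro conjI exI [of _ k]) simp_all
  then show False using pnp by blast
qed

end

section \<open>From the marking to words\<close>

lemma rose_map_W:
  assumes G: "finite_graph (G :: 'a::t2_space fgraph)" and m: "continuous_on (graph_space (rose r)) m" "m ` graph_space (rose r) \<subseteq> graph_space G"
    and w: "w \<in> carrier (free_group r)"
  shows "fin_graph.V G (m \<circ> rose_loop r w) 0 1 = ev (\<lambda>i. fin_graph.V G (m \<circ> edge (rose r) i) 0 1) w"
proof -
  have "fst ` set w \<subseteq> {..<r}" "reduced_word w" using w by (auto simp: free_group_def)
  then show ?thesis
    using rose.map_W [OF G m, of "rose_loop r w"] rose_loop [of w r] by (simp add: rose_simps)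
qed

text \<open>The base point \<open>m 0\<close> need not be a vertex, so loops are carried along
  \<open>\<eta>\<close> to one; \<open>y\<close> collects the conjugation caused by this and by
  \<open>\<delta>\<close>. The homotopy inverse of the marking supplies
  \<open>\<theta>\<close>.\<close>

lemma (in pf_train_track) no_fixed_free_factor:
  fixes r :: nat and m :: "complex \<Rightarrow> 'a" and f :: "letter list \<Rightarrow> letter list"
  defines "F \<equiv> free_group r"
  assumes pnp: "\<nexists>\<rho>. periodic_nielsen_path G g \<rho>"
    and m: "homotopy_equivalence (graph_space (rose r)) S m"
    and f: "\<And>w. w \<in> carrier F \<Longrightarrow> f w \<in> carrier F" "f ^^ \<kappa> \<in> hom F F" "bij_betw (f ^^ \<kappa>) (carrier F) (carrier F)"
    and \<delta>: "gpath \<delta>" "pathstart \<delta> = m 0" "pathfinish \<delta> = g (m 0)"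
    and ind: "\<And>w. w \<in> carrier F \<Longrightarrow> homotopic_paths S
        (\<delta> +++ ((g \<circ> m \<circ> rose_loop r w) +++ reversepath \<delta>)) (m \<circ> rose_loop r (f w))"
    and prod: "internal_free_product F UNIV (\<lambda>i. if i then A else K) (carrier F)"
    and AK: "A \<noteq> {\<one>\<^bsub>F\<^esub>}" "K \<noteq> {\<one>\<^bsub>F\<^esub>}"
    and b: "b \<in> carrier F" "\<And>a. a \<in> A \<Longrightarrow> \<exists>a'\<in>A. (f ^^ \<kappa>) a = b \<otimes>\<^bsub>F\<^esub> a' \<otimes>\<^bsub>F\<^esub> inv\<^bsub>F\<^esub> b"
  shows False
proof -
  let ?R = "graph_space (rose r)"
  obtain h where mc: "continuous_on ?R m" "m ` ?R \<subseteq> S" and h: "continuous_on S h" "h ` S \<subseteq> ?R"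
      and hm: "homotopic_with_canon (\<lambda>_. True) ?R ?R (h \<circ> m) id"
    using m unfolding homotopy_equivalence_def by blast
  have loop: "path (rose_loop r w)" "path_image (rose_loop r w) \<subseteq> ?R" "pathstart (rose_loop r w) = 0"
      "pathfinish (rose_loop r w) = 0" "rose.W r (rose_loop r w) = cls w" if "w \<in> carrier F" for w
    using rose_loop [of w r] that by (auto simp: F_def free_group_def)
  have mloop: "gpath (m \<circ> rose_loop r w)" "pathstart (m \<circ> rose_loop r w) = m 0" "pathfinish (m \<circ> rose_loop r w) = m 0"
    if "w \<in> carrier F" for w
    using rose.map_gpath [OF mc, of "rose_loop r w"] loop [OF that] by (simp_all add: pathstart_compose pathfinish_compose)
  define \<mu> where "\<mu> i = W (m \<circ> edge (rose r) i)" for i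
  have \<mu>: "W (m \<circ> rose_loop r w) = ev \<mu> w" if "w \<in> carrier F" for w
    using rose_map_W [OF fin mc] that unfolding F_def \<mu>_def by blast
  have "m 0 \<in> S" using mc(2) rose_simps(3) by blast
  then obtain \<eta> where \<eta>: "gpath \<eta>" "pathstart \<eta> \<in> verts G" "pathfinish \<eta> = m 0" using path_from_vertex by blast
  define L where "L w = (\<eta> +++ (m \<circ> rose_loop r w)) +++ reversepath \<eta>" for w
  define J where "J w = W \<eta> + ev \<mu> w + - W \<eta>" for w
  have L: "gpath (L w)" "pathstart (L w) = pathstart \<eta>" "pathfinish (L w) = pathstart \<eta>" "W (L w) = J w"
    if "w \<in> carrier F" for w
    using mloop [OF that] \<eta> \<mu> [OF that] by (simp_all add: L_def J_def gpath_join W_join W_reversepath)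
  have gpath_map: "gpath (g \<circ> p)" if "gpath p" for p using map_gpath [OF g_map that] by blast
  have ext0: "W (g \<circ> p) = cls (ext gw0 (word_of (W p)))"
    if "gpath p" "pathstart p \<in> verts G" "pathfinish p \<in> verts G" for p
    by (rule subst_W [OF g_map gw0_sym seg_gw0 that])
  define y where "y = W \<eta> + W \<delta> + - W (g \<circ> \<eta>)"
  have J_step: "J (f w) = y + cls (ext gw0 (word_of (J w))) + - y" if w: "w \<in> carrier F" for w
  proof -
    note gm = gpath_map [OF mloop(1) [OF w]] and g\<eta> = gpath_map [OF \<eta>(1)]
    have "g \<circ> L w = ((g \<circ> \<eta>) +++ (g \<circ> (m \<circ> rose_loop r w))) +++ reversepath (g \<circ> \<eta>)"
      by (simp only: L_def path_compose_join path_compose_reversepath)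
    then have gL: "W (g \<circ> L w) = W (g \<circ> \<eta>) + W (g \<circ> (m \<circ> rose_loop r w)) + - W (g \<circ> \<eta>)"
      using gm g\<eta> mloop [OF w] \<eta> by (simp add: gpath_join W_join W_reversepath pathstart_compose pathfinish_compose)
    have "W (g \<circ> L w) = cls (ext gw0 (word_of (J w)))" using ext0 [OF L(1) [OF w]] L [OF w] \<eta>(2) by simp
    note e1 = trans [OF this [symmetric] gL]
    have "W (\<delta> +++ ((g \<circ> m \<circ> rose_loop r w) +++ reversepath \<delta>)) = W (m \<circ> rose_loop r (f w))"
      by (rule homotopic_W [OF ind [OF w]])
    then have e2: "ev \<mu> (f w) = W \<delta> + (W (g \<circ> (m \<circ> rose_loop r w)) + - W \<delta>)"
      using gm mloop [OF w] \<delta> \<mu> [OF f(1) [OF w]]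
      by (simp add: comp_assoc gpath_join W_join W_reversepath pathstart_compose pathfinish_compose)
    show ?thesis unfolding y_def e1 J_def [of "f w"] e2
      by (simp only: minus_add minus_minus add.assoc minus_add_cancel add_minus_cancel)
  qed
  have f_pow: "(f ^^ k) w \<in> carrier F" if "w \<in> carrier F" for w k by (induction k) (use f(1) that in auto)
  have "\<exists>y. \<forall>w\<in>carrier F. J ((f ^^ k) w) = y + cls ((ext gw0 ^^ k) (word_of (J w))) + - y" for k
  proof (induction k)
    case 0
    show ?case by (intro exI [of _ 0]) simp
  next
    case (Suc k)
    then obtain y' where y': "\<And>w. w \<in> carrier F \<Longrightarrow> J ((f ^^ k) w) = y' + cls ((ext gw0 ^^ k) (word_of (J w))) + - y'" by blast
    let ?u = "word_of y'"
    have "J ((f ^^ Suc k) w) = (y + cls (ext gw0 ?u)) + cls ((ext gw0 ^^ Suc k) (word_of (J w))) + - (y + cls (ext gw0 ?u))"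
      if w: "w \<in> carrier F" for w
    proof -
      let ?E = "(ext gw0 ^^ k) (word_of (J w))"
      have "cls (word_of (J ((f ^^ k) w))) = cls (?u @ ?E @ iword ?u)" using y' [OF w] by (simp add: add.assoc del: add_uminus_conv_diff)
      then have "cls (ext gw0 (word_of (J ((f ^^ k) w)))) = cls (ext gw0 (?u @ ?E @ iword ?u))"
        by (rule cls_ext_cong [OF gw0_sym])
      also have "\<dots> = cls (ext gw0 ?u) + (cls (ext gw0 ?E) + - cls (ext gw0 ?u))"
        by (simp add: ext_iword [OF gw0_sym])
      finally show ?thesis using J_step [OF f_pow [OF w, of k]] by (simp add: add.assoc minus_add del: add_uminus_conv_diff)
    qed
    then show ?case by blast
  qed
  then obtain y' where y': "\<And>w. w \<in> carrier F \<Longrightarrow> J ((f ^^ \<kappa>) w) = y' + cls ((ext gw0 ^^ \<kappa>) (word_of (J w))) + - y'" by blast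
  define \<theta> where "\<theta> i = rose.W r (h \<circ> edge G i)" for i
  obtain c where c: "\<And>p. rose.gpath r p \<Longrightarrow> pathstart p = 0 \<Longrightarrow> pathfinish p = 0 \<Longrightarrow> rose.W r ((h \<circ> m) \<circ> p) = c + rose.W r p - c"
    using rose.homotopic_id_W [OF hm, of 0] by blast
  define q where "q = rose.W r (h \<circ> \<eta>)"
  have \<theta>: "ev \<theta> (word_of (J w)) = (q + c) + cls w - (q + c)" if w: "w \<in> carrier F" for w
  proof -
    have g1: "rose.gpath r (h \<circ> \<eta>)" "rose.gpath r (h \<circ> (m \<circ> rose_loop r w))"
      using map_gpath [OF h \<eta>(1)] map_gpath [OF h mloop(1) [OF w]] by blast+
    have "rose.W r (h \<circ> L w) = ev \<theta> (word_of (J w))"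
      using map_W [OF finite_graph_rose h L(1) [OF w]] L [OF w] \<eta>(2) unfolding \<theta>_def by simp
    moreover have "h \<circ> L w = ((h \<circ> \<eta>) +++ (h \<circ> (m \<circ> rose_loop r w))) +++ reversepath (h \<circ> \<eta>)"
      by (simp only: L_def path_compose_join path_compose_reversepath)
    then have "rose.W r (h \<circ> L w) = q + rose.W r (h \<circ> (m \<circ> rose_loop r w)) + - q"
      using g1 mloop [OF w] \<eta>
      by (simp add: q_def rose.gpath_join rose.W_join rose.W_reversepath pathstart_compose pathfinish_compose)
    moreover have "rose.W r (h \<circ> (m \<circ> rose_loop r w)) = c + cls w - c"
      using c [of "rose_loop r w"] loop [OF w] by (simp add: comp_assoc)
    ultimately show ?thesis by (simp only: diff_conv_add_uminus minus_add add.assoc)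
  qed
  show False
  proof (rule pf.no_invariant_free_factor [where r = r and A = A and K = K and f = "f ^^ \<kappa>" and b = b and J = J
        and \<theta> = \<theta> and y = y' and c = "q + c" and ?v0.0 = "pathstart \<eta>", folded F_def])
    show "J (u \<otimes>\<^bsub>F\<^esub> v) = J u + J v" if "u \<in> carrier F" "v \<in> carrier F" for u v
      by (simp add: J_def F_def free_group_def ev_foldr_push add.assoc del: add_uminus_conv_diff)
    show "ep (pathstart \<eta>) (word_of (J w)) (pathstart \<eta>)" if "w \<in> carrier F" for w
      using path_normal [OF L(1) [OF that]] L [OF that] \<eta>(2) unfolding normal_def by simp
    show "J ((f ^^ \<kappa>) w) = y' + cls (ext gw (word_of (J w))) - y'" if "w \<in> carrier F" for w
      using y' [OF that] by (simp add: ext_ext_pow)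
  qed (use prod AK f b \<theta> nielsen_word [OF pnp] in blast)+
qed

theorem lemma1p8:
  fixes r :: nat
    and \<phi> :: "(letter list \<Rightarrow> letter list) set"
    and G :: "('a::t2_space) fgraph"
    and m :: "complex \<Rightarrow> 'a"
    and g :: "'a \<Rightarrow> 'a"
  assumes "\<phi> \<in> carrier (Out (free_group r))"
    and "train_track_representative r G m g \<phi>"
    and "irreducible_map G g"
    and "\<nexists>\<rho>. periodic_nielsen_path G g \<rho>"
    and "perron_frobenius (transition_matrix G g)"
    and "\<forall>x\<in>verts G. LW_connected G g x"
  shows "fully_irreducible (free_group r) \<phi>"
  unfolding fully_irreducible_def
proof (intro allI impI notI)
  fix k :: nat
  assume k: "k > 0" and red: "reducible_out (free_group r) (\<phi> [^]\<^bsub>Out (free_group r)\<^esub> k)"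
  let ?F = "free_group r"
  interpret F: Group.group ?F by (rule group_free_group)
  note tt = assms(2) [unfolded train_track_representative_def marked_graph_def]
  have ind: "induces r G m g \<phi>" using tt by blast
  obtain f \<delta> where f: "f \<in> \<phi>" and \<delta>: "path \<delta>" "path_image \<delta> \<subseteq> graph_space G" "pathstart \<delta> = m 0" "pathfinish \<delta> = g (m 0)"
    and \<delta>f: "\<And>w. w \<in> carrier ?F \<Longrightarrow> homotopic_paths (graph_space G)
        (\<delta> +++ ((g \<circ> m \<circ> rose_loop r w) +++ reversepath \<delta>)) (m \<circ> rose_loop r (f w))"
    using ind unfolding induces_def by (elim bexE exE conjE) (rule that; (assumption | drule (1) bspec, assumption))
  \<comment> \<open>From the reducible power only one factor is kept, together with an exponent that
    brings it back to a conjugate of itself.\<close>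
  obtain A K \<kappa> b where A: "internal_free_product ?F UNIV (\<lambda>i. if i then A else K) (carrier ?F)"
      "A \<noteq> {\<one>\<^bsub>?F\<^esub>}" "K \<noteq> {\<one>\<^bsub>?F\<^esub>}" "\<kappa> > 0" "b \<in> carrier ?F"
      "\<And>a. a \<in> A \<Longrightarrow> \<exists>a'\<in>A. (f ^^ \<kappa>) a = b \<otimes>\<^bsub>?F\<^esub> a' \<otimes>\<^bsub>?F\<^esub> inv\<^bsub>?F\<^esub> b"
    using F.reducible_power_invariant_factor [OF assms(1) f k red] by blast
  have fa: "f \<in> auto ?F" using F.Out_subset_auto assms(1) f by blast
  interpret pf_train_track G g \<kappa>
    by unfold_locales (use tt assms(5,6) A(4) in blast)+
  show False
  proof (rule no_fixed_free_factor [OF assms(4), where r = r and m = m and f = f and \<delta> = \<delta> and A = A and K = K and b = b])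
    show "f w \<in> carrier ?F" if "w \<in> carrier ?F" for w
      using fa that by (auto simp: auto_def Bij_def bij_betw_def)
  qed (use tt F.auto_pow [OF fa, of \<kappa>] \<delta> \<delta>f A in blast)+
qed

end
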